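(* Let $d\ge1$, let $\Omega\subset\mathbb{R}^d$ be a bounded domain with Lipschitz boundary $\Gamma$, let $\omega\subset\Omega$ be a nonempty open subset, let $T>0$ and let $\mathfrak{B}\in L^\infty(0,T;W^{1,\infty}(\Omega)^d)$. Assume there exists $x_0\in\Omega$ such that $\Phi(t,T,x_0)\in\Omega\setminus\overline{\omega}$ for all $t\in[0,T]$. Then there exists a constant $C>0$ independent of $\varepsilon$ such that $\mathcal{K}(\varepsilon,T,\Omega,\omega)\ge\exp(C/\varepsilon)$ for all $\varepsilon>0$ small enough.
   Context: $\mathbf{n}$ is the outward unit normal on $\Gamma$. For $\varepsilon>0$ consider the controlled system $\partial_t y-\varepsilon\Delta y+\mathfrak{B}(x,t)\cdot\nabla y=u\mathbb{1}_\omega$ in $\Omega\times(0,T)$, $\partial_{\mathbf{n}}y=0$ on $\Gamma\times(0,T)$, $y(\cdot,0)=y_0\in L^2(\Omega)$, and its adjoint system $\partial_t\varphi+\varepsilon\Delta\varphi+\nabla\cdot(\varphi\mathfrak{B}(x,t))=0$ in $\Omega\times(0,T)$, $(\varepsilon\nabla\varphi+\varphi\mathfrak{B}(x,t))\cdot\mathbf{n}=0$ on $\Gamma\times(0,T)$, $\varphi(\cdot,T)=\varphi_T\in L^2(\Omega)$ (weak solutions). The cost of null controllability is $\mathcal{K}(\varepsilon,T,\Omega,\omega):=\sup_{\varphi_T\in L^2(\Omega)\setminus\{0\}}\|\varphi(\cdot,0)\|_{L^2(\Omega)}/\|\varphi\|_{L^2(\omega\times(0,T))}$ with $\varphi$ the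 adjoint solution. $\Phi(t,t_0,x_0)$ denotes the trajectory of $\mathfrak{B}$: $\frac{d}{dt}\Phi(t,t_0,x_0)=\mathfrak{B}(\Phi(t,t_0,x_0),t)$, $\Phi(t_0,t_0,x_0)=x_0$. *)

theory Defs
  imports "HOL-Analysis.Analysis"
begin

text \<open>Points of \<open>\<real>\<^sup>d\<close> are elements of an arbitrary Euclidean space \<open>'a\<close> (so \<open>d = DIM('a) \<ge> 1\<close>).
  Space-time points are pairs \<open>(x, t) :: 'a \<times> real\<close>, with Lebesgue measure \<open>lborel\<close>.\<close>

definition lipschitz_boundary :: "'a::euclidean_space set \<Rightarrow> bool" where
  "lipschitz_boundary \<Omega> \<longleftrightarrow>
     (\<forall>p\<in>frontier \<Omega>. \<exists>(e::'a) (r::real) (h::real) (L::real) (g::'a \<Rightarrow> real).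
        norm e = 1 \<and> r > 0 \<and> h > 0 \<and>
        L-lipschitz_on {y. y \<bullet> e = 0} g \<and>
        g (p - (p \<bullet> e) *\<^sub>R e) = p \<bullet> e \<and>
        (\<forall>y s. y \<bullet> e = 0 \<and> norm (y - (p - (p \<bullet> e) *\<^sub>R e)) < r \<and> \<bar>s - p \<bullet> e\<bar> < h \<longrightarrow>
               (y + s *\<^sub>R e \<in> \<Omega> \<longleftrightarrow> g y < s)))"

text \<open>\<open>\<BB> \<in> L\<^sup>\<infinity>(0,T;W\<^sup>1\<^sup>,\<^sup>\<infinity>(\<Omega>)\<^sup>d)\<close>, using the Lipschitz representative
  (on a bounded Lipschitz domain \<open>W\<^sup>1\<^sup>,\<^sup>\<infinity>(\<Omega>)\<close> = bounded Lipschitz functions).\<close>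
definition Linf_W1inf :: "real \<Rightarrow> 'a::euclidean_space set \<Rightarrow> (real \<Rightarrow> 'a \<Rightarrow> 'a) \<Rightarrow> bool" where
  "Linf_W1inf T \<Omega> B \<longleftrightarrow>
     set_borel_measurable lborel (\<Omega> \<times> {0<..<T}) (\<lambda>z. B (snd z) (fst z)) \<and>
     (\<exists>M. \<forall>t\<in>{0<..<T}. M-lipschitz_on \<Omega> (B t) \<and> (\<forall>x\<in>\<Omega>. norm (B t x) \<le> M))"

text \<open>\<open>\<gamma> t = \<Phi>(t,T,x\<^sub>0)\<close> for \<open>t \<in> [0,T]\<close>: Caratheodory solution of \<open>\<gamma>' = \<BB>(\<gamma>,t)\<close>, \<open>\<gamma>(T) = x\<^sub>0\<close>.\<close>
definition backward_trajectory :: "real \<Rightarrow> (real \<Rightarrow> 'a::euclidean_space \<Rightarrow> 'a) \<Rightarrow> 'a \<Rightarrow> (real \<Rightarrow> 'a) \<Rightarrow> bool" where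
  "backward_trajectory T B x0 \<gamma> \<longleftrightarrow>
     (\<forall>t\<in>{0..T}. (\<lambda>s. B s (\<gamma> s)) integrable_on {t..T} \<and>
                  \<gamma> t = x0 - integral {t..T} (\<lambda>s. B s (\<gamma> s)))"

definition C1_test :: "('a::euclidean_space \<times> real \<Rightarrow> real) \<Rightarrow> ('a \<times> real \<Rightarrow> 'a \<times> real) \<Rightarrow> bool" where
  "C1_test \<psi> D\<psi> \<longleftrightarrow> (\<forall>z. (\<psi> has_derivative (\<lambda>h. D\<psi> z \<bullet> h)) (at z)) \<and> continuous_on UNIV D\<psi>"

text \<open>Weak solution of the adjoint system
  \<open>\<partial>\<^sub>t\<phi> + \<epsilon>\<Delta>\<phi> + \<nabla>\<cdot>(\<phi>\<BB>) = 0\<close>, \<open>(\<epsilon>\<nabla>\<phi> + \<phi>\<BB>)\<cdot>n = 0\<close>, \<open>\<phi>(T) = \<phi>\<^sub>T\<close>: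
  \<open>\<phi> \<in> L\<^sup>2(0,T;H\<^sup>1(\<Omega>)) \<inter> C([0,T];L\<^sup>2(\<Omega>))\<close> (with weak spatial gradient \<open>G\<close>) such that for all
  \<open>C\<^sup>1\<close> test functions \<open>\<psi>\<close> on \<open>\<Omega>\<times>[0,T]\<close>:
  \<open>\<integral>\<phi>(T)\<psi>(T) - \<integral>\<phi>(0)\<psi>(0) - \<integral>\<integral>\<phi>\<partial>\<^sub>t\<psi> = \<integral>\<integral>(\<epsilon>\<nabla>\<phi>\<cdot>\<nabla>\<psi> + \<phi>\<BB>\<cdot>\<nabla>\<psi>)\<close>.\<close>
definition adjoint_weak_solution ::
  "real \<Rightarrow> real \<Rightarrow> 'a::euclidean_space set \<Rightarrow> (real \<Rightarrow> 'a \<Rightarrow> 'a) \<Rightarrow> ('a \<Rightarrow> real) \<Rightarrow> (real \<Rightarrow> 'a \<Rightarrow> real) \<Rightarrow> bool" where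
  "adjoint_weak_solution \<epsilon> T \<Omega> B \<phi>T \<phi> \<longleftrightarrow>
     (\<exists>G :: real \<Rightarrow> 'a \<Rightarrow> 'a.
        set_borel_measurable lborel (\<Omega> \<times> {0<..<T}) (\<lambda>z. \<phi> (snd z) (fst z)) \<and>
        set_borel_measurable lborel (\<Omega> \<times> {0<..<T}) (\<lambda>z. G (snd z) (fst z)) \<and>
        set_integrable lborel (\<Omega> \<times> {0<..<T}) (\<lambda>z. (\<phi> (snd z) (fst z))\<^sup>2) \<and>
        set_integrable lborel (\<Omega> \<times> {0<..<T}) (\<lambda>z. (norm (G (snd z) (fst z)))\<^sup>2) \<and>
        (\<forall>t\<in>{0..T}. set_borel_measurable lborel \<Omega> (\<phi> t) \<and>
                     set_integrable lborel \<Omega> (\<lambda>x. (\<phi> t x)\<^sup>2)) \<and>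
        (\<forall>t\<in>{0..T}. ((\<lambda>s. LINT x:\<Omega>|lborel. (\<phi> s x - \<phi> t x)\<^sup>2) \<longlongrightarrow> 0) (at t within {0..T})) \<and>
        (AE x in lborel. x \<in> \<Omega> \<longrightarrow> \<phi> T x = \<phi>T x) \<and>
        (\<forall>\<psi> D\<psi>. C1_test \<psi> D\<psi> \<and> closure {z. \<psi> z \<noteq> 0} \<subseteq> \<Omega> \<times> {0<..<T} \<and> compact (closure {z. \<psi> z \<noteq> 0}) \<longrightarrow>
            (LINT z:\<Omega> \<times> {0<..<T}|lborel. \<phi> (snd z) (fst z) *\<^sub>R fst (D\<psi> z)) =
            - (LINT z:\<Omega> \<times> {0<..<T}|lborel. \<psi> z *\<^sub>R G (snd z) (fst z))) \<and>
        (\<forall>\<psi> D\<psi>. C1_test \<psi> D\<psi> \<longrightarrow>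
            (LINT x:\<Omega>|lborel. \<phi> T x * \<psi> (x, T)) - (LINT x:\<Omega>|lborel. \<phi> 0 x * \<psi> (x, 0))
            - (LINT z:\<Omega> \<times> {0<..<T}|lborel. \<phi> (snd z) (fst z) * snd (D\<psi> z)) =
            (LINT z:\<Omega> \<times> {0<..<T}|lborel.
                \<epsilon> * (G (snd z) (fst z) \<bullet> fst (D\<psi> z)) +
                \<phi> (snd z) (fst z) * (B (snd z) (fst z) \<bullet> fst (D\<psi> z)))))"

definition L2_nonzero :: "'a::euclidean_space set \<Rightarrow> ('a \<Rightarrow> real) \<Rightarrow> bool" where
  "L2_nonzero \<Omega> f \<longleftrightarrow> set_borel_measurable lborel \<Omega> f \<and> set_integrable lborel \<Omega> (\<lambda>x. (f x)\<^sup>2) \<and>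
      \<not> (AE x in lborel. x \<in> \<Omega> \<longrightarrow> f x = 0)"

definition eratio :: "real \<Rightarrow> real \<Rightarrow> ereal" where
  "eratio a b = (if b = 0 then (if a = 0 then 0 else \<infinity>) else ereal (a / b))"

definition control_cost :: "real \<Rightarrow> real \<Rightarrow> 'a::euclidean_space set \<Rightarrow> 'a set \<Rightarrow> (real \<Rightarrow> 'a \<Rightarrow> 'a) \<Rightarrow> ereal" where
  "control_cost \<epsilon> T \<Omega> \<omega> B =
     (SUP p \<in> {(\<phi>T, \<phi>). L2_nonzero \<Omega> \<phi>T \<and> adjoint_weak_solution \<epsilon> T \<Omega> B \<phi>T \<phi>}.
        eratio (sqrt (LINT x:\<Omega>|lborel. (snd p 0 x)\<^sup>2))
               (sqrt (LINT z:\<omega> \<times> {0<..<T}|lborel. (snd p (snd z) (fst z))\<^sup>2)))"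

end

(* The adjoint equation is the forward equation of a diffusion run backwards in time along B, so a
   solution that starts at time T near x0 stays, up to exponentially small mass, near the trajectory,
   which avoids the closure of omega, while its total mass is conserved by the no-flux condition.
   Conservation of mass bounds |phi(0)| from below, and the L2 norm of phi on omega is at most
   C e^(-p/2) exp(-c/(2e)).

   Solutions are built from an explicit nonlocal scheme: a point x of the domain jumps to x + h z, with z
   uniform in a cube, whenever the target lies in the domain.  The scheme conserves mass, preserves
   positivity and has a discrete energy estimate up to the Lipschitz boundary.  Concentration follows from
   a truncated Gaussian weight exp(min (a |x - g|^2) s), a of order 1/e, that moves with the trajectory: a
   weighted L1 bound by duality, then a weighted L2 bound through a nonlocal Nash inequality at the scale
   r = kappa e, which costs only a power of e.  As h and the time step tend to 0, convex combinations of
   the schemes converge strongly in L2 (Mazur), and equicontinuity in time upgrades this to convergence of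
   every time slice; all bounds and the linear weak formulation survive convex combinations. *)

theory Submission
  imports Defs
begin

text \<open>A weighted energy estimate alone proves nothing: conjugation with a weight of slope 1/e
  lets the weighted L2 norm grow at a rate of order 1/e, and over the time T this loss is of the
  same order as the gain from the weight. The weighted L1 norm behaves better. The weight is a
  supersolution of the dual equation up to a rate free of e, because its coefficient a decreases
  along the scheme at relative rate 2 M + 1, which pays for the stretching by the Lipschitz drift
  and for the quadratic term of the Gaussian. With kappa fixed by the L2 growth constant, the Nash
  inequality lets the dissipation swallow the bad L2 growth and leaves only the L1 mass. The
  truncation level is reached within distance R / 2 of the trajectory: jumps from the Gaussian
  region never feel the boundary, and on omega the weight is saturated. The initial support is so
  small that the data carry at most a quarter of the saturated exponent. Existence is proved along
  with the bound, since the cost is a supremum over solutions and a concentrated one has to be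
  exhibited.\<close>

lemmas lint_add = Bochner_Integration.integral_add
 and lint_diff = Bochner_Integration.integral_diff
 and lint_cong = Bochner_Integration.integral_cong
 and lint_sum = Bochner_Integration.integral_sum
 and lint_minus = Bochner_Integration.integral_minus
 and lintegrable_add = Bochner_Integration.integrable_add
 and lintegrable_diff = Bochner_Integration.integrable_diff
 and lintegrable_sum = Bochner_Integration.integrable_sum
 and lintegrable_bound = Bochner_Integration.integrable_bound

section \<open>Restricted Lebesgue measure and bounded Borel functions\<close>

abbreviation ev :: "(real => 'a => 'b) => 'a \<times> real => 'b" where
 "ev F z \<equiv> F (snd z) (fst z)"

text \<open>A density instead of a restriction: the sigma algebra remains that of the whole type, so
  measurability never mentions \<open>A\<close>, and one function can be integrated over many sets
  without transfer.\<close>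

definition dm :: "'a::euclidean_space set => 'a measure" where
 "dm A = density lborel (indicator A)"

text \<open>Measurable on the whole type, but bounded only on \<open>A\<close>: such functions are
  closed under all operations used below, and on bounded Borel \<open>A\<close> each is integrable
  for \<open>dm A\<close>. The rules collected in \<open>bmon_intros\<close> therefore settle nearly
  all integrability goals.\<close>

definition bmon :: "'a::euclidean_space set => ('a => 'b::euclidean_space) => bool" where
 "bmon A F \<longleftrightarrow> F \<in> borel_measurable borel \<and> (\<exists>C. \<forall>p\<in>A. norm (F p) \<le> C)"

lemma sets_dm [simp, measurable_cong]: "sets (dm A) = sets borel"
 and space_dm [simp]: "space (dm A) = UNIV"
 by (simp_all add: dm_def)

lemma measurable_dm [simp]: "measurable (dm A) N = measurable borel N"
 by (rule measurable_cong_sets) simp_all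

lemma AE_dm:
 assumes "A \<in> sets borel"
 shows "(AE x in dm A. P x) \<longleftrightarrow> (AE x in lborel. x \<in> A \<longrightarrow> P x)"
proof -
 have "(AE x in lborel. 0 < (indicator A x :: ennreal) \<longrightarrow> P x) \<longleftrightarrow> (AE x in lborel. x \<in> A \<longrightarrow> P x)"
  by (intro arg_cong[where f="\<lambda>Q. almost_everywhere lborel Q"] ext) (auto split: split_indicator)
 then show ?thesis
  using assms unfolding dm_def by (subst AE_density) auto
qed

lemma AE_dmI: "A \<in> sets borel ==> (\<And>x. x \<in> A ==> P x) ==> AE x in dm A. P x"
 by (subst AE_dm) auto

lemma emeasure_dm: "A \<in> sets borel ==> X \<in> sets borel ==> emeasure (dm A) X = emeasure lborel (A \<inter> X)"
 unfolding dm_def by (subst emeasure_density) (auto simp: indicator_inter_arith[symmetric])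

lemma measure_dm: "A \<in> sets borel ==> X \<in> sets borel ==> measure (dm A) X = measure lborel (A \<inter> X)"
 by (simp add: measure_def emeasure_dm)

lemma finite_measure_dm:
 assumes "A \<in> sets borel" "bounded A"
 shows "finite_measure (dm A)"
proof
 have "emeasure lborel A < \<infinity>" by (rule emeasure_bounded_finite) fact
 then show "emeasure (dm A) (space (dm A)) \<noteq> \<infinity>" using assms by (simp add: emeasure_dm)
qed

lemma integral_dm:
 fixes f :: "'a::euclidean_space => 'b::euclidean_space"
 assumes "A \<in> sets borel" "f \<in> borel_measurable borel"
 shows "(LINT x|dm A. f x) = (LINT x|lborel. indicator A x *\<^sub>R f x)"
proof -
 have "dm A = density lborel (\<lambda>x. ennreal (indicator A x))"
  unfolding dm_def by (simp add: ennreal_indicator)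
 then show ?thesis using assms by (simp add: integral_density)
qed

lemma integrable_dm_iff:
 fixes f :: "'a::euclidean_space => 'b::euclidean_space"
 assumes "A \<in> sets borel" "f \<in> borel_measurable borel"
 shows "integrable (dm A) f \<longleftrightarrow> integrable lborel (\<lambda>x. indicator A x *\<^sub>R f x)"
proof -
 have "dm A = density lborel (\<lambda>x. ennreal (indicator A x))"
  unfolding dm_def by (simp add: ennreal_indicator)
 then show ?thesis using assms by (simp add: integrable_density)
qed

lemma integrable_bmon:
 assumes "A \<in> sets borel" "bounded A" "bmon A F"
 shows "integrable (dm A) F"
proof -
 obtain C where C: "\<forall>p\<in>A. norm (F p) \<le> C" using assms(3) by (auto simp: bmon_def)
 interpret finite_measure "dm A" using assms by (intro finite_measure_dm)
 show ?thesis
  by (rule integrable_const_bound[where B=C]) (use assms C in \<open>auto intro!: AE_dmI simp: bmon_def\<close>)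
qed

lemma bmon_measurable: "bmon A F ==> F \<in> borel_measurable borel"
 by (simp add: bmon_def)

lemma bmonI: "F \<in> borel_measurable borel ==> (\<And>p. p \<in> A ==> norm (F p) \<le> C) ==> bmon A F"
 by (auto simp: bmon_def)

lemma bmon_subset: "bmon A F ==> B \<subseteq> A ==> bmon B F"
 by (auto simp: bmon_def)

lemma bmon_const: "bmon A (\<lambda>_. c)"
 by (rule bmonI[of _ _ "norm c"]) auto

lemma bmon_add: assumes "bmon A F" "bmon A G" shows "bmon A (\<lambda>x. F x + G x)"
proof -
 obtain C D where "\<forall>p\<in>A. norm (F p) \<le> C" "\<forall>p\<in>A. norm (G p) \<le> D" using assms by (auto simp: bmon_def)
 then show ?thesis using assms
  by (intro bmonI[of _ _ "C + D"]) (auto simp: bmon_def intro: norm_triangle_mono)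
qed

lemma bmon_minus: "bmon A F ==> bmon A (\<lambda>x. - F x)"
 by (auto simp: bmon_def)

lemma bmon_diff: assumes "bmon A F" "bmon A G" shows "bmon A (\<lambda>x. F x - G x)"
 using bmon_add[OF assms(1) bmon_minus[OF assms(2)]] by simp

lemma bmon_scaleR: assumes "bmon A F" "bmon A G" shows "bmon A (\<lambda>x. F x *\<^sub>R G x)"
proof -
 obtain C D where "\<forall>p\<in>A. norm (F p) \<le> C" "\<forall>p\<in>A. norm (G p) \<le> D" using assms by (auto simp: bmon_def)
 then show ?thesis using assms
  by (intro bmonI[of _ _ "C * D"]) (auto simp: bmon_def intro!: mult_mono intro: order_trans[OF abs_ge_zero])
qed

lemma bmon_mult: fixes F G :: "_ => real" shows "bmon A F ==> bmon A G ==> bmon A (\<lambda>x. F x * G x)"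
 using bmon_scaleR[of A F G] by simp

lemma bmon_divide: fixes F :: "_ => real" shows "bmon A F ==> bmon A (\<lambda>x. F x / c)"
 using bmon_mult[OF _ bmon_const, of A F "1/c"] by simp

lemma bmon_inner: assumes "bmon A F" "bmon A G" shows "bmon A (\<lambda>x. F x \<bullet> G x)"
proof -
 obtain C D where CD: "\<forall>p\<in>A. norm (F p) \<le> C" "\<forall>p\<in>A. norm (G p) \<le> D" using assms by (auto simp: bmon_def)
 have "\<bar>F p \<bullet> G p\<bar> \<le> C * D" if "p \<in> A" for p
 proof -
  have "\<bar>F p \<bullet> G p\<bar> \<le> norm (F p) * norm (G p)" by (rule Cauchy_Schwarz_ineq2)
  also have "... \<le> C * D" using CD that by (intro mult_mono) (auto intro: order_trans[OF norm_ge_zero])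
  finally show ?thesis .
 qed
 then show ?thesis using assms by (intro bmonI[of _ _ "C * D"]) (auto simp: bmon_def)
qed

lemma bmon_norm: "bmon A F ==> bmon A (\<lambda>x. norm (F x))"
 by (auto simp: bmon_def)

lemma bmon_abs: fixes F :: "_ => real" shows "bmon A F ==> bmon A (\<lambda>x. \<bar>F x\<bar>)"
 by (auto simp: bmon_def)

lemma bmon_power: fixes F :: "_ => real" shows "bmon A F ==> bmon A (\<lambda>x. F x ^ n)"
 by (induction n) (auto intro: bmon_const bmon_mult)

lemma bmon_sum: "(\<And>i. i \<in> I ==> bmon A (F i)) ==> bmon A (\<lambda>x. \<Sum>i\<in>I. F i x)"
 by (induction I rule: infinite_finite_induct) (auto intro: bmon_const bmon_add)

lemma bmon_max: fixes F G :: "_ => real"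
 assumes "bmon A F" "bmon A G" shows "bmon A (\<lambda>x. max (F x) (G x))"
proof -
 have "(\<lambda>x. max (F x) (G x)) = (\<lambda>x. (F x + G x + \<bar>F x - G x\<bar>) / 2)" by (auto simp: max_def)
 then show ?thesis using assms by (auto intro!: bmon_divide bmon_add bmon_abs bmon_diff)
qed

lemma bmon_min: fixes F G :: "_ => real"
 assumes "bmon A F" "bmon A G" shows "bmon A (\<lambda>x. min (F x) (G x))"
proof -
 have "(\<lambda>x. min (F x) (G x)) = (\<lambda>x. (F x + G x - \<bar>F x - G x\<bar>) / 2)" by (auto simp: min_def)
 then show ?thesis using assms by (auto intro!: bmon_divide bmon_add bmon_abs bmon_diff)
qed

lemma bmon_exp: fixes F :: "_ => real" assumes "bmon A F" shows "bmon A (\<lambda>x. exp (F x))"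
proof -
 obtain C where C: "\<forall>p\<in>A. norm (F p) \<le> C" using assms by (auto simp: bmon_def)
 have "exp (F p) \<le> exp C" if "p \<in> A" for p using C that by (auto simp: abs_le_iff)
 then show ?thesis using assms by (intro bmonI[of _ _ "exp C"]) (auto simp: bmon_def)
qed

lemma bmon_ident: "bounded A ==> bmon A (\<lambda>x. x)"
 by (auto simp: bmon_def bounded_iff)

lemma bmon_compose:
 "bmon B F ==> g \<in> borel_measurable borel ==> (\<And>p. p \<in> A ==> g p \<in> B) ==> bmon A (\<lambda>x. F (g x))"
 by (auto simp: bmon_def intro!: measurable_compose[of g borel borel F])

lemmas bmon_intros = bmon_const bmon_add bmon_minus bmon_diff bmon_scaleR bmon_mult bmon_divide bmon_inner
 bmon_norm bmon_abs bmon_power bmon_sum bmon_max bmon_min bmon_exp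

section \<open>Changes of variables for Lebesgue measure\<close>

lemma integral_translate:
 fixes f :: "'a::euclidean_space => 'b::euclidean_space"
 assumes [measurable]: "f \<in> borel_measurable borel"
 shows "(LINT x|lborel. f (t + x)) = (LINT x|lborel. f x)"
proof -
 have "(LINT x|lborel. f x) = (LINT x|distr lborel borel ((+) t). f x)" by (simp add: lborel_distr_plus)
 also have "... = (LINT x|lborel. f (t + x))" by (subst integral_distr) auto
 finally show ?thesis by simp
qed

lemma integral_scale:
 fixes f :: "'a::euclidean_space => real"
 assumes [measurable]: "f \<in> borel_measurable borel" and "c \<noteq> 0"
 shows "\<bar>c\<bar> ^ DIM('a) * (LINT x|lborel. f (t + c *\<^sub>R x)) = (LINT x|lborel. f x)"
proof -
 have *: "lborel = density (distr lborel borel (\<lambda>x. t + c *\<^sub>R x)) (\<lambda>_. ennreal (\<bar>c\<bar>^DIM('a)))"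
  using lborel_affine[of c t] assms by simp
 have "(LINT x|lborel. f x) = (LINT x|density (distr lborel borel (\<lambda>x. t + c *\<^sub>R x)) (\<lambda>_. ennreal (\<bar>c\<bar>^DIM('a))). f x)"
  using * by simp
 also have "... = \<bar>c\<bar> ^ DIM('a) * (LINT x|lborel. f (t + c *\<^sub>R x))"
  by (subst integral_density) (auto simp: integral_distr)
 finally show ?thesis by simp
qed

lemma integral_uminus:
 fixes f :: "'a::euclidean_space => real"
 assumes [measurable]: "f \<in> borel_measurable borel"
 shows "(LINT x|lborel. f (- x)) = (LINT x|lborel. f x)"
 using integral_scale[OF assms, of "-1" 0] by simp

text \<open>The diagonal map with entries -1 and 1 has Jacobian of modulus 1; this symmetry is what
  kills the mixed second moments of the cube.\<close>

lemma integral_reflect: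
 fixes f :: "'a::euclidean_space => real"
 assumes [measurable]: "f \<in> borel_measurable borel" and i: "i \<in> Basis"
 shows "(LINT x|lborel. f (x - (2 * (x \<bullet> i)) *\<^sub>R i)) = (LINT x|lborel. f x)"
proof -
 define c where "c j = (if j = i then -1 else 1 :: real)" for j
 define T where "T x = 0 + (\<Sum>j\<in>Basis. (c j * (x \<bullet> j)) *\<^sub>R j)" for x :: 'a
 have T: "T x = x - (2 * (x \<bullet> i)) *\<^sub>R i" for x
  by (rule euclidean_eqI)
    (auto simp: T_def c_def inner_diff_left inner_sum_left_Basis inner_Basis i)
 have TT: "T \<in> borel_measurable borel" unfolding T by measurable
 have "lborel = density (distr lborel borel T) (\<lambda>_. ennreal (\<Prod>j\<in>Basis. \<bar>c j\<bar>))"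
  unfolding T_def by (rule lborel_affine_euclidean) (auto simp: c_def)
 moreover have "(\<Prod>j\<in>(Basis::'a set). \<bar>c j\<bar>) = 1" by (rule prod.neutral) (auto simp: c_def)
 ultimately have *: "lborel = distr lborel borel T" by (simp add: density_1)
 have "(LINT x|lborel. f x) = (LINT x|distr lborel borel T. f x)" using * by simp
 also have "... = (LINT x|lborel. f (T x))" using TT by (subst integral_distr) auto
 finally show ?thesis by (simp add: T)
qed

section \<open>Moments of the cube of jump directions\<close>

text \<open>A cube rather than a ball: its indicator is a product over coordinates, so the second
  moments reduce to one-dimensional integrals, while the symmetry under \<open>z\<close> to
  \<open>- z\<close> and under coordinate reflections is retained.\<close>

definition cube :: "'a::euclidean_space set" where
 "cube = cbox (- One) One"

text \<open>The factor that turns the second moments of the cube into the identity matrix.\<close>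

definition kc :: "'a::euclidean_space itself => real" where
 "kc _ = 3 / 2 ^ DIM('a)"

lemma in_cube: "z \<in> cube \<longleftrightarrow> (\<forall>i\<in>Basis. \<bar>z \<bullet> i\<bar> \<le> 1)"
 by (auto simp: cube_def mem_box abs_le_iff)

lemma cube_sets [measurable, simp]: "cube \<in> sets borel" by (simp add: cube_def)
lemma cube_bounded [simp]: "bounded cube" by (simp add: cube_def)

lemma cube_uminus: "- z \<in> cube \<longleftrightarrow> z \<in> cube" by (simp add: in_cube)

lemma cube_norm: "z \<in> cube ==> norm (z :: 'a::euclidean_space) \<le> DIM('a)"
 using norm_le_l1[of z] sum_bounded_above[of Basis "\<lambda>i. \<bar>z \<bullet> i\<bar>" 1] by (simp add: in_cube)

lemma cube_ball: "norm z \<le> 1 ==> z \<in> cube"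
 unfolding in_cube using Basis_le_norm order_trans by blast

lemma kc_pos: "kc TYPE('a::euclidean_space) > 0" by (simp add: kc_def)

lemma cube_measure: "measure lborel (cube :: 'a::euclidean_space set) = 2 ^ DIM('a)"
proof -
 have "measure lborel (cube :: 'a set) = (\<Prod>b\<in>(Basis::'a set). (One - - One) \<bullet> b)"
  unfolding cube_def by (rule measure_lborel_cbox) auto
 also have "... = (\<Prod>b\<in>(Basis::'a set). 2)" by (rule prod.cong) (auto simp: inner_diff_left inner_add_left)
 also have "... = 2 ^ DIM('a)" by simp
 finally show ?thesis .
qed

lemma cube_odd:
 fixes f :: "'a::euclidean_space => real"
 assumes [measurable]: "f \<in> borel_measurable borel" and odd: "\<And>z. f (- z) = - f z"
 shows "(LINT z|dm cube. f z) = 0"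
proof -
 have "(LINT z|lborel. indicator cube z *\<^sub>R f z) = (LINT z|lborel. indicator cube (-z) *\<^sub>R f (- z))"
  by (rule integral_uminus[symmetric]) simp
 also have "... = - (LINT z|lborel. indicator cube z *\<^sub>R f z)"
  by (simp add: odd indicator_def cube_uminus flip: lint_minus)
 finally show ?thesis by (subst integral_dm) auto
qed

lemma nn_sq: "(\<integral>\<^sup>+x. ennreal (indicator {-1..1} x * x^2) \<partial>lborel) = ennreal (2/3 :: real)"
proof -
 have "(\<integral>\<^sup>+x. ennreal (x^2) * indicator {-1..1} x \<partial>lborel) = ennreal ((\<lambda>x. x^3/3) 1 - (\<lambda>x::real. x^3/3) (-1))"
  by (rule nn_integral_FTC_Icc) (auto intro!: derivative_eq_intros simp: power2_eq_square)
 moreover have "ennreal (indicator {-1..1} x * x^2) = ennreal (x^2) * indicator {-1..1} x" for x :: real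
  by (simp add: indicator_def)
 ultimately show ?thesis by simp
qed

lemma cube_moment_diag:
 assumes i: "(i::'a::euclidean_space) \<in> Basis"
 shows "(LINT z|dm (cube::'a set). (z \<bullet> i)^2) = 2 ^ DIM('a) / 3"
proof -
 define f :: "'a => real => real" where "f b x = indicator {-1..1} x * (if b = i then x^2 else 1)" for b x
 have prod: "indicator cube z * (z \<bullet> i)^2 = (\<Prod>b\<in>Basis. f b (z \<bullet> b))" for z
 proof -
  have "(\<Prod>b\<in>Basis. f b (z \<bullet> b)) = (\<Prod>b\<in>Basis. indicator {-1..1} (z \<bullet> b)) * (\<Prod>b\<in>Basis. if b = i then (z \<bullet> b)^2 else 1)"
   unfolding f_def by (rule prod.distrib)
  also have "(\<Prod>b\<in>Basis. if b = i then (z \<bullet> b)^2 else 1) = (z \<bullet> i)^2"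
   using i by (simp add: prod.delta')
  also have "(\<Prod>b\<in>Basis. indicator {-1..1} (z \<bullet> b)) = (indicator cube z :: real)"
   by (auto simp: indicator_def in_cube abs_le_iff)
  finally show ?thesis by simp
 qed
 have "(\<integral>\<^sup>+z. ennreal (indicator cube z * (z \<bullet> i)^2) \<partial>lborel) = (\<integral>\<^sup>+z. (\<Prod>b\<in>Basis. ennreal (f b (z \<bullet> b))) \<partial>lborel)"
  by (intro nn_integral_cong, subst prod, rule prod_ennreal[symmetric]) (simp add: f_def)
 also have "... = (\<Prod>b\<in>(Basis::'a set). (\<integral>\<^sup>+x. ennreal (f b x) \<partial>lborel))"
  by (rule nn_integral_lborel_prod) (auto simp: f_def)
 also have "... = (\<Prod>b\<in>(Basis::'a set). ennreal (if b = i then 2/3 else 2))"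
 proof (rule prod.cong)
  fix b :: 'a
  have "(\<integral>\<^sup>+x. ennreal (indicator {-1..1::real} x) \<partial>lborel) = ennreal (2::real)"
   by (simp add: ennreal_indicator)
  then show "(\<integral>\<^sup>+x. ennreal (f b x) \<partial>lborel) = ennreal (if b = i then 2/3 else 2)"
   using nn_sq by (simp add: f_def)
 qed simp
 also have "... = ennreal (\<Prod>b\<in>(Basis::'a set). if b = i then 2/3 else 2)"
  by (rule prod_ennreal) auto
 also have "(\<Prod>b\<in>(Basis::'a set). if b = i then 2/3 else 2) = (2::real) ^ DIM('a) / 3"
 proof -
  have "(\<Prod>b\<in>(Basis::'a set). if b = i then 2/3 else 2) = (2/3) * (\<Prod>b\<in>Basis - {i}. (2::real))"
   using i by (subst prod.remove[of _ i]) (auto intro!: prod.cong)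
  also have "... = (2/3) * 2 ^ (DIM('a) - 1)" using i by simp
  also have "... = 2 ^ DIM('a) / 3" by (cases "DIM('a)") auto
  finally show ?thesis .
 qed
 finally have "(LINT z|lborel. indicator cube z * (z \<bullet> i)^2) = 2 ^ DIM('a) / 3"
  by (subst integral_eq_nn_integral) auto
 then show ?thesis by (subst integral_dm) auto
qed

lemma cube_moment_off:
 assumes i: "(i::'a::euclidean_space) \<in> Basis" "j \<in> Basis" "i \<noteq> j"
 shows "(LINT z|dm (cube::'a set). (z \<bullet> i) * (z \<bullet> j)) = 0"
proof -
 let ?R = "\<lambda>z::'a. z - (2 * (z \<bullet> i)) *\<^sub>R i"
 let ?f = "\<lambda>z::'a. indicator cube z *\<^sub>R ((z \<bullet> i) * (z \<bullet> j))"
 have R: "?R z \<bullet> k = (if k = i then - (z \<bullet> k) else z \<bullet> k)" if "k \<in> Basis" for z k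
  using that i by (auto simp: inner_diff_left inner_Basis)
 have cu: "?R z \<in> cube \<longleftrightarrow> z \<in> cube" for z
  unfolding in_cube by (intro ball_cong refl) (auto simp: R)
 have "(LINT z|lborel. ?f z) = (LINT z|lborel. ?f (?R z))"
  by (rule integral_reflect[symmetric]) (use i in auto)
 also have "... = (LINT z|lborel. - ?f z)"
  by (rule lint_cong) (use i in \<open>auto simp: R indicator_def cu\<close>)
 also have "... = - (LINT z|lborel. ?f z)" by simp
 finally show ?thesis by (subst integral_dm) auto
qed

lemma bmon_cube: "bmon cube (\<lambda>z. z)" by (rule bmon_ident) simp

lemma integrable_cube: "bmon cube F ==> integrable (dm cube) F"
 by (rule integrable_bmon) auto

text \<open>The second moment tensor of the cube is a multiple of the identity, and
  \<open>kc\<close> removes the multiple. This identity converts averages over jump directions into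
  inner products of gradients.\<close>

lemma cube_moment:
 fixes a b :: "'a::euclidean_space"
 shows "kc TYPE('a) * (LINT z|dm cube. (a \<bullet> z) * (b \<bullet> z)) = a \<bullet> b"
proof -
 have "(a \<bullet> z) * (b \<bullet> z) = (\<Sum>i\<in>Basis. \<Sum>j\<in>Basis. (a \<bullet> i) * (b \<bullet> j) * ((z \<bullet> i) * (z \<bullet> j)))" for z
  unfolding euclidean_inner[of a z] euclidean_inner[of b z] sum_product
  by (intro sum.cong) (auto simp: inner_commute mult_ac)
 then have "(LINT z|dm cube. (a \<bullet> z) * (b \<bullet> z)) =
   (\<Sum>i\<in>Basis. \<Sum>j\<in>Basis. (a \<bullet> i) * (b \<bullet> j) * (LINT z|dm cube. (z \<bullet> i) * (z \<bullet> j)))"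
  by (simp add: lint_sum integrable_cube bmon_intros bmon_cube)
 also have "... = (\<Sum>i\<in>Basis. \<Sum>j\<in>Basis. (a \<bullet> i) * (b \<bullet> j) * (if i = j then 2 ^ DIM('a) / 3 else 0))"
  by (intro sum.cong refl) (auto simp: cube_moment_off simp flip: power2_eq_square simp: cube_moment_diag)
 also have "... = (2 ^ DIM('a) / 3) * (a \<bullet> b)"
  unfolding euclidean_inner[of a b] sum_distrib_left
  by (intro sum.cong refl) (simp add: if_distrib sum.delta' cong: if_cong)
 finally show ?thesis unfolding kc_def by (simp only:) (simp add: field_simps)
qed

lemma kc_cube: "kc TYPE('a) * measure lborel (cube :: 'a::euclidean_space set) = 3"
 by (simp add: kc_def cube_measure)

section \<open>A nonlocal diffusion scheme\<close>

locale jump =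
 fixes Om :: "'a::euclidean_space set" and h :: real
 assumes open_Om: "open Om" and bounded_Om: "bounded Om" and h_pos: "h > 0"
begin

definition J :: "('a \<times> 'a) set" where
 "J = {p. fst p \<in> Om \<and> fst p + h *\<^sub>R snd p \<in> Om \<and> snd p \<in> cube}"

definition JX :: "'a => 'a set" where
 "JX x = {z. x + h *\<^sub>R z \<in> Om \<and> z \<in> cube}"

definition tgt :: "'a \<times> 'a => 'a" where
 "tgt p = fst p + h *\<^sub>R snd p"

text \<open>The same jump traversed backwards. It is an involution of \<open>J\<close> that
  preserves Lebesgue measure, and it is the symmetry behind integration by parts.\<close>

definition flip :: "'a \<times> 'a => 'a \<times> 'a" where
 "flip p = (tgt p, - snd p)"

text \<open>Discrete Dirichlet energy: for smooth \<open>v\<close> and small \<open>h\<close> the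
  factor \<open>kc\<close> makes it approach the integral of the squared gradient, by
  \<open>cube_moment\<close>.\<close>

definition energy :: "('a => real) => real" where
 "energy v = kc TYPE('a) / h^2 * (LINT p|dm J. (v (tgt p) - v (fst p))^2)"

text \<open>Discrete counterpart of the integral of \<open>e\<close> grad f . grad g + f b . grad g.
  The drift is evaluated at the starting point of the jump, which makes the dual operator
  \<open>gadj\<close> a pure jump operator with nonnegative rates for small
  \<open>h\<close>.\<close>

definition form :: "real => ('a => 'a) => ('a => real) => ('a => real) => real" where
 "form e b f g = kc TYPE('a) * (LINT p|dm J. e / h^2 * ((f (tgt p) - f (fst p)) * (g (tgt p) - g (fst p)))
   + f (fst p) * (b (fst p) \<bullet> snd p) * (g (tgt p) - g (fst p)) / h)"

text \<open>For smooth \<open>f\<close> and small \<open>h\<close> this is \<open>e \<Delta>f + \<nabla>\<cdot>(f b)\<close>; suppressing the jumps that leave the domain encodes the no-flux condition.\<close>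

definition gen :: "real => ('a => 'a) => ('a => real) => 'a => real" where
 "gen e b f x = kc TYPE('a) * (LINT z|dm (JX x). 2 * e / h^2 * (f (x + h *\<^sub>R z) - f x)
   + (z \<bullet> (f (x + h *\<^sub>R z) *\<^sub>R b (x + h *\<^sub>R z) + f x *\<^sub>R b x)) / h)"

text \<open>First moment of the difference quotients. Where the full cube of jumps is admissible it
  recovers the gradient of a smooth function in the limit, by \<open>cube_moment\<close>; up to the
  boundary it is controlled by the energy and is exactly dual to increments
  (\<open>gradh_dual\<close>).\<close>

definition gradh :: "('a => real) => 'a => 'a" where
 "gradh f x = (kc TYPE('a) / h) *\<^sub>R (LINT z|dm (JX x). (f (x + h *\<^sub>R z) - f x) *\<^sub>R z)"

lemma Om_sets [measurable, simp]: "Om \<in> sets borel" using open_Om by simp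

lemma tgt_measurable [measurable]: "tgt \<in> borel_measurable borel"
 unfolding tgt_def by (intro borel_measurable_continuous_onI continuous_intros)

lemma fst_measurable [measurable]: "(fst :: 'a \<times> 'a => 'a) \<in> borel_measurable borel"
 and snd_measurable [measurable]: "(snd :: 'a \<times> 'a => 'a) \<in> borel_measurable borel"
 by (intro borel_measurable_continuous_onI continuous_intros)+

lemma flip_measurable [measurable]: "flip \<in> borel_measurable borel"
 unfolding flip_def tgt_def by (intro borel_measurable_continuous_onI continuous_intros)

lemma tgt_flip [simp]: "tgt (flip p) = fst p" "fst (flip p) = tgt p" "snd (flip p) = - snd p"
 by (simp_all add: tgt_def flip_def)

lemma flip_J [simp]: "flip p \<in> J \<longleftrightarrow> p \<in> J"
 by (auto simp: J_def flip_def tgt_def cube_uminus)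

lemma J_iff: "p \<in> J \<longleftrightarrow> fst p \<in> Om \<and> tgt p \<in> Om \<and> snd p \<in> cube"
 by (auto simp: J_def tgt_def)

lemma J_sets [measurable, simp]: "J \<in> sets borel"
proof -
 have "J = (fst -` Om \<inter> space borel) \<inter> (tgt -` Om \<inter> space borel) \<inter> (snd -` cube \<inter> space borel)"
  by (auto simp: J_iff)
 also have "... \<in> sets borel"
  by (intro sets.Int measurable_sets[of _ borel borel]) auto
 finally show ?thesis .
qed

lemma J_bounded [simp]: "bounded J"
proof -
 have "J \<subseteq> Om \<times> cube" by (auto simp: J_iff)
 then show ?thesis using bounded_subset bounded_Times[OF bounded_Om cube_bounded] by blast
qed

lemma JX_sets [measurable, simp]: "JX x \<in> sets borel"
proof -
 have [measurable]: "(\<lambda>z. x + h *\<^sub>R z) \<in> borel_measurable borel" by simp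
 have "JX x = ((\<lambda>z. x + h *\<^sub>R z) -` Om \<inter> space borel) \<inter> cube" by (auto simp: JX_def)
 also have "... \<in> sets borel" by (intro sets.Int measurable_sets[of _ borel borel]) auto
 finally show ?thesis .
qed

lemma JX_cube: "JX x \<subseteq> cube" by (auto simp: JX_def)

lemma JX_bounded [simp]: "bounded (JX x)"
 by (rule bounded_subset[OF cube_bounded JX_cube])

lemma bmon_fst: "bmon Om f ==> bmon J (\<lambda>p. f (fst p))"
 by (rule bmon_compose) (auto simp: J_iff)
lemma bmon_tgt: "bmon Om f ==> bmon J (\<lambda>p. f (tgt p))"
 by (rule bmon_compose) (auto simp: J_iff)
lemma bmon_snd: "bmon J snd"
 by (rule bmon_compose[OF bmon_cube, of snd, simplified]) (auto simp: J_iff)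
lemmas bmon_J = bmon_fst bmon_tgt bmon_snd

lemma bmon_X: "bmon Om f ==> bmon (JX x) (\<lambda>z. f (x + h *\<^sub>R z))"
 by (rule bmon_compose) (auto simp: JX_def)
lemma bmon_JX_id: "bmon (JX x) (\<lambda>z. z)" by (rule bmon_ident) simp

lemma integrable_J: "bmon J F ==> integrable (dm J) F" by (rule integrable_bmon) auto
lemma integrable_Om: "bmon Om F ==> integrable (dm Om) F" by (rule integrable_bmon) (auto intro: bounded_Om)
lemma integrable_JX: "bmon (JX x) F ==> integrable (dm (JX x)) F" by (rule integrable_bmon) auto

lemma integral_J_mono:
 fixes F G :: "_ => real"
 assumes "bmon J F" "bmon J G" "\<And>p. p \<in> J ==> F p \<le> G p"
 shows "(LINT p|dm J. F p) \<le> (LINT p|dm J. G p)"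
 by (intro integral_mono_AE integrable_J AE_dmI assms) auto

lemma integral_Om_mono:
 fixes F G :: "_ => real"
 assumes "bmon Om F" "bmon Om G" "\<And>p. p \<in> Om ==> F p \<le> G p"
 shows "(LINT p|dm Om. F p) \<le> (LINT p|dm Om. G p)"
 by (intro integral_mono_AE integrable_Om AE_dmI assms) auto

lemma integral_Om_nonneg: 
 fixes F :: "_ => real"
 shows "(\<And>p. p \<in> Om ==> 0 \<le> F p) ==> 0 \<le> (LINT p|dm Om. F p)"
 by (intro integral_nonneg_AE AE_dmI) auto

text \<open>Reflect \<open>z\<close>, then translate \<open>x\<close> by
  \<open>h *\<^sub>R z\<close> for fixed \<open>z\<close>: both preserve Lebesgue measure, so no
  Jacobian appears. Every integration by parts in the scheme is this identity.\<close>

lemma integral_flip: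
 fixes F :: "_ => real"
 assumes F: "bmon J F"
 shows "(LINT p|dm J. F (flip p)) = (LINT p|dm J. F p)"
proof -
 define f where "f p = indicator J p *\<^sub>R F p" for p
 have Fm [measurable]: "F \<in> borel_measurable borel" using F by (rule bmon_measurable)
 have fm [measurable]: "f \<in> borel_measurable borel" unfolding f_def by measurable
 have fi: "integrable (lborel \<Otimes>\<^sub>M lborel) f"
  using integrable_J[OF F] unfolding lborel_prod f_def by (subst (asm) integrable_dm_iff) auto
 have bR: "bmon J (\<lambda>p. F (flip p))" by (rule bmon_compose[OF F]) auto
 have ri: "integrable (lborel \<Otimes>\<^sub>M lborel) (\<lambda>p. f (flip p))"
  using integrable_J[OF bR] unfolding lborel_prod f_def
  by (subst (asm) integrable_dm_iff) (auto simp: indicator_def)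
 have fp: "f (x, z) = case_prod (\<lambda>x z. f (x, z)) (x, z)" for x z by simp
 have m1: "(\<lambda>z. (LINT x|lborel. f (x, z))) \<in> borel_measurable borel"
 proof -
  have "(\<lambda>(z, x). f (x, z)) \<in> borel_measurable (lborel \<Otimes>\<^sub>M lborel)"
   unfolding lborel_prod by (simp add: split_beta') measurable
  from lborel.borel_measurable_lebesgue_integral[OF this] show ?thesis by simp
 qed
 have "(LINT p|lborel. f p) = (LINT z|lborel. LINT x|lborel. f (x, z))"
  using lborel_pair.integral_snd[of "\<lambda>x z. f (x, z)"] fi by (simp add: lborel_prod)
 also have "... = (LINT z|lborel. LINT x|lborel. f (x, - z))"
  by (rule integral_uminus[symmetric, OF m1])
 also have "... = (LINT z|lborel. LINT x|lborel. f (h *\<^sub>R z + x, - z))"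
  by (intro lint_cong refl integral_translate[symmetric]) measurable
 also have "... = (LINT z|lborel. LINT x|lborel. f (flip (x, z)))"
  by (simp add: flip_def tgt_def add.commute)
 also have "... = (LINT p|lborel. f (flip p))"
  using lborel_pair.integral_snd[of "\<lambda>x z. f (flip (x, z))"] ri by (simp add: lborel_prod split_beta')
 finally show ?thesis
  using F bR by (simp add: integral_dm bmon_measurable f_def indicator_def)
qed

lemma bmon_inner_integral:
 fixes F :: "'a \<times> 'a => 'b::euclidean_space"
 assumes F: "bmon J F"
 shows "bmon Om (\<lambda>x. LINT z|dm (JX x). F (x, z))"
proof -
 have Fm [measurable]: "F \<in> borel_measurable borel" using F by (rule bmon_measurable)
 obtain C where C: "\<forall>p\<in>J. norm (F p) \<le> C" using F by (auto simp: bmon_def)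
 have Fx: "(\<lambda>z. F (x, z)) \<in> borel_measurable borel" for x by measurable
 have set: "{p. tgt p \<in> Om \<and> snd p \<in> cube} \<in> sets borel"
 proof -
  have "{p. tgt p \<in> Om \<and> snd p \<in> cube} = (tgt -` Om \<inter> space borel) \<inter> (snd -` cube \<inter> space borel)" by auto
  also have "... \<in> sets borel" by (intro sets.Int measurable_sets[of _ borel borel]) auto
  finally show ?thesis .
 qed
 \<comment> \<open>The inner domain \<open>JX x\<close> moves with \<open>x\<close>; writing it as a
   slice of one fixed Borel set of pairs makes measurability of parameter integrals
   applicable.\<close>
 have eq: "(LINT z|dm (JX x). F (x, z)) = integral\<^sup>L lborel (\<lambda>z. indicator {p. tgt p \<in> Om \<and> snd p \<in> cube} (x, z) *\<^sub>R F (x, z))" for x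
  using Fx by (subst integral_dm) (auto simp: indicator_def JX_def tgt_def intro!: lint_cong)
 have "(\<lambda>(x, z). indicator {p. tgt p \<in> Om \<and> snd p \<in> cube} (x, z) *\<^sub>R F (x, z)) \<in> borel_measurable (lborel \<Otimes>\<^sub>M lborel)"
  unfolding lborel_prod using set by (simp add: split_beta')
 from lborel.borel_measurable_lebesgue_integral[OF this]
 have m: "(\<lambda>x. LINT z|dm (JX x). F (x, z)) \<in> borel_measurable borel" unfolding eq by simp
 have "norm (LINT z|dm (JX x). F (x, z)) \<le> \<bar>C\<bar> * 2 ^ DIM('a)" if x: "x \<in> Om" for x
 proof -
  interpret finite_measure "dm (JX x)" by (intro finite_measure_dm) auto
  have b: "bmon (JX x) (\<lambda>z. F (x, z))"
   by (rule bmonI[of _ _ C]) (use Fx C x in \<open>auto simp: J_iff JX_def tgt_def\<close>)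
  have "norm (LINT z|dm (JX x). F (x, z)) \<le> (LINT z|dm (JX x). norm (F (x, z)))"
   by (rule integral_norm_bound)
  also have "... \<le> (LINT z|dm (JX x). \<bar>C\<bar>)"
  proof (intro integral_mono_AE integrable_JX bmon_norm b bmon_const AE_dmI)
   fix z assume "z \<in> JX x"
   then have "(x, z) \<in> J" using x by (auto simp: J_iff JX_def tgt_def)
   then show "norm (F (x, z)) \<le> \<bar>C\<bar>" using C by force
  qed simp
  also have "... = \<bar>C\<bar> * measure lborel (JX x)" by (simp add: measure_dm)
  also have "... \<le> \<bar>C\<bar> * measure lborel (cube :: 'a set)"
  proof (intro mult_left_mono measure_mono_fmeasurable)
   show "(cube :: 'a set) \<in> fmeasurable lborel" by (simp add: cube_def fmeasurable_cbox)
  qed (auto intro: JX_cube[THEN subsetD])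
  finally show ?thesis by (simp add: cube_measure)
 qed
 then show ?thesis using m by (auto simp: bmon_def)
qed

lemma integral_J_iterated:
 fixes F :: "'a \<times> 'a => 'b::euclidean_space"
 assumes F: "bmon J F"
 shows "(LINT p|dm J. F p) = (LINT x|dm Om. LINT z|dm (JX x). F (x, z))"
proof -
 have Fm [measurable]: "F \<in> borel_measurable borel" using F by (rule bmon_measurable)
 have Fx: "(\<lambda>z. F (x, z)) \<in> borel_measurable borel" for x by measurable
 have fi: "integrable (lborel \<Otimes>\<^sub>M lborel) (\<lambda>p. indicator J p *\<^sub>R F p)"
  using integrable_J[OF F] unfolding lborel_prod by (subst (asm) integrable_dm_iff) auto
 have "(LINT p|dm J. F p) = integral\<^sup>L (lborel \<Otimes>\<^sub>M lborel) (\<lambda>p. indicator J p *\<^sub>R F p)"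
  by (simp add: integral_dm lborel_prod)
 also have "... = (LINT x|lborel. LINT z|lborel. indicator J (x, z) *\<^sub>R F (x, z))"
  using lborel_pair.integral_fst[of "\<lambda>x z. indicator J (x, z) *\<^sub>R F (x, z)"] fi by (simp add: split_beta')
 also have "... = (LINT x|lborel. indicator Om x *\<^sub>R (LINT z|dm (JX x). F (x, z)))"
  using Fx
  by (intro lint_cong refl)
    (auto simp: integral_dm indicator_def J_iff JX_def tgt_def intro!: lint_cong)
 also have "... = (LINT x|dm Om. LINT z|dm (JX x). F (x, z))"
  using bmon_inner_integral[OF F] by (subst integral_dm) (auto simp: bmon_def)
 finally show ?thesis .
qed

text \<open>Origin of the factor 3 in the estimates: it is \<open>kc\<close> times the volume of the
  cube, which dominates the volume of the admissible jumps from any point.\<close>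

lemma measure_JX: "kc TYPE('a) * measure lborel (JX x) \<le> 3"
proof -
 have "measure lborel (JX x) \<le> measure lborel (cube :: 'a set)"
 proof (rule measure_mono_fmeasurable)
  show "(cube :: 'a set) \<in> fmeasurable lborel" by (simp add: cube_def fmeasurable_cbox)
 qed (auto intro: JX_cube[THEN subsetD])
 then have "kc TYPE('a) * measure lborel (JX x) \<le> kc TYPE('a) * measure lborel (cube :: 'a set)"
  by (intro mult_left_mono) (auto intro: less_imp_le kc_pos)
 then show ?thesis by (simp add: kc_cube)
qed

lemma integral_J_fst:
 assumes f: "bmon Om f" and nn: "\<And>x. x \<in> Om ==> 0 \<le> (f x :: real)"
 shows "kc TYPE('a) * (LINT p|dm J. f (fst p)) \<le> 3 * (LINT x|dm Om. f x)"
proof -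
 have b: "bmon Om (\<lambda>x. LINT z|dm (JX x). f (fst (x, z)))"
  by (rule bmon_inner_integral, rule bmon_fst[OF f])
 have eq: "(LINT z|dm (JX x). f (fst (x, z))) = f x * measure lborel (JX x)" for x
  by (simp add: measure_dm)
 have "kc TYPE('a) * (LINT p|dm J. f (fst p)) = (LINT x|dm Om. kc TYPE('a) * (f x * measure lborel (JX x)))"
  by (subst integral_J_iterated[OF bmon_fst[OF f]]) (simp add: measure_dm mult.commute)
 also have "... \<le> (LINT x|dm Om. 3 * f x)"
 proof (rule integral_Om_mono)
  show "bmon Om (\<lambda>x. kc TYPE('a) * (f x * measure lborel (JX x)))"
   using bmon_mult[OF bmon_const b] unfolding eq .
  fix x assume "x \<in> Om"
  then show "kc TYPE('a) * (f x * measure lborel (JX x)) \<le> 3 * f x"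
   using mult_right_mono[OF measure_JX[of x] nn[of x]] by (simp add: mult_ac)
 qed (intro bmon_intros f)
 finally show ?thesis by simp
qed

lemma integral_J_tgt:
 assumes f: "bmon Om f"
 shows "(LINT p|dm J. f (tgt p)) = (LINT p|dm J. f (fst p) :: real)"
 using integral_flip[OF bmon_fst[OF f]] by simp

lemma bmon_gen:
 assumes f: "bmon Om f" and b: "bmon Om b"
 shows "bmon Om (gen e b f)"
proof -
 have "bmon J (\<lambda>p. 2 * e / h^2 * (f (tgt p) - f (fst p))
   + (snd p \<bullet> (f (tgt p) *\<^sub>R b (tgt p) + f (fst p) *\<^sub>R b (fst p))) / h)"
  by (intro bmon_intros bmon_J f b)
 from bmon_inner_integral[OF this]
 show ?thesis unfolding gen_def[abs_def] by (intro bmon_intros) (simp add: tgt_def)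
qed

lemma bmon_gradh: assumes f: "bmon Om f" shows "bmon Om (gradh f)"
proof -
 have "bmon J (\<lambda>p. (f (tgt p) - f (fst p)) *\<^sub>R snd p)"
  by (intro bmon_intros bmon_J f)
 from bmon_inner_integral[OF this]
 show ?thesis unfolding gradh_def[abs_def] by (intro bmon_intros) (simp add: tgt_def)
qed

text \<open>Symmetrization: the integrands \<open>H\<close> and \<open>- P\<close> differ, but their
  sums with their flipped copies agree pointwise (\<open>pw\<close>), and flipping does not change
  integrals over \<open>J\<close>.\<close>

lemma gen_dual:
 assumes f: "bmon Om f" and b: "bmon Om b" and g: "bmon Om g"
 shows "(LINT x|dm Om. g x * gen e b f x) = - form e b f g"
proof -
 define H where "H p = g (fst p) * (2 * e / h^2 * (f (tgt p) - f (fst p))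
   + (snd p \<bullet> (f (tgt p) *\<^sub>R b (tgt p) + f (fst p) *\<^sub>R b (fst p))) / h)" for p
 define P where "P p = e / h^2 * ((f (tgt p) - f (fst p)) * (g (tgt p) - g (fst p)))
   + f (fst p) * (b (fst p) \<bullet> snd p) * (g (tgt p) - g (fst p)) / h" for p
 have bH: "bmon J H" unfolding H_def[abs_def] by (intro bmon_intros bmon_J f b g)
 have bP: "bmon J P" unfolding P_def[abs_def] by (intro bmon_intros bmon_J f b g)
 have bHr: "bmon J (\<lambda>p. H (flip p))" and bPr: "bmon J (\<lambda>p. P (flip p))"
  by (rule bmon_compose[OF bH], auto)(rule bmon_compose[OF bP], auto)
 have pw: "H p + H (flip p) = - (P p + P (flip p))" for p
  unfolding H_def P_def using h_pos
  by (simp add: inner_add_right inner_commute divide_simps) algebra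
 have "(LINT p|dm J. H p) + (LINT p|dm J. H (flip p)) = (LINT p|dm J. H p + H (flip p))"
  by (rule lint_add[symmetric]) (intro integrable_J bH bHr)+
 also have "... = (LINT p|dm J. - (P p + P (flip p)))" by (simp only: pw)
 also have "... = - ((LINT p|dm J. P p) + (LINT p|dm J. P (flip p)))"
  by (subst lint_add[symmetric], intro integrable_J bP bPr, intro integrable_J bP bPr)
    (rule lint_minus)
 finally have HP: "(LINT p|dm J. H p) = - (LINT p|dm J. P p)"
  using integral_flip[OF bH] integral_flip[OF bP] by simp
 have "(LINT x|dm Om. g x * gen e b f x) = (LINT x|dm Om. kc TYPE('a) * (LINT z|dm (JX x). H (x, z)))"
  by (intro lint_cong refl) (simp add: gen_def H_def tgt_def)
 also have "... = kc TYPE('a) * (LINT p|dm J. H p)"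
  by (simp add: integral_J_iterated[OF bH])
 finally show ?thesis by (simp add: HP form_def P_def)
qed

lemma gradh_dual:
 assumes f: "bmon Om f" and g: "bmon Om g"
 shows "(LINT x|dm Om. gradh f x \<bullet> g x) = kc TYPE('a) / h * (LINT p|dm J. (f (tgt p) - f (fst p)) * (snd p \<bullet> g (fst p)))"
proof -
 have bF: "bmon J (\<lambda>p. (f (tgt p) - f (fst p)) * (snd p \<bullet> g (fst p)))"
  by (intro bmon_intros bmon_J f g)
 have "gradh f x \<bullet> g x = kc TYPE('a) / h * (LINT z|dm (JX x). (f (x + h *\<^sub>R z) - f x) * (z \<bullet> g x))" for x
 proof (cases "x \<in> Om")
  have "integrable (dm (JX x)) (\<lambda>z. (f (x + h *\<^sub>R z) - f x) *\<^sub>R z)"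
   by (intro integrable_JX bmon_intros bmon_X[OF f] bmon_JX_id)
  then show ?thesis by (simp add: gradh_def flip: integral_inner_left)
 qed (auto simp: gradh_def integral_inner_left[symmetric] integrable_JX bmon_intros bmon_X[OF f] bmon_JX_id)
 then show ?thesis unfolding integral_J_iterated[OF bF] by (simp add: tgt_def)
qed

end

section \<open>Elementary inequalities for the exponential\<close>

text \<open>For negative \<open>u\<close> the product of the quadratic Taylor polynomials at
  \<open>u\<close> and \<open>- u\<close> is 1 plus a nonnegative term, and the polynomial at
  \<open>- u\<close> lies below \<open>exp (- u)\<close>.\<close>

lemma exp_le_quadratic:
 fixes u :: real assumes "u \<le> 1" shows "exp u \<le> 1 + u + u^2"
proof (cases "u \<ge> 0")
 case True then show ?thesis using exp_bound[of u] assms by auto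
next
 case False
 have "1 \<le> (1 + u + u^2 / 2) * (1 + (-u) + (-u)^2 / 2)"
 proof -
  have "(1 + u + u^2 / 2) * (1 + (-u) + (-u)^2 / 2) = 1 + (u^2)^2 / 4"
   by (simp add: field_simps power2_eq_square)
  then show ?thesis by simp
 qed
 also have "... \<le> (1 + u + u^2 / 2) * exp (-u)"
 proof (rule mult_left_mono)
  show "1 + - u + (- u)^2 / 2 \<le> exp (- u)" using exp_lower_Taylor_quadratic[of "-u"] False by simp
  have "1 + u + u^2 / 2 = ((1 + u)^2 + 1) / 2" by (simp add: field_simps power2_eq_square)
  then show "0 \<le> 1 + u + u^2 / 2" by (simp only:) simp
 qed
 finally have "exp u \<le> 1 + u + u^2 / 2" by (simp add: exp_minus field_simps)
 then show ?thesis using zero_le_power2[of u] by linarith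
qed

lemma cosh_minus_one_le:
 fixes u :: real assumes "\<bar>u\<bar> \<le> 1" shows "exp u + exp (- u) - 2 \<le> 2 * u^2"
 using exp_le_quadratic[of u] exp_le_quadratic[of "-u"] assms by (simp add: abs_le_iff)

lemma abs_exp_minus_one_le:
 fixes u :: real assumes "\<bar>u\<bar> \<le> 1" shows "\<bar>exp u - 1\<bar> \<le> 2 * \<bar>u\<bar>"
proof -
 have "u^2 \<le> \<bar>u\<bar>" using assms by (metis abs_ge_zero mult_left_le power2_abs power2_eq_square)
 moreover have "exp u \<le> 1 + u + u^2" using assms by (intro exp_le_quadratic) auto
 moreover have "1 + u \<le> exp u" by (rule exp_ge_add_one_self)
 ultimately show ?thesis by (cases "u \<ge> 0"; cases "exp u \<ge> 1") linarith+
qed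

lemma sum_power2_le: "((x::real) + y)^2 \<le> 2 * x^2 + 2 * y^2"
 using zero_le_power2[of "x - y"] by (simp add: power2_eq_square algebra_simps)

lemma young: fixes x y a :: real assumes "a > 0" shows "x * y \<le> a * x^2 + y^2 / (4 * a)"
proof -
 have "0 \<le> (2 * a * x - y)^2" by simp
 also have "... = 4 * a * (a * x^2 + y^2 / (4 * a) - x * y)" using assms by (simp add: field_simps power2_eq_square)
 finally show ?thesis using assms by (simp add: zero_le_mult_iff)
qed

section \<open>Energy estimates for the nonlocal form\<close>

context jump
begin

lemma J_norm: "p \<in> J ==> norm (snd p) \<le> (real DIM('a))"
 by (simp add: J_iff cube_norm)

lemma d_ge1: "(real DIM('a)) \<ge> 1" using DIM_positive[where 'a='a] by linarith

lemma energy_nonneg: "0 \<le> energy v"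
 unfolding energy_def using kc_pos[where 'a='a]
 by (intro mult_nonneg_nonneg divide_nonneg_nonneg integral_nonneg_AE) auto

lemma integral_J_tgt_le:
 assumes f: "bmon Om f" and nn: "\<And>x. x \<in> Om ==> 0 \<le> (f x :: real)"
 shows "kc TYPE('a) * (LINT p|dm J. f (tgt p)) \<le> 3 * (LINT x|dm Om. f x)"
 using integral_J_fst[OF f nn] integral_J_tgt[OF f] by simp

lemma energy_le:
 assumes f: "bmon Om f" shows "energy f \<le> 12 / h^2 * (LINT x|dm Om. (f x)^2)"
proof -
 have f2: "bmon Om (\<lambda>x. (f x)^2)" by (intro bmon_intros f)
 have "(LINT p|dm J. (f (tgt p) - f (fst p))^2) \<le> (LINT p|dm J. 2 * (f (tgt p))^2 + 2 * (f (fst p))^2)"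
 proof (rule integral_J_mono)
  fix p
  show "(f (tgt p) - f (fst p))^2 \<le> 2 * (f (tgt p))^2 + 2 * (f (fst p))^2"
   using zero_le_power2[of "f (tgt p) + f (fst p)"] by (simp add: power2_eq_square algebra_simps)
 qed (intro bmon_intros bmon_J f)+
 also have "... = 2 * (LINT p|dm J. (f (tgt p))^2) + 2 * (LINT p|dm J. (f (fst p))^2)"
  by (subst lint_add) (auto intro!: integrable_J bmon_intros bmon_J f)
 finally have "kc TYPE('a) * (LINT p|dm J. (f (tgt p) - f (fst p))^2) \<le>
   kc TYPE('a) * (2 * (LINT p|dm J. (f (tgt p))^2) + 2 * (LINT p|dm J. (f (fst p))^2))"
  by (intro mult_left_mono) (auto intro: less_imp_le kc_pos)
 also have "... \<le> 12 * (LINT x|dm Om. (f x)^2)"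
  using integral_J_fst[OF f2] integral_J_tgt_le[OF f2] by (simp add: algebra_simps)
 finally have "kc TYPE('a) * (LINT p|dm J. (f (tgt p) - f (fst p))^2) / h^2 \<le> 12 * (LINT x|dm Om. (f x)^2) / h^2"
  by (rule divide_right_mono) simp
 then show ?thesis unfolding energy_def by simp
qed

text \<open>By \<open>form_bound\<close> this controls the square of \<open>form e b f\<close> as a
  functional on the energy seminorm when the drift is bounded by \<open>\<beta>\<close>; the factor
  3 comes from \<open>integral_J_fst\<close>. Keeping \<open>e\<close> and \<open>\<beta>\<close>
  separate allows \<open>e = 0\<close>, a pure drift source.\<close>

definition kap :: "real => real => ('a => real) => real" where
 "kap e \<beta> f = e^2 * energy f + 3 * \<beta>^2 * (real DIM('a))^2 * (LINT x|dm Om. (f x)^2)"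

lemma kap_nonneg: "0 \<le> kap e \<beta> f"
 unfolding kap_def by (intro add_nonneg_nonneg mult_nonneg_nonneg energy_nonneg integral_Om_nonneg) auto

lemma kap_le:
 assumes f: "bmon Om f" shows "kap e \<beta> f \<le> (12 * e^2 / h^2 + 3 * \<beta>^2 * (real DIM('a))^2) * (LINT x|dm Om. (f x)^2)"
 using mult_left_mono[OF energy_le[OF f], of "e^2"] unfolding kap_def by (simp add: algebra_simps)

lemma drift_bound:
 assumes b: "\<And>x. x \<in> Om ==> norm (b x) \<le> \<beta>" and p: "p \<in> J"
 shows "\<bar>b (fst p) \<bullet> snd p\<bar> \<le> \<beta> * (real DIM('a))"
proof -
 have "\<bar>b (fst p) \<bullet> snd p\<bar> \<le> norm (b (fst p)) * norm (snd p)" by (rule Cauchy_Schwarz_ineq2)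
 also have "... \<le> \<beta> * (real DIM('a))" using b[of "fst p"] p J_norm[OF p]
  by (intro mult_mono) (auto simp: J_iff intro: order_trans[OF norm_ge_zero])
 finally show ?thesis .
qed

text \<open>The free parameter \<open>a\<close> lets each caller decide how much energy of
  \<open>g\<close> to spend: \<open>h^2 / 24\<close> in \<open>gen_bound\<close>,
  \<open>e / 4\<close> in \<open>step_energy\<close>.\<close>

lemma form_bound:
 assumes f: "bmon Om f" and b: "bmon Om b" and g: "bmon Om g" and a: "a > 0" and e: "e \<ge> 0"
  and bd: "\<And>x. x \<in> Om ==> norm (b x) \<le> \<beta>"
 shows "\<bar>form e b f g\<bar> \<le> a * energy g + kap e \<beta> f / (2 * a)"
proof -
 define P where "P p = e / h^2 * ((f (tgt p) - f (fst p)) * (g (tgt p) - g (fst p)))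
   + f (fst p) * (b (fst p) \<bullet> snd p) * (g (tgt p) - g (fst p)) / h" for p
 have bP: "bmon J P" unfolding P_def[abs_def] by (intro bmon_intros bmon_J f b g)
 have f2: "bmon Om (\<lambda>x. (f x)^2)" by (intro bmon_intros f)
 define Q where "Q p = a / h^2 * (g (tgt p) - g (fst p))^2 + e^2 / (2 * a * h^2) * (f (tgt p) - f (fst p))^2
   + \<beta>^2 * (real DIM('a))^2 / (2 * a) * (f (fst p))^2" for p
 have bQ: "bmon J Q" unfolding Q_def[abs_def] by (intro bmon_intros bmon_J f g)
 have pw: "\<bar>P p\<bar> \<le> Q p" if p: "p \<in> J" for p
 proof -
  define F G where "F = f (tgt p) - f (fst p)" and "G = g (tgt p) - g (fst p)"
  define X where "X = e / h * F + f (fst p) * (b (fst p) \<bullet> snd p)"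
  have "P p = (G / h) * X" unfolding P_def X_def F_def G_def using h_pos
   by (simp add: field_simps power2_eq_square)
  then have "\<bar>P p\<bar> = \<bar>G / h\<bar> * \<bar>X\<bar>" by (simp only: abs_mult)
  also have "... \<le> a * (G / h)^2 + X^2 / (4 * a)" using young[OF a, of "\<bar>G / h\<bar>" "\<bar>X\<bar>"] by (simp only: power2_abs)
  also have "X^2 \<le> 2 * (e / h * F)^2 + 2 * (f (fst p) * (b (fst p) \<bullet> snd p))^2"
   unfolding X_def by (rule sum_power2_le)
  also have "(f (fst p) * (b (fst p) \<bullet> snd p))^2 \<le> (f (fst p))^2 * (\<beta> * (real DIM('a)))^2"
   using drift_bound[where b=b, OF bd p] unfolding power_mult_distrib
   by (intro mult_left_mono) (auto simp flip: power_mult_distrib intro: order_trans[OF abs_ge_zero] simp: abs_le_square_iff[symmetric])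
  finally show ?thesis unfolding Q_def F_def[symmetric] G_def[symmetric] using a h_pos
   by (simp add: field_simps power2_eq_square)
 qed
 have "\<bar>LINT p|dm J. P p\<bar> \<le> (LINT p|dm J. \<bar>P p\<bar>)" using integral_norm_bound[of "dm J" P] by simp
 also have "... \<le> (LINT p|dm J. Q p)" by (rule integral_J_mono) (intro bmon_abs bP bQ pw)+
 finally have "\<bar>form e b f g\<bar> \<le> kc TYPE('a) * (LINT p|dm J. Q p)"
  unfolding form_def P_def[symmetric] using kc_pos[where 'a='a] by (simp add: abs_mult)
 also have "... = a * energy g + (e^2 * energy f + \<beta>^2 * (real DIM('a))^2 * (kc TYPE('a) * (LINT p|dm J. (f (fst p))^2))) / (2 * a)"
 proof -
  have "(LINT p|dm J. Q p) = a / h^2 * (LINT p|dm J. (g (tgt p) - g (fst p))^2)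
    + e^2 / (2 * a * h^2) * (LINT p|dm J. (f (tgt p) - f (fst p))^2)
   + \<beta>^2 * (real DIM('a))^2 / (2 * a) * (LINT p|dm J. (f (fst p))^2)"
   unfolding Q_def
   apply (subst lint_add, (intro integrable_J bmon_intros bmon_J f g)+)
   apply (subst lint_add, (intro integrable_J bmon_intros bmon_J f g)+)
   by (simp only: integral_mult_right_zero)
  then show ?thesis unfolding energy_def using a h_pos by (simp add: field_simps power2_eq_square)
 qed
 also have "... \<le> a * energy g + kap e \<beta> f / (2 * a)"
 proof -
  have "\<beta>^2 * (real DIM('a))^2 * (kc TYPE('a) * (LINT p|dm J. (f (fst p))^2)) \<le> \<beta>^2 * (real DIM('a))^2 * (3 * (LINT x|dm Om. (f x)^2))"
   using integral_J_fst[OF f2] by (intro mult_left_mono) auto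
  then show ?thesis unfolding kap_def using a by (intro add_left_mono divide_right_mono) (auto simp: algebra_simps)
 qed
 finally show ?thesis .
qed

lemma gen_bound:
 assumes f: "bmon Om f" and b: "bmon Om b" and e: "e \<ge> 0"
  and bd: "\<And>x. x \<in> Om ==> norm (b x) \<le> \<beta>"
 shows "(LINT x|dm Om. (gen e b f x)^2) \<le> 24 / h^2 * kap e \<beta> f"
proof -
 let ?X = "LINT x|dm Om. (gen e b f x)^2"
 have bg: "bmon Om (gen e b f)" by (rule bmon_gen[OF f b])
 \<comment> \<open>The operator is tested against itself. The value \<open>h^2 / 24\<close> below is
   chosen so that \<open>energy_le\<close>, with its factor \<open>12 / h^2\<close>, returns exactly
   half of the left-hand side.\<close>
 have "?X = - form e b f (gen e b f)" using gen_dual[OF f b bg] by (simp add: power2_eq_square)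
 also have "... \<le> (h^2 / 24) * energy (gen e b f) + kap e \<beta> f / (2 * (h^2 / 24))"
  using form_bound[OF f b bg _ e bd, of "h^2/24"] h_pos by simp
 also have "... \<le> (h^2 / 24) * (12 / h^2 * ?X) + kap e \<beta> f / (2 * (h^2 / 24))"
  by (intro add_right_mono mult_left_mono energy_le bg) auto
 also have "(h^2 / 24) * (12 / h^2 * ?X) = ?X / 2" using h_pos by simp
 finally show ?thesis using h_pos by (simp add: field_simps)
qed

lemma gen_bound_L2:
 assumes f: "bmon Om f" and b: "bmon Om b" and e: "e \<ge> 0"
  and bd: "\<And>x. x \<in> Om ==> norm (b x) \<le> \<beta>"
 shows "(LINT x|dm Om. (gen e b f x)^2) \<le> 24 / h^2 * (12 * e^2 / h^2 + 3 * \<beta>^2 * (real DIM('a))^2) * (LINT x|dm Om. (f x)^2)"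
proof -
 have "24 / h^2 * kap e \<beta> f \<le> 24 / h^2 * ((12 * e^2 / h^2 + 3 * \<beta>^2 * (real DIM('a))^2) * (LINT x|dm Om. (f x)^2))"
  by (intro mult_left_mono kap_le f) auto
 from order_trans[OF gen_bound[OF assms] this] show ?thesis by (simp only: mult.assoc)
qed

lemma gradh_bound:
 assumes f: "bmon Om f"
 shows "(LINT x|dm Om. (norm (gradh f x))^2) \<le> 3 * (real DIM('a))^2 * energy f"
proof -
 let ?G = "gradh f" and ?X = "LINT x|dm Om. (norm (gradh f x))^2"
 have bG: "bmon Om ?G" by (rule bmon_gradh[OF f])
 have G2: "bmon Om (\<lambda>x. (norm (?G x))^2)" by (intro bmon_intros bG)
 define P where "P p = (f (tgt p) - f (fst p)) * (snd p \<bullet> ?G (fst p)) / h" for p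
 have bP: "bmon J P" unfolding P_def[abs_def] by (intro bmon_intros bmon_J f bG)
 have "(LINT p|dm J. P p) \<le> (LINT p|dm J. (3 * (real DIM('a))^2 / 2) / h^2 * (f (tgt p) - f (fst p))^2 + (1 / 6) * (norm (?G (fst p)))^2)"
 proof (rule integral_J_mono[OF bP])
  show "bmon J (\<lambda>p. (3 * (real DIM('a))^2 / 2) / h^2 * (f (tgt p) - f (fst p))^2 + (1 / 6) * (norm (?G (fst p)))^2)"
   by (intro bmon_intros bmon_J f bG)
  fix p assume p: "p \<in> J"
  let ?F = "f (tgt p) - f (fst p)"
  have "P p \<le> \<bar>?F / h\<bar> * \<bar>snd p \<bullet> ?G (fst p)\<bar>"
   unfolding P_def using abs_ge_self[of "?F / h * (snd p \<bullet> ?G (fst p))"] by (simp add: abs_mult)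
  also have "... \<le> \<bar>?F / h\<bar> * ((real DIM('a)) * norm (?G (fst p)))"
   by (intro mult_left_mono order_trans[OF Cauchy_Schwarz_ineq2] mult_right_mono J_norm p) auto
  also have "... = (\<bar>?F / h\<bar> * (real DIM('a))) * norm (?G (fst p))" by simp
  \<comment> \<open>The weight 3/2 leaves 1/6 on the gradient; after the factor 3 of
    \<open>integral_J_fst\<close> this is half of the left-hand side, which can be absorbed.\<close>
  also have "... \<le> (3/2) * (\<bar>?F / h\<bar> * (real DIM('a)))^2 + (norm (?G (fst p)))^2 / (4 * (3/2))"
   by (rule young) simp
  finally show "P p \<le> (3 * (real DIM('a))^2 / 2) / h^2 * ?F^2 + (1 / 6) * (norm (?G (fst p)))^2"
   by (simp add: power_mult_distrib power_divide mult_ac)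
 qed
 also have "... = (3 * (real DIM('a))^2 / 2) / h^2 * (LINT p|dm J. (f (tgt p) - f (fst p))^2) + (1 / 6) * (LINT p|dm J. (norm (?G (fst p)))^2)"
  apply (subst lint_add, (intro integrable_J bmon_intros bmon_J f bG)+)
  by (simp only: integral_mult_right_zero)
 finally have "kc TYPE('a) * (LINT p|dm J. P p) \<le> kc TYPE('a) * ((3 * (real DIM('a))^2 / 2) / h^2 * (LINT p|dm J. (f (tgt p) - f (fst p))^2) + (1 / 6) * (LINT p|dm J. (norm (?G (fst p)))^2))"
  by (intro mult_left_mono) (auto intro: less_imp_le kc_pos)
 also have "... = (3 * (real DIM('a))^2 / 2) * energy f + (1 / 6) * (kc TYPE('a) * (LINT p|dm J. (norm (?G (fst p)))^2))"
  unfolding energy_def by (simp add: algebra_simps)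
 also have "kc TYPE('a) * (LINT p|dm J. (norm (?G (fst p)))^2) \<le> 3 * ?X"
  by (rule integral_J_fst[OF G2]) auto
 finally have "kc TYPE('a) * (LINT p|dm J. P p) \<le> (3 * (real DIM('a))^2 / 2) * energy f + ?X / 2" by simp
 moreover have "?X = kc TYPE('a) * (LINT p|dm J. P p)"
  using gradh_dual[OF f bG] unfolding P_def by (simp add: power2_norm_eq_inner)
 ultimately show ?thesis by simp
qed

text \<open>Conjugation with the exponential weight. In terms of \<open>v\<close> the product of
  increments is the squared increment of \<open>v\<close> minus a multiple of
  \<open>r + 1 / r - 2\<close>, where \<open>r\<close> is the ratio of the weights at the two ends.
  The exponents differ by a quantity of order \<open>h * Lam\<close>, so this term is quadratic in
  \<open>h\<close> and offsets the division by \<open>h^2\<close>. The loss is of size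
  \<open>e * Lam^2 + M * Lam\<close>, plus \<open>M^2 / e\<close> from the drift alone.\<close>

lemma form_weighted:
 assumes f: "bmon Om f" and b: "bmon Om b" and th: "bmon Om th" and e: "e > 0" and M: "M \<ge> 0"
  and bd: "\<And>x. x \<in> Om ==> norm (b x) \<le> M"
  and lip: "\<And>x y. x \<in> Om ==> y \<in> Om ==> \<bar>th x - th y\<bar> \<le> Lam * norm (x - y)"
  and hL: "h * Lam * (real DIM('a)) \<le> 1" and L0: "Lam \<ge> 0"
 defines "v \<equiv> \<lambda>x. f x * exp (th x)"
 shows "form e b f (\<lambda>x. f x * (exp (th x))^2) \<ge> e / 2 * energy v
   - (6 * (e * Lam^2 * (real DIM('a))^2 + M * Lam * (real DIM('a))^2) + 3 * M^2 * (real DIM('a))^2 / (2 * e)) * (LINT x|dm Om. (v x)^2)"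
proof -
 let ?g = "\<lambda>x. f x * (exp (th x))^2"
 have bg: "bmon Om ?g" by (intro bmon_intros f th)
 have bv: "bmon Om v" unfolding v_def by (intro bmon_intros f th)
 have v2: "bmon Om (\<lambda>x. (v x)^2)" by (intro bmon_intros bv)
 define P where "P p = e / h^2 * ((f (tgt p) - f (fst p)) * (?g (tgt p) - ?g (fst p)))
   + f (fst p) * (b (fst p) \<bullet> snd p) * (?g (tgt p) - ?g (fst p)) / h" for p
 have bP: "bmon J P" unfolding P_def[abs_def] by (intro bmon_intros bmon_J f b th)
 define c1 where "c1 = e * Lam^2 * (real DIM('a))^2 + M * Lam * (real DIM('a))^2"
 define c2 where "c2 = M^2 * (real DIM('a))^2 / (2 * e)"
 have c: "c1 \<ge> 0" "c2 \<ge> 0" unfolding c1_def c2_def using e M L0 by auto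
 define Q where "Q p = e / (2 * h^2) * (v (tgt p) - v (fst p))^2 - (c1 + c2) * (v (fst p))^2 - c1 * (v (tgt p))^2" for p
 have bQ: "bmon J Q" unfolding Q_def[abs_def] by (intro bmon_intros bmon_J bv)
 have pw: "Q p \<le> P p" if p: "p \<in> J" for p
 proof -
  define u where "u = th (tgt p) - th (fst p)"
  define V V' where "V = v (fst p)" and "V' = v (tgt p)"
  define r where "r = exp u"
  have r0: "r > 0" by (simp add: r_def)
  have "\<bar>u\<bar> \<le> Lam * norm (tgt p - fst p)" unfolding u_def using p by (intro lip) (auto simp: J_iff)
  also have "norm (tgt p - fst p) = h * norm (snd p)" using h_pos by (simp add: tgt_def)
  also have "Lam * (h * norm (snd p)) \<le> Lam * (h * (real DIM('a)))"
   using L0 h_pos J_norm[OF p] by (intro mult_left_mono) auto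
  finally have u1: "\<bar>u\<bar> \<le> Lam * h * (real DIM('a))" by simp
  have u2: "\<bar>u\<bar> \<le> 1" using u1 hL by (simp add: mult_ac)
  have u3: "u^2 \<le> (Lam * h * (real DIM('a)))^2" using u1 by (metis abs_ge_zero power2_abs power_mono)
  have ch: "r + 1 / r - 2 \<le> 2 * u^2" using cosh_minus_one_le[OF u2] by (simp add: r_def exp_minus inverse_eq_divide)
  have ch0: "r + 1 / r - 2 \<ge> 0"
  proof -
   have "r + 1 / r - 2 = (r - 1)^2 / r" using r0 by (simp add: field_simps power2_eq_square)
   then show ?thesis using r0 by simp
  qed
  have ab: "\<bar>r - 1\<bar> \<le> 2 * (Lam * h * (real DIM('a)))" using abs_exp_minus_one_le[OF u2] u1 by (simp add: r_def)
  have et: "exp (th (tgt p)) = exp (th (fst p)) * r" by (simp add: r_def u_def flip: exp_add)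
  have fV: "f (fst p) = V / exp (th (fst p))" "f (tgt p) = V' / (exp (th (fst p)) * r)"
   unfolding V_def V'_def v_def et using r0 by auto
  have gV: "?g (fst p) = V * exp (th (fst p))" "?g (tgt p) = V' * (exp (th (fst p)) * r)"
   unfolding V_def V'_def v_def et by (auto simp: power2_eq_square)
  have VV: "\<bar>V * V'\<bar> \<le> (V^2 + V'^2) / 2"
   using zero_le_power2[of "\<bar>V\<bar> - \<bar>V'\<bar>"] by (simp add: power2_eq_square algebra_simps abs_mult)
  have d1: "(f (tgt p) - f (fst p)) * (?g (tgt p) - ?g (fst p)) = (V' - V)^2 - V * V' * (r + 1 / r - 2)"
   apply (simp only: gV) apply (simp only: fV) using r0 by (simp add: field_simps power2_eq_square)
  have d2: "V * V' * (r + 1 / r - 2) \<le> (V^2 + V'^2) * (Lam * h * (real DIM('a)))^2"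
  proof -
   have "V * V' * (r + 1 / r - 2) \<le> \<bar>V * V'\<bar> * (r + 1 / r - 2)" by (intro mult_right_mono ch0) auto
   also have "... \<le> ((V^2 + V'^2) / 2) * (2 * (Lam * h * (real DIM('a)))^2)"
    using ch u3 ch0 VV by (intro mult_mono) auto
   finally show ?thesis by simp
  qed
  have d3: "f (fst p) * (?g (tgt p) - ?g (fst p)) = V * (V' * r - V)"
   apply (simp only: gV) apply (simp only: fV) using r0 by (simp add: field_simps)
  have d4: "\<bar>V * (V' * r - V)\<bar> \<le> \<bar>V\<bar> * \<bar>V' - V\<bar> + (V^2 + V'^2) * (Lam * h * (real DIM('a)))"
  proof -
   have "V * (V' * r - V) = V * (V' - V) + V * V' * (r - 1)" by (simp add: algebra_simps)
   then have "\<bar>V * (V' * r - V)\<bar> \<le> \<bar>V\<bar> * \<bar>V' - V\<bar> + \<bar>V * V'\<bar> * \<bar>r - 1\<bar>"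
    by (simp only:) (rule order_trans[OF abs_triangle_ineq], simp add: abs_mult)
   also have "\<bar>V * V'\<bar> * \<bar>r - 1\<bar> \<le> ((V^2 + V'^2) / 2) * (2 * (Lam * h * (real DIM('a))))"
    using ab VV by (intro mult_mono) auto
   finally show ?thesis by simp
  qed
  define s where "s = (b (fst p) \<bullet> snd p) / h"
  have s: "\<bar>s\<bar> \<le> M * (real DIM('a)) / h" unfolding s_def using drift_bound[where b=b, OF bd p] h_pos
   by (simp add: divide_right_mono)
  have "\<bar>s * (V * (V' * r - V))\<bar> \<le> M * (real DIM('a)) / h * (\<bar>V\<bar> * \<bar>V' - V\<bar> + (V^2 + V'^2) * (Lam * h * (real DIM('a))))"
   unfolding abs_mult[of s] using s d4 by (intro mult_mono) (auto intro: order_trans[OF abs_ge_zero])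
  also have "... = (\<bar>V' - V\<bar> / h) * (M * (real DIM('a)) * \<bar>V\<bar>) + (V^2 + V'^2) * (M * Lam * (real DIM('a))^2)"
   using h_pos by (simp add: field_simps power2_eq_square)
  \<comment> \<open>Young with weight \<open>e / 2\<close> spends half of the diffusion on the
    drift; the other half is the energy kept in the conclusion.\<close>
  also have "(\<bar>V' - V\<bar> / h) * (M * (real DIM('a)) * \<bar>V\<bar>) \<le> (e / 2) * (\<bar>V' - V\<bar> / h)^2 + (M * (real DIM('a)) * \<bar>V\<bar>)^2 / (4 * (e / 2))"
   using e by (intro young) auto
  finally have d5: "- (s * (V * (V' * r - V))) \<le> e / (2 * h^2) * (V' - V)^2 + c2 * V^2 + (V^2 + V'^2) * (M * Lam * (real DIM('a))^2)"
   using abs_ge_minus_self[of "s * (V * (V' * r - V))"] unfolding c2_def by (simp add: power_divide power_mult_distrib)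
  have "P p = e / h^2 * ((V' - V)^2 - V * V' * (r + 1 / r - 2)) + s * (V * (V' * r - V))"
  proof -
   have "P p = e / h^2 * ((f (tgt p) - f (fst p)) * (?g (tgt p) - ?g (fst p)))
    + s * (f (fst p) * (?g (tgt p) - ?g (fst p)))"
    unfolding P_def s_def by (simp add: mult_ac)
   then show ?thesis unfolding d1 d3 .
  qed
  moreover have "e / h^2 * (V * V' * (r + 1 / r - 2)) \<le> (e * Lam^2 * (real DIM('a))^2) * (V^2 + V'^2)"
  proof -
   have "e / h^2 * (V * V' * (r + 1 / r - 2)) \<le> e / h^2 * ((V^2 + V'^2) * (Lam * h * (real DIM('a)))^2)"
    using e by (intro mult_left_mono d2) auto
   also have "... = (e * Lam^2 * (real DIM('a))^2) * (V^2 + V'^2)" using h_pos by (simp add: power_mult_distrib)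
   finally show ?thesis .
  qed
  ultimately have "P p \<ge> e / h^2 * (V' - V)^2 - (e * Lam^2 * (real DIM('a))^2) * (V^2 + V'^2)
    - (e / (2 * h^2) * (V' - V)^2 + c2 * V^2 + (V^2 + V'^2) * (M * Lam * (real DIM('a))^2))"
   using d5 unfolding right_diff_distrib by linarith
  then show ?thesis unfolding Q_def V_def[symmetric] V'_def[symmetric] c1_def
   by (simp add: field_simps)
 qed
 have "kc TYPE('a) * (LINT p|dm J. Q p) \<le> kc TYPE('a) * (LINT p|dm J. P p)"
  by (intro mult_left_mono integral_J_mono bP bQ pw) (auto intro: less_imp_le kc_pos)
 also have "... = form e b f ?g" unfolding form_def P_def ..
 finally have 1: "kc TYPE('a) * (LINT p|dm J. Q p) \<le> form e b f ?g" .
 have "(LINT p|dm J. Q p) = e / (2 * h^2) * (LINT p|dm J. (v (tgt p) - v (fst p))^2)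
   - (c1 + c2) * (LINT p|dm J. (v (fst p))^2) - c1 * (LINT p|dm J. (v (tgt p))^2)"
  unfolding Q_def
  apply (subst lint_diff, (intro integrable_J bmon_intros bmon_J bv)+)
  apply (subst lint_diff, (intro integrable_J bmon_intros bmon_J bv)+)
  by (simp only: integral_mult_right_zero)
 then have 2: "kc TYPE('a) * (LINT p|dm J. Q p) = e / 2 * energy v
   - (c1 + c2) * (kc TYPE('a) * (LINT p|dm J. (v (fst p))^2)) - c1 * (kc TYPE('a) * (LINT p|dm J. (v (tgt p))^2))"
  unfolding energy_def by (simp only:) (simp add: field_simps)
 have 3: "(c1 + c2) * (kc TYPE('a) * (LINT p|dm J. (v (fst p))^2)) \<le> (c1 + c2) * (3 * (LINT x|dm Om. (v x)^2))"
  using c integral_J_fst[OF v2] by (intro mult_left_mono) auto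
 have 4: "c1 * (kc TYPE('a) * (LINT p|dm J. (v (tgt p))^2)) \<le> c1 * (3 * (LINT x|dm Om. (v x)^2))"
  using c integral_J_tgt_le[OF v2] by (intro mult_left_mono) auto
 have "(6 * (e * Lam^2 * (real DIM('a))^2 + M * Lam * (real DIM('a))^2) + 3 * M^2 * (real DIM('a))^2 / (2 * e)) * (LINT x|dm Om. (v x)^2)
   = (c1 + c2) * (3 * (LINT x|dm Om. (v x)^2)) + c1 * (3 * (LINT x|dm Om. (v x)^2))"
  unfolding c1_def[symmetric] c2_def by (simp add: algebra_simps)
 with 1 2 3 4 show ?thesis by linarith
qed

end

section \<open>The dual operator, positivity and one explicit step\<close>

context jump
begin

text \<open>Discrete version of \<open>e\<close> times the Laplacian of \<open>g\<close> minus b .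
  grad g: the generator of the jump process whose density is evolved by \<open>gen\<close>. It acts
  on weights. The integrand contains only increments of \<open>g\<close>, so constants are
  annihilated, which is conservation of mass for \<open>gen\<close>.\<close>

definition gadj :: "real => ('a => 'a) => ('a => real) => 'a => real" where
 "gadj e b g x = kc TYPE('a) * (LINT z|dm (JX x). (2 * e / h^2 - (b x \<bullet> z) / h) * (g (x + h *\<^sub>R z) - g x))"

lemma bmon_gadj:
 assumes g: "bmon Om g" and b: "bmon Om b"
 shows "bmon Om (gadj e b g)"
proof -
 have "bmon J (\<lambda>p. (2 * e / h^2 - (b (fst p) \<bullet> snd p) / h) * (g (tgt p) - g (fst p)))"
  by (intro bmon_intros bmon_J g b)
 from bmon_inner_integral[OF this]
 show ?thesis unfolding gadj_def[abs_def] by (intro bmon_intros) (simp add: tgt_def)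
qed

text \<open>The integrands \<open>H\<close> and \<open>- P\<close> differ by \<open>S\<close>, which
  changes sign under \<open>flip\<close> and hence integrates to 0.\<close>

lemma gadj_dual:
 assumes f: "bmon Om f" and b: "bmon Om b" and g: "bmon Om g"
 shows "(LINT x|dm Om. f x * gadj e b g x) = - form e b f g"
proof -
 define H where "H p = f (fst p) * ((2 * e / h^2 - (b (fst p) \<bullet> snd p) / h) * (g (tgt p) - g (fst p)))" for p
 define P where "P p = e / h^2 * ((f (tgt p) - f (fst p)) * (g (tgt p) - g (fst p)))
   + f (fst p) * (b (fst p) \<bullet> snd p) * (g (tgt p) - g (fst p)) / h" for p
 define S where "S p = e / h^2 * ((f (tgt p) + f (fst p)) * (g (tgt p) - g (fst p)))" for p
 have bH: "bmon J H" unfolding H_def[abs_def] by (intro bmon_intros bmon_J f b g)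
 have bP: "bmon J P" unfolding P_def[abs_def] by (intro bmon_intros bmon_J f b g)
 have bS: "bmon J S" unfolding S_def[abs_def] by (intro bmon_intros bmon_J f b g)
 have "(LINT p|dm J. S p) = (LINT p|dm J. - S p)"
  using integral_flip[OF bS] by (simp add: S_def algebra_simps)
 also have "... = - (LINT p|dm J. S p)" by simp
 finally have S0: "(LINT p|dm J. S p) = 0" by simp
 have pw3: "H p = S p - P p" for p
  unfolding H_def P_def S_def using h_pos by (simp add: field_simps)
 have "(LINT p|dm J. H p) = (LINT p|dm J. S p) - (LINT p|dm J. P p)"
  unfolding pw3 by (rule lint_diff) (intro integrable_J bS bP)+
 then have HP: "(LINT p|dm J. H p) = - (LINT p|dm J. P p)" using S0 by simp
 have "(LINT x|dm Om. f x * gadj e b g x) = (LINT x|dm Om. kc TYPE('a) * (LINT z|dm (JX x). H (x, z)))"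
  by (intro lint_cong refl) (simp add: gadj_def H_def tgt_def)
 also have "... = kc TYPE('a) * (LINT p|dm J. H p)"
  by (simp add: integral_J_iterated[OF bH])
 finally show ?thesis by (simp add: HP form_def P_def)
qed

lemma gen_adjoint:
 assumes f: "bmon Om f" and b: "bmon Om b" and g: "bmon Om g"
 shows "(LINT x|dm Om. g x * (f x + dt * gen e b f x)) = (LINT x|dm Om. f x * (g x + dt * gadj e b g x))"
proof -
 note i = integrable_Om bmon_intros f g bmon_gen[OF f b] bmon_gadj[OF g b]
 have "(LINT x|dm Om. g x * (f x + dt * gen e b f x)) = (LINT x|dm Om. g x * f x + dt * (g x * gen e b f x))"
  by (simp add: algebra_simps)
 also have "... = (LINT x|dm Om. g x * f x) + dt * (LINT x|dm Om. g x * gen e b f x)"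
  by (subst lint_add, (intro i)+) simp
 also have "... = (LINT x|dm Om. f x * g x) + dt * (LINT x|dm Om. f x * gadj e b g x)"
  by (simp add: gen_dual[OF f b g] gadj_dual[OF f b g] mult.commute)
 also have "... = (LINT x|dm Om. f x * g x + dt * (f x * gadj e b g x))"
  by (subst lint_add, (intro i)+) simp
 finally show ?thesis by (simp add: algebra_simps)
qed

text \<open>A cell Peclet condition: for \<open>h\<close> at most of order \<open>e / M\<close>
  diffusion dominates drift within one jump, so both jump rates are nonnegative. All comparison
  arguments rest on it.\<close>

lemma rate_nonneg:
 fixes c z :: 'a
 assumes b: "norm (c) \<le> M" and hM: "h * (real DIM('a)) * M \<le> 2 * e" and z: "z \<in> cube" 
 shows "0 \<le> 2 * e / h^2 - (c \<bullet> z) / h" "0 \<le> 2 * e / h^2 + (z \<bullet> c) / h"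
   "2 * e / h^2 - (c \<bullet> z) / h \<le> 4 * e / h^2"
proof -
 have "\<bar>c \<bullet> z\<bar> \<le> M * (real DIM('a))"
 proof -
  have "\<bar>c \<bullet> z\<bar> \<le> norm c * norm z" by (rule Cauchy_Schwarz_ineq2)
  also have "... \<le> M * (real DIM('a))"
   using b cube_norm[OF z] order_trans[OF norm_ge_zero b] by (intro mult_mono) auto
  finally show ?thesis .
 qed
 then have "h * \<bar>c \<bullet> z\<bar> \<le> h * (M * (real DIM('a)))" using h_pos by (intro mult_left_mono) auto
 then have "h * \<bar>c \<bullet> z\<bar> \<le> 2 * e" using hM by (simp add: mult_ac)
 then have "\<bar>c \<bullet> z\<bar> / h \<le> 2 * e / h^2" using h_pos by (simp add: field_simps power2_eq_square)
 moreover have "\<bar>c \<bullet> z\<bar> / h = \<bar>(c \<bullet> z) / h\<bar>" using h_pos by simp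
 ultimately have "\<bar>(c \<bullet> z) / h\<bar> \<le> 2 * e / h^2" by simp
 then have *: "- (2 * e / h^2) \<le> (c \<bullet> z) / h" "(c \<bullet> z) / h \<le> 2 * e / h^2" unfolding abs_le_iff by linarith+
 moreover have "4 * e / h^2 = 2 * e / h^2 + 2 * e / h^2" by simp
 ultimately show "0 \<le> 2 * e / h^2 - (c \<bullet> z) / h" "0 \<le> 2 * e / h^2 + (z \<bullet> c) / h"
   "2 * e / h^2 - (c \<bullet> z) / h \<le> 4 * e / h^2" unfolding inner_commute[of z] by linarith+
qed

lemma integral_JX_mono:
 fixes F G :: "_ => real"
 assumes "bmon (JX x) F" "bmon (JX x) G" "\<And>p. p \<in> JX x ==> F p \<le> G p"
 shows "(LINT p|dm (JX x). F p) \<le> (LINT p|dm (JX x). G p)"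
 by (intro integral_mono_AE integrable_JX AE_dmI assms) auto

text \<open>Mass arrives at \<open>x\<close> with nonnegative rates, and the total rate of leaving
  is at most \<open>12 * e / h^2\<close> (a rate \<open>4 * e / h^2\<close> times the factor 3 of
  \<open>measure_JX\<close>). Under the restriction on \<open>dt\<close> no more leaves in one step
  than is there.\<close>

lemma gen_positive:
 assumes f: "bmon Om f" and b: "bmon Om b"
  and bd: "\<And>x. x \<in> Om ==> norm (b x) \<le> M" and hM: "h * (real DIM('a)) * M \<le> 2 * e"
  and fn: "\<And>x. x \<in> Om ==> 0 \<le> f x" and dt: "dt * (12 * e / h^2) \<le> 1" "dt \<ge> 0" and e: "e > 0" and x: "x \<in> Om"
 shows "0 \<le> f x + dt * gen e b f x"
proof -
 have "- (12 * e / h^2 * f x) \<le> - (4 * e / h^2 * f x * (kc TYPE('a) * measure lborel (JX x)))"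
  using mult_left_mono[OF measure_JX[of x], of "4 * e / h^2 * f x"] fn[OF x] e by simp
 also have "... = kc TYPE('a) * (LINT z|dm (JX x). - (4 * e / h^2 * f x))"
  by (simp add: measure_dm)
 also have "... \<le> gen e b f x"
  unfolding gen_def
 proof (intro mult_left_mono integral_JX_mono)
  show "bmon (JX x) (\<lambda>z. - (4 * e / h^2 * f x))" by (intro bmon_intros)
  show "bmon (JX x) (\<lambda>z. 2 * e / h^2 * (f (x + h *\<^sub>R z) - f x) + z \<bullet> (f (x + h *\<^sub>R z) *\<^sub>R b (x + h *\<^sub>R z) + f x *\<^sub>R b x) / h)"
   by (intro bmon_intros bmon_X[OF f] bmon_X[OF b] bmon_JX_id)
  fix z assume z: "z \<in> JX x"
  let ?y = "x + h *\<^sub>R z"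
  have y: "?y \<in> Om" "z \<in> cube" using z by (auto simp: JX_def)
  have "0 \<le> f ?y * (2 * e / h^2 + (z \<bullet> b ?y) / h)"
   by (intro mult_nonneg_nonneg fn y rate_nonneg(2)[OF _ hM] bd) 
  moreover have "f x * (2 * e / h^2 - (b x \<bullet> z) / h) \<le> f x * (4 * e / h^2)"
   by (intro mult_left_mono fn x y rate_nonneg(3)[OF _ hM] bd)
  moreover have "2 * e / h^2 * (f (x + h *\<^sub>R z) - f x) + z \<bullet> (f (x + h *\<^sub>R z) *\<^sub>R b (x + h *\<^sub>R z) + f x *\<^sub>R b x) / h
   = f ?y * (2 * e / h^2 + (z \<bullet> b ?y) / h) - f x * (2 * e / h^2 - (b x \<bullet> z) / h)"
   by (simp add: inner_add_right inner_commute algebra_simps add_divide_distrib diff_divide_distrib)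
  ultimately show "- (4 * e / h^2 * f x) \<le> 2 * e / h^2 * (f (x + h *\<^sub>R z) - f x) + z \<bullet> (f (x + h *\<^sub>R z) *\<^sub>R b (x + h *\<^sub>R z) + f x *\<^sub>R b x) / h"
   by (simp add: mult.commute)
 qed (auto intro: less_imp_le kc_pos)
 finally have "dt * - (12 * e / h^2 * f x) \<le> dt * gen e b f x" using dt by (intro mult_left_mono)
 moreover have "(dt * (12 * e / h^2)) * f x \<le> 1 * f x" using dt fn[OF x] by (intro mult_right_mono)
 ultimately show ?thesis by (simp add: mult_ac)
qed

text \<open>The drift enters linearly and apart from diffusion, so two drifts differ by an operator
  with \<open>e = 0\<close>; this is the source term in \<open>it_shift\<close>.\<close>

lemma gen_diff_drift:
 assumes f: "bmon Om f" and b: "bmon Om b" and b': "bmon Om b'"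
 shows "gen e b f x - gen e b' f x = gen 0 (\<lambda>x. b x - b' x) f x"
proof -
 note i = integrable_JX bmon_intros bmon_X[OF f] bmon_X[OF b] bmon_X[OF b'] bmon_JX_id
 show ?thesis unfolding gen_def right_diff_distrib[symmetric]
  by (subst lint_diff[symmetric], (intro i)+)
    (simp add: algebra_simps inner_diff_right inner_add_right diff_divide_distrib add_divide_distrib)
qed

lemma gen_diff:
 assumes f: "bmon Om f" and b: "bmon Om b" and g: "bmon Om g"
 shows "gen e b f x - gen e b g x = gen e b (\<lambda>x. f x - g x) x"
proof -
 note i = integrable_JX bmon_intros bmon_X[OF f] bmon_X[OF b] bmon_X[OF g] bmon_JX_id
 show ?thesis unfolding gen_def right_diff_distrib[symmetric]
  by (subst lint_diff[symmetric], (intro i)+)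
    (simp add: algebra_simps inner_diff_right inner_add_right diff_divide_distrib add_divide_distrib)
qed

text \<open>Bound for the squared L2 operator norm of \<open>gen\<close>, of order
  \<open>1 / h^4\<close>. It enters only through restrictions on \<open>dt\<close>, which are
  imposed after \<open>h\<close> is fixed, so its size is harmless.\<close>

definition crude :: "real => real => real" where
 "crude e M = 24 / h^2 * (12 * e^2 / h^2 + 3 * M^2 * (real DIM('a))^2)"

text \<open>The source \<open>gen e2 b2 f\<close> serves three purposes: zero in
  \<open>it_energy\<close>, and in \<open>it_shift\<close> once the operator applied to the data and
  once a difference of drifts with \<open>e2 = 0\<close>. The terms quadratic in \<open>dt\<close>
  that an explicit step creates are made linear by the restrictions on \<open>dt\<close>.\<close>

lemma step_energy:
 assumes u: "bmon Om u" and f: "bmon Om f" and b: "bmon Om b" and b2: "bmon Om b2"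
  and e: "e > 0" and e2: "e2 \<ge> 0" and M: "M \<ge> 0"
  and bd: "\<And>x. x \<in> Om ==> norm (b x) \<le> M" and bd2: "\<And>x. x \<in> Om ==> norm (b2 x) \<le> \<beta>"
  and dt: "dt \<ge> 0" "2 * dt * crude e M \<le> 1" "48 * dt \<le> h^2"
 shows "(LINT x|dm Om. (u x + dt * (gen e b u x + gen e2 b2 f x))^2) + dt * (e / 2) * energy u
   \<le> (1 + dt * (3 * M^2 * (real DIM('a))^2 / e + 1)) * (LINT x|dm Om. (u x)^2) + dt * (4 / e + 1) * kap e2 \<beta> f"
proof -
 let ?A = "gen e b u" and ?F = "gen e2 b2 f"
 let ?U = "LINT x|dm Om. (u x)^2"
 note bA = bmon_gen[OF u b, of e] and bF = bmon_gen[OF f b2, of e2]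
 note i = integrable_Om bmon_intros u bA bF
 have U0: "?U \<ge> 0" by (intro integral_Om_nonneg) auto
 have "(LINT x|dm Om. (u x + dt * (?A x + ?F x))^2) \<le>
   (LINT x|dm Om. (u x)^2 + (2 * dt) * (u x * ?A x) + (2 * dt) * (u x * ?F x) + (2 * dt^2) * (?A x)^2 + (2 * dt^2) * (?F x)^2)"
 proof (rule integral_Om_mono)
  fix x
  have "(u x + dt * (?A x + ?F x))^2 = (u x)^2 + (2 * dt) * (u x * ?A x) + (2 * dt) * (u x * ?F x) + dt^2 * (?A x + ?F x)^2"
   by (simp add: power2_eq_square algebra_simps)
  also have "dt^2 * (?A x + ?F x)^2 \<le> dt^2 * (2 * (?A x)^2 + 2 * (?F x)^2)" by (intro mult_left_mono sum_power2_le) auto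
  finally show "(u x + dt * (?A x + ?F x))^2 \<le> (u x)^2 + (2 * dt) * (u x * ?A x) + (2 * dt) * (u x * ?F x) + (2 * dt^2) * (?A x)^2 + (2 * dt^2) * (?F x)^2"
   by (simp add: algebra_simps)
 qed (intro i)+
 also have "... = ?U + (2 * dt) * (LINT x|dm Om. u x * ?A x) + (2 * dt) * (LINT x|dm Om. u x * ?F x)
   + (2 * dt^2) * (LINT x|dm Om. (?A x)^2) + (2 * dt^2) * (LINT x|dm Om. (?F x)^2)"
  apply (subst lint_add, (intro i)+)
  apply (subst lint_add, (intro i)+)
  apply (subst lint_add, (intro i)+)
  apply (subst lint_add, (intro i)+)
  by (simp only: integral_mult_right_zero)
 finally have 0: "(LINT x|dm Om. (u x + dt * (?A x + ?F x))^2) \<le> ..." .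
 have f0: "form e b u u \<ge> e / 2 * energy u - 3 * M^2 * (real DIM('a))^2 / (2 * e) * ?U"
  using form_weighted[OF u b bmon_const[of _ 0] e M bd, of 0] h_pos by simp
 have 1: "(2 * dt) * (LINT x|dm Om. u x * ?A x) \<le> (2 * dt) * (- (e / 2 * energy u) + 3 * M^2 * (real DIM('a))^2 / (2 * e) * ?U)"
  using f0 dt unfolding gen_dual[OF u b u] by (intro mult_left_mono) auto
 \<comment> \<open>Young with \<open>e / 4\<close> against the dissipation \<open>e / 2\<close>:
   half of the latter survives.\<close>
 have 2: "(2 * dt) * (LINT x|dm Om. u x * ?F x) \<le> (2 * dt) * ((e / 4) * energy u + kap e2 \<beta> f / (2 * (e / 4)))"
  using form_bound[OF f b2 u _ e2 bd2, of "e/4"] dt e unfolding gen_dual[OF f b2 u] by (intro mult_left_mono) auto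
 have 3: "(2 * dt^2) * (LINT x|dm Om. (?A x)^2) \<le> dt * ?U"
 proof -
  have "(2 * dt^2) * (LINT x|dm Om. (?A x)^2) \<le> (2 * dt^2) * (crude e M * ?U)"
   using gen_bound_L2[OF u b _ bd] e unfolding crude_def by (intro mult_left_mono) auto
  also have "... = dt * ((2 * dt * crude e M) * ?U)" by (simp add: power2_eq_square)
  also have "... \<le> dt * (1 * ?U)" using dt U0 by (intro mult_left_mono mult_right_mono) auto
  finally show ?thesis by simp
 qed
 have 4: "(2 * dt^2) * (LINT x|dm Om. (?F x)^2) \<le> dt * kap e2 \<beta> f"
 proof -
  have "(2 * dt^2) * (LINT x|dm Om. (?F x)^2) \<le> (2 * dt^2) * (24 / h^2 * kap e2 \<beta> f)"
   using gen_bound[OF f b2 e2 bd2] by (intro mult_left_mono) auto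
  also have "... = dt * ((48 * dt / h^2) * kap e2 \<beta> f)" by (simp add: power2_eq_square)
  also have "... \<le> dt * (1 * kap e2 \<beta> f)" using dt h_pos kap_nonneg[of e2 \<beta> f] by (intro mult_left_mono mult_right_mono) auto
  finally show ?thesis by simp
 qed
 have "(2 * dt) * (- (e / 2 * energy u) + 3 * M^2 * (real DIM('a))^2 / (2 * e) * ?U) + (2 * dt) * ((e / 4) * energy u + kap e2 \<beta> f / (2 * (e / 4)))
  = - (dt * (e / 2) * energy u) + dt * (3 * M^2 * (real DIM('a))^2 / e) * ?U + dt * (4 / e) * kap e2 \<beta> f"
  using e by (simp add: field_simps)
 then show ?thesis using 0 1 2 3 4 by (simp add: algebra_simps)
qed

lemma step_weighted:
 assumes f: "bmon Om f" and b: "bmon Om b" and th: "bmon Om th" and e: "e > 0" and M: "M \<ge> 0"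
  and bd: "\<And>x. x \<in> Om ==> norm (b x) \<le> M"
  and lip: "\<And>x y. x \<in> Om ==> y \<in> Om ==> \<bar>th x - th y\<bar> \<le> Lam * norm (x - y)"
  and hL: "h * Lam * (real DIM('a)) \<le> 1" and L0: "Lam \<ge> 0"
  and th0: "\<And>x. x \<in> Om ==> 0 \<le> th x" and thW: "\<And>x. x \<in> Om ==> th x \<le> W"
  and dt: "dt \<ge> 0" "dt * (exp W)^2 * crude e M \<le> 1"
 defines "v \<equiv> \<lambda>x. f x * exp (th x)"
 shows "(LINT x|dm Om. ((f x + dt * gen e b f x) * exp (th x))^2) \<le>
  (1 + dt * (12 * (e * Lam^2 * (real DIM('a))^2 + M * Lam * (real DIM('a))^2) + 3 * M^2 * (real DIM('a))^2 / e + 1)) * (LINT x|dm Om. (v x)^2)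
   - dt * e * energy v"
proof -
 let ?A = "gen e b f" and ?w = "\<lambda>x. exp (th x)"
 let ?V = "LINT x|dm Om. (v x)^2"
 have bv: "bmon Om v" unfolding v_def by (intro bmon_intros f th)
 note bA = bmon_gen[OF f b, of e]
 have bg: "bmon Om (\<lambda>x. f x * (?w x)^2)" by (intro bmon_intros f th)
 note i = integrable_Om bmon_intros f bA bv th
 have V0: "?V \<ge> 0" by (intro integral_Om_nonneg) auto
 have C0: "crude e M \<ge> 0" unfolding crude_def by (intro mult_nonneg_nonneg add_nonneg_nonneg) auto
 have "(LINT x|dm Om. ((f x + dt * ?A x) * ?w x)^2) \<le>
   (LINT x|dm Om. (v x)^2 + (2 * dt) * ((f x * (?w x)^2) * ?A x) + (dt^2 * (exp W)^2) * (?A x)^2)"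
 proof (rule integral_Om_mono)
  fix x assume x: "x \<in> Om"
  have "((f x + dt * ?A x) * ?w x)^2 = (v x)^2 + (2 * dt) * ((f x * (?w x)^2) * ?A x) + (dt^2 * (?A x)^2) * (?w x)^2"
   unfolding v_def by (simp add: power2_eq_square algebra_simps)
  also have "(dt^2 * (?A x)^2) * (?w x)^2 \<le> (dt^2 * (?A x)^2) * (exp W)^2"
   using thW[OF x] by (intro mult_left_mono power_mono) auto
  finally show "((f x + dt * ?A x) * ?w x)^2 \<le> (v x)^2 + (2 * dt) * ((f x * (?w x)^2) * ?A x) + (dt^2 * (exp W)^2) * (?A x)^2"
   by (simp add: algebra_simps)
 qed (intro i)+
 also have "... = ?V + (2 * dt) * (LINT x|dm Om. (f x * (?w x)^2) * ?A x) + (dt^2 * (exp W)^2) * (LINT x|dm Om. (?A x)^2)"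
  apply (subst lint_add, (intro i)+)
  apply (subst lint_add, (intro i)+)
  by (simp only: integral_mult_right_zero)
 finally have 0: "(LINT x|dm Om. ((f x + dt * ?A x) * ?w x)^2) \<le> ..." .
 let ?C = "6 * (e * Lam^2 * (real DIM('a))^2 + M * Lam * (real DIM('a))^2) + 3 * M^2 * (real DIM('a))^2 / (2 * e)"
 have f0: "form e b f (\<lambda>x. f x * (?w x)^2) \<ge> e / 2 * energy v - ?C * ?V"
  unfolding v_def by (rule form_weighted[OF f b th e M bd lip hL L0])
 have 1: "(2 * dt) * (LINT x|dm Om. (f x * (?w x)^2) * ?A x) \<le> (2 * dt) * (- (e / 2 * energy v) + ?C * ?V)"
  using f0 dt unfolding gen_dual[OF f b bg] by (intro mult_left_mono) auto
 \<comment> \<open>The operator bound is unweighted, so the explicit error costs the square of the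
   largest weight; the restriction on \<open>dt\<close> pays for it.\<close>
 have 3: "(dt^2 * (exp W)^2) * (LINT x|dm Om. (?A x)^2) \<le> dt * ?V"
 proof -
  have fv: "(LINT x|dm Om. (f x)^2) \<le> ?V"
  proof (rule integral_Om_mono)
   fix x assume x: "x \<in> Om"
   have "(f x)^2 * 1 \<le> (f x)^2 * (exp (th x))^2" using th0[OF x] by (intro mult_left_mono) (auto simp: one_le_power)
   then show "(f x)^2 \<le> (v x)^2" by (simp add: v_def power_mult_distrib)
  qed (intro i)+
  have "(LINT x|dm Om. (?A x)^2) \<le> crude e M * (LINT x|dm Om. (f x)^2)"
   using gen_bound_L2[OF f b _ bd] e unfolding crude_def by auto
  also have "... \<le> crude e M * ?V" using C0 fv by (intro mult_left_mono)
  finally have "(dt^2 * (exp W)^2) * (LINT x|dm Om. (?A x)^2) \<le> (dt^2 * (exp W)^2) * (crude e M * ?V)"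
   by (intro mult_left_mono) auto
  also have "... = dt * ((dt * (exp W)^2 * crude e M) * ?V)" by (simp add: power2_eq_square)
  also have "... \<le> dt * (1 * ?V)" using dt V0 by (intro mult_left_mono mult_right_mono) auto
  finally show ?thesis by simp
 qed
 have "(2 * dt) * (- (e / 2 * energy v) + ?C * ?V) + dt * ?V =
   dt * (12 * (e * Lam^2 * (real DIM('a))^2 + M * Lam * (real DIM('a))^2) + 3 * M^2 * (real DIM('a))^2 / e + 1) * ?V - dt * e * energy v"
  using e by (simp add: field_simps)
 then show ?thesis using 0 1 3 by (simp add: algebra_simps)
qed

end

section \<open>Product sets, Fubini and shears\<close>

lemma fst_borel_measurable: "(fst :: 'a::euclidean_space \<times> 'b::euclidean_space => 'a) \<in> borel_measurable borel"
 and snd_borel_measurable: "(snd :: 'a::euclidean_space \<times> 'b::euclidean_space => 'b) \<in> borel_measurable borel"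
 by (intro borel_measurable_continuous_onI continuous_intros)+

lemma Times_sets_borel:
 fixes A :: "'a::euclidean_space set" and B :: "'b::euclidean_space set"
 assumes "A \<in> sets borel" "B \<in> sets borel"
 shows "A \<times> B \<in> sets borel"
proof -
 have "A \<times> B = (fst -` A \<inter> space borel) \<inter> (snd -` B \<inter> space borel)" by auto
 also have "... \<in> sets borel"
  by (intro sets.Int measurable_sets[of _ borel borel] assms fst_borel_measurable snd_borel_measurable)
 finally show ?thesis .
qed

lemma bmon_section:
 fixes F :: "'a::euclidean_space \<times> 'b::euclidean_space => 'c::euclidean_space"
 assumes "bmon (A \<times> B) F" "x \<in> A"
 shows "bmon B (\<lambda>z. F (x, z))"
proof -
 obtain C where "\<forall>p\<in>A \<times> B. norm (F p) \<le> C" using assms by (auto simp: bmon_def)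
 moreover have "(\<lambda>z. F (x, z)) \<in> borel_measurable borel"
  using bmon_measurable[OF assms(1)] by measurable
 ultimately show ?thesis using assms by (intro bmonI[of _ _ C]) auto
qed

lemma integral_dm_Times:
 fixes F :: "'a::euclidean_space \<times> 'b::euclidean_space => 'c::euclidean_space"
 assumes A: "A \<in> sets borel" and B: "B \<in> sets borel" and F: "F \<in> borel_measurable borel"
  and int: "integrable (dm (A \<times> B)) F"
 shows "(LINT p|dm (A \<times> B). F p) = (LINT x|dm A. LINT z|dm B. F (x, z))" (is ?E1)
  and "(LINT p|dm (A \<times> B). F p) = (LINT z|dm B. LINT x|dm A. F (x, z))" (is ?E2)
proof -
 note [measurable] = F A B fst_borel_measurable snd_borel_measurable
 have AB [measurable]: "A \<times> B \<in> sets borel" by (rule Times_sets_borel[OF A B])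
 have Fx: "(\<lambda>z. F (x, z)) \<in> borel_measurable borel" for x by measurable
 have Fz: "(\<lambda>x. F (x, z)) \<in> borel_measurable borel" for z by measurable
 have ind: "indicator (A \<times> B) (x, z) *\<^sub>R F (x, z) = indicator A x *\<^sub>R (indicator B z *\<^sub>R F (x, z))" for x z
  by (auto simp: indicator_def)
 have ind2: "indicator (A \<times> B) (x, z) *\<^sub>R F (x, z) = indicator B z *\<^sub>R (indicator A x *\<^sub>R F (x, z))" for x z
  by (auto simp: indicator_def)
 have fi: "integrable (lborel \<Otimes>\<^sub>M lborel) (\<lambda>(x, z). indicator (A \<times> B) (x, z) *\<^sub>R F (x, z))"
  using int unfolding lborel_prod by (subst (asm) integrable_dm_iff) (auto simp: split_beta')
 have 0: "(LINT p|dm (A \<times> B). F p) = integral\<^sup>L (lborel \<Otimes>\<^sub>M lborel) (\<lambda>(x, z). indicator (A \<times> B) (x, z) *\<^sub>R F (x, z))"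
  by (simp add: integral_dm lborel_prod split_beta')
 have m1: "(\<lambda>x. LINT z|dm B. F (x, z)) \<in> borel_measurable borel"
 proof -
  have "(\<lambda>(x, z). indicator B z *\<^sub>R F (x, z)) \<in> borel_measurable (lborel \<Otimes>\<^sub>M lborel)"
   unfolding lborel_prod split_beta' by measurable
  from lborel.borel_measurable_lebesgue_integral[OF this] show ?thesis using Fx B by (simp add: integral_dm)
 qed
 have m2: "(\<lambda>z. LINT x|dm A. F (x, z)) \<in> borel_measurable borel"
 proof -
  have "(\<lambda>(z, x). indicator A x *\<^sub>R F (x, z)) \<in> borel_measurable (lborel \<Otimes>\<^sub>M lborel)"
   unfolding lborel_prod split_beta' by measurable
  from lborel.borel_measurable_lebesgue_integral[OF this] show ?thesis using Fz A by (simp add: integral_dm)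
 qed
 have "(LINT x|lborel. LINT z|lborel. indicator (A \<times> B) (x, z) *\<^sub>R F (x, z)) = (LINT p|dm (A \<times> B). F p)"
  unfolding 0 by (rule lborel_pair.integral_fst[OF fi])
 then show ?E1 using A B Fx m1 unfolding ind by (simp add: integral_dm del: scaleR_scaleR)
 have "(LINT z|lborel. LINT x|lborel. indicator (A \<times> B) (x, z) *\<^sub>R F (x, z)) = (LINT p|dm (A \<times> B). F p)"
  unfolding 0 by (rule lborel_pair.integral_snd[OF fi])
 then show ?E2 using A B Fz m2 unfolding ind2 by (simp add: integral_dm del: scaleR_scaleR)
qed

text \<open>Moves the starting point of a jump along its own direction. It lets every link of a
  chain of equal jumps be compared with one and the same energy integral over
  \<open>J\<close>.\<close>

lemma lborel_shear:
 "distr (lborel :: ('a::euclidean_space \<times> 'a) measure) borel (\<lambda>p. (fst p + c *\<^sub>R snd p, snd p)) = lborel"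
proof (rule measure_eqI)
 let ?S = "\<lambda>p::'a \<times> 'a. (fst p + c *\<^sub>R snd p, snd p)"
 have S: "?S \<in> borel_measurable borel" by (intro borel_measurable_continuous_onI continuous_intros)
 fix X assume "X \<in> sets (distr (lborel :: ('a \<times> 'a) measure) borel ?S)"
 then have X [measurable]: "X \<in> sets borel" by simp
 have Xs: "?S -` X \<in> sets borel" using measurable_sets[OF S X] by simp
 have tr: "(\<integral>\<^sup>+x. indicator X (x + c *\<^sub>R z, z) \<partial>lborel) = (\<integral>\<^sup>+x. indicator X (x, z) \<partial>lborel)" for z
 proof -
  have [measurable]: "(\<lambda>x. indicator X (x, z) :: ennreal) \<in> borel_measurable borel" by measurable
  have "(\<integral>\<^sup>+x. indicator X (x, z) \<partial>lborel) = (\<integral>\<^sup>+x. indicator X (x, z) \<partial>distr lborel borel ((+) (c *\<^sub>R z)))"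
   by (simp add: lborel_distr_plus)
  also have "... = (\<integral>\<^sup>+x. indicator X (c *\<^sub>R z + x, z) \<partial>lborel)"
   by (subst nn_integral_distr) auto
  finally show ?thesis by (simp add: add.commute)
 qed
 have ind: "indicator (?S -` X) (x, z) = (indicator X (x + c *\<^sub>R z, z) :: ennreal)" for x z by (simp add: indicator_def)
 have "emeasure (distr lborel borel ?S) X = emeasure lborel (?S -` X)"
  by (subst emeasure_distr) (use S X in auto)
 also have "... = (\<integral>\<^sup>+p. indicator (?S -` X) p \<partial>(lborel \<Otimes>\<^sub>M lborel))"
  using Xs by (simp add: lborel_prod)
 also have "... = (\<integral>\<^sup>+z. \<integral>\<^sup>+x. indicator (?S -` X) (x, z) \<partial>lborel \<partial>lborel)"
  by (rule lborel_pair.nn_integral_snd[symmetric]) (use Xs in \<open>simp add: lborel_prod\<close>)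
 also have "... = (\<integral>\<^sup>+z. \<integral>\<^sup>+x. indicator X (x, z) \<partial>lborel \<partial>lborel)" unfolding ind tr ..
 also have "... = (\<integral>\<^sup>+p. indicator X p \<partial>(lborel \<Otimes>\<^sub>M lborel))"
  by (rule lborel_pair.nn_integral_snd) (simp add: lborel_prod)
 also have "... = emeasure lborel X" by (simp add: lborel_prod)
 finally show "emeasure (distr lborel borel ?S) X = emeasure lborel X" .
qed simp

lemma integrable_scale:
 fixes f :: "'a::euclidean_space => real"
 assumes f: "integrable lborel f" and "c \<noteq> 0"
 shows "integrable lborel (\<lambda>x. f (t + c *\<^sub>R x))"
proof -
 have [measurable]: "f \<in> borel_measurable borel" using f by auto
 have "integrable (density (distr lborel borel (\<lambda>x. t + c *\<^sub>R x)) (\<lambda>_. ennreal (\<bar>c\<bar>^DIM('a)))) f"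
  using f lborel_affine[of c t] assms by simp
 then have "integrable (distr lborel borel (\<lambda>x. t + c *\<^sub>R x)) (\<lambda>x. \<bar>c\<bar>^DIM('a) * f x)"
  by (subst (asm) integrable_density) auto
 then have "integrable (distr lborel borel (\<lambda>x. t + c *\<^sub>R x)) f" using assms by simp
 then show ?thesis by (subst (asm) integrable_distr_eq) auto
qed

section \<open>The cone property and a nonlocal Nash inequality\<close>

text \<open>Near a boundary point the cone opens around the graph direction \<open>e\<close>. Moving
  along \<open>z\<close> with \<open>norm (z - e) < \<eta>\<close> for a time \<open>t\<close>
  raises the height by at least \<open>t * (1 - \<eta>)\<close>, while the graph rises by at most
  \<open>t * L * \<eta>\<close>; the two balance for \<open>\<eta> = 1 / (L + 1)\<close>.\<close>

lemma lipschitz_boundary_local_cone: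
 fixes Om :: "'a::euclidean_space set"
 assumes lb: "lipschitz_boundary Om" and op: "open Om" and p: "p \<in> closure Om"
 shows "\<exists>\<rho>>0. \<exists>r>0. \<exists>\<eta>>0. \<exists>e. \<eta> \<le> 1 \<and> norm e = 1 \<and>
  (\<forall>x\<in>Om \<inter> ball p \<rho>. \<forall>z. norm (z - e) < \<eta> \<longrightarrow> (\<forall>t\<in>{0..r}. x + t *\<^sub>R z \<in> Om))"
proof (cases "p \<in> Om")
 case True
 then obtain R where R: "R > 0" "ball p R \<subseteq> Om" using op openE by blast
 obtain e :: 'a where e: "norm e = 1" using vector_choose_size[of 1] by auto
 have "x + t *\<^sub>R z \<in> Om" if x: "x \<in> ball p (R/2)" and z: "norm (z - e) < 1" and t: "t \<in> {0..R/4}" for x z t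
 proof -
  have "norm z \<le> 2" using norm_triangle_sub[of z e] e z by simp
  then have "t * norm z \<le> R/4 * 2" using t R by (intro mult_mono) auto
  then have "norm (t *\<^sub>R z) \<le> R/4 * 2" using t by simp
  then have "dist p (x + t *\<^sub>R z) < R" using x dist_triangle[of p "x + t *\<^sub>R z" x] by (simp add: dist_norm)
  then show ?thesis using R by auto
 qed
 then show ?thesis using R e by (intro exI[of _ "R/2"] exI[of _ "R/4"] conjI exI[of _ 1] exI[of _ e]) auto
next
 case False
 then have "p \<in> frontier Om" using p op by (simp add: frontier_def interior_open)
 then obtain e r h L g where e: "norm (e::'a) = 1" and r: "r > 0" and h: "h > 0"
  and lip: "L-lipschitz_on {y. y \<bullet> e = 0} g"
  and g: "\<And>y s. y \<bullet> e = 0 ==> norm (y - (p - (p \<bullet> e) *\<^sub>R e)) < r ==> \<bar>s - p \<bullet> e\<bar> < h ==>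
        y + s *\<^sub>R e \<in> Om \<longleftrightarrow> g y < s"
  using lb unfolding lipschitz_boundary_def by metis
 have L0: "L \<ge> 0" using lip by (rule lipschitz_on_nonneg)
 \<comment> \<open>Fractions of the chart size: the moved point deviates from \<open>p\<close> by
   less than \<open>\<rho> + 2 * r0\<close> in each of the two chart directions and so stays in the
   cylinder where the graph describes the domain.\<close>
 define \<rho> where "\<rho> = min r h / 2"
 define r0 where "r0 = min r h / 4"
 define \<eta> where "\<eta> = 1 / (L + 1)"
 have pos: "\<rho> > 0" "r0 > 0" "\<eta> > 0" "\<eta> \<le> 1" using r h L0 by (auto simp: \<rho>_def r0_def \<eta>_def)
 have Le: "L * \<eta> = 1 - \<eta>" using L0 by (simp add: \<eta>_def field_simps)
 have ee: "e \<bullet> e = 1" using e by (simp add: dot_square_norm)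
 define pr where "pr x = x - (x \<bullet> e) *\<^sub>R e" for x
 have pr0: "pr x \<bullet> e = 0" for x by (simp add: pr_def inner_diff_left ee)
 have prn: "norm (pr x) \<le> norm x" for x
 proof -
  have "(norm (pr x))^2 = (norm x)^2 - (x \<bullet> e)^2"
   unfolding power2_norm_eq_inner pr_def
   by (simp add: inner_diff_left inner_diff_right ee inner_commute[of e x] power2_eq_square)
  then have "(norm (pr x))^2 \<le> (norm x)^2" by simp
  then show ?thesis by (rule power2_le_imp_le) simp
 qed
 have prd: "pr (x + y) = pr x + pr y" "pr (x - y) = pr x - pr y" "pr (t *\<^sub>R x) = t *\<^sub>R pr x" for x y t
  by (simp_all add: pr_def inner_add_left inner_diff_left algebra_simps scaleR_add_left scaleR_diff_left)
 have pre: "pr e = 0" by (simp add: pr_def ee)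
 have decomp: "pr x + (x \<bullet> e) *\<^sub>R e = x" for x by (simp add: pr_def)
 have abse: "\<bar>x \<bullet> e\<bar> \<le> norm x" for x using Cauchy_Schwarz_ineq2[of x e] e by simp
 have "x + t *\<^sub>R z \<in> Om" if x: "x \<in> Om" "x \<in> ball p \<rho>" and z: "norm (z - e) < \<eta>" and t: "t \<in> {0..r0}" for x z t
 proof -
  have xp: "norm (x - p) < \<rho>" using x by (simp add: dist_norm norm_minus_commute)
  have a1: "norm (pr x - pr p) < \<rho>" using prn[of "x - p"] xp by (simp add: prd)
  have a2: "\<bar>x \<bullet> e - p \<bullet> e\<bar> < \<rho>" using abse[of "x - p"] xp by (simp add: inner_diff_left)
  have gx: "g (pr x) < x \<bullet> e"
   using g[OF pr0[of x], of "x \<bullet> e"] a1 a2 x r h by (simp add: decomp) (simp add: pr_def \<rho>_def)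
  have z1: "norm (pr z) \<le> \<eta>" using prn[of "z - e"] z by (simp add: prd pre)
  have z2: "\<bar>z \<bullet> e - 1\<bar> < \<eta>" using abse[of "z - e"] z by (simp add: inner_diff_left ee)
  let ?x = "x + t *\<^sub>R z"
  have b1: "norm (pr ?x - pr x) \<le> t * \<eta>" using z1 t by (simp add: prd mult_left_mono)
  have "g (pr ?x) \<le> g (pr x) + L * norm (pr ?x - pr x)"
   using lipschitz_onD[OF lip, of "pr ?x" "pr x"] pr0 by (simp add: dist_norm)
  also have "... \<le> g (pr x) + L * (t * \<eta>)" using b1 L0 by (intro add_left_mono mult_left_mono)
  also have "... = g (pr x) + t * (1 - \<eta>)" using Le by (simp add: mult_ac)
  also have "... < x \<bullet> e + t * (1 - \<eta>)" using gx by simp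
  also have "... \<le> x \<bullet> e + t * (z \<bullet> e)" using z2 t by (intro add_left_mono mult_left_mono) auto
  finally have gg: "g (pr ?x) < ?x \<bullet> e" by (simp add: inner_add_left)
  have "t * \<eta> \<le> r0 * 1" using t pos by (intro mult_mono) auto
  then have "norm (pr ?x - pr p) < \<rho> + r0" using norm_triangle_ineq[of "pr ?x - pr x" "pr x - pr p"] a1 b1 by simp
  also have "... \<le> r" using r h by (auto simp: \<rho>_def r0_def)
  finally have c1: "norm (pr ?x - pr p) < r" .
  have "t * \<bar>z \<bullet> e\<bar> \<le> r0 * 2" using t pos z2 by (intro mult_mono) auto
  moreover have "\<bar>?x \<bullet> e - p \<bullet> e\<bar> \<le> \<bar>x \<bullet> e - p \<bullet> e\<bar> + t * \<bar>z \<bullet> e\<bar>"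
  proof -
   have "?x \<bullet> e - p \<bullet> e = (x \<bullet> e - p \<bullet> e) + t * (z \<bullet> e)" by (simp add: inner_add_left)
   then show ?thesis using abs_triangle_ineq[of "x \<bullet> e - p \<bullet> e" "t * (z \<bullet> e)"] t by (simp add: abs_mult)
  qed
  ultimately have "\<bar>?x \<bullet> e - p \<bullet> e\<bar> < \<rho> + r0 * 2" using a2 by simp
  also have "... \<le> h" using r h by (auto simp: \<rho>_def r0_def)
  finally have c2: "\<bar>?x \<bullet> e - p \<bullet> e\<bar> < h" .
  show ?thesis using g[OF pr0[of ?x] _ c2] c1 gg by (simp add: decomp) (simp add: pr_def)
 qed
 then show ?thesis using pos e by (intro exI[of _ \<rho>] exI[of _ r0] conjI exI[of _ \<eta>] exI[of _ e]) auto
qed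

text \<open>Compactness of the closure makes reach and opening uniform, as minima over finitely many
  charts. The 1 inserted into the minima covers an empty family and keeps
  \<open>\<eta> \<le> 1\<close>.\<close>

lemma lipschitz_boundary_cone:
 fixes Om :: "'a::euclidean_space set"
 assumes lb: "lipschitz_boundary Om" and op: "open Om" and bd: "bounded Om"
 shows "\<exists>r>0. \<exists>\<eta>>0. \<exists>I. finite I \<and> Om \<subseteq> (\<Union>i\<in>I. fst i) \<and> \<eta> \<le> 1 \<and> (\<forall>(U, e)\<in>I. open U \<and> norm e = 1 \<and>
  (\<forall>x\<in>Om \<inter> U. \<forall>z. norm (z - e) < \<eta> \<longrightarrow> (\<forall>t\<in>{0..r}. x + t *\<^sub>R z \<in> Om)))"
proof -
 have "\<forall>p\<in>closure Om. \<exists>\<rho>>0. \<exists>r>0. \<exists>\<eta>>0. \<exists>e. \<eta> \<le> 1 \<and> norm e = 1 \<and>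
  (\<forall>x\<in>Om \<inter> ball p \<rho>. \<forall>z. norm (z - e) < \<eta> \<longrightarrow> (\<forall>t\<in>{0..r}. x + t *\<^sub>R z \<in> Om))"
  using lipschitz_boundary_local_cone[OF lb op] by blast
 then obtain \<rho> r \<eta> e where H: "\<And>p. p \<in> closure Om ==> \<rho> p > 0 \<and> r p > 0 \<and> \<eta> p > 0 \<and> \<eta> p \<le> 1 \<and> norm (e p :: 'a) = 1 \<and>
  (\<forall>x\<in>Om \<inter> ball p (\<rho> p). \<forall>z. norm (z - e p) < \<eta> p \<longrightarrow> (\<forall>t\<in>{0..r p}. x + t *\<^sub>R z \<in> Om))"
  by metis
 have "compact (closure Om)" using bd by simp
 then obtain P where P: "finite P" "P \<subseteq> closure Om" "closure Om \<subseteq> (\<Union>p\<in>P. ball p (\<rho> p))"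
  by (rule compactE_image[of _ "closure Om" "\<lambda>p. ball p (\<rho> p)"]) (use H in \<open>auto intro!: centre_in_ball[THEN iffD2]\<close>)
 define r0 where "r0 = Min (insert 1 (r ` P))"
 define \<eta>0 where "\<eta>0 = Min (insert 1 (\<eta> ` P))"
 have fin: "finite (insert 1 (r ` P))" "finite (insert 1 (\<eta> ` P))" using P by auto
 have r0: "r0 > 0" "\<And>p. p \<in> P ==> r0 \<le> r p"
 proof -
  show "r0 > 0" unfolding r0_def using P H by (subst Min_gr_iff[OF fin(1)]) auto
  show "r0 \<le> r p" if "p \<in> P" for p unfolding r0_def using that by (intro Min_le fin) auto
 qed
 have e0: "\<eta>0 > 0" "\<eta>0 \<le> 1" "\<And>p. p \<in> P ==> \<eta>0 \<le> \<eta> p"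
 proof -
  show "\<eta>0 > 0" unfolding \<eta>0_def using P H by (subst Min_gr_iff[OF fin(2)]) auto
  show "\<eta>0 \<le> \<eta> p" if "p \<in> P" for p unfolding \<eta>0_def using that by (intro Min_le fin) auto
  show "\<eta>0 \<le> 1" unfolding \<eta>0_def by (intro Min_le fin) auto
 qed
 let ?I = "(\<lambda>p. (ball p (\<rho> p), e p)) ` P"
 have "finite ?I" "Om \<subseteq> (\<Union>i\<in>?I. fst i)" using P closure_subset[of Om] by auto
 moreover have "\<forall>(U, e)\<in>?I. open U \<and> norm e = 1 \<and>
  (\<forall>x\<in>Om \<inter> U. \<forall>z. norm (z - e) < \<eta>0 \<longrightarrow> (\<forall>t\<in>{0..r0}. x + t *\<^sub>R z \<in> Om))"
 proof (clarsimp, intro conjI ballI allI impI)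
  fix p assume p: "p \<in> P"
  then have pc: "p \<in> closure Om" using P by auto
  show "norm (e p) = 1" using H[OF pc] by blast
  fix x z t assume "x \<in> Om \<inter> ball p (\<rho> p)" "norm (z - e p) < \<eta>0" "t \<in> {0..r0}"
  then show "x + t *\<^sub>R z \<in> Om" using H[OF pc] r0(2)[OF p] e0(3)[OF p]
   by (meson atLeastAtMost_iff order_less_le_trans order_trans)
 qed
 ultimately show ?thesis using r0(1) e0(1,2) by blast
qed

context jump
begin

text \<open>Compare \<open>v x\<close> with \<open>v\<close> after \<open>N\<close> equal jumps
  along some \<open>z\<close> in \<open>K\<close>. The difference telescopes; Cauchy-Schwarz and the
  shear bound its square integral by \<open>N^2\<close> times that of a single jump, that is, by
  \<open>(N * h)^2\<close> times the energy up to a constant. The value at the end, integrated over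
  \<open>z\<close>, is at most the L1 norm divided by the volume scale
  \<open>(N * h) ^ DIM('a)\<close>.\<close>

lemma nash_patch:
 fixes K U :: "'a set" and N :: nat
 assumes v: "bmon Om v" and U: "open U" and K: "K \<in> sets borel" "K \<subseteq> cube" and N: "N \<ge> 1"
  and cone: "\<And>x z j. x \<in> Om ==> x \<in> U ==> z \<in> K ==> j \<le> N ==> x + (real j * h) *\<^sub>R z \<in> Om"
  and k: "k = measure lborel K" "k > 0"
 shows "(LINT x|dm (Om \<inter> U). (v x)^2) \<le> 2 / (k * kc TYPE('a)) * (real N * h)^2 * energy v
   + 2 * measure lborel Om / k^2 * ((LINT x|dm Om. \<bar>v x\<bar>) / (real N * h) ^ DIM('a))^2"
proof -
 let ?A = "Om \<inter> U"
 let ?r = "real N * h"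
 have r: "?r > 0" using N h_pos by (intro mult_pos_pos) auto
 have A: "?A \<in> sets borel" "bounded ?A" "?A \<subseteq> Om" using U bounded_Om by (auto intro: bounded_subset)
 have Kb: "bounded K" using K cube_bounded bounded_subset by blast
 have vA: "bmon ?A v" by (rule bmon_subset[OF v A(3)])
 have AK: "?A \<times> K \<in> sets borel" "bounded (?A \<times> K)" using A K Kb by (auto intro: Times_sets_borel bounded_Times)
 note [measurable] = K(1)
 have vm [measurable]: "v \<in> borel_measurable borel" by (rule bmon_measurable[OF v])
 define X where "X j p = fst p + (real j * h) *\<^sub>R snd p" for j and p :: "'a \<times> 'a"
 have Xm [measurable]: "X j \<in> borel_measurable borel" for j
  unfolding X_def by (intro borel_measurable_continuous_onI continuous_intros)
 have XOm: "X j p \<in> Om" if "p \<in> ?A \<times> K" "j \<le> N" for p j using that cone by (auto simp: X_def)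
 have bX: "bmon (?A \<times> K) (\<lambda>p. v (X j p))" if "j \<le> N" for j
  by (rule bmon_compose[OF v]) (use XOm that in auto)
 note iAK = integrable_bmon[OF AK]
 define g where "g p = indicator J p * (v (tgt p) - v (fst p))^2" for p
 have gi: "integrable lborel g"
 proof -
  have "integrable (dm J) (\<lambda>p. (v (tgt p) - v (fst p))^2)" by (intro integrable_J bmon_intros bmon_J v)
  then show ?thesis unfolding g_def by (subst (asm) integrable_dm_iff) auto
 qed
 have g0: "g p \<ge> 0" for p by (simp add: g_def)
 have gm [measurable]: "g \<in> borel_measurable borel" using gi by auto
 have step: "(LINT p|dm (?A \<times> K). (v (X (Suc j) p) - v (X j p))^2) \<le> (LINT p|dm J. (v (tgt p) - v (fst p))^2)" if j: "j < N" for j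
 proof -
  let ?S = "\<lambda>p::'a \<times> 'a. (fst p + (real j * h) *\<^sub>R snd p, snd p)"
  have S: "?S \<in> borel_measurable borel" by (intro borel_measurable_continuous_onI continuous_intros)
  have gS: "integrable lborel (\<lambda>p. g (?S p))"
  proof -
   have "integrable (distr lborel borel ?S) g" using gi by (simp add: lborel_shear)
   then show ?thesis using S by (subst (asm) integrable_distr_eq) auto
  qed
  have gI: "(LINT p|lborel. g (?S p)) = (LINT p|lborel. g p)"
  proof -
   have "(LINT p|distr lborel borel ?S. g p) = (LINT p|lborel. g (?S p))" using S by (subst integral_distr) auto
   then show ?thesis by (simp add: lborel_shear)
  qed
  have "(LINT p|dm (?A \<times> K). (v (X (Suc j) p) - v (X j p))^2) = (LINT p|lborel. indicator (?A \<times> K) p *\<^sub>R (v (X (Suc j) p) - v (X j p))^2)"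
   by (rule integral_dm[OF AK(1)]) measurable
  also have "... \<le> (LINT p|lborel. g (?S p))"
  proof (rule integral_mono)
   have "integrable (dm (?A \<times> K)) (\<lambda>p. (v (X (Suc j) p) - v (X j p))^2)"
    using j by (intro iAK bmon_intros bX) auto
   then show "integrable lborel (\<lambda>p. indicator (?A \<times> K) p *\<^sub>R (v (X (Suc j) p) - v (X j p))^2)"
    by (subst (asm) integrable_dm_iff) (use AK in auto)
   fix p
   show "indicator (?A \<times> K) p *\<^sub>R (v (X (Suc j) p) - v (X j p))^2 \<le> g (?S p)"
   proof (cases "p \<in> ?A \<times> K")
    case True
    have t: "tgt (?S p) = X (Suc j) p" by (simp add: tgt_def X_def algebra_simps)
    have "?S p \<in> J" using XOm[OF True, of j] XOm[OF True, of "Suc j"] j True K(2) unfolding J_iff t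
     by (auto simp: X_def)
    then show ?thesis using True by (simp add: g_def t) (simp add: X_def)
   qed (simp add: g0)
  qed (rule gS)
  also have "... = (LINT p|dm J. (v (tgt p) - v (fst p))^2)" unfolding gI unfolding g_def by (subst integral_dm) auto
  finally show ?thesis .
 qed
 let ?D = "\<lambda>p. (v (X 0 p) - v (X N p))^2"
 have bD: "bmon (?A \<times> K) ?D" by (intro bmon_intros bX) auto
 have "(LINT p|dm (?A \<times> K). ?D p) \<le> (LINT p|dm (?A \<times> K). real N * (\<Sum>j<N. (v (X (Suc j) p) - v (X j p))^2))"
 proof (rule integral_mono)
  show "integrable (dm (?A \<times> K)) ?D" by (rule iAK[OF bD])
  show "integrable (dm (?A \<times> K)) (\<lambda>p. real N * (\<Sum>j<N. (v (X (Suc j) p) - v (X j p))^2))"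
   by (intro iAK bmon_intros bX) auto
  fix p
  have "v (X N p) - v (X 0 p) = (\<Sum>j<N. v (X (Suc j) p) - v (X j p))"
   by (rule sum_lessThan_telescope[symmetric])
  then have "?D p = (\<Sum>j<N. v (X (Suc j) p) - v (X j p))^2" by (metis power2_commute)
  also have "... \<le> (\<Sum>j<N. (v (X (Suc j) p) - v (X j p))^2) * real (card {..<N})"
   by (rule sum_squared_le_sum_of_squares)
  finally show "?D p \<le> real N * (\<Sum>j<N. (v (X (Suc j) p) - v (X j p))^2)" by (simp add: mult.commute)
 qed
 also have "... = real N * (\<Sum>j<N. LINT p|dm (?A \<times> K). (v (X (Suc j) p) - v (X j p))^2)"
  by (simp only: integral_mult_right_zero, subst lint_sum) (auto intro!: iAK bmon_intros bX)
 also have "... \<le> real N * (\<Sum>j<N. LINT p|dm J. (v (tgt p) - v (fst p))^2)"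
  by (intro mult_left_mono sum_mono step) auto
 also have "... = (real N)^2 * (LINT p|dm J. (v (tgt p) - v (fst p))^2)" by (simp add: power2_eq_square)
 also have "... = ?r^2 * energy v / kc TYPE('a)"
  unfolding energy_def using h_pos kc_pos[where 'a='a] by (simp add: power_mult_distrib)
 finally have D: "(LINT p|dm (?A \<times> K). ?D p) \<le> ?r^2 * energy v / kc TYPE('a)" .
 define m where "m = (LINT x|dm Om. \<bar>v x\<bar>) / ?r ^ DIM('a)"
 have pw: "k / 2 * (v x)^2 \<le> (LINT z|dm K. ?D (x, z)) + m^2 / k" if x: "x \<in> ?A" for x
 proof -
  have Xx: "bmon K (\<lambda>z. v (X N (x, z)))" by (rule bmon_section[OF bX[of N] x]) simp
  have X0: "v (X 0 (x, z)) = v x" for z by (simp add: X_def)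
  note iK = integrable_bmon[OF K(1) Kb]
  \<comment> \<open>A quarter of \<open>(v x)^2\<close> is spent by Young here and another quarter
    in the last estimate of this block, so half of it is left.\<close>
  have "(LINT z|dm K. 3/4 * (v x)^2) \<le> (LINT z|dm K. ?D (x, z) + v x * v (X N (x, z)))"
  proof (rule integral_mono)
   show "integrable (dm K) (\<lambda>z. 3/4 * (v x)^2)" by (intro iK bmon_intros)
   show "integrable (dm K) (\<lambda>z. ?D (x, z) + v x * v (X N (x, z)))" unfolding X0 by (intro iK bmon_intros Xx)
   fix z
   have "v x * (v x - v (X N (x, z))) \<le> 1/4 * (v x)^2 + (v x - v (X N (x, z)))^2"
    using young[of "1/4" "v x" "v x - v (X N (x, z))"] by simp
   then show "3/4 * (v x)^2 \<le> ?D (x, z) + v x * v (X N (x, z))" unfolding X0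
    by (simp add: power2_eq_square algebra_simps)
  qed
  also have "... = (LINT z|dm K. ?D (x, z)) + v x * (LINT z|dm K. v (X N (x, z)))"
   unfolding X0 by (subst lint_add) (auto intro!: iK bmon_intros Xx)
  also have "(LINT z|dm K. 3/4 * (v x)^2) = 3/4 * k * (v x)^2" using K k by (simp add: measure_dm)
  finally have 1: "3/4 * k * (v x)^2 \<le> (LINT z|dm K. ?D (x, z)) + v x * (LINT z|dm K. v (X N (x, z)))" .
  define w where "w y = indicator Om y * \<bar>v y\<bar>" for y
  have wi: "integrable lborel w"
  proof -
   have "integrable (dm Om) (\<lambda>y. \<bar>v y\<bar>)" by (intro integrable_Om bmon_intros v)
   then show ?thesis unfolding w_def by (subst (asm) integrable_dm_iff) auto
  qed
  have wm: "w \<in> borel_measurable borel" using wi by auto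
  have "\<bar>LINT z|dm K. v (X N (x, z))\<bar> \<le> (LINT z|dm K. \<bar>v (X N (x, z))\<bar>)"
   using integral_norm_bound[of "dm K" "\<lambda>z. v (X N (x, z))"] by simp
  also have "... = (LINT z|lborel. indicator K z *\<^sub>R \<bar>v (X N (x, z))\<bar>)"
   using Xx K by (subst integral_dm) (auto simp: bmon_def)
  also have "... \<le> (LINT z|lborel. w (x + ?r *\<^sub>R z))"
  proof (rule integral_mono)
   have "integrable (dm K) (\<lambda>z. \<bar>v (X N (x, z))\<bar>)" by (intro iK bmon_intros Xx)
   then show "integrable lborel (\<lambda>z. indicator K z *\<^sub>R \<bar>v (X N (x, z))\<bar>)"
    using Xx K by (subst (asm) integrable_dm_iff) (auto simp: bmon_def)
   show "integrable lborel (\<lambda>z. w (x + ?r *\<^sub>R z))" using r N by (intro integrable_scale wi) auto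
   fix z
   show "indicator K z *\<^sub>R \<bar>v (X N (x, z))\<bar> \<le> w (x + ?r *\<^sub>R z)"
    using XOm[of "(x, z)" N] x by (auto simp: w_def X_def indicator_def)
  qed
  also have "... = m" 
  proof -
   have "?r ^ DIM('a) * (LINT z|lborel. w (x + ?r *\<^sub>R z)) = (LINT z|lborel. w z)"
    using integral_scale[OF wm, of ?r x] r h_pos N by simp
   moreover have "(LINT z|lborel. w z) = (LINT x|dm Om. \<bar>v x\<bar>)"
    unfolding w_def by (subst integral_dm) auto
   moreover have rn: "?r ^ DIM('a) \<noteq> 0" using N h_pos by simp
   ultimately show ?thesis unfolding m_def by (intro eq_divide_imp[OF rn]) (simp only: mult.commute)
  qed
  finally have 2: "\<bar>LINT z|dm K. v (X N (x, z))\<bar> \<le> m" .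
  have "v x * (LINT z|dm K. v (X N (x, z))) \<le> \<bar>v x\<bar> * m"
   by (rule order_trans[OF abs_ge_self]) (simp only: abs_mult, rule mult_left_mono[OF 2 abs_ge_zero])
  also have "... \<le> k / 4 * \<bar>v x\<bar>^2 + m^2 / (4 * (k / 4))" using k by (intro young) auto
  finally show ?thesis using 1 by simp
 qed
 obtain C where C: "\<forall>p\<in>?A \<times> K. norm (?D p) \<le> C" using bD by (auto simp: bmon_def)
 have bI: "bmon ?A (\<lambda>x. LINT z|dm K. ?D (x, z))"
 proof (rule bmonI)
  have "(\<lambda>(x, z). indicator K z *\<^sub>R ?D (x, z)) \<in> borel_measurable (lborel \<Otimes>\<^sub>M lborel)"
   unfolding lborel_prod split_beta' by measurable
  moreover have "(\<lambda>z. ?D (x, z)) \<in> borel_measurable borel" for x by measurable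
  ultimately show "(\<lambda>x. LINT z|dm K. ?D (x, z)) \<in> borel_measurable borel"
   using lborel.borel_measurable_lebesgue_integral[of "\<lambda>x z. indicator K z *\<^sub>R ?D (x, z)" lborel] K
   by (simp add: integral_dm)
  fix x assume x: "x \<in> ?A"
  have "norm (LINT z|dm K. ?D (x, z)) \<le> (LINT z|dm K. norm (?D (x, z)))" by (rule integral_norm_bound)
  also have "... \<le> (LINT z|dm K. \<bar>C\<bar>)"
  proof (intro integral_mono_AE integrable_bmon[OF K(1) Kb] bmon_const bmon_norm bmon_section[OF bD x] AE_dmI K(1))
   fix z assume "z \<in> K"
   then have "norm (?D (x, z)) \<le> C" using C x by (meson mem_Sigma_iff)
   then show "norm (?D (x, z)) \<le> \<bar>C\<bar>" by linarith
  qed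
  finally show "norm (LINT z|dm K. ?D (x, z)) \<le> (LINT z|dm K. \<bar>C\<bar>)" .
 qed
 have "(LINT x|dm ?A. k / 2 * (v x)^2) \<le> (LINT x|dm ?A. (LINT z|dm K. ?D (x, z)) + m^2 / k)"
  by (intro integral_mono_AE AE_dmI A pw integrable_bmon bmon_intros vA bI)
 also have "... = (LINT x|dm ?A. LINT z|dm K. ?D (x, z)) + (LINT x|dm ?A. m^2 / k)"
  by (intro lint_add integrable_bmon A bI bmon_const)
 also have "(LINT x|dm ?A. LINT z|dm K. ?D (x, z)) = (LINT p|dm (?A \<times> K). ?D p)"
  by (rule integral_dm_Times(1)[symmetric, OF A(1) K(1) _ iAK[OF bD]]) measurable
 also have "(LINT x|dm ?A. m^2 / k) = m^2 / k * measure lborel ?A"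
  using A by (simp add: measure_dm)
 also have "(LINT p|dm (?A \<times> K). ?D p) + m^2 / k * measure lborel ?A \<le> ?r^2 * energy v / kc TYPE('a) + m^2 / k * measure lborel Om"
 proof (intro add_mono D mult_left_mono measure_mono_fmeasurable)
  show "Om \<in> fmeasurable lborel" using emeasure_bounded_finite[OF bounded_Om] by (auto simp: fmeasurable_def)
 qed (use A k in auto)
 finally have "k / 2 * (LINT x|dm ?A. (v x)^2) \<le> ?r^2 * energy v / kc TYPE('a) + m^2 / k * measure lborel Om" by simp
 then have "(LINT x|dm ?A. (v x)^2) \<le> 2 / k * (?r^2 * energy v / kc TYPE('a) + m^2 / k * measure lborel Om)"
  using k by (simp add: field_simps)
 also have "... = 2 / (k * kc TYPE('a)) * ?r^2 * energy v + 2 * measure lborel Om / k^2 * m^2"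
  using k kc_pos[where 'a='a] by (simp add: field_simps power2_eq_square)
 finally show ?thesis unfolding m_def .
qed

end

text \<open>A Nash inequality with a free scale \<open>N * h\<close> in place of the optimal one,
  because the application prescribes the scale as a multiple of \<open>e\<close>. Summing one patch
  per chart of the cone property gives a constant independent of \<open>h\<close>.\<close>

lemma nash_inequality:
 fixes Om :: "'a::euclidean_space set"
 assumes lb: "lipschitz_boundary Om" and op: "open Om" and bd: "bounded Om"
 obtains C r0 where "C > 0" "r0 > 0"
  "\<And>h N v. h > 0 ==> N \<ge> 1 ==> real N * h \<le> r0 ==> bmon Om v ==>
   (LINT x|dm Om. (v x)^2) \<le> C * ((real N * h)^2 * jump.energy Om h v + ((LINT x|dm Om. \<bar>v x\<bar>) / (real N * h) ^ DIM('a))^2)"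
proof -
 obtain r \<eta> I where r: "r > 0" and \<eta>: "\<eta> > 0" "\<eta> \<le> 1" and I: "finite I" "Om \<subseteq> (\<Union>i\<in>I. fst i)"
  and cone: "\<forall>(U, e)\<in>I. open U \<and> norm (e::'a) = 1 \<and>
  (\<forall>x\<in>Om \<inter> U. \<forall>z. norm (z - e) < \<eta> \<longrightarrow> (\<forall>t\<in>{0..r}. x + t *\<^sub>R z \<in> Om))"
  using lipschitz_boundary_cone[OF assms] by (elim exE conjE) (rule that)
 define k where "k = measure lborel (ball (0::'a) (\<eta>/2))"
 have kk: "measure lborel (ball (a::'a) (\<eta>/2)) = k" for a
  unfolding k_def using \<eta> by (simp add: content_ball)
 have k0: "k > 0" unfolding k_def using \<eta> by (simp add: content_ball)
 define c where "c = 2 / (k * kc TYPE('a)) + 2 * measure lborel Om / k^2 + 1"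
 have kcp: "kc TYPE('a) > 0" by (rule kc_pos)
 have c: "c > 0" "2 / (k * kc TYPE('a)) \<le> c" "2 * measure lborel Om / k^2 \<le> c"
  unfolding c_def using k0 kcp by (auto intro!: add_nonneg_pos add_nonneg_nonneg)
 show ?thesis
 proof (rule that[of "real (card I) * c + 1" r])
  show "real (card I) * c + 1 > 0" using c by (intro add_nonneg_pos) auto
  show "r > 0" by fact
  fix h :: real and N :: nat and v :: "'a => real"
  assume h: "h > 0" and N: "N \<ge> 1" and Nh: "real N * h \<le> r" and v: "bmon Om v"
  interpret jump Om h using op bd h by unfold_locales
  let ?Y = "(real N * h)^2 * energy v + ((LINT x|dm Om. \<bar>v x\<bar>) / (real N * h) ^ DIM('a))^2"
  have Y0: "?Y \<ge> 0" by (intro add_nonneg_nonneg mult_nonneg_nonneg energy_nonneg) auto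
  have patch: "(LINT x|dm (Om \<inter> fst i). (v x)^2) \<le> c * ?Y" if i: "i \<in> I" for i
  proof -
   obtain U e where ie: "i = (U, e)" by (cases i)
   have U: "open U" and e: "norm e = 1"
    and co: "\<And>x z t. x \<in> Om ==> x \<in> U ==> norm (z - e) < \<eta> ==> 0 \<le> t ==> t \<le> r ==> x + t *\<^sub>R z \<in> Om"
    using cone i ie by auto
   \<comment> \<open>The ball consists of halves of cone directions: \<open>2 *\<^sub>R z\<close>
     lies in the cone, while \<open>z\<close> itself has norm at most 1 and so belongs to the cube.
     The time travelled is halved accordingly.\<close>
   let ?K = "ball ((1/2) *\<^sub>R e) (\<eta>/2)"
   have Kc: "?K \<subseteq> cube"
   proof
    fix z assume "z \<in> ?K"
    then have "norm (z - (1/2) *\<^sub>R e) < 1/2" using \<eta> by (auto simp: dist_norm norm_minus_commute)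
    then have "norm z \<le> 1" using norm_triangle_sub[of z "(1/2) *\<^sub>R e"] e by simp
    then show "z \<in> cube" by (rule cube_ball)
   qed
   have "(LINT x|dm (Om \<inter> U). (v x)^2) \<le> 2 / (k * kc TYPE('a)) * (real N * h)^2 * energy v
     + 2 * measure lborel Om / k^2 * ((LINT x|dm Om. \<bar>v x\<bar>) / (real N * h) ^ DIM('a))^2"
   proof (rule nash_patch[OF v U _ Kc N _ kk[symmetric] k0])
    show "?K \<in> sets borel" by simp
    fix x z and j :: nat assume x: "x \<in> Om" "x \<in> U" and z: "z \<in> ?K" and j: "j \<le> N"
    have "norm ((2::real) *\<^sub>R (z - (1/2) *\<^sub>R e)) < \<eta>" using z by (simp add: dist_norm norm_minus_commute)
    then have zz: "norm (2 *\<^sub>R z - e) < \<eta>" by (simp add: scaleR_diff_right)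
    have "real j * h \<le> real N * h" using j h by (intro mult_right_mono) auto
    then have "real j * h / 2 \<le> r" using Nh mult_nonneg_nonneg[of "real j" h] h by linarith
    then have "x + (real j * h / 2) *\<^sub>R (2 *\<^sub>R z) \<in> Om" using h by (intro co x zz) auto
    then show "x + (real j * h) *\<^sub>R z \<in> Om" by simp
   qed
   also have "... \<le> c * (real N * h)^2 * energy v + c * ((LINT x|dm Om. \<bar>v x\<bar>) / (real N * h) ^ DIM('a))^2"
    by (intro add_mono mult_right_mono c energy_nonneg) auto
   finally show ?thesis unfolding ie by (simp add: algebra_simps)
  qed
  have v2: "bmon Om (\<lambda>x. (v x)^2)" by (intro bmon_intros v)
  have Ui: "Om \<inter> fst i \<in> sets borel" "bounded (Om \<inter> fst i)" if "i \<in> I" for i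
  proof -
   have "open (fst i)" using cone that by (cases i) auto
   then show "Om \<inter> fst i \<in> sets borel" using op by (intro borel_open open_Int)
   show "bounded (Om \<inter> fst i)" using bd by (rule bounded_subset) auto
  qed
  have ints: "integrable lborel (\<lambda>x. indicator (Om \<inter> fst i) x *\<^sub>R (v x)^2)" if "i \<in> I" for i
  proof -
   have "integrable (dm (Om \<inter> fst i)) (\<lambda>x. (v x)^2)"
    by (intro integrable_bmon Ui that bmon_subset[OF v2]) auto
   then show ?thesis using Ui[OF that] v2 by (subst (asm) integrable_dm_iff) (auto simp: bmon_def)
  qed
  have "(LINT x|dm Om. (v x)^2) = (LINT x|lborel. indicator Om x *\<^sub>R (v x)^2)"
   using v2 by (subst integral_dm) (auto simp: bmon_def)
  also have "... \<le> (LINT x|lborel. (\<Sum>i\<in>I. indicator (Om \<inter> fst i) x *\<^sub>R (v x)^2))"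
  proof (rule integral_mono)
   show "integrable lborel (\<lambda>x. indicator Om x *\<^sub>R (v x)^2)"
    using integrable_Om[OF v2] v2 by (subst (asm) integrable_dm_iff) (auto simp: bmon_def)
   show "integrable lborel (\<lambda>x. \<Sum>i\<in>I. indicator (Om \<inter> fst i) x *\<^sub>R (v x)^2)"
    by (intro lintegrable_sum ints)
   fix x
   show "indicator Om x *\<^sub>R (v x)^2 \<le> (\<Sum>i\<in>I. indicator (Om \<inter> fst i) x *\<^sub>R (v x)^2)"
   proof (cases "x \<in> Om")
    case True
    then obtain i where i: "i \<in> I" "x \<in> fst i" using I by auto
    have "(v x)^2 = indicator (Om \<inter> fst i) x *\<^sub>R (v x)^2" using True i by simp
    also have "... \<le> (\<Sum>i\<in>I. indicator (Om \<inter> fst i) x *\<^sub>R (v x)^2)"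
     by (rule member_le_sum[OF i(1)]) (auto intro: I)
    finally show ?thesis using True by simp
   qed (auto intro: sum_nonneg)
  qed
  also have "... = (\<Sum>i\<in>I. LINT x|lborel. indicator (Om \<inter> fst i) x *\<^sub>R (v x)^2)"
   by (rule lint_sum) (rule ints)
  also have "... = (\<Sum>i\<in>I. LINT x|dm (Om \<inter> fst i). (v x)^2)"
   by (intro sum.cong refl integral_dm[symmetric] Ui bmon_measurable[OF v2])
  also have "... \<le> real (card I) * (c * ?Y)" by (rule sum_bounded_above) (rule patch)
  also have "... \<le> (real (card I) * c + 1) * ?Y" using Y0 by (simp add: algebra_simps)
  finally show "(LINT x|dm Om. (v x)^2) \<le> (real (card I) * c + 1) * ?Y" .
 qed
qed

section \<open>The explicit iteration and the moving Gaussian weight\<close>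

context jump
begin

primrec it :: "real => real => (nat => 'a => 'a) => ('a => real) => nat => 'a => real" where
 "it e dt b f 0 = f"
| "it e dt b f (Suc n) = (\<lambda>x. it e dt b f n x + dt * gen e (b n) (it e dt b f n) x)"

lemma bmon_it:
 assumes f: "bmon Om f" and b: "\<And>n. bmon Om (b n)"
 shows "bmon Om (it e dt b f n)"
 by (induction n) (auto intro!: bmon_intros f bmon_gen b)

lemma it_nonneg:
 assumes f: "bmon Om f" and b: "\<And>n. bmon Om (b n)"
  and bd: "\<And>n x. x \<in> Om ==> norm (b n x) \<le> M" and hM: "h * (real DIM('a)) * M \<le> 2 * e"
  and fn: "\<And>x. x \<in> Om ==> 0 \<le> f x" and dt: "dt * (12 * e / h^2) \<le> 1" "dt \<ge> 0" and e: "e > 0"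
 shows "x \<in> Om ==> 0 \<le> it e dt b f n x"
proof (induction n arbitrary: x)
 case (Suc n)
 show ?case unfolding it.simps
  by (rule gen_positive[OF bmon_it[OF f b] b bd hM Suc.IH dt e Suc.prems]) auto
qed (use fn in auto)

lemma gadj_const: "gadj e b (\<lambda>_. c) x = 0"
 by (simp add: gadj_def)

lemma gadj_diff:
 assumes f: "bmon Om f" and g: "bmon Om g"
 shows "gadj e b f x - gadj e b g x = gadj e b (\<lambda>x. f x - g x) x"
proof -
 note i = integrable_JX bmon_intros bmon_X[OF f] bmon_X[OF g] bmon_JX_id
 have pt: "q * (r - s) - q * (t - u) = q * ((r - t) - (s - u))" for q r s t u :: real by algebra
 show ?thesis unfolding gadj_def right_diff_distrib[of "kc TYPE('a)", symmetric]
  by (subst lint_diff[symmetric], (intro i)+) (simp only: pt)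
qed

lemma gadj_positive:
 assumes f: "bmon Om f"
  and bd: "norm (b x) \<le> M" and hM: "h * (real DIM('a)) * M \<le> 2 * e"
  and fn: "\<And>x. x \<in> Om ==> 0 \<le> f x" and dt: "dt * (12 * e / h^2) \<le> 1" "dt \<ge> 0" and e: "e > 0" and x: "x \<in> Om"
 shows "0 \<le> f x + dt * gadj e b f x"
proof -
 have "- (12 * e / h^2 * f x) \<le> - (4 * e / h^2 * f x * (kc TYPE('a) * measure lborel (JX x)))"
  using mult_left_mono[OF measure_JX[of x], of "4 * e / h^2 * f x"] fn[OF x] e by simp
 also have "... = kc TYPE('a) * (LINT z|dm (JX x). - (4 * e / h^2 * f x))"
  by (simp add: measure_dm)
 also have "... \<le> gadj e b f x"
  unfolding gadj_def
 proof (intro mult_left_mono integral_JX_mono)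
  show "bmon (JX x) (\<lambda>z. - (4 * e / h^2 * f x))" by (intro bmon_intros)
  show "bmon (JX x) (\<lambda>z. (2 * e / h^2 - b x \<bullet> z / h) * (f (x + h *\<^sub>R z) - f x))"
   by (intro bmon_intros bmon_X[OF f] bmon_JX_id)
  fix z assume z: "z \<in> JX x"
  let ?y = "x + h *\<^sub>R z" and ?q = "2 * e / h^2 - b x \<bullet> z / h"
  have y: "?y \<in> Om" "z \<in> cube" using z by (auto simp: JX_def)
  have "0 \<le> ?q * f ?y" by (intro mult_nonneg_nonneg fn y rate_nonneg(1)[OF bd hM])
  moreover have "?q * f x \<le> 4 * e / h^2 * f x" by (intro mult_right_mono fn x rate_nonneg(3)[OF bd hM] y)
  ultimately show "- (4 * e / h^2 * f x) \<le> ?q * (f ?y - f x)"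
   unfolding right_diff_distrib by linarith
 qed (auto intro: less_imp_le kc_pos)
 finally have "dt * - (12 * e / h^2 * f x) \<le> dt * gadj e b f x" using dt by (intro mult_left_mono)
 moreover have "(dt * (12 * e / h^2)) * f x \<le> 1 * f x" using dt fn[OF x] by (intro mult_right_mono)
 ultimately show ?thesis by (simp add: mult_ac)
qed

text \<open>Comparison principle for one step. It allows a truncated weight to be replaced by a
  larger and simpler function: the constant at saturation, or the untruncated Gaussian.\<close>

lemma gadj_mono:
 assumes f: "bmon Om f" and g: "bmon Om g"
  and bd: "norm (b x) \<le> M" and hM: "h * (real DIM('a)) * M \<le> 2 * e"
  and fg: "\<And>x. x \<in> Om ==> f x \<le> g x" and dt: "dt * (12 * e / h^2) \<le> 1" "dt \<ge> 0" and e: "e > 0" and x: "x \<in> Om"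
 shows "f x + dt * gadj e b f x \<le> g x + dt * gadj e b g x"
proof -
 have "0 \<le> (g x - f x) + dt * gadj e b (\<lambda>x. g x - f x) x"
  by (rule gadj_positive[where b=b and x=x, OF bmon_diff[OF g f] bd hM _ dt e x]) (use fg in auto)
 then show ?thesis unfolding gadj_diff[OF g f, symmetric] by (simp add: algebra_simps)
qed

text \<open>Duality: \<open>gen_adjoint\<close> transfers the step to the weight, and the hypothesis
  \<open>step\<close> makes \<open>w\<close> a discrete supersolution of the dual equation up to the
  factor \<open>exp (K * dt)\<close>. Nonnegativity of the iterates turns the pointwise inequality
  into one for integrals.\<close>

lemma it_L1:
 assumes f: "bmon Om f" and b: "\<And>n. bmon Om (b n)"
  and nn: "\<And>n x. x \<in> Om ==> 0 \<le> it e dt b f n x"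
  and w: "\<And>n. bmon Om (w n)"
  and step: "\<And>n x. n < N ==> x \<in> Om ==> w (Suc n) x + dt * gadj e (b n) (w (Suc n)) x \<le> exp (K * dt) * w n x"
 shows "n \<le> N ==> (LINT x|dm Om. it e dt b f n x * w n x) \<le> exp (K * dt * real n) * (LINT x|dm Om. f x * w 0 x)"
proof (induction n)
 case (Suc n)
 let ?u = "it e dt b f n"
 have bu: "bmon Om ?u" by (rule bmon_it[OF f b])
 have "(LINT x|dm Om. it e dt b f (Suc n) x * w (Suc n) x) = (LINT x|dm Om. w (Suc n) x * (?u x + dt * gen e (b n) ?u x))"
  by (simp add: mult.commute)
 also have "... = (LINT x|dm Om. ?u x * (w (Suc n) x + dt * gadj e (b n) (w (Suc n)) x))"
  by (rule gen_adjoint[OF bu b w])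
 also have "... \<le> (LINT x|dm Om. exp (K * dt) * (?u x * w n x))"
 proof (rule integral_Om_mono)
  show "bmon Om (\<lambda>x. ?u x * (w (Suc n) x + dt * gadj e (b n) (w (Suc n)) x))"
   by (intro bmon_intros bu w bmon_gadj b)
  show "bmon Om (\<lambda>x. exp (K * dt) * (?u x * w n x))" by (intro bmon_mult bmon_const bu w)
  fix x assume x: "x \<in> Om"
  show "?u x * (w (Suc n) x + dt * gadj e (b n) (w (Suc n)) x) \<le> exp (K * dt) * (?u x * w n x)"
   using mult_left_mono[OF step[OF _ x] nn[OF x, of n], of n] Suc.prems by (simp add: mult_ac)
 qed
 also have "... = exp (K * dt) * (LINT x|dm Om. ?u x * w n x)" by simp
 also have "... \<le> exp (K * dt) * (exp (K * dt * real n) * (LINT x|dm Om. f x * w 0 x))"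
  using Suc by (intro mult_left_mono) auto
 also have "... = exp (K * dt * real (Suc n)) * (LINT x|dm Om. f x * w 0 x)"
  by (simp add: algebra_simps exp_add)
 finally show ?case .
qed simp

text \<open>A jump along \<open>z\<close> changes the exponent by \<open>u z\<close>, and
  \<open>exp (u z) - 1 \<le> u z + (u z)^2\<close>. Since the full cube is admissible at
  \<open>x\<close>, the odd part \<open>o1\<close> integrates to 0 and the even part is given by the
  second moments; a cut cube would leave a term of order \<open>1 / h\<close>.\<close>

lemma gadj_gaussian:
 fixes b :: "'a => 'a" and g :: 'a
 defines "c x \<equiv> x - g"
 assumes inner: "\<And>z. z \<in> cube ==> x + h *\<^sub>R z \<in> Om" 
  and bd: "norm (b x) \<le> M" and hM: "h * (real DIM('a)) * M \<le> 2 * e" and e: "e > 0" and a: "a > 0"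
  and small: "a * (2 * h * norm (c x) * real DIM('a) + h^2 * (real DIM('a))^2) \<le> 1"
  and W: "W = (\<lambda>y. exp (a * (norm (c y))^2))"
 shows "gadj e b W x \<le> W x * (a * (6 * e * (real DIM('a))^2 - 2 * (b x \<bullet> c x)) + e * a^2 * (32 * (norm (c x))^2 + 24 * h^2 * (real DIM('a))^4))"
proof -
 let ?D = "real DIM('a)" and ?K = "kc TYPE('a)"
 have JX: "JX x = cube" using inner by (auto simp: JX_def)
 define u where "u z = a * (2 * h * (c x \<bullet> z) + h^2 * (norm z)^2)" for z
 define q where "q z = 2 * e / h^2 - (b x \<bullet> z) / h" for z
 have Wy: "W (x + h *\<^sub>R z) = W x * exp (u z)" for z
 proof -
  have "(norm (c (x + h *\<^sub>R z)))^2 = (norm (c x))^2 + (2 * h * (c x \<bullet> z) + h^2 * (norm z)^2)"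
   unfolding c_def power2_norm_eq_inner
   by (simp add: algebra_simps inner_add_left inner_add_right inner_diff_left inner_diff_right inner_commute power2_eq_square)
  then show ?thesis unfolding W u_def exp_add[symmetric] by (simp add: algebra_simps)
 qed
 have bu: "bmon cube u" and bq: "bmon cube q"
  unfolding u_def[abs_def] q_def[abs_def] by (intro bmon_intros bmon_cube)+
 define P where "P z = q z * u z + e * a^2 * (32 * ((c x \<bullet> z) * (c x \<bullet> z)) + 8 * h^2 * ?D^4)" for z
 have bP: "bmon cube P" unfolding P_def[abs_def] by (intro bmon_intros bmon_cube bu bq)
 have pw: "q z * (exp (u z) - 1) \<le> P z" if z: "z \<in> cube" for z
 proof -
  have nz: "norm z \<le> ?D" by (rule cube_norm[OF z])
  have cz: "\<bar>c x \<bullet> z\<bar> \<le> norm (c x) * ?D"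
   using order_trans[OF Cauchy_Schwarz_ineq2 mult_left_mono[OF nz norm_ge_zero]] .
  have nz2: "(norm z)^2 \<le> ?D^2" using nz by (intro power_mono) auto
  have "u z \<le> a * (2 * h * (norm (c x) * ?D) + h^2 * ?D^2)"
   unfolding u_def using a h_pos cz nz2 by (intro mult_left_mono add_mono) auto
  then have u1: "u z \<le> 1" using small by (simp add: mult_ac)
  have q: "0 \<le> q z" "q z \<le> 4 * e / h^2" unfolding q_def using rate_nonneg(1,3)[OF bd hM z] by auto
  have "q z * (exp (u z) - 1) \<le> q z * (u z + (u z)^2)"
   using exp_le_quadratic[OF u1] q by (intro mult_left_mono) auto
  also have "... \<le> q z * u z + 4 * e / h^2 * (u z)^2"
   using mult_right_mono[OF q(2), of "(u z)^2"] unfolding distrib_left by simp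
  also have "4 * e / h^2 * (u z)^2 \<le> 4 * e / h^2 * (a^2 * (2 * (2 * h * (c x \<bullet> z))^2 + 2 * (h^2 * ?D^2)^2))"
  proof (intro mult_left_mono)
   have "(u z)^2 = a^2 * (2 * h * (c x \<bullet> z) + h^2 * (norm z)^2)^2" by (simp add: u_def power_mult_distrib)
   also have "... \<le> a^2 * (2 * (2 * h * (c x \<bullet> z))^2 + 2 * (h^2 * (norm z)^2)^2)"
    by (intro mult_left_mono sum_power2_le) auto
   also have "... \<le> a^2 * (2 * (2 * h * (c x \<bullet> z))^2 + 2 * (h^2 * ?D^2)^2)"
    using nz2 by (intro mult_left_mono add_left_mono power_mono) auto
   finally show "(u z)^2 \<le> a^2 * (2 * (2 * h * (c x \<bullet> z))^2 + 2 * (h^2 * ?D^2)^2)" .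
  qed (use e in auto)
  also have "4 * e / h^2 * (a^2 * (2 * (2 * h * (c x \<bullet> z))^2 + 2 * (h^2 * ?D^2)^2)) = e * a^2 * (32 * ((c x \<bullet> z) * (c x \<bullet> z)) + 8 * h^2 * ?D^4)"
   using h_pos by (simp add: field_simps power2_eq_square power4_eq_xxxx)
  finally show ?thesis unfolding P_def by simp
 qed
 have "gadj e b W x = W x * (?K * (LINT z|dm cube. q z * (exp (u z) - 1)))"
  unfolding gadj_def JX Wy q_def[symmetric]
 proof -
  have "q z * (W x * exp (u z) - W x) = W x * (q z * (exp (u z) - 1))" for z by (simp add: algebra_simps)
  then show "?K * (LINT z|dm cube. q z * (W x * exp (u z) - W x)) = W x * (?K * (LINT z|dm cube. q z * (exp (u z) - 1)))"
   by (simp only: integral_mult_right_zero) (simp only: mult.left_commute)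
 qed
 also have "... \<le> W x * (?K * (LINT z|dm cube. P z))"
 proof (intro mult_left_mono)
  show "(LINT z|dm cube. q z * (exp (u z) - 1)) \<le> (LINT z|dm cube. P z)"
   by (intro integral_mono_AE AE_dmI pw integrable_cube bmon_intros bu bq bP) auto
 qed (auto simp: W intro: less_imp_le kc_pos)
 also have "?K * (LINT z|dm cube. P z) \<le> a * (6 * e * ?D^2 - 2 * (b x \<bullet> c x)) + e * a^2 * (32 * (norm (c x))^2 + 24 * h^2 * ?D^4)"
 proof -
  note i = integrable_cube bmon_intros bmon_cube
  define o1 where "o1 z = a * (4 * e / h) * (c x \<bullet> z) - a * h * ((b x \<bullet> z) * (norm z)^2)" for z
  have o1: "(LINT z|dm cube. o1 z) = 0"
   by (rule cube_odd) (auto simp: o1_def[abs_def])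
  have Pe: "P z = o1 z + (a * 2 * e) * (norm z)^2 - (2 * a) * ((b x \<bullet> z) * (c x \<bullet> z)) + (e * a^2 * 32) * ((c x \<bullet> z) * (c x \<bullet> z)) + e * a^2 * (8 * h^2 * ?D^4)" for z
   unfolding P_def o1_def q_def u_def using h_pos by (simp add: field_simps power2_eq_square)
  have bo: "bmon cube o1" unfolding o1_def[abs_def] by (intro bmon_intros bmon_cube)
  have "(LINT z|dm cube. P z) = (LINT z|dm cube. o1 z) + (a * 2 * e) * (LINT z|dm (cube::'a set). (norm z)^2)
    - (2 * a) * (LINT z|dm cube. (b x \<bullet> z) * (c x \<bullet> z)) + (e * a^2 * 32) * (LINT z|dm cube. (c x \<bullet> z) * (c x \<bullet> z))
    + e * a^2 * (8 * h^2 * ?D^4) * measure lborel (cube :: 'a set)"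
   unfolding Pe
   apply (subst lint_add, (intro i bo)+)
   apply (subst lint_add, (intro i bo)+)
   apply (subst lint_diff, (intro i bo)+)
   apply (subst lint_add, (intro i bo)+)
   by (simp add: measure_dm)
  then have "?K * (LINT z|dm cube. P z) = (a * 2 * e) * (?K * (LINT z|dm (cube::'a set). (norm z)^2))
    - (2 * a) * (?K * (LINT z|dm cube. (b x \<bullet> z) * (c x \<bullet> z))) + (e * a^2 * 32) * (?K * (LINT z|dm cube. (c x \<bullet> z) * (c x \<bullet> z)))
    + e * a^2 * (8 * h^2 * ?D^4) * (?K * measure lborel (cube :: 'a set))"
   unfolding o1 by (simp only:) (simp add: algebra_simps)
  also have "... = (a * 2 * e) * (?K * (LINT z|dm (cube::'a set). (norm z)^2)) - (2 * a) * (b x \<bullet> c x) + (e * a^2 * 32) * (c x \<bullet> c x) + e * a^2 * (8 * h^2 * ?D^4) * 3"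
   by (simp only: cube_moment kc_cube)
  also have "?K * (LINT z|dm (cube::'a set). (norm z)^2) \<le> ?K * (LINT z|dm (cube::'a set). ?D^2)"
   using kc_pos[where 'a='a]
   by (intro mult_left_mono integral_mono_AE AE_dmI i) (auto intro!: power_mono cube_norm)
  also have "... = 3 * ?D^2" using kc_cube[where 'a='a] by (simp add: measure_dm mult_ac)
  finally show ?thesis using a e by (simp add: power2_norm_eq_inner algebra_simps)
 qed
 finally show ?thesis by (simp add: W)
qed

text \<open>Saturated points are compared with the constant \<open>exp s\<close>, which
  \<open>gadj\<close> annihilates. At all other points no jump leaves the domain and the Gaussian
  computation applies. There the relative growth \<open>2 * M + 1\<close> of \<open>a\<close> over
  \<open>a'\<close> absorbs two terms: \<open>2 * M\<close> cancels the Lipschitz mismatch between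
  the drift at \<open>x\<close> and the velocity of the centre, and 1 cancels the quadratic term
  because \<open>32 * e * a' \<le> 1\<close>. The remaining rate is free of
  \<open>e\<close>.\<close>

lemma weight_step:
 fixes b :: "'a => 'a" and g g' \<beta> :: 'a
 assumes bd: "\<And>y. y \<in> Om ==> norm (b y) \<le> M" and blip: "\<And>y. y \<in> Om ==> norm (b y - b g) \<le> M * norm (y - g)"
  and g: "g' = g - dt *\<^sub>R \<beta>" and be: "norm \<beta> \<le> M" "norm (\<beta> - b g) \<le> M^2 * dt"
  and e: "e > 0" "e \<le> 1" and M: "M \<ge> 0" and a': "a' > 0" "32 * e * a' \<le> 1" and aa: "a \<ge> a' * (1 + (2 * M + 1) * dt)"
  and hM: "h * (real DIM('a)) * M \<le> 2 * e" and dt: "dt * (12 * e / h^2) \<le> 1" "dt \<ge> 0"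
  and inner: "\<And>y z. y \<in> Om ==> a * (norm (y - g))^2 \<le> s ==> z \<in> cube ==> y + h *\<^sub>R z \<in> Om"
  and R: "\<And>y. y \<in> Om ==> norm (y - g') \<le> R" 
  and small: "a' * (2 * h * R * real DIM('a) + h^2 * (real DIM('a))^2) \<le> 1" "a' * h^2 * (real DIM('a))^4 \<le> 1"
   "a' * (dt * R * (4 * M^2 + 2 * (2 * M + 1) * M)) \<le> 1"
  and x: "x \<in> Om"
 defines "w \<equiv> \<lambda>y. exp (min (a * (norm (y - g))^2) s)" and "w' \<equiv> \<lambda>y. exp (min (a' * (norm (y - g'))^2) s)"
 shows "w' x + dt * gadj e b w' x \<le> exp (((real DIM('a))^2 + 2) * dt) * w x"
proof -
 let ?D = "real DIM('a)"
 have bi: "bmon Om (\<lambda>y. y)" by (rule bmon_ident[OF bounded_Om])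
 have bw': "bmon Om w'" unfolding w'_def by (intro bmon_intros bi)
 show ?thesis
 \<comment> \<open>The split uses the weight \<open>w\<close> on the right-hand side: where that one
   is saturated, its value \<open>exp s\<close> already bounds \<open>w'\<close> everywhere.\<close>
 proof (cases "a * (norm (x - g))^2 \<le> s")
  case False
  have "w' x + dt * gadj e b w' x \<le> exp s + dt * gadj e b (\<lambda>_. exp s) x"
   by (rule gadj_mono[where b=b and x=x, OF bw' bmon_const bd[OF x] hM _ dt e(1) x]) (auto simp: w'_def)
  also have "... = w x" using False by (simp add: gadj_const w_def)
  also have "... \<le> exp ((?D^2 + 2) * dt) * w x"
   using mult_right_mono[of 1 "exp ((?D^2 + 2) * dt)" "w x"] dt by (simp add: w_def)
  finally show ?thesis .
 next
  case True
  define W where "W y = exp (a' * (norm (y - g'))^2)" for y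
  have bW: "bmon Om W" unfolding W_def[abs_def] by (intro bmon_intros bi)
  define c where "c = x - g'"
  have cR: "norm c \<le> R" unfolding c_def by (rule R[OF x])
  have xg: "x - g = c - dt *\<^sub>R \<beta>" by (simp add: c_def g)
  have "w' x + dt * gadj e b w' x \<le> W x + dt * gadj e b W x"
   by (rule gadj_mono[where b=b and x=x, OF bw' bW bd[OF x] hM _ dt e(1) x]) (auto simp: w'_def W_def)
  also have "... \<le> W x + dt * (W x * (a' * (6 * e * ?D^2 - 2 * (b x \<bullet> c)) + e * a'^2 * (32 * (norm c)^2 + 24 * h^2 * ?D^4)))"
  proof (intro add_left_mono mult_left_mono)
   show "gadj e b W x \<le> W x * (a' * (6 * e * ?D^2 - 2 * (b x \<bullet> c)) + e * a'^2 * (32 * (norm c)^2 + 24 * h^2 * ?D^4))"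
    unfolding c_def
   proof (rule gadj_gaussian[where b=b and x=x and g=g', OF inner[OF x True] bd[OF x] hM e(1) a'(1)])
    have "a' * (2 * h * norm (x - g') * ?D + h^2 * ?D^2) \<le> a' * (2 * h * R * ?D + h^2 * ?D^2)"
     using a' h_pos R[OF x] by (intro mult_left_mono add_right_mono mult_right_mono) auto
    then show "a' * (2 * h * norm (x - g') * ?D + h^2 * ?D^2) \<le> 1" using small(1) by linarith
   qed (auto simp: W_def)
  qed (rule dt)
  also have "... = W x * (1 + dt * (a' * (6 * e * ?D^2 - 2 * (b x \<bullet> c)) + e * a'^2 * (32 * (norm c)^2 + 24 * h^2 * ?D^4)))"
   (is "_ = W x * (1 + dt * ?G)") by (simp add: algebra_simps)
  also have "... \<le> W x * exp (dt * ?G)" using exp_ge_add_one_self[of "dt * ?G"] by (intro mult_left_mono) (auto simp: W_def)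
  also have "... = exp (a' * (norm c)^2 + dt * ?G)" by (simp add: W_def c_def exp_add)
  also have "... \<le> exp ((?D^2 + 2) * dt + a * (norm (x - g))^2)"
  proof (rule exp_le_cancel_iff[THEN iffD2])
   define k where "k = 2 * M + 1"
   have n1: "(norm (x - g))^2 \<ge> (norm c)^2 - 2 * dt * (\<beta> \<bullet> c)"
   proof -
    have "(norm (x - g))^2 = (norm c)^2 - 2 * dt * (\<beta> \<bullet> c) + dt^2 * (norm \<beta>)^2"
     unfolding xg power2_norm_eq_inner
     by (simp add: inner_diff_left inner_diff_right inner_commute power2_eq_square algebra_simps)
    moreover have "dt^2 * (norm \<beta>)^2 \<ge> 0" by simp
    ultimately show ?thesis by linarith
   qed
   have k: "k \<ge> 1" using M by (simp add: k_def)
   have "a * (norm (x - g))^2 \<ge> a' * (1 + k * dt) * (norm (x - g))^2"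
    using aa unfolding k_def by (intro mult_right_mono) auto
   moreover have "a' * (1 + k * dt) * (norm (x - g))^2 \<ge> a' * (1 + k * dt) * ((norm c)^2 - 2 * dt * (\<beta> \<bullet> c))"
    using n1 a' k dt by (intro mult_left_mono) auto
   ultimately have A1: "a * (norm (x - g))^2 \<ge> a' * (1 + k * dt) * ((norm c)^2 - 2 * dt * (\<beta> \<bullet> c))" by linarith
   have nx: "norm (x - g) \<le> norm c + dt * M"
    unfolding xg using norm_triangle_ineq4[of c "dt *\<^sub>R \<beta>"] mult_left_mono[OF be(1) dt(2)] dt(2) by simp
   have "norm (\<beta> - b x) \<le> norm (\<beta> - b g) + norm (b x - b g)"
    using norm_triangle_ineq4[of "\<beta> - b g" "b x - b g"] by simp
   also have "... \<le> M^2 * dt + M * (norm c + dt * M)"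
    using be(2) order_trans[OF blip[OF x] mult_left_mono[OF nx M]] by linarith
   finally have bb: "norm (\<beta> - b x) \<le> 2 * M^2 * dt + M * norm c" by (simp add: algebra_simps power2_eq_square)
   have "2 * (\<beta> \<bullet> c) - 2 * (b x \<bullet> c) = 2 * ((\<beta> - b x) \<bullet> c)" by (simp add: inner_diff_left)
   also have "... \<le> 2 * (norm (\<beta> - b x) * norm c)" using norm_cauchy_schwarz by (intro mult_left_mono) auto
   also have "... \<le> 2 * ((2 * M^2 * dt + M * norm c) * norm c)" using bb by (intro mult_left_mono mult_right_mono) auto
   finally have B1: "2 * (\<beta> \<bullet> c) - 2 * (b x \<bullet> c) \<le> 4 * M^2 * dt * norm c + 2 * M * (norm c)^2"
    by (simp add: algebra_simps power2_eq_square)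
   have B2: "\<beta> \<bullet> c \<le> M * norm c" using order_trans[OF norm_cauchy_schwarz mult_right_mono[OF be(1) norm_ge_zero]] .
   have tr: "dt * norm c \<le> dt * R" using cR dt by (intro mult_left_mono)
   have "?G + a' * (2 * (\<beta> \<bullet> c)) - a' * k * (norm c)^2 + 2 * a' * k * dt * (\<beta> \<bullet> c)
     = a' * 6 * e * ?D^2 + a' * (2 * (\<beta> \<bullet> c) - 2 * (b x \<bullet> c)) + (32 * e * a') * (a' * (norm c)^2) + 24 * (e * a') * (a' * h^2 * ?D^4)
      - a' * k * (norm c)^2 + 2 * a' * k * dt * (\<beta> \<bullet> c)" by (simp add: algebra_simps power2_eq_square)
   also have "... \<le> ?D^2 + a' * (4 * M^2 * dt * norm c + 2 * M * (norm c)^2) + 1 * (a' * (norm c)^2) + 1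
      - a' * k * (norm c)^2 + 2 * a' * k * dt * (M * norm c)"
   proof -
    have "a' * 6 * e * ?D^2 \<le> 1 * ?D^2"
    proof (rule mult_right_mono)
     show "a' * 6 * e \<le> 1" using a' e mult_pos_pos[OF e(1) a'(1)] by (simp add: mult_ac)
    qed simp
    moreover have "a' * (2 * (\<beta> \<bullet> c) - 2 * (b x \<bullet> c)) \<le> a' * (4 * M^2 * dt * norm c + 2 * M * (norm c)^2)"
     using B1 a' by (intro mult_left_mono) auto
    moreover have "(32 * e * a') * (a' * (norm c)^2) \<le> 1 * (a' * (norm c)^2)" using a' by (intro mult_right_mono) auto
    moreover have "24 * (e * a') * (a' * h^2 * ?D^4) \<le> 1 * 1"
     using a' e small(2) by (intro mult_mono) auto
    moreover have "2 * a' * k * dt * (\<beta> \<bullet> c) \<le> 2 * a' * k * dt * (M * norm c)" using B2 a' k dt by (intro mult_left_mono) auto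
    ultimately show ?thesis by linarith
   qed
   also have "... = ?D^2 + 1 + a' * ((dt * norm c) * (4 * M^2 + 2 * k * M))"
    unfolding k_def by (simp add: algebra_simps power2_eq_square)
   also have "... \<le> ?D^2 + 1 + a' * (dt * R * (4 * M^2 + 2 * k * M))"
    using tr cR dt a' k M by (intro add_left_mono mult_left_mono mult_right_mono) auto
   also have "... \<le> ?D^2 + 2" using small(3) by (simp add: k_def)
   finally have "dt * (?G + a' * (2 * (\<beta> \<bullet> c)) - a' * k * (norm c)^2 + 2 * a' * k * dt * (\<beta> \<bullet> c)) \<le> dt * (?D^2 + 2)"
    using dt by (intro mult_left_mono)
   moreover have "a' * (norm c)^2 + dt * ?G - a' * (1 + k * dt) * ((norm c)^2 - 2 * dt * (\<beta> \<bullet> c))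
    = dt * (?G + a' * (2 * (\<beta> \<bullet> c)) - a' * k * (norm c)^2 + 2 * a' * k * dt * (\<beta> \<bullet> c))"
    by (simp add: algebra_simps power2_eq_square)
   ultimately show "a' * (norm c)^2 + dt * ?G \<le> (?D^2 + 2) * dt + a * (norm (x - g))^2"
    using A1 by (simp only: mult.commute[of dt "?D^2 + 2"])
  qed
  also have "... = exp ((?D^2 + 2) * dt) * w x" using True by (simp add: w_def exp_add)
  finally show ?thesis .
 qed
qed

end

lemma exp_le_linear: assumes "0 \<le> y" "y \<le> (1::real)" shows "exp y \<le> 1 + 2 * y"
proof -
 have "y^2 \<le> y" using assms by (simp add: power2_eq_square mult_left_le)
 then show ?thesis using exp_le_quadratic[OF assms(2)] by linarith
qed

section \<open>The drift and its trajectory\<close>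

text \<open>The drift is taken globally Borel and zero outside the time interval, which an extension
  by zero achieves; \<open>adjoint_weak_solution_cong\<close> returns to the original drift at the
  end.\<close>

locale drift =
 fixes Om :: "'a::euclidean_space set" and T :: real and B :: "real => 'a => 'a" and M :: real
 assumes open_dom: "open Om" and bounded_dom: "bounded Om" and T_pos: "T > 0" and M_ge1: "M \<ge> 1"
  and B_measurable: "(\<lambda>z. ev B z) \<in> borel_measurable borel"
  and B_bound: "\<And>t x. norm (B t x) \<le> M"
  and B_lip: "\<And>t x y. x \<in> Om ==> y \<in> Om ==> norm (B t x - B t y) \<le> M * norm (x - y)"
  and B_zero: "\<And>t x. t \<notin> {0<..<T} ==> B t x = 0"
begin

text \<open>Slots are numbered backwards from the final time \<open>T\<close>, at which the scheme starts.\<close>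

definition slot :: "real => nat => real set" where
 "slot dt n = {T - real (Suc n) * dt <..< T - real n * dt}"

text \<open>Averaged over a slot rather than sampled, because the drift is only measurable in time.
  The average also makes the drift term exact when a test function frozen in time is integrated over
  the slot (\<open>slot_average\<close>).\<close>

definition bav :: "real => nat => 'a => 'a" where
 "bav dt n x = (1 / dt) *\<^sub>R (LINT s|dm (slot dt n). B s x)"

lemma slot_sets [simp]: "slot dt n \<in> sets borel" "bounded (slot dt n)"
 by (simp_all add: slot_def flip: box_real)

lemma measure_slot: "dt > 0 ==> measure lborel (slot dt n) = dt"
 by (simp add: slot_def algebra_simps)

lemma B_section_measurable: "(\<lambda>s. B s x) \<in> borel_measurable borel"
proof -
 have "(\<lambda>s. (x, s)) \<in> borel_measurable borel" by (intro borel_measurable_continuous_onI continuous_intros)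
 from measurable_compose[OF this B_measurable] show ?thesis by simp
qed

lemma integrable_slot: "integrable (dm (slot dt n)) (\<lambda>s. B s x)"
 by (intro integrable_bmon slot_sets bmonI[of _ _ M] B_section_measurable B_bound)

lemma norm_integral_slot:
 fixes f :: "real => 'b::euclidean_space"
 assumes t: "dt > 0" and f: "integrable (dm (slot dt n)) f" and C: "\<And>s. s \<in> slot dt n ==> norm (f s) \<le> C"
 shows "norm (LINT s|dm (slot dt n). f s) \<le> dt * C"
proof -
 have "norm (LINT s|dm (slot dt n). f s) \<le> (LINT s|dm (slot dt n). norm (f s))" by (rule integral_norm_bound)
 also have "... \<le> (LINT s|dm (slot dt n). C)"
  by (intro integral_mono_AE AE_dmI slot_sets C integrable_norm f integrable_bmon bmon_const)
 finally show ?thesis using t by (simp add: measure_dm measure_slot)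
qed

lemma bav_bound: "dt > 0 ==> norm (bav dt n x) \<le> M"
 using norm_integral_slot[OF _ integrable_slot B_bound, of dt n x] by (simp add: bav_def field_simps)

lemma bav_lip:
 assumes "dt > 0" "x \<in> Om" "y \<in> Om" shows "norm (bav dt n x - bav dt n y) \<le> M * norm (x - y)"
proof -
 have "bav dt n x - bav dt n y = (1 / dt) *\<^sub>R (LINT s|dm (slot dt n). B s x - B s y)"
  by (simp add: bav_def scaleR_diff_right[symmetric] lint_diff integrable_slot)
 also have "norm ... = (1 / dt) * norm (LINT s|dm (slot dt n). B s x - B s y)" using assms by simp
 also have "... \<le> (1 / dt) * (dt * (M * norm (x - y)))"
  using assms by (intro mult_left_mono norm_integral_slot lintegrable_diff integrable_slot B_lip) auto
 finally show ?thesis using assms by simp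
qed

lemma bav_measurable: "bav dt n \<in> borel_measurable borel"
proof -
 have "(\<lambda>(x, s). indicator (slot dt n) s *\<^sub>R B s x) \<in> borel_measurable (lborel \<Otimes>\<^sub>M lborel)"
  unfolding lborel_prod split_beta'
  using B_measurable snd_borel_measurable slot_sets(1)[of dt n] by measurable
 from lborel.borel_measurable_lebesgue_integral[OF this]
 show ?thesis unfolding bav_def[abs_def] by (simp add: integral_dm B_section_measurable)
qed

lemma bmon_bav: "dt > 0 ==> bmon Om (bav dt n)"
 by (rule bmonI[OF bav_measurable bav_bound])

lemma trajectory_increment:
 assumes tr: "backward_trajectory T B x0 \<gamma>" and st: "0 \<le> s" "s \<le> t" "t \<le> T"
 shows "(\<lambda>r. B r (\<gamma> r)) integrable_on {s..t}" "\<gamma> t - \<gamma> s = integral {s..t} (\<lambda>r. B r (\<gamma> r))"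
  "norm (\<gamma> t - \<gamma> s) \<le> M * (t - s)"
proof -
 have i: "(\<lambda>r. B r (\<gamma> r)) integrable_on {s..T}" and gs: "\<gamma> s = x0 - integral {s..T} (\<lambda>r. B r (\<gamma> r))"
  using tr st unfolding backward_trajectory_def by auto
 have gt: "\<gamma> t = x0 - integral {t..T} (\<lambda>r. B r (\<gamma> r))"
  using tr st unfolding backward_trajectory_def by auto
 show i2: "(\<lambda>r. B r (\<gamma> r)) integrable_on {s..t}"
  by (rule integrable_on_subinterval[OF i]) (use st in auto)
 have "integral {s..t} (\<lambda>r. B r (\<gamma> r)) + integral {t..T} (\<lambda>r. B r (\<gamma> r)) = integral {s..T} (\<lambda>r. B r (\<gamma> r))"
  by (rule Henstock_Kurzweil_Integration.integral_combine[OF st(2,3) i])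
 then show eq: "\<gamma> t - \<gamma> s = integral {s..t} (\<lambda>r. B r (\<gamma> r))" unfolding gs gt by (simp add: algebra_simps)
 show "norm (\<gamma> t - \<gamma> s) \<le> M * (t - s)" unfolding eq
  using has_integral_bound_real[OF _ finite.emptyI integrable_integral[OF i2], of M] B_bound M_ge1 st by auto
qed

text \<open>\<open>\<beta>\<close> is the mean velocity over the slot. It differs from the averaged
  drift at the later endpoint only because the trajectory moves by at most \<open>M * dt\<close>
  within the slot, which the Lipschitz bound turns into \<open>M^2 * dt\<close>.\<close>

lemma trajectory_step:
 assumes tr: "backward_trajectory T B x0 \<gamma>" and inOm: "\<And>t. t \<in> {0..T} ==> \<gamma> t \<in> Om"
  and dt: "dt > 0" and n: "real (Suc n) * dt \<le> T"
 shows "\<exists>\<beta>. \<gamma> (T - real (Suc n) * dt) = \<gamma> (T - real n * dt) - dt *\<^sub>R \<beta> \<and> norm \<beta> \<le> M \<and>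
   norm (\<beta> - bav dt n (\<gamma> (T - real n * dt))) \<le> M^2 * dt"
proof -
 define t s where "t = T - real n * dt" and "s = T - real (Suc n) * dt"
 have ts: "t - s = dt" "0 \<le> s" "s \<le> t" "t \<le> T" using dt n by (auto simp: t_def s_def algebra_simps)
 note inc = trajectory_increment[OF tr ts(2-4)]
 define \<beta> where "\<beta> = (1 / dt) *\<^sub>R (\<gamma> t - \<gamma> s)"
 have 1: "\<gamma> s = \<gamma> t - dt *\<^sub>R \<beta>" using dt by (simp add: \<beta>_def)
 have 2: "norm \<beta> \<le> M"
 proof -
  have "norm \<beta> = norm (\<gamma> t - \<gamma> s) / dt" using dt by (simp add: \<beta>_def)
  also have "... \<le> M * dt / dt" using inc(3) ts dt by (intro divide_right_mono) auto
  finally show ?thesis using dt by simp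
 qed
 have sl: "slot dt n = {s<..<t}" by (simp add: slot_def s_def t_def)
 have si: "set_integrable lborel {s<..<t} (\<lambda>r. B r (\<gamma> t))"
  using integrable_slot[of dt n "\<gamma> t"] B_section_measurable unfolding sl set_integrable_def
  by (subst (asm) integrable_dm_iff) auto
 have bi: "(LINT r|dm (slot dt n). B r (\<gamma> t)) = integral {s..t} (\<lambda>r. B r (\<gamma> t))"
  using set_borel_integral_eq_integral(2)[OF si] B_section_measurable
  by (simp add: sl integral_dm set_lebesgue_integral_def integral_open_interval_real)
 have i2: "(\<lambda>r. B r (\<gamma> t)) integrable_on {s..t}"
  using set_borel_integral_eq_integral(1)[OF si] by (simp add: integrable_on_Icc_iff_Ioo)
 have "\<beta> - bav dt n (\<gamma> t) = (1 / dt) *\<^sub>R integral {s..t} (\<lambda>r. B r (\<gamma> r) - B r (\<gamma> t))"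
  unfolding \<beta>_def bav_def bi inc(2)
  by (subst Henstock_Kurzweil_Integration.integral_diff[OF inc(1) i2]) (simp add: scaleR_diff_right)
 moreover have "norm (integral {s..t} (\<lambda>r. B r (\<gamma> r) - B r (\<gamma> t))) \<le> M * (M * dt) * (t - s)"
 proof -
  have "norm (B r (\<gamma> r) - B r (\<gamma> t)) \<le> M * (M * dt)" if r: "r \<in> {s..t}" for r
  proof -
   have rt: "norm (\<gamma> r - \<gamma> t) \<le> M * (t - r)" using trajectory_increment(3)[OF tr, of r t] r ts
    by (simp add: norm_minus_commute)
   have "norm (B r (\<gamma> r) - B r (\<gamma> t)) \<le> M * norm (\<gamma> r - \<gamma> t)"
    by (intro B_lip inOm) (use r ts in auto)
   also have "... \<le> M * (M * dt)" using rt r ts M_ge1 by (intro mult_left_mono) (auto intro: order_trans[OF rt] mult_left_mono)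
   finally show ?thesis .
  qed
  then show ?thesis
   using has_integral_bound_real[OF _ finite.emptyI integrable_integral[OF Henstock_Kurzweil_Integration.integrable_diff[OF inc(1) i2]], of "M * (M * dt)"] ts M_ge1 dt
   by auto
 qed
 ultimately have "norm (\<beta> - bav dt n (\<gamma> t)) \<le> (1 / dt) * (M * (M * dt) * dt)"
  using dt ts by (simp add: pos_divide_le_eq)
 also have "... = M^2 * dt" using dt by (simp add: power2_eq_square)
 finally show ?thesis using 1 2 unfolding t_def s_def by blast
qed

end

section \<open>Weighted decay of the scheme\<close>

context jump
begin

text \<open>The change of weight costs a factor \<open>exp (2 * y)\<close> with
  \<open>y = dt * (c / e)\<close> at most 1/2, after which \<open>step_weighted\<close> applies with
  the old weight. Slope \<open>L / e\<close> and speed \<open>c / e\<close> of the exponent make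
  every growth rate a multiple of \<open>1 / e\<close>.\<close>

lemma it_weighted_step:
 assumes u: "bmon Om u" and b: "bmon Om b" and th: "bmon Om th" and th': "bmon Om th'" and e: "e > 0" "e \<le> 1" and M: "M \<ge> 0"
  and bd: "\<And>x. x \<in> Om ==> norm (b x) \<le> M"
  and lip: "\<And>x y. x \<in> Om ==> y \<in> Om ==> \<bar>th x - th y\<bar> \<le> L / e * norm (x - y)"
  and hL: "h * (L / e) * (real DIM('a)) \<le> 1" and L0: "L \<ge> 0"
  and th0: "\<And>x. x \<in> Om ==> 0 \<le> th x" and thW: "\<And>x. x \<in> Om ==> th x \<le> W"
  and tht: "\<And>x. x \<in> Om ==> th' x \<le> th x + dt * (c / e)" and c0: "c \<ge> 0"
  and dt: "dt \<ge> 0" "dt * (exp W)^2 * crude e M \<le> 1" "2 * (dt * (c / e)) \<le> 1"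
  and C5: "C5 = 12 * (L^2 * (real DIM('a))^2 + M * L * (real DIM('a))^2) + 3 * M^2 * (real DIM('a))^2 + 1"
 shows "(LINT x|dm Om. ((u x + dt * gen e b u x) * exp (th' x))^2) \<le>
  (1 + dt * ((4 * c + 3 * C5) / e)) * (LINT x|dm Om. (u x * exp (th x))^2) - dt * e * energy (\<lambda>x. u x * exp (th x))"
proof -
 let ?D = "real DIM('a)"
 let ?u' = "\<lambda>x. u x + dt * gen e b u x" and ?V = "LINT x|dm Om. (u x * exp (th x))^2"
 let ?E = "energy (\<lambda>x. u x * exp (th x))"
 define y where "y = dt * (c / e)"
 have y: "0 \<le> y" "2 * y \<le> 1" using dt c0 e by (auto simp: y_def)
 have V0: "?V \<ge> 0" by (intro integral_Om_nonneg) auto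
 have C50: "C5 \<ge> 0" unfolding C5 using M L0 by auto
 have "(LINT x|dm Om. (?u' x * exp (th' x))^2) \<le> (LINT x|dm Om. exp (2 * y) * (?u' x * exp (th x))^2)"
 proof (rule integral_Om_mono)
  fix x assume x: "x \<in> Om"
  have "(exp (th' x))^2 \<le> (exp (th x + y))^2" using tht[OF x] by (intro power_mono) (auto simp: y_def)
  also have "... = exp (2 * y) * (exp (th x))^2" by (simp add: power2_eq_square flip: exp_add)
  finally have "(?u' x)^2 * (exp (th' x))^2 \<le> (?u' x)^2 * (exp (2 * y) * (exp (th x))^2)"
   by (intro mult_left_mono) auto
  then show "(?u' x * exp (th' x))^2 \<le> exp (2 * y) * (?u' x * exp (th x))^2"
   by (simp add: power_mult_distrib mult_ac)
 qed (intro bmon_intros u bmon_gen b th th')+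
 also have "... = exp (2 * y) * (LINT x|dm Om. (?u' x * exp (th x))^2)" by simp
 also have "... \<le> exp (2 * y) * ((1 + dt * (C5 / e)) * ?V - dt * e * ?E)"
 proof (rule mult_left_mono)
  have "(LINT x|dm Om. (?u' x * exp (th x))^2) \<le>
   (1 + dt * (12 * (e * (L / e)^2 * ?D^2 + M * (L / e) * ?D^2) + 3 * M^2 * ?D^2 / e + 1)) * ?V - dt * e * ?E"
   using L0 e by (intro step_weighted[OF u b th e(1) M bd lip hL _ th0 thW dt(1,2)]) auto
  also have "12 * (e * (L / e)^2 * ?D^2 + M * (L / e) * ?D^2) + 3 * M^2 * ?D^2 / e + 1
    \<le> 12 * (e * (L / e)^2 * ?D^2 + M * (L / e) * ?D^2) + 3 * M^2 * ?D^2 / e + 1 / e" using e by simp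
  also have "... = C5 / e" unfolding C5 using e by (simp add: field_simps power2_eq_square)
  finally show "(LINT x|dm Om. (?u' x * exp (th x))^2) \<le> (1 + dt * (C5 / e)) * ?V - dt * e * ?E"
   using V0 dt by (simp add: mult_left_mono mult_right_mono)
 qed simp
 also have "... \<le> (1 + 4 * y) * ((1 + dt * (C5 / e)) * ?V) - dt * e * ?E"
 proof -
  have "exp (2 * y) * ((1 + dt * (C5 / e)) * ?V) \<le> (1 + 4 * y) * ((1 + dt * (C5 / e)) * ?V)"
   using exp_le_linear[of "2 * y"] y dt C50 e V0 by (intro mult_right_mono) auto
  moreover have "1 * (dt * e * ?E) \<le> exp (2 * y) * (dt * e * ?E)"
   using y dt e energy_nonneg by (intro mult_right_mono) auto
  ultimately show ?thesis unfolding right_diff_distrib by linarith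
 qed
 also have "(1 + 4 * y) * ((1 + dt * (C5 / e)) * ?V) \<le> (1 + dt * ((4 * c + 3 * C5) / e)) * ?V"
 proof -
  have "(1 + 4 * y) * (dt * (C5 / e)) \<le> 3 * (dt * (C5 / e))" using y dt C50 e by (intro mult_right_mono) auto
  then have "(1 + 4 * y) * (1 + dt * (C5 / e)) \<le> 1 + dt * ((4 * c + 3 * C5) / e)"
   unfolding y_def by (simp add: algebra_simps add_divide_distrib)
  from mult_right_mono[OF this V0] show ?thesis by (simp only: mult.assoc)
 qed
 finally show ?thesis by simp
qed

end

context drift
begin

text \<open>The Nash scale \<open>\<kappa> * e\<close> has to be a whole number of jumps, hence the
  divisibility condition on \<open>h\<close>. The thresholds are nested, \<open>h\<close> after
  \<open>e\<close> and \<open>dt\<close> after \<open>h\<close>, since the bounds on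
  \<open>dt\<close> involve \<open>exp s\<close> and \<open>crude\<close>; the constants of the
  final bound are fixed before \<open>e\<close>.\<close>

lemma discrete_decay:
 assumes lb: "lipschitz_boundary Om"
  and tr: "backward_trajectory T B x0 \<gamma>" and inOm: "\<And>t. t \<in> {0..T} ==> ball (\<gamma> t) R \<subseteq> Om" and R: "R > 0"
  and f: "bmon Om f" and f0: "\<And>x. 0 \<le> f x" and supp: "\<And>x. f x \<noteq> 0 ==> exp ((2 * M + 1) * T) * (norm (x - x0))^2 \<le> R^2 / 16"
 obtains \<kappa> c C p where "\<kappa> > 0" "c > 0" "C > 0"
  "\<And>e. 0 < e ==> e \<le> 1 ==> \<exists>h0>0. \<forall>h. 0 < h \<and> h \<le> h0 \<and> (\<exists>k\<ge>1. real (k::nat) * h = \<kappa> * e) \<longrightarrow>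
    (\<exists>dt0>0. \<forall>dt N. 0 < dt \<and> dt \<le> dt0 \<and> real N * dt = T \<longrightarrow>
     (\<forall>n\<le>N. \<forall>A. A \<in> sets borel \<and> A \<subseteq> Om \<and> (\<forall>t\<in>{0..T}. \<forall>x\<in>A. R \<le> norm (x - \<gamma> t)) \<longrightarrow>
      (LINT x|dm A. (jump.it Om h e dt (bav dt) f n x)^2) \<le> C / e ^ p * exp (- c / e)))"
proof -
 let ?D = "real DIM('a)"
 have D1: "?D \<ge> 1" using DIM_positive[where 'a='a] by linarith
 have \<gamma>Om: "\<gamma> t \<in> Om" if "t \<in> {0..T}" for t using inOm[OF that] R by auto
 obtain \<Delta>0 where \<Delta>0: "\<And>x y. x \<in> Om ==> y \<in> Om ==> norm (x - y) \<le> \<Delta>0"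
  using bounded_dom unfolding bounded_two_points dist_norm by blast
 define \<Delta> where "\<Delta> = max \<Delta>0 1"
 have \<Delta>: "\<Delta> \<ge> 1" "\<And>x y. x \<in> Om ==> y \<in> Om ==> norm (x - y) \<le> \<Delta>"
  using \<Delta>0 by (auto simp: \<Delta>_def le_max_iff_disj)
 obtain CN r0 where CN: "CN > 0" "r0 > 0" and nash:
  "\<And>h N v. h > 0 ==> N \<ge> 1 ==> real N * h \<le> r0 ==> bmon Om v ==>
   (LINT x|dm Om. (v x)^2) \<le> CN * ((real N * h)^2 * jump.energy Om h v + ((LINT x|dm Om. \<bar>v x\<bar>) / (real N * h) ^ DIM('a))^2)"
  using nash_inequality[OF lb open_dom bounded_dom] by metis
 define k where "k = 2 * M + 1"
 have k: "k \<ge> 1" using M_ge1 by (simp add: k_def)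
 define E where "E = exp (k * T)"
 have E: "E \<ge> 1" using k T_pos by (simp add: E_def)
 \<comment> \<open>Ensures that \<open>a j\<close>, which is largest at time \<open>T\<close>, never
   exceeds \<open>1 / (32 * e)\<close>, as the quadratic term in \<open>weight_step\<close>
   requires.\<close>
 define \<delta> where "\<delta> = 1 / (32 * E)"
 have \<delta>: "\<delta> > 0" "\<delta> * E = 1/32" using E by (auto simp: \<delta>_def)
 \<comment> \<open>As \<open>a j \<ge> \<delta> / e\<close>, the unsaturated region lies within
   \<open>R / 2\<close> of the centre; jumps of length at most \<open>R / 4\<close> from there end
   inside the ball of radius \<open>R\<close>, and points at distance \<open>R\<close> or more are
   saturated.\<close>
 define s1 where "s1 = (R / 2)^2"
 have s1: "s1 > 0" using R by (simp add: s1_def)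
 \<comment> \<open>Lipschitz constant of the exponent times \<open>e\<close>: \<open>a j\<close> is
   at most \<open>1 / (32 * e)\<close>, and the squared distance to the centre has slope at most
   \<open>2 * \<Delta>\<close> on the domain. In the same way \<open>c4\<close> comes from the
   motion of the centre.\<close>
 define L where "L = \<Delta> / 16"
 define c4 where "c4 = M * (2 * \<Delta> + 1) / 32"
 have L0: "L \<ge> 0" and c40: "c4 \<ge> 0" using \<Delta>(1) M_ge1 by (auto simp: L_def c4_def)
 define C5 where "C5 = 12 * (L^2 * ?D^2 + M * L * ?D^2) + 3 * M^2 * ?D^2 + 1"
 have C51: "C5 \<ge> 1" using L0 M_ge1 by (simp add: C5_def)
 define C6 where "C6 = 4 * c4 + 3 * C5"
 have C6: "C6 > 0" using c40 C51 by (simp add: C6_def)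
 \<comment> \<open>The first entry keeps the scale within the range of the Nash inequality, as
   \<open>e \<le> 1\<close>; the second makes \<open>C6 / e\<close> at most
   \<open>e / (r^2 * CN)\<close> for \<open>r = \<kappa> * e\<close>.\<close>
 define \<kappa> where "\<kappa> = min r0 (1 / sqrt (C6 * CN))"
 have \<kappa>: "\<kappa> > 0" "\<kappa> \<le> r0" "\<kappa>^2 * (C6 * CN) \<le> 1"
 proof -
  show p: "\<kappa> > 0" "\<kappa> \<le> r0" using CN C6 by (auto simp: \<kappa>_def)
  have "\<kappa>^2 \<le> (1 / sqrt (C6 * CN))^2" using p by (intro power_mono) (auto simp: \<kappa>_def)
  also have "... = 1 / (C6 * CN)" using CN C6 by (simp add: power_divide)
  finally show "\<kappa>^2 * (C6 * CN) \<le> 1" using CN C6 by (simp add: field_simps)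
 qed
 define m0 where "m0 = (LINT x|dm Om. f x)"
 define F2 where "F2 = (LINT x|dm Om. (f x)^2)"
 define EE where "EE = exp ((?D^2 + 2) * T)"
 define C where "C = F2 + T * (EE * m0)^2 / \<kappa> ^ (2 * DIM('a) + 2) + 1"
 have F20: "F2 \<ge> 0" unfolding F2_def by (intro integral_nonneg_AE) auto
 have C0: "C > 0" unfolding C_def using F20 T_pos \<kappa> by (intro add_nonneg_pos add_nonneg_nonneg) auto
 \<comment> \<open>On \<open>A\<close> the squared weight is \<open>exp (2 * s)\<close>, while the
   squared weighted norm is at most \<open>exp (s / 2)\<close> times a power of
   \<open>1 / e\<close>; the exponents differ by \<open>3/2 * s\<close>.\<close>
 define c where "c = 3/2 * (\<delta> * s1)"
 have c0: "c > 0" using \<delta> s1 by (simp add: c_def)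
 show ?thesis
 proof (rule that[of \<kappa> c C "2 * DIM('a) + 2"])
  show "\<kappa> > 0" "c > 0" "C > 0" by fact+
  fix e :: real assume e: "0 < e" "e \<le> 1"
  \<comment> \<open>The smallness conditions below reduce to bounding \<open>h\<close> times a
    product of powers of \<open>\<Delta>\<close>, \<open>M\<close> and the dimension. All these
    factors are at least 1, so the largest product serves for every condition.\<close>
  define h0 where "h0 = min 1 R * e / (4 * \<Delta> * M * ?D^4)"
  have DD: "?D^4 \<ge> 1" "?D \<le> ?D^4" "?D^2 \<le> ?D^4"
   using D1 power_increasing[of 1 4 ?D] power_increasing[of 2 4 ?D] by (auto simp: one_le_power)
  have den: "4 * \<Delta> * M * ?D^4 > 0" using \<Delta>(1) M_ge1 DD by (intro mult_pos_pos) auto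
  have h00: "h0 > 0" unfolding h0_def using den e R \<Delta>(1) M_ge1 DD by (intro divide_pos_pos) auto
  show "\<exists>h0>0. \<forall>h. 0 < h \<and> h \<le> h0 \<and> (\<exists>k\<ge>1. real (k::nat) * h = \<kappa> * e) \<longrightarrow>
    (\<exists>dt0>0. \<forall>dt N. 0 < dt \<and> dt \<le> dt0 \<and> real N * dt = T \<longrightarrow>
     (\<forall>n\<le>N. \<forall>A. A \<in> sets borel \<and> A \<subseteq> Om \<and> (\<forall>t\<in>{0..T}. \<forall>x\<in>A. R \<le> norm (x - \<gamma> t)) \<longrightarrow>
      (LINT x|dm A. (jump.it Om h e dt (bav dt) f n x)^2) \<le> C / e ^ (2 * DIM('a) + 2) * exp (- c / e)))"
  proof (rule exI[of _ h0], intro conjI h00 allI impI, elim conjE exE)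
   fix h :: real and K :: nat assume h: "0 < h" "h \<le> h0" and K: "K \<ge> 1" "real K * h = \<kappa> * e"
   interpret jump Om h using open_dom bounded_dom h by unfold_locales
   have hden: "h * (4 * \<Delta> * M * ?D^4) \<le> min 1 R * e" using h(2) den by (simp add: h0_def pos_le_divide_eq)
   have big: "X \<le> \<Delta> * M * ?D^4" if "X \<le> A1 * (A2 * A3)" "A1 \<le> \<Delta>" "A2 \<le> M" "A3 \<le> ?D^4" "0 \<le> A1" "0 \<le> A2" "0 \<le> A3" for X A1 A2 A3
    using that(1) mult_mono[OF that(2) mult_mono[OF that(3,4)]] that \<Delta>(1) M_ge1 by (auto simp: mult.assoc)
   have hX: "4 * (h * X) \<le> min 1 R * e" if "X \<le> \<Delta> * M * ?D^4" for X
   proof -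
    have "h * X \<le> h * (\<Delta> * M * ?D^4)" using that h by (intro mult_left_mono) auto
    then show ?thesis using hden by (simp add: mult_ac)
   qed
   have m1: "min 1 R * e \<le> e" using e R by (simp add: min_def mult_left_le_one_le)
   have h1: "4 * (h * (\<Delta> * ?D)) \<le> e"
    using hX[OF big[of "\<Delta> * ?D" \<Delta> 1 ?D]] m1 \<Delta>(1) M_ge1 D1 DD by simp
   have h2: "4 * (h * ?D^4) \<le> e" using hX[OF big[of "?D^4" 1 1 "?D^4"]] m1 \<Delta>(1) M_ge1 D1 DD by simp
   have h3: "4 * (h * (M * ?D)) \<le> e" using hX[OF big[of "M * ?D" 1 M ?D]] m1 \<Delta>(1) M_ge1 D1 DD by simp
   have h4: "4 * (h * ?D) \<le> R"
   proof -
    have "min 1 R * e \<le> R" using e R by (smt (verit) mult_left_le)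
    then show ?thesis using hX[OF big[of "?D" 1 1 ?D]] \<Delta>(1) M_ge1 D1 DD by simp
   qed
   have h5: "h \<le> 1"
   proof -
    have "h * 1 \<le> h * ?D^4" using DD h by (intro mult_left_mono) auto
    then show ?thesis using h2 e by simp
   qed
   have h6: "h^2 * ?D^4 \<le> e / 4"
   proof -
    have "h^2 * ?D^4 \<le> (h * 1) * ?D^4" unfolding power2_eq_square using h5 h by (intro mult_right_mono mult_left_mono) auto
    then show ?thesis using h2 by linarith
   qed
   have h7: "h^2 * ?D^2 \<le> e / 4" using order_trans[OF mult_left_mono[OF DD(3) zero_le_power2] h6] .
   define s where "s = \<delta> * s1 / e"
   have s0: "s > 0" using \<delta> s1 e by (simp add: s_def)
   \<comment> \<open>In order: positivity, the time discretization error of the moving centre, the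
     explicit error in the weighted norm, the change of weight in one step, and a centre
     displacement of at most 1.\<close>
   define dts where "dts = {h^2 / (12 * e), e / (\<Delta> * (4 * M^2 + 2 * k * M)), 1 / ((exp s)^2 * crude e M + 1), e / (4 * c4 + 1), 1 / M}"
   have dts: "finite dts" "dts \<noteq> {}" by (auto simp: dts_def)
   have cr: "crude e M \<ge> 0" unfolding crude_def by (intro mult_nonneg_nonneg add_nonneg_nonneg) auto
   have kM: "4 * M^2 + 2 * k * M > 0" using M_ge1 k by (intro add_pos_pos mult_pos_pos) auto
   have "\<forall>t\<in>dts. t > 0" using e h \<Delta>(1) M_ge1 kM cr c40 by (auto simp: dts_def intro!: divide_pos_pos mult_pos_pos add_nonneg_pos)
   then have dt0: "Min dts > 0" using dts by simp
   show "\<exists>dt0>0. \<forall>dt N. 0 < dt \<and> dt \<le> dt0 \<and> real N * dt = T \<longrightarrow>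
     (\<forall>n\<le>N. \<forall>A. A \<in> sets borel \<and> A \<subseteq> Om \<and> (\<forall>t\<in>{0..T}. \<forall>x\<in>A. R \<le> norm (x - \<gamma> t)) \<longrightarrow>
      (LINT x|dm A. (it e dt (bav dt) f n x)^2) \<le> C / e ^ (2 * DIM('a) + 2) * exp (- c / e))"
   proof (rule exI[of _ "Min dts"], intro conjI dt0 allI impI, elim conjE)
    fix dt :: real and N n :: nat and A :: "'a set"
    assume dt: "0 < dt" "dt \<le> Min dts" and N: "real N * dt = T" and n: "n \<le> N"
     and A: "A \<in> sets borel" "A \<subseteq> Om" "\<forall>t\<in>{0..T}. \<forall>x\<in>A. R \<le> norm (x - \<gamma> t)"
    have dtm: "dt \<le> t" if "t \<in> dts" for t using dt(2) that dts by simp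
    have t1: "dt * (12 * e / h^2) \<le> 1" using dtm[of "h^2 / (12 * e)"] e h by (simp add: dts_def field_simps)
    have t2: "dt * (\<Delta> * (4 * M^2 + 2 * k * M)) \<le> e"
    proof -
     have "dt \<le> e / (\<Delta> * (4 * M^2 + 2 * k * M))" by (rule dtm) (simp add: dts_def)
     then show ?thesis using \<Delta>(1) kM by (subst (asm) pos_le_divide_eq) auto
    qed
    have t3: "dt * (exp s)^2 * crude e M \<le> 1"
    proof -
     have "dt \<le> 1 / ((exp s)^2 * crude e M + 1)" by (rule dtm) (simp add: dts_def)
     then have "dt * ((exp s)^2 * crude e M + 1) \<le> 1" using cr by (subst (asm) pos_le_divide_eq) (auto intro: add_nonneg_pos)
     then show ?thesis using dt by (simp add: algebra_simps)
    qed
    have t4: "2 * (dt * (c4 / e)) \<le> 1"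
    proof -
     have "dt \<le> e / (4 * c4 + 1)" by (rule dtm) (simp add: dts_def)
     then have "dt * (4 * c4 + 1) \<le> e" using c40 by (subst (asm) pos_le_divide_eq) auto
     then have "4 * (dt * c4) \<le> e" using dt by (simp add: algebra_simps)
     then have "4 * (dt * (c4 / e)) \<le> 1" using e by (simp add: field_simps)
     moreover have "dt * (c4 / e) \<ge> 0" using dt c40 e by simp
     ultimately show ?thesis by linarith
    qed
    have t5: "dt * M \<le> 1"
    proof -
     have "dt \<le> 1 / M" by (rule dtm) (simp add: dts_def)
     then show ?thesis using M_ge1 by (simp add: field_simps)
    qed
    define t where "t j = T - real j * dt" for j
    have tT: "t j \<in> {0..T}" if "j \<le> N" for j
    proof -
     have "real j * dt \<le> real N * dt" using that dt by (intro mult_right_mono) auto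
     then show ?thesis using N dt by (auto simp: t_def)
    qed
    define g where "g j = \<gamma> (t j)" for j
    \<comment> \<open>Since \<open>t\<close> decreases with \<open>j\<close>, so does
      \<open>a\<close>: one step divides it by \<open>exp (k * dt) \<ge> 1 + k * dt\<close>, which
      is the growth that \<open>weight_step\<close> requires backwards.\<close>
    define a where "a j = \<delta> / e * exp (k * t j)" for j
    define th where "th j x = min (a j * (norm (x - g j))^2) s" for j x
    let ?it = "it e dt (bav dt) f"
    have bb: "bmon Om (bav dt j)" for j by (rule bmon_bav[OF dt(1)])
    have bd: "norm (bav dt j x) \<le> M" for j x by (rule bav_bound[OF dt(1)])
    have M0: "M \<ge> 0" using M_ge1 by simp
    have hM: "h * ?D * M \<le> 2 * e" using h3 e by (simp add: mult_ac)
    have itb: "bmon Om (?it j)" for j by (rule bmon_it[OF f bb])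
    have itn: "0 \<le> ?it j x" if "x \<in> Om" for j x
     by (rule it_nonneg[OF f bb bd hM f0 t1 _ e(1) that]) (use dt in auto)
    have gOm: "g j \<in> Om" if "j \<le> N" for j using \<gamma>Om[OF tT[OF that]] by (simp add: g_def)
    have a0: "a j > 0" for j using \<delta> e by (simp add: a_def)
    have aE: "32 * e * a j \<le> 1" if "j \<le> N" for j
    proof -
     have "exp (k * t j) \<le> E" unfolding E_def using tT[OF that] k by (simp add: mult_left_mono)
     then have "32 * \<delta> * exp (k * t j) \<le> 32 * \<delta> * E" using \<delta> by (intro mult_left_mono) auto
     then show ?thesis using \<delta> e by (simp add: a_def)
    qed
    have ae: "a j \<le> 1 / (32 * e)" if "j \<le> N" for j using aE[OF that] e by (simp add: field_simps)
    have al: "\<delta> / e \<le> a j" if "j \<le> N" for j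
    proof -
     have "k * t j \<ge> 0" using tT[OF that] k by (intro mult_nonneg_nonneg) auto
     then have "exp (k * t j) \<ge> 1" by simp
     then show ?thesis unfolding a_def using mult_left_mono[of 1 "exp (k * t j)" "\<delta> / e"] \<delta> e by simp
    qed
    have asuc: "a j \<ge> a (Suc j) * (1 + (2 * M + 1) * dt)" for j
    proof -
     have "a j = a (Suc j) * exp (k * dt)" by (simp add: a_def t_def algebra_simps flip: exp_add)
     moreover have "1 + k * dt \<le> exp (k * dt)" by (rule exp_ge_add_one_self)
     ultimately show ?thesis unfolding k_def[symmetric] using a0[of "Suc j"] by (simp add: mult_left_mono)
    qed
    have asuc': "a (Suc j) \<le> a j" for j
    proof -
     have "a (Suc j) * 1 \<le> a (Suc j) * (1 + (2 * M + 1) * dt)"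
      using a0[of "Suc j"] M0 dt by (intro mult_left_mono) auto
     then show ?thesis using asuc[of j] by linarith
    qed
    have step: "\<exists>\<beta>. g (Suc j) = g j - dt *\<^sub>R \<beta> \<and> norm \<beta> \<le> M \<and> norm (\<beta> - bav dt j (g j)) \<le> M^2 * dt" if "Suc j \<le> N" for j
    proof -
     have "real (Suc j) * dt \<le> T" using tT[OF that] by (simp add: t_def)
     from trajectory_step[OF tr \<gamma>Om dt(1) this] show ?thesis by (simp add: g_def t_def)
    qed
    have thb: "bmon Om (th j)" for j
     unfolding th_def[abs_def] by (intro bmon_intros bmon_ident bounded_dom)
    have th0: "0 \<le> th j x" "th j x \<le> s" for j x using a0[of j] s0 by (auto simp: th_def)
    have wstep: "exp (th (Suc j) x) + dt * gadj e (bav dt j) (\<lambda>x. exp (th (Suc j) x)) x \<le> exp ((?D^2 + 2) * dt) * exp (th j x)"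
     if j: "j < N" and x: "x \<in> Om" for j x
    proof -
     from j have j': "j \<le> N" "Suc j \<le> N" by auto
     obtain \<beta> where \<beta>: "g (Suc j) = g j - dt *\<^sub>R \<beta>" "norm \<beta> \<le> M" "norm (\<beta> - bav dt j (g j)) \<le> M^2 * dt"
      using step[OF j'(2)] by blast
     have inner: "y + h *\<^sub>R z \<in> Om" if "y \<in> Om" "a j * (norm (y - g j))^2 \<le> s" "z \<in> cube" for y z
     proof -
      have "\<delta> / e * (norm (y - g j))^2 \<le> \<delta> / e * s1"
       using mult_right_mono[OF al[OF j'(1)], of "(norm (y - g j))^2"] that(2) by (simp add: s_def)
      then have "(norm (y - g j))^2 \<le> s1" using \<delta> e by (simp add: field_simps)
      then have "norm (y - g j) \<le> R / 2" unfolding s1_def using R by (auto intro: power2_le_imp_le)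
      moreover have "norm (h *\<^sub>R z) \<le> h * ?D" using cube_norm[OF that(3)] h by (simp add: mult_left_mono)
      moreover have "norm (y + h *\<^sub>R z - g j) \<le> norm (y - g j) + norm (h *\<^sub>R z)"
       using norm_triangle_ineq[of "y - g j" "h *\<^sub>R z"] by (simp add: algebra_simps)
      ultimately have "norm (y + h *\<^sub>R z - g j) < R" using h4 R by linarith
      then show ?thesis using inOm[OF tT[OF j'(1)]] by (auto simp: g_def dist_norm norm_minus_commute)
     qed
     have sm: "a (Suc j) * X \<le> 1" if "X \<le> e" "0 \<le> X" for X
     proof -
      have "a (Suc j) * X \<le> 1 / (32 * e) * e" using ae[OF j'(2)] that e by (intro mult_mono) auto
      then show ?thesis using e by simp
     qed
     show ?thesis unfolding th_def
     proof (rule weight_step[where \<beta>=\<beta> and R=\<Delta> and M=M and x=x and e=e and b="bav dt j" and g="g j" and g'="g (Suc j)" and a="a j" and a'="a (Suc j)" and dt=dt and s=s, OF bd _ \<beta> e M0 a0 aE[OF j'(2)] asuc hM t1 _ inner _ _ _ _ x])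
      show "norm (bav dt j y - bav dt j (g j)) \<le> M * norm (y - g j)" if "y \<in> Om" for y
       by (rule bav_lip[OF dt(1) that gOm[OF j'(1)]])
      show "norm (y - g (Suc j)) \<le> \<Delta>" if "y \<in> Om" for y by (rule \<Delta>(2)[OF that gOm[OF j'(2)]])
      show "a (Suc j) * (2 * h * \<Delta> * ?D + h^2 * ?D^2) \<le> 1"
       using h1 h7 h \<Delta>(1) e by (intro sm add_nonneg_nonneg mult_nonneg_nonneg) auto
      show "a (Suc j) * h^2 * ?D ^ 4 \<le> 1" using sm[of "h^2 * ?D^4"] h6 e by (simp add: mult.assoc)
      show "a (Suc j) * (dt * \<Delta> * (4 * M^2 + 2 * (2 * M + 1) * M)) \<le> 1"
       using t2 dt \<Delta>(1) kM unfolding k_def by (intro sm) (auto simp: mult.assoc)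
     qed (use dt in auto)
    qed
    have W: "(LINT x|dm Om. ?it j x * exp (th j x)) \<le> EE * (exp (s / 4) * m0)" if j: "j \<le> N" for j
    proof -
     have "(LINT x|dm Om. ?it j x * exp (th j x)) \<le> exp ((?D^2 + 2) * dt * real j) * (LINT x|dm Om. f x * exp (th 0 x))"
      by (rule it_L1[OF f bb itn bmon_exp[OF thb] wstep j])
     \<comment> \<open>On the support of \<open>f\<close> the first weight has exponent at most
       \<open>s / 4\<close>, by the support hypothesis.\<close>
     also have "(LINT x|dm Om. f x * exp (th 0 x)) \<le> (LINT x|dm Om. exp (s / 4) * f x)"
     proof (rule integral_Om_mono)
      fix x
      show "f x * exp (th 0 x) \<le> exp (s / 4) * f x"
      proof (cases "f x = 0")
       case False
       have "g 0 = x0" using tr T_pos unfolding g_def t_def backward_trajectory_def by auto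
       moreover have "a 0 = \<delta> / e * E" by (simp add: a_def t_def E_def)
       ultimately have "a 0 * (norm (x - g 0))^2 = \<delta> / e * (E * (norm (x - x0))^2)" by (simp only: mult.assoc)
       also have "... \<le> \<delta> / e * (R^2 / 16)"
        using supp[OF False] less_imp_le[OF \<delta>(1)] e unfolding E_def k_def by (intro mult_left_mono) auto
       also have "... = s / 4" by (simp add: s_def s1_def power_divide)
       finally show ?thesis using f0[of x] by (simp add: th_def mult.commute mult_left_mono min.coboundedI1)
      qed simp
     qed (intro bmon_intros f thb)+
     also have "... = exp (s / 4) * m0" by (simp add: m0_def)
     also have "exp ((?D^2 + 2) * dt * real j) * (exp (s / 4) * m0) \<le> EE * (exp (s / 4) * m0)"
     proof (intro mult_right_mono mult_nonneg_nonneg)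
      have "real j * dt \<le> T" using tT[OF j] by (simp add: t_def)
      then have "(?D^2 + 2) * (real j * dt) \<le> (?D^2 + 2) * T" by (intro mult_left_mono) auto
      then show "exp ((?D^2 + 2) * dt * real j) \<le> EE" unfolding EE_def by (simp add: mult_ac)
      show "m0 \<ge> 0" unfolding m0_def by (intro integral_Om_nonneg f0)
     qed simp
     finally show ?thesis by (simp add: mult_left_mono)
    qed
    define V where "V j = (LINT x|dm Om. (?it j x * exp (th j x))^2)" for j
    define r where "r = \<kappa> * e"
    have "\<kappa> * e \<le> \<kappa> * 1" using \<kappa>(1) e by (intro mult_left_mono) auto
    then have r: "r > 0" "r \<le> r0" unfolding r_def using \<kappa>(1,2) mult_pos_pos[OF \<kappa>(1) e(1)] by linarith+
    define Y where "Y = (EE * (exp (s / 4) * m0) / r ^ DIM('a))^2"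
    have Vstep: "V (Suc j) \<le> V j + dt * (e * Y / r^2)" if j: "j < N" for j
    proof -
     from j have j': "j \<le> N" "Suc j \<le> N" by auto
     let ?v = "\<lambda>x. ?it j x * exp (th j x)"
     let ?E = "energy ?v"
     have V0: "V j \<ge> 0" unfolding V_def by (intro integral_Om_nonneg) auto
     have "V (Suc j) \<le> (1 + dt * ((4 * c4 + 3 * C5) / e)) * V j - dt * e * ?E"
      unfolding V_def it.simps
     proof (rule it_weighted_step[OF itb bb thb thb e M0 bd _ _ L0 th0(1) th0(2) _ c40 _ t3 t4 C5_def])
      show "h * (L / e) * ?D \<le> 1" using h1 e by (simp add: L_def field_simps)
      obtain \<beta> where \<beta>: "g (Suc j) = g j - dt *\<^sub>R \<beta>" "norm \<beta> \<le> M"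
       using step[OF j'(2)] by blast
      fix x assume x: "x \<in> Om"
      have nx: "norm (x - g j) \<le> \<Delta>" by (rule \<Delta>(2)[OF x gOm[OF j'(1)]])
      { fix y assume y: "y \<in> Om"
       have ny: "norm (y - g j) \<le> \<Delta>" by (rule \<Delta>(2)[OF y gOm[OF j'(1)]])
       have "\<bar>norm (x - g j) - norm (y - g j)\<bar> \<le> norm (x - y)"
        using norm_triangle_ineq3[of "x - g j" "y - g j"] by simp
       moreover have "(norm (x - g j))^2 - (norm (y - g j))^2 = (norm (x - g j) - norm (y - g j)) * (norm (x - g j) + norm (y - g j))"
        by (simp add: power2_eq_square algebra_simps)
       ultimately have q: "\<bar>(norm (x - g j))^2 - (norm (y - g j))^2\<bar> \<le> norm (x - y) * (2 * \<Delta>)"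
        using nx ny by (simp add: abs_mult) (intro mult_mono, auto)
       have "\<bar>th j x - th j y\<bar> \<le> \<bar>a j * (norm (x - g j))^2 - a j * (norm (y - g j))^2\<bar>"
        by (auto simp: th_def min_def)
       also have "... = a j * \<bar>(norm (x - g j))^2 - (norm (y - g j))^2\<bar>"
        using a0[of j] by (simp add: abs_mult flip: right_diff_distrib)
       also have "... \<le> 1 / (32 * e) * (norm (x - y) * (2 * \<Delta>))"
        using q ae[OF j'(1)] a0[of j] e by (intro mult_mono) auto
       also have "... = L / e * norm (x - y)" by (simp add: L_def)
       finally show "\<bar>th j x - th j y\<bar> \<le> L / e * norm (x - y)" . }
      have "(norm (x - g (Suc j)))^2 \<le> (norm (x - g j))^2 + dt * (M * (2 * \<Delta> + 1))"
      proof -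
       have eq: "x - g (Suc j) = (x - g j) + dt *\<^sub>R \<beta>" by (simp add: \<beta>)
       have "dt * norm \<beta> \<le> dt * M" using \<beta>(2) dt by (intro mult_left_mono) auto
       then have "norm (x - g (Suc j)) \<le> norm (x - g j) + dt * M"
        unfolding eq using norm_triangle_ineq[of "x - g j" "dt *\<^sub>R \<beta>"] abs_of_pos[OF dt(1)] unfolding norm_scaleR by linarith
       then have "(norm (x - g (Suc j)))^2 \<le> (norm (x - g j) + dt * M)^2" by (intro power_mono) auto
       also have "... = (norm (x - g j))^2 + (dt * M) * (2 * norm (x - g j) + dt * M)" by (simp add: power2_eq_square algebra_simps)
       also have "(dt * M) * (2 * norm (x - g j) + dt * M) \<le> (dt * M) * (2 * \<Delta> + 1)"
        using nx t5 dt M0 by (intro mult_left_mono) auto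
       finally show ?thesis by (simp add: mult.assoc)
      qed
      then have "a (Suc j) * (norm (x - g (Suc j)))^2 \<le> a (Suc j) * ((norm (x - g j))^2 + dt * (M * (2 * \<Delta> + 1)))"
       using a0[of "Suc j"] by (intro mult_left_mono) auto
      also have "... \<le> a j * (norm (x - g j))^2 + 1 / (32 * e) * (dt * (M * (2 * \<Delta> + 1)))"
       unfolding distrib_left using asuc'[of j] ae[OF j'(2)] dt M0 \<Delta>(1)
       by (intro add_mono mult_right_mono) auto
      also have "1 / (32 * e) * (dt * (M * (2 * \<Delta> + 1))) = dt * (c4 / e)" by (simp add: c4_def)
      finally show "th (Suc j) x \<le> th j x + dt * (c4 / e)"
       using dt c40 e unfolding th_def by (auto simp: min_def intro: add_increasing2)
     qed (use dt in auto)
     then have 1: "V (Suc j) \<le> V j + dt * (C6 / e * V j - e * ?E)" by (simp add: C6_def algebra_simps)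
     have bv: "bmon Om ?v" by (intro bmon_intros itb thb)
     have "V j \<le> CN * (r^2 * ?E + ((LINT x|dm Om. \<bar>?v x\<bar>) / r ^ DIM('a))^2)"
      using nash[OF h(1) K(1) _ bv] K(2) r unfolding V_def r_def by simp
     also have "... \<le> CN * (r^2 * ?E + Y)"
     proof (intro mult_left_mono add_left_mono)
      have "(LINT x|dm Om. \<bar>?v x\<bar>) = (LINT x|dm Om. ?v x)"
       using bmon_measurable[OF bv] bmon_measurable[OF bmon_abs[OF bv]] itn
       by (intro integral_cong_AE AE_dmI) (auto simp: abs_mult)
      then have "(LINT x|dm Om. \<bar>?v x\<bar>) \<le> EE * (exp (s / 4) * m0)" using W[OF j'(1)] by simp
      then show "((LINT x|dm Om. \<bar>?v x\<bar>) / r ^ DIM('a))^2 \<le> Y" unfolding Y_def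
       using r by (intro power_mono divide_right_mono divide_nonneg_nonneg integral_Om_nonneg) auto
     qed (use CN in auto)
     finally have "V j / CN \<le> r^2 * ?E + Y" using CN by (simp add: pos_divide_le_eq mult.commute)
     then have "e / r^2 * (V j / CN) \<le> e / r^2 * (r^2 * ?E + Y)" using e r by (intro mult_left_mono) auto
     \<comment> \<open>The choice of \<open>\<kappa>\<close> enters here: the growth term is
       dominated by what the Nash inequality extracts from the dissipation.\<close>
     moreover have "C6 / e * V j \<le> e / r^2 * (V j / CN)"
     proof -
      have "r^2 * (C6 * CN) \<le> e^2" unfolding r_def using mult_right_mono[OF \<kappa>(3), of "e^2"] by (simp add: power_mult_distrib mult_ac)
      then have "C6 / e \<le> e / r^2 / CN" using e r CN by (simp add: field_simps power2_eq_square)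
      from mult_right_mono[OF this V0] show ?thesis by simp
     qed
     moreover have "e / r^2 * (r^2 * ?E + Y) = e * ?E + e * Y / r^2" using r by (simp add: field_simps)
     ultimately have "C6 / e * V j - e * ?E \<le> e * Y / r^2" by linarith
     then have "dt * (C6 / e * V j - e * ?E) \<le> dt * (e * Y / r^2)" using dt by (intro mult_left_mono) auto
     with 1 show ?thesis by linarith
    qed
    have Y0: "Y \<ge> 0" by (simp add: Y_def)
    have Vn: "j \<le> N ==> V j \<le> V 0 + real j * (dt * (e * Y / r^2))" for j
    proof (induction j)
     case (Suc j)
     have "real (Suc j) * (dt * (e * Y / r^2)) = real j * (dt * (e * Y / r^2)) + dt * (e * Y / r^2)"
      by (simp only: of_nat_Suc distrib_right)
     then show ?case using Vstep[of j] Suc by linarith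
    qed simp
    have V0: "V 0 \<le> exp (s / 2) * F2"
    proof -
     have "V 0 \<le> (LINT x|dm Om. exp (s / 2) * (f x)^2)" unfolding V_def it.simps
     proof (rule integral_Om_mono)
      fix x
      show "(f x * exp (th 0 x))^2 \<le> exp (s / 2) * (f x)^2"
      proof (cases "f x = 0")
       case False
       have "g 0 = x0" using tr T_pos unfolding g_def t_def backward_trajectory_def by auto
       moreover have "a 0 = \<delta> / e * E" by (simp add: a_def t_def E_def)
       ultimately have "a 0 * (norm (x - g 0))^2 = \<delta> / e * (E * (norm (x - x0))^2)" by (simp only: mult.assoc)
       also have "... \<le> \<delta> / e * (R^2 / 16)"
        using supp[OF False] less_imp_le[OF \<delta>(1)] e unfolding E_def k_def by (intro mult_left_mono) auto
       also have "... = s / 4" by (simp add: s_def s1_def power_divide)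
       finally have "(exp (th 0 x))^2 \<le> (exp (s / 4))^2" by (intro power_mono) (auto simp: th_def min.coboundedI1)
       also have "... = exp (s / 2)" by (simp add: power2_eq_square flip: exp_add)
       finally show ?thesis by (simp add: power_mult_distrib mult.commute mult_left_mono)
      qed simp
     qed (intro bmon_intros f thb)+
     then show ?thesis by (simp add: F2_def)
    qed
    have itA: "bmon A (?it n)" by (rule bmon_subset[OF itb A(2)])
    have Ab: "bounded A" using A(2) bounded_dom bounded_subset by blast
    have "(exp s)^2 * (LINT x|dm A. (?it n x)^2) = (LINT x|dm A. (exp s)^2 * (?it n x)^2)" by simp
    also have "... = (LINT x|dm A. (?it n x * exp (th n x))^2)"
    proof (intro integral_cong_AE AE_dmI A(1))
     show "(\<lambda>x. (exp s)^2 * (?it n x)^2) \<in> borel_measurable (dm A)"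
      "(\<lambda>x. (?it n x * exp (th n x))^2) \<in> borel_measurable (dm A)"
      using bmon_measurable[OF itb[of n]] bmon_measurable[OF thb[of n]] by auto
     fix x assume x: "x \<in> A"
     have "R^2 \<le> (norm (x - g n))^2" using A(3) tT[OF n] x R unfolding g_def by (intro power_mono) auto
     moreover have "s1 = R^2 / 4" by (simp add: s1_def power_divide)
     ultimately have "s1 \<le> (norm (x - g n))^2" using zero_le_power2[of R] by linarith
     then have "\<delta> / e * s1 \<le> a n * (norm (x - g n))^2" using al[OF n] \<delta> e s1 a0[of n] by (intro mult_mono) auto
     then have "th n x = s" by (simp add: th_def s_def)
     then show "(exp s)^2 * (?it n x)^2 = (?it n x * exp (th n x))^2" by (simp add: power_mult_distrib)
    qed
    also have "... \<le> V n"
    proof -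
     let ?F = "\<lambda>x. (?it n x * exp (th n x))^2"
     have bF: "bmon Om ?F" by (intro bmon_intros itb thb)
     have "(LINT x|lborel. indicator A x *\<^sub>R ?F x) \<le> (LINT x|lborel. indicator Om x *\<^sub>R ?F x)"
     proof (rule integral_mono)
      show "integrable lborel (\<lambda>x. indicator A x *\<^sub>R ?F x)"
       using integrable_bmon[OF A(1) Ab bmon_subset[OF bF A(2)]] A(1) bmon_measurable[OF bF] by (subst (asm) integrable_dm_iff) auto
      show "integrable lborel (\<lambda>x. indicator Om x *\<^sub>R ?F x)"
       using integrable_Om[OF bF] bmon_measurable[OF bF] by (subst (asm) integrable_dm_iff) auto
     qed (use A(2) in \<open>auto simp: indicator_def\<close>)
     then show ?thesis unfolding V_def using A(1) bmon_measurable[OF bF] by (simp add: integral_dm)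
    qed
    also have "... \<le> exp (s / 2) * F2 + T * (e * Y / r^2)"
    proof -
     have "real n * dt \<le> T" using tT[OF n] by (simp add: t_def)
     then have "real n * dt * (e * Y / r^2) \<le> T * (e * Y / r^2)" using e Y0 by (intro mult_right_mono) auto
     then show ?thesis using Vn[OF n] V0 by (simp add: mult.assoc)
    qed
    also have "... \<le> exp (s / 2) * (C / e ^ (2 * DIM('a) + 2))"
    proof -
     have ep: "e ^ (2 * DIM('a) + 2) > 0" "e ^ (2 * DIM('a) + 2) \<le> 1" using e by (simp, intro power_le_one) auto
     have "Y = exp (s / 2) * ((EE * m0)^2 / r ^ (2 * DIM('a)))"
      unfolding Y_def by (simp add: power_divide power_mult_distrib power2_eq_square power_mult mult_ac flip: exp_add power_add)
     then have "e * Y / r^2 = exp (s / 2) * (e * ((EE * m0)^2 / r ^ (2 * DIM('a) + 2)))"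
      by (simp add: power_add power2_eq_square mult_ac)
     also have "... \<le> exp (s / 2) * (1 * ((EE * m0)^2 / r ^ (2 * DIM('a) + 2)))"
      using e r by (intro mult_left_mono mult_right_mono) auto
     also have "... = exp (s / 2) * ((EE * m0)^2 / \<kappa> ^ (2 * DIM('a) + 2) / e ^ (2 * DIM('a) + 2))"
      by (simp add: r_def power_mult_distrib)
     finally have "T * (e * Y / r^2) \<le> T * (exp (s / 2) * ((EE * m0)^2 / \<kappa> ^ (2 * DIM('a) + 2) / e ^ (2 * DIM('a) + 2)))"
      using T_pos by (intro mult_left_mono) auto
     moreover have "exp (s / 2) * F2 \<le> exp (s / 2) * (F2 / e ^ (2 * DIM('a) + 2))"
      using ep F20 by (intro mult_left_mono) (auto simp: pos_le_divide_eq mult_left_le)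
     moreover have "exp (s / 2) * (C / e ^ (2 * DIM('a) + 2)) = exp (s / 2) * (F2 / e ^ (2 * DIM('a) + 2))
       + T * (exp (s / 2) * ((EE * m0)^2 / \<kappa> ^ (2 * DIM('a) + 2) / e ^ (2 * DIM('a) + 2))) + exp (s / 2) / e ^ (2 * DIM('a) + 2)"
      unfolding C_def by (simp add: algebra_simps add_divide_distrib)
     moreover have "exp (s / 2) / e ^ (2 * DIM('a) + 2) \<ge> 0" using ep by simp
     ultimately show ?thesis by linarith
    qed
    finally have "(LINT x|dm A. (?it n x)^2) \<le> exp (s / 2) * (C / e ^ (2 * DIM('a) + 2)) / (exp s)^2"
     by (subst pos_le_divide_eq) (simp_all add: mult.commute)
    also have "... = C / e ^ (2 * DIM('a) + 2) * (exp (s / 2) / (exp s)^2)" by simp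
    also have "exp (s / 2) / (exp s)^2 = exp (- c / e)"
     unfolding c_def s_def power2_eq_square by (simp flip: exp_add exp_diff)
    finally show "(LINT x|dm A. (?it n x)^2) \<le> C / e ^ (2 * DIM('a) + 2) * exp (- c / e)" .
   qed
  qed
 qed
qed

end

section \<open>Compactness by convex combinations\<close>

lemma norm_add_power2_le:
 fixes x y :: "'b::real_inner"
 shows "(norm (x + y))^2 \<le> 2 * (norm x)^2 + 2 * (norm y)^2"
 using zero_le_power2[of "norm (x - y)"]
 by (simp add: power2_norm_eq_inner inner_add_left inner_add_right inner_diff_left inner_diff_right inner_commute)

lemma norm_diff_power2_le:
 fixes x y :: "'b::real_inner"
 shows "(norm (x - y))^2 \<le> 2 * (norm x)^2 + 2 * (norm y)^2"
 using norm_add_power2_le[of x "- y"] by simp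

lemma norm_add3_power2_le:
 fixes x y z :: "'b::real_inner"
 shows "(norm (x + y + z))^2 \<le> 4 * (norm x)^2 + 4 * (norm y)^2 + 2 * (norm z)^2"
 using norm_add_power2_le[of "x + y" z] norm_add_power2_le[of x y] by linarith

definition sqint :: "'p measure => ('p => 'b::euclidean_space) => bool" where
 "sqint P f \<longleftrightarrow> f \<in> borel_measurable P \<and> integrable P (\<lambda>x. (norm (f x))^2)"

lemma sqint_measurable: "sqint P f ==> f \<in> borel_measurable P"
 and sqint_integrable: "sqint P f ==> integrable P (\<lambda>x. (norm (f x))^2)"
 by (auto simp: sqint_def)

lemma sqint_add:
 assumes "sqint P f" "sqint P g" shows "sqint P (\<lambda>x. f x + g x)"
 unfolding sqint_def
proof
 have [measurable]: "f \<in> borel_measurable P" "g \<in> borel_measurable P" using assms by (auto simp: sqint_def)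
 show "(\<lambda>x. f x + g x) \<in> borel_measurable P" by measurable
 show "integrable P (\<lambda>x. (norm (f x + g x))^2)"
 proof (rule lintegrable_bound)
  show "integrable P (\<lambda>x. 2 * (norm (f x))^2 + 2 * (norm (g x))^2)"
   using assms by (auto simp: sqint_def)
  show "AE x in P. norm ((norm (f x + g x))^2) \<le> norm (2 * (norm (f x))^2 + 2 * (norm (g x))^2)"
   by (rule AE_I2) (use norm_add_power2_le in auto)
 qed measurable
qed

lemma sqint_scaleR: "sqint P f ==> sqint P (\<lambda>x. c *\<^sub>R f x)"
 by (auto simp: sqint_def power_mult_distrib)

lemma sqint_diff: "sqint P f ==> sqint P g ==> sqint P (\<lambda>x. f x - g x)"
 using sqint_add[of P f "\<lambda>x. (-1) *\<^sub>R g x"] sqint_scaleR[of P g "-1"] by simp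

lemma sqint_zero: "sqint P (\<lambda>_. 0)"
 by (simp add: sqint_def)

lemma sqint_sum: "(\<And>i. i \<in> I ==> sqint P (f i)) ==> sqint P (\<lambda>x. \<Sum>i\<in>I. f i x)"
 by (induction I rule: infinite_finite_induct) (auto intro: sqint_zero sqint_add)

text \<open>The lower index bound \<open>n\<close> lets statements about late members of a sequence
  pass to the combination. The upper bound \<open>L\<close> keeps sums finite and may be enlarged
  (\<open>adm_extend\<close>), which brings two combinations to a common range.\<close>

definition adm :: "nat => (nat => real) => nat => bool" where
 "adm n c L \<longleftrightarrow> (\<forall>k. 0 \<le> c k) \<and> (\<forall>k. k < n \<or> L \<le> k \<longrightarrow> c k = 0) \<and> (\<Sum>k<L. c k) = 1"

definition comb :: "(nat => 'p => 'b::real_vector) => (nat => real) => nat => 'p => 'b" where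
 "comb H c L x = (\<Sum>k<L. c k *\<^sub>R H k x)"

lemma adm_extend:
 assumes "adm n c L" "L \<le> L'" shows "adm n c L'" "comb H c L' = comb H c L"
proof -
 have "(\<Sum>k<L'. c k) = (\<Sum>k<L. c k)"
  by (rule sum.mono_neutral_right) (use assms in \<open>auto simp: adm_def\<close>)
 then show "adm n c L'" using assms by (auto simp: adm_def)
 have "(\<Sum>k<L'. c k *\<^sub>R H k x) = (\<Sum>k<L. c k *\<^sub>R H k x)" for x
  by (rule sum.mono_neutral_right) (use assms in \<open>auto simp: adm_def\<close>)
 then show "comb H c L' = comb H c L" by (auto simp: comb_def)
qed

lemma adm_unit: "adm n (\<lambda>k. if k = n then 1 else 0) (Suc n)"
 "comb H (\<lambda>k. if k = n then 1 else 0) (Suc n) = H n"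
 by (auto simp: adm_def comb_def intro!: ext) 

lemma adm_mid:
 assumes "adm n c L" "adm n c' L"
 shows "adm n (\<lambda>k. (c k + c' k) / 2) L" "comb H (\<lambda>k. (c k + c' k) / 2) L x = (1/2) *\<^sub>R (comb H c L x + comb H c' L x)"
 using assms
 by (auto simp: adm_def comb_def sum.distrib scaleR_sum_right scaleR_add_left scaleR_add_right add_divide_distrib
   simp flip: sum_divide_distrib)

lemma adm_mono: "adm m c L ==> n \<le> m ==> adm n c L"
 by (auto simp: adm_def)

lemma sqint_comb: "(\<And>k. sqint P (H k)) ==> sqint P (comb H c L)"
 unfolding comb_def[abs_def] by (intro sqint_sum sqint_scaleR)

text \<open>The difference of the two sides is the weighted variance around the mean
  \<open>m\<close>.\<close>

lemma norm_convex_comb: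
 fixes y :: "nat => 'b::real_inner"
 assumes "\<And>k. k < L ==> 0 \<le> c k" "(\<Sum>k<L. c k) = 1"
 shows "(norm (\<Sum>k<L. c k *\<^sub>R y k))^2 \<le> (\<Sum>k<L. c k * (norm (y k))^2)"
proof -
 define m where "m = (\<Sum>k<L. c k *\<^sub>R y k)"
 have "0 \<le> (\<Sum>k<L. c k * (norm (y k - m))^2)" by (intro sum_nonneg mult_nonneg_nonneg assms) auto
 also have "... = (\<Sum>k<L. c k * (norm (y k))^2 - 2 * (m \<bullet> (c k *\<^sub>R y k)) + c k * (m \<bullet> m))"
  by (intro sum.cong refl) (simp add: power2_norm_eq_inner inner_diff_left inner_diff_right inner_commute algebra_simps)
 also have "... = (\<Sum>k<L. c k * (norm (y k))^2) - 2 * (m \<bullet> m) + m \<bullet> m"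
 proof -
  have "(\<Sum>k<L. 2 * (m \<bullet> (c k *\<^sub>R y k))) = 2 * (m \<bullet> m)"
   by (simp only: sum_distrib_left[symmetric] inner_sum_right[symmetric] m_def[symmetric])
  moreover have "(\<Sum>k<L. c k * (m \<bullet> m)) = m \<bullet> m" by (simp add: sum_distrib_right[symmetric] assms(2))
  ultimately show ?thesis by (simp only: sum.distrib sum_subtractf)
 qed
 finally show ?thesis by (simp add: m_def[symmetric] power2_norm_eq_inner)
qed

lemma comb_bound:
 assumes H: "\<And>k. sqint P (H k)" and c: "adm n c L" and b: "\<And>k. n \<le> k ==> (LINT x|P. (norm (H k x))^2) \<le> C"
 shows "(LINT x|P. (norm (comb H c L x))^2) \<le> C"
proof -
 have c': "\<And>k. 0 \<le> c k" "\<And>k. k < n ==> c k = 0" "(\<Sum>k<L. c k) = 1" using c by (auto simp: adm_def)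
 have "(LINT x|P. (norm (comb H c L x))^2) \<le> (LINT x|P. (\<Sum>k<L. c k * (norm (H k x))^2))"
  unfolding comb_def using sqint_comb[of P H c L, OF H] H
  by (intro integral_mono lintegrable_sum) (auto simp: sqint_def comb_def intro!: norm_convex_comb c')
 also have "... = (\<Sum>k<L. c k * (LINT x|P. (norm (H k x))^2))"
  using H by (subst lint_sum) (auto simp: sqint_def)
 also have "... \<le> (\<Sum>k<L. c k * C)"
  using c' b by (intro sum_mono) (metis mult_left_mono mult_zero_left not_le order_refl)
 also have "... = C" using c' by (simp flip: sum_distrib_right)
 finally show ?thesis .
qed

text \<open>\<open>D n\<close> is the infimum of the squared norm over combinations of indices at
  least \<open>n\<close>. Midpoints stay admissible, so the parallelogram identity bounds the
  distance of near-minimizers by increments of \<open>D\<close>, and \<open>D\<close> is increasing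
  and bounded. Strong convergence results without weak limits.\<close>

lemma mazur:
 fixes H :: "nat => 'p => 'b::euclidean_space"
 assumes H: "\<And>k. sqint P (H k)" and b: "\<And>k. (LINT x|P. (norm (H k x))^2) \<le> C"
 obtains c L where "\<And>j. adm j (c j) (L j)"
  "\<And>\<eta>. \<eta> > 0 ==> \<exists>J. \<forall>i\<ge>J. \<forall>j\<ge>J. (LINT x|P. (norm (comb H (c i) (L i) x - comb H (c j) (L j) x))^2) \<le> \<eta>"
proof -
 define q where "q p = (LINT x|P. (norm (comb H (fst p) (snd p) x))^2)" for p
 define A where "A n = {p. adm n (fst p) (snd p)}" for n
 define D where "D n = Inf (q ` A n)" for n
 have q0: "q p \<ge> 0" for p unfolding q_def by simp
 have bdd: "bdd_below (q ` A n)" for n using q0 by (intro bdd_belowI[of _ 0]) auto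
 have ne: "A n \<noteq> {}" for n using adm_unit(1)[of n] by (auto simp: A_def intro!: exI[of _ "(_, _)"])
 have Dq: "p \<in> A n ==> D n \<le> q p" for p n unfolding D_def by (intro cInf_lower bdd) auto
 have DC: "D n \<le> C" for n
 proof -
  have "D n \<le> q ((\<lambda>k. if k = n then 1 else 0), Suc n)" by (rule Dq) (simp add: A_def adm_unit)
  also have "... \<le> C" using b[of n] by (simp only: q_def fst_conv snd_conv adm_unit(2))
  finally show ?thesis .
 qed
 have Dm: "D n \<le> D m" if "n \<le> m" for n m
 proof -
  have "A m \<subseteq> A n" using adm_mono[OF _ that] by (auto simp: A_def)
  then show ?thesis unfolding D_def using ne[of m] bdd by (intro cInf_superset_mono image_mono) auto
 qed
 have "\<exists>p\<in>A n. q p \<le> D n + 1 / real (Suc n)" for n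
 proof -
  have "\<exists>y\<in>q ` A n. y < D n + 1 / real (Suc n)"
   using ne bdd unfolding D_def by (subst cInf_less_iff[symmetric]) auto
  then show ?thesis by (auto intro: less_imp_le)
 qed
 then obtain p where p: "\<And>n. p n \<in> A n" "\<And>n. q (p n) \<le> D n + 1 / real (Suc n)" by metis
 have pa: "adm n (fst (p n)) (snd (p n))" for n using p(1)[of n] by (simp add: A_def)
 have par: "(LINT x|P. (norm (comb H (fst (p i)) (snd (p i)) x - comb H (fst (p j)) (snd (p j)) x))^2) \<le> 2 * (D j - D i) + 4 / real (Suc i)"
  if ij: "i \<le> j" for i j
 proof -
  define L where "L = max (snd (p i)) (snd (p j))"
  let ?X = "comb H (fst (p i)) (snd (p i))" and ?Y = "comb H (fst (p j)) (snd (p j))"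
  have a1: "adm i (fst (p i)) L" "comb H (fst (p i)) L = ?X"
   using adm_extend[OF pa[of i], of L] by (auto simp: L_def)
  have a2: "adm i (fst (p j)) L" "comb H (fst (p j)) L = ?Y"
   using adm_extend[OF pa[of j], of L] adm_mono[OF _ ij] by (auto simp: L_def)
  let ?c = "\<lambda>k. (fst (p i) k + fst (p j) k) / 2"
  \<comment> \<open>The midpoint uses only indices at least \<open>i\<close>, the smaller of the
    two, so \<open>D i\<close> bounds its squared norm from below.\<close>
  have mid: "D i \<le> q (?c, L)" by (rule Dq) (use adm_mid(1)[OF a1(1) a2(1)] in \<open>simp add: A_def\<close>)
  have qm: "q (?c, L) = (LINT x|P. (norm ((1/2) *\<^sub>R (?X x + ?Y x)))^2)"
   unfolding q_def fst_conv snd_conv by (simp only: adm_mid(2)[OF a1(1) a2(1)] a1(2) a2(2))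
  have sX: "sqint P ?X" "sqint P ?Y" by (intro sqint_comb H)+
  have "(LINT x|P. (norm (?X x - ?Y x))^2) = (LINT x|P. 2 * (norm (?X x))^2 + 2 * (norm (?Y x))^2 - 4 * (norm ((1/2) *\<^sub>R (?X x + ?Y x)))^2)"
   by (intro lint_cong refl)
     (simp add: power2_norm_eq_inner inner_add_left inner_add_right inner_diff_left inner_diff_right inner_commute algebra_simps)
  also have "... = 2 * q (p i) + 2 * q (p j) - 4 * q (?c, L)"
   unfolding qm using sqint_integrable[OF sX(1)] sqint_integrable[OF sX(2)] sqint_integrable[OF sqint_scaleR[OF sqint_add[OF sX], of "1/2"]]
   by (subst lint_diff) (auto simp: q_def)
  also have "... \<le> 2 * (D i + 1 / real (Suc i)) + 2 * (D j + 1 / real (Suc j)) - 4 * D i"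
  proof -
   have gen: "2 * r + 2 * t - 4 * u \<le> 2 * (v + w) + 2 * (y + z) - 4 * v" if "r \<le> v + w" "t \<le> y + z" "v \<le> u" for r t u v w y z :: real
    using that by simp
   show ?thesis by (rule gen[OF p(2) p(2) mid])
  qed
  also have "1 / real (Suc j) \<le> 1 / real (Suc i)" using ij by (simp add: frac_le)
  finally show ?thesis by simp
 qed
 have "incseq D" using Dm by (auto simp: incseq_def)
 then obtain l where "D \<longlonglongrightarrow> l" using incseq_convergent[of D C] DC by blast
 then have "convergent D" by (rule convergentI)
 then have Cau: "Cauchy D" by (rule convergent_Cauchy)
 show ?thesis
 proof (rule that[of "\<lambda>n. fst (p n)" "\<lambda>n. snd (p n)"])
  show "adm j (fst (p j)) (snd (p j))" for j by (rule pa)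
  fix \<eta> :: real assume \<eta>: "\<eta> > 0"
  then obtain J1 where J1: "\<And>i j. i \<ge> J1 ==> j \<ge> J1 ==> \<bar>D i - D j\<bar> < \<eta> / 4"
   using CauchyD[OF Cau, of "\<eta>/4"] by auto
  obtain J2 where J2: "real (Suc J2) > 8 / \<eta>" by (metis reals_Archimedean2 less_Suc_eq of_nat_less_iff order_less_trans)
  have key: "(LINT x|P. (norm (comb H (fst (p i)) (snd (p i)) x - comb H (fst (p j)) (snd (p j)) x))^2) \<le> \<eta>"
   if "i \<ge> max J1 J2" "j \<ge> i" for i j
  proof -
   have "real (Suc i) > 8 / \<eta>" using J2 that by simp
   then have "4 / real (Suc i) \<le> \<eta> / 2" using \<eta> by (simp add: field_simps)
   then show ?thesis using par[OF that(2)] J1[of i j] that by (auto simp: abs_if split: if_splits)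
  qed
  show "\<exists>J. \<forall>i\<ge>J. \<forall>j\<ge>J. (LINT x|P. (norm (comb H (fst (p i)) (snd (p i)) x - comb H (fst (p j)) (snd (p j)) x))^2) \<le> \<eta>"
  proof (intro exI[of _ "max J1 J2"] allI impI)
   fix i j assume "max J1 J2 \<le> i" "max J1 J2 \<le> j"
   then show "(LINT x|P. (norm (comb H (fst (p i)) (snd (p i)) x - comb H (fst (p j)) (snd (p j)) x))^2) \<le> \<eta>"
    using key[of i j] key[of j i] by (cases "i \<le> j") (auto simp: norm_minus_commute)
  qed
 qed
qed

text \<open>The limit is the pointwise \<open>lim\<close>, not an unspecified L2 class. The same
  formula then serves in space-time and on each time slice, so that the slices of the space-time
  limit are the limits of the slices. Increments of L2 size \<open>2^-j\<close> are summable in L1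
  on a finite measure, which gives convergence almost everywhere; Fatou gives the rate.\<close>

lemma L2_fast_limit:
 fixes Y :: "nat => 'p => 'b::euclidean_space"
 assumes fin: "finite_measure P" and Y: "\<And>j. sqint P (Y j)"
  and ca: "\<And>i j. i \<le> j ==> (LINT x|P. (norm (Y j x - Y i x))^2) \<le> (1/4) ^ i"
 shows "AE x in P. convergent (\<lambda>j. Y j x)"
  and "sqint P (\<lambda>x. lim (\<lambda>j. Y j x))"
  and "(LINT x|P. (norm (lim (\<lambda>j. Y j x) - Y i x))^2) \<le> (1/4) ^ i"
proof -
 interpret finite_measure P by fact
 have Ym [measurable]: "Y j \<in> borel_measurable P" for j using Y by (auto simp: sqint_def)
 let ?d = "\<lambda>j x. norm (Y (Suc j) x - Y j x)"
 let ?\<mu> = "measure P (space P)"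
 have di: "integrable P (\<lambda>x. (?d j x)^2)" for j using sqint_diff[OF Y Y] by (auto simp: sqint_def)
 have d1: "integrable P (?d j)" "(LINT x|P. ?d j x) \<le> (?\<mu> + 1) * (1/2) ^ j" for j
 proof -
  \<comment> \<open>Arithmetic-geometric mean at scale \<open>2^-j\<close>, matched to the L2 size
    of the increment.\<close>
  have pw: "?d j x \<le> (1/2) ^ j + 2 ^ j * (?d j x)^2" for x
  proof -
   have "0 \<le> (2 ^ j * ?d j x - 1)^2 + 2 ^ j * ?d j x" by (intro add_nonneg_nonneg) auto
   also have "... = 2 ^ j * ((1/2) ^ j + 2 ^ j * (?d j x)^2 - ?d j x)"
    by (simp add: power2_eq_square algebra_simps power_one_over)
   finally have "2 ^ j * 0 \<le> 2 ^ j * ((1/2) ^ j + 2 ^ j * (?d j x)^2 - ?d j x)" by simp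
   then have "0 \<le> (1/2) ^ j + 2 ^ j * (?d j x)^2 - ?d j x" by (subst (asm) mult_le_cancel_left_pos) auto
   then show ?thesis by simp
  qed
  have ib: "integrable P (\<lambda>x. (1/2) ^ j + 2 ^ j * (?d j x)^2)" using di by auto
  show i: "integrable P (?d j)"
   by (rule lintegrable_bound[OF ib]) (use pw in \<open>auto intro!: AE_I2 intro: order_trans[OF pw] simp: abs_of_nonneg\<close>)
  have "(LINT x|P. ?d j x) \<le> (LINT x|P. (1/2) ^ j + 2 ^ j * (?d j x)^2)" by (intro integral_mono i ib pw)
  also have "... = ?\<mu> * (1/2) ^ j + 2 ^ j * (LINT x|P. (?d j x)^2)"
   using di by (subst lint_add) auto
  also have "2 ^ j * (LINT x|P. (?d j x)^2) \<le> 2 ^ j * (1/4) ^ j" using ca[of j "Suc j"] by (intro mult_left_mono) auto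
  also have "2 ^ j * (1/4::real) ^ j = (1/2) ^ j" by (simp flip: power_mult_distrib)
  finally show "(LINT x|P. ?d j x) \<le> (?\<mu> + 1) * (1/2) ^ j" by (simp add: algebra_simps)
 qed
 have "(\<integral>\<^sup>+x. (\<Sum>j. ennreal (?d j x)) \<partial>P) = (\<Sum>j. \<integral>\<^sup>+x. ennreal (?d j x) \<partial>P)"
  by (rule nn_integral_suminf) measurable
 also have "... = (\<Sum>j. ennreal (LINT x|P. ?d j x))"
  by (intro suminf_cong nn_integral_eq_integral d1 AE_I2) auto
 also have "... \<le> (\<Sum>j. ennreal ((?\<mu> + 1) * (1/2) ^ j))"
  by (intro suminf_le ennreal_leI d1) auto
 also have "... < \<infinity>"
 proof -
  have "summable (\<lambda>j. (?\<mu> + 1) * (1/2) ^ j)" by (intro summable_mult summable_geometric) auto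
  then show ?thesis by (subst suminf_ennreal2) auto
 qed
 finally have "AE x in P. (\<Sum>j. ennreal (?d j x)) \<noteq> \<infinity>"
  by (intro nn_integral_PInf_AE) (auto simp: less_top)
 then show conv: "AE x in P. convergent (\<lambda>j. Y j x)"
 proof eventually_elim
  fix x assume "(\<Sum>j. ennreal (?d j x)) \<noteq> \<infinity>"
  then have "summable (\<lambda>j. ?d j x)" by (intro summable_suminf_not_top) (auto simp: top_ennreal_def infinity_ennreal_def)
  then have "summable (\<lambda>j. Y (Suc j) x - Y j x)" by (rule summable_norm_cancel)
  then have "convergent (\<lambda>n. \<Sum>j<n. Y (Suc j) x - Y j x)" by (simp add: summable_iff_convergent)
  moreover have "(\<Sum>j<n. Y (Suc j) x - Y j x) = Y n x - Y 0 x" for n by (rule sum_lessThan_telescope)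
  ultimately have "convergent (\<lambda>n. Y n x - Y 0 x)" by simp
  then have "convergent (\<lambda>n. (Y n x - Y 0 x) + Y 0 x)" by (intro convergent_add convergent_const)
  then show "convergent (\<lambda>j. Y j x)" by simp
 qed
 let ?l = "\<lambda>x. lim (\<lambda>j. Y j x)"
 have lm [measurable]: "?l \<in> borel_measurable P" by measurable
 have fat: "(\<integral>\<^sup>+x. ennreal ((norm (?l x - Y i x))^2) \<partial>P) \<le> ennreal ((1/4) ^ i)" for i
 proof -
  have "(\<integral>\<^sup>+x. ennreal ((norm (?l x - Y i x))^2) \<partial>P) = (\<integral>\<^sup>+x. liminf (\<lambda>j. ennreal ((norm (Y j x - Y i x))^2)) \<partial>P)"
  proof (rule nn_integral_cong_AE, use conv in eventually_elim)
   fix x assume "convergent (\<lambda>j. Y j x)"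
   then have "(\<lambda>j. Y j x) \<longlonglongrightarrow> ?l x" by (simp add: convergent_LIMSEQ_iff)
   then have "(\<lambda>j. ennreal ((norm (Y j x - Y i x))^2)) \<longlonglongrightarrow> ennreal ((norm (?l x - Y i x))^2)"
    by (intro tendsto_ennrealI tendsto_intros)
   then show "ennreal ((norm (?l x - Y i x))^2) = liminf (\<lambda>j. ennreal ((norm (Y j x - Y i x))^2))"
    by (rule lim_imp_Liminf[OF sequentially_bot, symmetric])
  qed
  also have "... \<le> liminf (\<lambda>j. \<integral>\<^sup>+x. ennreal ((norm (Y j x - Y i x))^2) \<partial>P)"
   by (rule nn_integral_liminf) measurable
  also have "... \<le> ennreal ((1/4) ^ i)"
  proof (rule Liminf_le)
   show "\<forall>\<^sub>F j in sequentially. (\<integral>\<^sup>+x. ennreal ((norm (Y j x - Y i x))^2) \<partial>P) \<le> ennreal ((1/4) ^ i)"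
    unfolding eventually_sequentially
   proof (intro exI[of _ i] allI impI)
    fix j assume "i \<le> j"
    have "(\<integral>\<^sup>+x. ennreal ((norm (Y j x - Y i x))^2) \<partial>P) = ennreal (LINT x|P. (norm (Y j x - Y i x))^2)"
     by (intro nn_integral_eq_integral sqint_integrable sqint_diff Y AE_I2) auto
    then show "(\<integral>\<^sup>+x. ennreal ((norm (Y j x - Y i x))^2) \<partial>P) \<le> ennreal ((1/4) ^ i)"
     using ca[OF \<open>i \<le> j\<close>] by (simp add: ennreal_leI)
   qed
  qed simp
  finally show ?thesis .
 qed
 have si: "sqint P (\<lambda>x. ?l x - Y i x)" for i
  unfolding sqint_def
 proof
  have "(\<integral>\<^sup>+x. ennreal (norm ((norm (?l x - Y i x))^2)) \<partial>P) < \<infinity>"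
   using le_less_trans[OF fat[of i] ennreal_less_top] by simp
  then show "integrable P (\<lambda>x. (norm (?l x - Y i x))^2)" by (intro integrableI_bounded) auto
 qed measurable
 show "sqint P ?l" using sqint_add[OF si[of 0] Y[of 0]] by simp
 show "(LINT x|P. (norm (?l x - Y i x))^2) \<le> (1/4) ^ i"
  using fat[of i] nn_integral_eq_integral[OF sqint_integrable[OF si[of i]]]
  by (simp add: ennreal_le_iff)
qed

lemma integral_sum3_le:
 fixes u v w :: "'p => 'b::euclidean_space"
 assumes "sqint P u" "sqint P v" "sqint P w"
 shows "(LINT x|P. (norm (u x + v x + w x))^2) \<le> 4 * (LINT x|P. (norm (u x))^2) + 4 * (LINT x|P. (norm (v x))^2) + 2 * (LINT x|P. (norm (w x))^2)"
proof -
 note i = assms[THEN sqint_integrable]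
 have "(LINT x|P. (norm (u x + v x + w x))^2) \<le> (LINT x|P. 4 * (norm (u x))^2 + 4 * (norm (v x))^2 + 2 * (norm (w x))^2)"
  using i sqint_integrable[OF sqint_add[OF sqint_add[OF assms(1,2)] assms(3)]]
  by (intro integral_mono norm_add3_power2_le) auto
 also have "... = 4 * (LINT x|P. (norm (u x))^2) + 4 * (LINT x|P. (norm (v x))^2) + 2 * (LINT x|P. (norm (w x))^2)"
  using i by simp
 finally show ?thesis .
qed

text \<open>Equicontinuity in time upgrades convergence in \<open>L\<^sup>2\<close> of space-time to convergence in \<open>L\<^sup>2(\<Omega>)\<close>
 uniformly in time: average over a time interval on which the slices hardly move.\<close>

lemma slice_bound:
 fixes u :: "real => 'a::euclidean_space => real"
 assumes Om: "Om \<in> sets borel" and d: "0 < d" "d \<le> T" and t: "t \<in> {0..T}"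
  and um: "(\<lambda>z. ev u z) \<in> borel_measurable borel"
  and uQ: "sqint (dm (Om \<times> {0<..<T})) (\<lambda>z. ev u z)"
  and us: "\<And>t. t \<in> {0..T} ==> sqint (dm Om) (u t)"
  and eq: "\<And>s. s \<in> {0..T} ==> \<bar>s - t\<bar> \<le> d ==> (LINT x|dm Om. (u t x - u s x)^2) \<le> \<eta>"
 shows "(LINT x|dm Om. (u t x)^2) \<le> 2 / d * (LINT z|dm (Om \<times> {0<..<T}). (ev u z)^2) + 2 * \<eta>"
proof -
 \<comment> \<open>An interval of length \<open>d\<close> inside the time range and within distance
   \<open>d\<close> of \<open>t\<close>, also when \<open>t\<close> is close to
   \<open>T\<close>.\<close>
 define l where "l = min t (T - d)"
 define I where "I = {l<..<l + d}"
 have I: "I \<subseteq> {0<..<T}" "\<And>s. s \<in> I ==> \<bar>s - t\<bar> \<le> d"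
  using t d by (auto simp: I_def l_def min_def abs_le_iff split: if_splits)
 have Is: "I \<in> sets borel" "bounded I" by (auto simp: I_def simp flip: box_real)
 have mI: "measure lborel I = d" using d by (simp add: I_def)
 let ?f = "\<lambda>s. LINT x|dm Om. (u s x)^2"
 have fi: "integrable (dm (Om \<times> {0<..<T})) (\<lambda>z. (ev u z)^2)" using sqint_integrable[OF uQ] by simp
 have m2: "(\<lambda>z. (ev u z)^2) \<in> borel_measurable borel" using um by measurable
 have QF: "(LINT z|dm (Om \<times> {0<..<T}). (ev u z)^2) = (LINT s|dm {0<..<T}. ?f s)"
  by (subst integral_dm_Times(2)[OF Om _ m2 fi]) auto
 have fm: "?f \<in> borel_measurable borel"
 proof -
  have "(\<lambda>(s, x). indicator Om x *\<^sub>R (u s x)^2) \<in> borel_measurable (lborel \<Otimes>\<^sub>M lborel)"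
  proof -
   have sw: "(\<lambda>z::real \<times> 'a. (snd z, fst z)) \<in> borel_measurable borel"
    by (intro borel_measurable_continuous_onI continuous_intros)
   have "(\<lambda>z. (u (fst z) (snd z))^2) \<in> borel_measurable borel"
    using measurable_compose[OF sw m2] by simp
   then show ?thesis unfolding lborel_prod split_beta' using Om snd_borel_measurable by measurable
  qed
  from lborel.borel_measurable_lebesgue_integral[OF this]
  have "(\<lambda>s. LINT x|lborel. indicator Om x *\<^sub>R (u s x)^2) \<in> borel_measurable borel" by simp
  moreover have "(\<lambda>x. (u s x)^2) \<in> borel_measurable borel" for s
  proof -
   have pm: "(\<lambda>x::'a. (x, s)) \<in> borel_measurable borel" by (intro borel_measurable_continuous_onI continuous_intros)
   show ?thesis using measurable_compose[OF pm m2] by simp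
  qed
  ultimately show ?thesis using Om by (simp add: integral_dm)
 qed
 have fint: "integrable (dm {0<..<T}) ?f"
 proof -
  have "integrable (lborel \<Otimes>\<^sub>M lborel) (\<lambda>(x, s). indicator (Om \<times> {0<..<T}) (x, s) *\<^sub>R (u s x)^2)"
   using fi m2 Om by (subst (asm) integrable_dm_iff) (auto simp: lborel_prod split_beta' intro!: Times_sets_borel)
  from lborel_pair.integrable_snd[OF this]
  have "integrable lborel (\<lambda>s. LINT x|lborel. indicator (Om \<times> {0<..<T}) (x, s) *\<^sub>R (u s x)^2)" .
  moreover have "(LINT x|lborel. indicator (Om \<times> {0<..<T}) (x, s) *\<^sub>R (u s x)^2) = indicator {0<..<T} s *\<^sub>R ?f s" for s
  proof -
   have pm: "(\<lambda>x::'a. (x, s)) \<in> borel_measurable borel" by (intro borel_measurable_continuous_onI continuous_intros)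
   have "(\<lambda>x. (u s x)^2) \<in> borel_measurable borel" using measurable_compose[OF pm m2] by simp
   then show ?thesis using Om by (auto simp: integral_dm indicator_def)
  qed
  ultimately show ?thesis using fm by (subst integrable_dm_iff) auto
 qed
 have fI: "integrable (dm I) ?f" "(LINT s|dm I. ?f s) \<le> (LINT s|dm {0<..<T}. ?f s)"
 proof -
  have i1: "integrable lborel (\<lambda>s. indicator {0<..<T} s *\<^sub>R ?f s)" using fint fm by (subst (asm) integrable_dm_iff) auto
  have i2: "integrable lborel (\<lambda>s. indicator I s *\<^sub>R ?f s)"
   by (rule lintegrable_bound[OF i1])
     (use fm Is I in \<open>auto simp: indicator_def intro!: AE_I2\<close>)
  show "integrable (dm I) ?f" using i2 fm Is by (subst integrable_dm_iff) auto
  have "(LINT s|lborel. indicator I s *\<^sub>R ?f s) \<le> (LINT s|lborel. indicator {0<..<T} s *\<^sub>R ?f s)"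
   by (intro integral_mono i1 i2) (use I in \<open>auto simp: indicator_def\<close>)
  then show "(LINT s|dm I. ?f s) \<le> (LINT s|dm {0<..<T}. ?f s)" using fm Is by (simp add: integral_dm)
 qed
 interpret finite_measure "dm I" by (rule finite_measure_dm[OF Is])
 have "d * ?f t = (LINT s|dm I. ?f t)" using Is by (simp add: measure_dm mI)
 also have "... \<le> (LINT s|dm I. 2 * ?f s + 2 * \<eta>)"
 proof (intro integral_mono_AE AE_dmI Is)
  show "integrable (dm I) (\<lambda>s. 2 * ?f s + 2 * \<eta>)" using fI(1) by auto
  fix s assume s: "s \<in> I"
  then have sT: "s \<in> {0..T}" using I by auto
  have "?f t \<le> (LINT x|dm Om. 2 * (u s x)^2 + 2 * (u t x - u s x)^2)"
  proof (rule integral_mono)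
   show "integrable (dm Om) (\<lambda>x. (u t x)^2)" using sqint_integrable[OF us[OF t]] by simp
   show "integrable (dm Om) (\<lambda>x. 2 * (u s x)^2 + 2 * (u t x - u s x)^2)"
    using sqint_integrable[OF us[OF sT]] sqint_integrable[OF sqint_diff[OF us[OF t] us[OF sT]]] by simp
   show "(u t x)^2 \<le> 2 * (u s x)^2 + 2 * (u t x - u s x)^2" for x
    using sum_power2_le[of "u s x" "u t x - u s x"] by simp
  qed
  also have "... = 2 * ?f s + 2 * (LINT x|dm Om. (u t x - u s x)^2)"
   using sqint_integrable[OF us[OF sT]] sqint_integrable[OF sqint_diff[OF us[OF t] us[OF sT]]] by simp
  also have "... \<le> 2 * ?f s + 2 * \<eta>" using eq[OF sT I(2)[OF s]] by simp
  finally show "?f t \<le> 2 * ?f s + 2 * \<eta>" .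
 qed auto
 also have "... = 2 * (LINT s|dm I. ?f s) + 2 * \<eta> * d" using fI(1) Is by (simp add: measure_dm mI)
 also have "... \<le> 2 * (LINT s|dm {0<..<T}. ?f s) + 2 * \<eta> * d" using fI(2) by simp
 finally have "?f t \<le> (2 * (LINT s|dm {0<..<T}. ?f s) + 2 * \<eta> * d) / d"
  using d by (simp add: pos_le_divide_eq mult.commute)
 also have "... = 2 / d * (LINT s|dm {0<..<T}. ?f s) + 2 * \<eta>" using d by (simp add: field_simps)
 finally show ?thesis unfolding QF .
qed

text \<open>Convex combinations are chosen for the pair of function and gradient, so one sequence of
  coefficients serves both. \<open>slice_bound\<close> makes the same combinations Cauchy on every
  time slice, uniformly in \<open>t\<close>, and a fast subsequence of them is passed to
  \<open>L2_fast_limit\<close>.\<close>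

lemma evolution_compactness:
 fixes \<Phi> :: "nat => real => 'a::euclidean_space => real" and G :: "nat => real => 'a => 'a"
 assumes Om: "Om \<in> sets borel" "bounded Om" and T: "T > 0"
  and \<Phi>m: "\<And>k. (\<lambda>z. ev (\<Phi> k) z) \<in> borel_measurable borel"
  and Gm: "\<And>k. (\<lambda>z. ev (G k) z) \<in> borel_measurable borel"
  and \<Phi>Q: "\<And>k. sqint (dm (Om \<times> {0<..<T})) (\<lambda>z. ev (\<Phi> k) z)"
  and GQ: "\<And>k. sqint (dm (Om \<times> {0<..<T})) (\<lambda>z. ev (G k) z)"
  and \<Phi>C: "\<And>k. (LINT z|dm (Om \<times> {0<..<T}). (ev (\<Phi> k) z)^2) \<le> C1"
  and GC: "\<And>k. (LINT z|dm (Om \<times> {0<..<T}). (norm (ev (G k) z))^2) \<le> C2"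
  and \<Phi>s: "\<And>k t. t \<in> {0..T} ==> sqint (dm Om) (\<Phi> k t)"
  and eqc: "\<And>\<eta>. \<eta> > 0 ==> \<exists>d>0. \<exists>K. \<forall>k\<ge>K. \<forall>s\<in>{0..T}. \<forall>t\<in>{0..T}. \<bar>s - t\<bar> \<le> d \<longrightarrow>
    (LINT x|dm Om. (\<Phi> k s x - \<Phi> k t x)^2) \<le> \<eta>"
 obtains c L \<phi> g where "\<And>j. adm j (c j) (L j)"
  "(\<lambda>z. ev \<phi> z) \<in> borel_measurable borel" "(\<lambda>z. ev g z) \<in> borel_measurable borel"
  "sqint (dm (Om \<times> {0<..<T})) (\<lambda>z. ev \<phi> z)" "sqint (dm (Om \<times> {0<..<T})) (\<lambda>z. ev g z)"
  "\<And>t. t \<in> {0..T} ==> sqint (dm Om) (\<phi> t)"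
  "\<And>j. (LINT z|dm (Om \<times> {0<..<T}). (ev \<phi> z - comb (\<lambda>k z. ev (\<Phi> k) z) (c j) (L j) z)^2) \<le> (1/4) ^ j"
  "\<And>j. (LINT z|dm (Om \<times> {0<..<T}). (norm (ev g z - comb (\<lambda>k z. ev (G k) z) (c j) (L j) z))^2) \<le> (1/4) ^ j"
  "\<And>j t. t \<in> {0..T} ==> (LINT x|dm Om. (\<phi> t x - comb (\<lambda>k. \<Phi> k t) (c j) (L j) x)^2) \<le> (1/4) ^ j"
  "\<And>t. t \<in> {0..T} ==> ((\<lambda>s. LINT x|dm Om. (\<phi> s x - \<phi> t x)^2) \<longlongrightarrow> 0) (at t within {0..T})"
proof -
 let ?Q = "Om \<times> {0<..<T}"
 have Qs: "?Q \<in> sets borel" "bounded ?Q" using Om by (auto intro!: Times_sets_borel bounded_Times simp flip: box_real)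
 define H where "H k z = (ev (\<Phi> k) z, ev (G k) z)" for k z
 have nH: "(norm (p :: real \<times> 'a))^2 = (norm (fst p))^2 + (norm (snd p))^2" for p
  by (cases p) (simp add: norm_Pair)
 have Hq: "sqint (dm ?Q) (H k)" for k
  unfolding sqint_def
 proof
  show "H k \<in> borel_measurable (dm ?Q)" unfolding H_def[abs_def] measurable_dm using \<Phi>m Gm by measurable
  show "integrable (dm ?Q) (\<lambda>x. (norm (H k x))^2)"
   unfolding nH H_def fst_conv snd_conv
   using sqint_integrable[OF \<Phi>Q] sqint_integrable[OF GQ] by (intro lintegrable_add)
 qed
 have HC: "(LINT z|dm ?Q. (norm (H k z))^2) \<le> C1 + C2" for k
 proof -
  have "(LINT z|dm ?Q. (norm (H k z))^2) = (LINT z|dm ?Q. (norm (ev (\<Phi> k) z))^2) + (LINT z|dm ?Q. (norm (ev (G k) z))^2)"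
   unfolding nH H_def fst_conv snd_conv
   by (intro lint_add sqint_integrable \<Phi>Q GQ)
  then show ?thesis using \<Phi>C[of k] GC[of k] by simp
 qed
 obtain c0 L0 where adm0: "\<And>j. adm j (c0 j) (L0 j)" and cau0:
  "\<And>\<eta>. \<eta> > 0 ==> \<exists>J. \<forall>i\<ge>J. \<forall>j\<ge>J. (LINT x|dm ?Q. (norm (comb H (c0 i) (L0 i) x - comb H (c0 j) (L0 j) x))^2) \<le> \<eta>"
  by (rule mazur[where H=H, OF Hq HC]) (rule that)
 define F where "F c L t = comb (\<lambda>k. \<Phi> k t) c L" for c L t
 define FG where "FG c L z = comb (\<lambda>k z. ev (G k) z) c L z" for c L z
 have Fz: "ev (F c L) z = comb (\<lambda>k z. ev (\<Phi> k) z) c L z" for c L z by (simp add: F_def comb_def)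
 have compH: "comb H c L z = (ev (F c L) z, FG c L z)" for c L z
  unfolding F_def FG_def comb_def H_def by (rule prod_eqI) (simp_all add: fst_sum snd_sum)
 have Fm: "(\<lambda>z. ev (F c L) z) \<in> borel_measurable borel" for c L
  unfolding Fz comb_def using \<Phi>m by measurable
 have FGm: "FG c L \<in> borel_measurable borel" for c L
  unfolding FG_def[abs_def] comb_def using Gm by measurable
 have FQ: "sqint (dm ?Q) (\<lambda>z. ev (F c L) z)" for c L unfolding Fz by (rule sqint_comb[OF \<Phi>Q])
 have FGQ: "sqint (dm ?Q) (FG c L)" for c L unfolding FG_def[abs_def] by (rule sqint_comb[OF GQ])
 have Fs: "sqint (dm Om) (F c L t)" if "t \<in> {0..T}" for c L t unfolding F_def by (rule sqint_comb[OF \<Phi>s[OF that]])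
 have normH: "(LINT z|dm ?Q. (norm (comb H c L z - comb H c' L' z))^2) =
   (LINT z|dm ?Q. (ev (F c L) z - ev (F c' L') z)^2) + (LINT z|dm ?Q. (norm (FG c L z - FG c' L' z))^2)" for c L c' L'
 proof -
  have "(LINT z|dm ?Q. (norm (comb H c L z - comb H c' L' z))^2) =
   (LINT z|dm ?Q. (norm (ev (F c L) z - ev (F c' L') z))^2 + (norm (FG c L z - FG c' L' z))^2)"
   unfolding nH compH by simp
  also have "... = (LINT z|dm ?Q. (norm (ev (F c L) z - ev (F c' L') z))^2) + (LINT z|dm ?Q. (norm (FG c L z - FG c' L' z))^2)"
   by (intro lint_add sqint_integrable sqint_diff FQ FGQ)
  finally show ?thesis by simp
 qed
 have eqF: "\<exists>d>0. \<exists>K. \<forall>j\<ge>K. \<forall>c L. adm j c L \<longrightarrow> (\<forall>s\<in>{0..T}. \<forall>t\<in>{0..T}. \<bar>s - t\<bar> \<le> d \<longrightarrow>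
    (LINT x|dm Om. (F c L s x - F c L t x)^2) \<le> \<eta>)" if \<eta>: "\<eta> > 0" for \<eta>
 proof -
  obtain d K where d: "d > 0" and K: "\<And>k s t. k \<ge> K ==> s \<in> {0..T} ==> t \<in> {0..T} ==> \<bar>s - t\<bar> \<le> d ==>
    (LINT x|dm Om. (\<Phi> k s x - \<Phi> k t x)^2) \<le> \<eta>" using eqc[OF \<eta>] by blast
  have "(LINT x|dm Om. (F c L s x - F c L t x)^2) \<le> \<eta>"
   if "j \<ge> K" "adm j c L" "s \<in> {0..T}" "t \<in> {0..T}" "\<bar>s - t\<bar> \<le> d" for j c L s t
  proof -
   have eq: "F c L s x - F c L t x = comb (\<lambda>k x. \<Phi> k s x - \<Phi> k t x) c L x" for x
    by (simp add: F_def comb_def right_diff_distrib sum_subtractf)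
   have "(LINT x|dm Om. (norm (comb (\<lambda>k x. \<Phi> k s x - \<Phi> k t x) c L x))^2) \<le> \<eta>"
    by (rule comb_bound[OF sqint_diff[OF \<Phi>s \<Phi>s] that(2)]) (use that K in auto)
   then show ?thesis unfolding eq by simp
  qed
  then show ?thesis using d by blast
 qed
 have cauC: "\<exists>J. \<forall>i\<ge>J. \<forall>j\<ge>J. (LINT x|dm ?Q. (norm (comb H (c0 i) (L0 i) x - comb H (c0 j) (L0 j) x))^2) \<le> \<eta> \<and>
   (\<forall>t\<in>{0..T}. (LINT x|dm Om. (F (c0 i) (L0 i) t x - F (c0 j) (L0 j) t x)^2) \<le> \<eta>)" if \<eta>: "\<eta> > 0" for \<eta>
 proof -
  have "\<eta> / 16 > 0" using \<eta> by simp
  from eqF[OF this] obtain d0 K where d0: "d0 > 0" and K': "\<forall>j\<ge>K. \<forall>c L. adm j c L \<longrightarrow> (\<forall>s\<in>{0..T}. \<forall>t\<in>{0..T}. \<bar>s - t\<bar> \<le> d0 \<longrightarrow>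
    (LINT x|dm Om. (F c L s x - F c L t x)^2) \<le> \<eta> / 16)" by blast
  have K: "\<And>j s t. j \<ge> K ==> s \<in> {0..T} ==> t \<in> {0..T} ==> \<bar>s - t\<bar> \<le> d0 ==>
    (LINT x|dm Om. (F (c0 j) (L0 j) s x - F (c0 j) (L0 j) t x)^2) \<le> \<eta> / 16"
   using K' adm0 by blast
  define d where "d = min d0 T"
  have d: "0 < d" "d \<le> T" "d \<le> d0" using d0 T by (auto simp: d_def)
  \<comment> \<open>The space-time distance is required below \<open>\<eta> * d / 4\<close> so that
    the factor \<open>2 / d\<close> of \<open>slice_bound\<close> leaves \<open>\<eta> / 2\<close>;
    the other half is twice the oscillation bound \<open>\<eta> / 4\<close>.\<close>
  obtain J where J: "\<And>i j. i \<ge> J ==> j \<ge> J ==> (LINT x|dm ?Q. (norm (comb H (c0 i) (L0 i) x - comb H (c0 j) (L0 j) x))^2) \<le> min \<eta> (\<eta> * d / 4)"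
   using cau0[of "min \<eta> (\<eta> * d / 4)"] \<eta> d by (auto simp: min_less_iff_conj)
  have "(LINT x|dm Om. (F (c0 i) (L0 i) t x - F (c0 j) (L0 j) t x)^2) \<le> \<eta>"
   if ij: "i \<ge> max J K" "j \<ge> max J K" and t: "t \<in> {0..T}" for i j t
  proof -
   define u where "u t x = F (c0 i) (L0 i) t x - F (c0 j) (L0 j) t x" for t x
   have "(LINT x|dm Om. (u t x)^2) \<le> 2 / d * (LINT z|dm ?Q. (ev u z)^2) + 2 * (\<eta> / 4)"
   proof (rule slice_bound[OF Om(1) d(1,2) t])
    show "(\<lambda>z. ev u z) \<in> borel_measurable borel" unfolding u_def using Fm by measurable
    show "sqint (dm ?Q) (\<lambda>z. ev u z)" unfolding u_def by (intro sqint_diff FQ)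
    show "sqint (dm Om) (u t)" if "t \<in> {0..T}" for t unfolding u_def by (intro sqint_diff Fs that)
    fix s assume s: "s \<in> {0..T}" "\<bar>s - t\<bar> \<le> d"
    let ?p = "\<lambda>x. F (c0 i) (L0 i) t x - F (c0 i) (L0 i) s x" and ?q = "\<lambda>x. F (c0 j) (L0 j) t x - F (c0 j) (L0 j) s x"
    have sq: "sqint (dm Om) ?p" "sqint (dm Om) ?q" by (intro sqint_diff Fs s t)+
    have "(LINT x|dm Om. (u t x - u s x)^2) = (LINT x|dm Om. (norm (?p x - ?q x))^2)"
     unfolding u_def by (intro lint_cong refl) (simp add: algebra_simps)
    also have "... \<le> (LINT x|dm Om. 2 * (norm (?p x))^2 + 2 * (norm (?q x))^2)"
     using sqint_integrable[OF sq(1)] sqint_integrable[OF sq(2)] sqint_integrable[OF sqint_diff[OF sq]]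
     by (intro integral_mono norm_diff_power2_le) auto
    also have "... = 2 * (LINT x|dm Om. (?p x)^2) + 2 * (LINT x|dm Om. (?q x)^2)"
     using sqint_integrable[OF sq(1)] sqint_integrable[OF sq(2)] by simp
    also have "... \<le> 2 * (\<eta> / 16) + 2 * (\<eta> / 16)"
     using K[of i t s] K[of j t s] ij s t d(3) by (intro add_mono mult_left_mono) (auto simp: abs_minus_commute)
    finally show "(LINT x|dm Om. (u t x - u s x)^2) \<le> \<eta> / 4" by simp
   qed
   moreover have "2 / d * (LINT z|dm ?Q. (ev u z)^2) \<le> 2 / d * (\<eta> * d / 4)"
   proof (rule mult_left_mono)
    have "(LINT z|dm ?Q. (norm (FG (c0 i) (L0 i) z - FG (c0 j) (L0 j) z))^2) \<ge> 0" by simp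
    moreover have "(LINT z|dm ?Q. (ev u z)^2) + (LINT z|dm ?Q. (norm (FG (c0 i) (L0 i) z - FG (c0 j) (L0 j) z))^2) \<le> min \<eta> (\<eta> * d / 4)"
     using J[of i j] ij unfolding normH u_def by (simp only: max.bounded_iff)
    ultimately show "(LINT z|dm ?Q. (ev u z)^2) \<le> \<eta> * d / 4" by linarith
   qed (use d in auto)
   moreover have "2 / d * (\<eta> * d / 4) = \<eta> / 2" using d by simp
   moreover have "a \<le> e" if "a \<le> b + 2 * (e / 4)" "b \<le> f" "f = e / 2" for a b e f :: real using that by simp
   ultimately have "(LINT x|dm Om. (u t x)^2) \<le> \<eta>" by blast
   then show ?thesis by (simp only: u_def)
  qed
  then show ?thesis using J by (intro exI[of _ "max J K"]) auto
 qed
 have "\<exists>J. \<forall>n. \<forall>i\<ge>J n. \<forall>j\<ge>J n. (LINT x|dm ?Q. (norm (comb H (c0 i) (L0 i) x - comb H (c0 j) (L0 j) x))^2) \<le> (1/4)^n \<and>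
   (\<forall>t\<in>{0..T}. (LINT x|dm Om. (F (c0 i) (L0 i) t x - F (c0 j) (L0 j) t x)^2) \<le> (1/4)^n)"
  by (rule choice) (intro allI cauC, simp)
 then obtain J where J0: "\<forall>n. \<forall>i\<ge>J n. \<forall>j\<ge>J n. (LINT x|dm ?Q. (norm (comb H (c0 i) (L0 i) x - comb H (c0 j) (L0 j) x))^2) \<le> (1/4)^n \<and>
   (\<forall>t\<in>{0..T}. (LINT x|dm Om. (F (c0 i) (L0 i) t x - F (c0 j) (L0 j) t x)^2) \<le> (1/4)^n)" by (rule exE)
 have J: "\<And>n i j. i \<ge> J n ==> j \<ge> J n ==> (LINT x|dm ?Q. (norm (comb H (c0 i) (L0 i) x - comb H (c0 j) (L0 j) x))^2) \<le> (1/4)^n"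
   "\<And>n i j t. i \<ge> J n ==> j \<ge> J n ==> t \<in> {0..T} ==> (LINT x|dm Om. (F (c0 i) (L0 i) t x - F (c0 j) (L0 j) t x)^2) \<le> (1/4)^n"
  using J0 by blast+
 \<comment> \<open>Beyond the thresholds of all exponents up to \<open>n\<close>, and at least
   \<open>n\<close> so that the index bound in \<open>adm\<close> is kept.\<close>
 define r where "r n = Max (J ` {..n}) + n" for n
 have r: "r n \<ge> J m" if "m \<le> n" for m n
 proof -
  have "J m \<le> Max (J ` {..n})" using that by (intro Max_ge) auto
  then show ?thesis by (simp add: r_def)
 qed
 have rn: "r n \<ge> n" for n by (simp add: r_def)
 define c where "c n = c0 (r n)" for n
 define L where "L n = L0 (r n)" for n
 have adm: "adm n (c n) (L n)" for n unfolding c_def L_def by (rule adm_mono[OF adm0 rn])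
 define \<phi> where "\<phi> t x = lim (\<lambda>n. F (c n) (L n) t x)" for t x
 define g where "g t x = lim (\<lambda>n. FG (c n) (L n) (x, t))" for t x
 have fQ: "finite_measure (dm ?Q)" by (rule finite_measure_dm[OF Qs])
 have fOm: "finite_measure (dm Om)" by (rule finite_measure_dm[OF Om])
 have caF: "(LINT z|dm ?Q. (norm (ev (F (c j) (L j)) z - ev (F (c i) (L i)) z))^2) \<le> (1/4)^i"
  and caG: "(LINT z|dm ?Q. (norm (FG (c j) (L j) z - FG (c i) (L i) z))^2) \<le> (1/4)^i" if "i \<le> j" for i j
 proof -
  have "(LINT z|dm ?Q. (norm (comb H (c j) (L j) z - comb H (c i) (L i) z))^2) \<le> (1/4)^i"
   unfolding c_def L_def using that by (intro J(1) r) auto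
  moreover have "(LINT z|dm ?Q. (norm (FG (c j) (L j) z - FG (c i) (L i) z))^2) \<ge> 0"
   "(LINT z|dm ?Q. (ev (F (c j) (L j)) z - ev (F (c i) (L i)) z)^2) \<ge> 0" by simp_all
  ultimately show "(LINT z|dm ?Q. (norm (ev (F (c j) (L j)) z - ev (F (c i) (L i)) z))^2) \<le> (1/4)^i"
   "(LINT z|dm ?Q. (norm (FG (c j) (L j) z - FG (c i) (L i) z))^2) \<le> (1/4)^i"
   unfolding normH real_norm_def power2_abs by linarith+
 qed
 have caS: "(LINT x|dm Om. (norm (F (c j) (L j) t x - F (c i) (L i) t x))^2) \<le> (1/4)^i" if "i \<le> j" "t \<in> {0..T}" for i j t
  using J(2)[of i "r j" "r i" t] r[of i j] r[of i i] that by (simp add: c_def L_def)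
 note limF = L2_fast_limit[OF fQ FQ caF]
 note limG = L2_fast_limit[OF fQ FGQ caG]
 have limS: "sqint (dm Om) (\<phi> t)" "(LINT x|dm Om. (\<phi> t x - F (c i) (L i) t x)^2) \<le> (1/4)^i" if t: "t \<in> {0..T}" for t i
  using L2_fast_limit(2,3)[OF fOm Fs[OF t] caS[OF _ t]] unfolding \<phi>_def[abs_def] by simp_all
 show ?thesis
 proof (rule that[of c L \<phi> g])
  show "\<And>j. adm j (c j) (L j)" by (rule adm)
  show "(\<lambda>z. ev \<phi> z) \<in> borel_measurable borel"
   unfolding \<phi>_def using Fm by measurable
  show "(\<lambda>z. ev g z) \<in> borel_measurable borel"
   unfolding g_def prod.collapse using FGm by measurable
  show "sqint (dm ?Q) (\<lambda>z. ev \<phi> z)" unfolding \<phi>_def using limF(2) .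
  show "sqint (dm ?Q) (\<lambda>z. ev g z)" unfolding g_def prod.collapse using limG(2) .
  show "sqint (dm Om) (\<phi> t)" if "t \<in> {0..T}" for t by (rule limS(1)[OF that])
  show "(LINT z|dm ?Q. (ev \<phi> z - comb (\<lambda>k z. ev (\<Phi> k) z) (c j) (L j) z)^2) \<le> (1/4) ^ j" for j
   using limF(3)[of j] unfolding \<phi>_def Fz[symmetric] by simp
  show "(LINT z|dm ?Q. (norm (ev g z - comb (\<lambda>k z. ev (G k) z) (c j) (L j) z))^2) \<le> (1/4) ^ j" for j
   using limG(3)[of j] unfolding g_def FG_def[symmetric] prod.collapse by simp
  show "(LINT x|dm Om. (\<phi> t x - comb (\<lambda>k. \<Phi> k t) (c j) (L j) x)^2) \<le> (1/4) ^ j" if "t \<in> {0..T}" for j t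
   using limS(2)[OF that, of j] unfolding F_def .
  fix t assume t: "t \<in> {0..T}"
  show "((\<lambda>s. LINT x|dm Om. (\<phi> s x - \<phi> t x)^2) \<longlongrightarrow> 0) (at t within {0..T})"
  proof (rule tendstoI)
   fix \<eta> :: real assume \<eta>: "\<eta> > 0"
   have "\<eta> / 16 > 0" using \<eta> by simp
   from eqF[OF this] obtain d K where d: "d > 0" and K': "\<forall>j\<ge>K. \<forall>c L. adm j c L \<longrightarrow> (\<forall>s\<in>{0..T}. \<forall>t\<in>{0..T}. \<bar>s - t\<bar> \<le> d \<longrightarrow>
    (LINT x|dm Om. (F c L s x - F c L t x)^2) \<le> \<eta> / 16)" by blast
   have K: "\<And>j s t. j \<ge> K ==> s \<in> {0..T} ==> t \<in> {0..T} ==> \<bar>s - t\<bar> \<le> d ==>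
    (LINT x|dm Om. (F (c j) (L j) s x - F (c j) (L j) t x)^2) \<le> \<eta> / 16"
    using K' adm by blast
   obtain j0 where j0: "(1/4::real) ^ j0 < \<eta> / 32" using real_arch_pow_inv[of "\<eta>/32" "1/4"] \<eta> by auto
   define j where "j = max j0 K"
   have "(1/4::real) ^ j \<le> (1/4) ^ j0" by (intro power_decreasing) (auto simp: j_def)
   then have j: "(1/4::real) ^ j < \<eta> / 32" "j \<ge> K" using j0 by (linarith, simp add: j_def)
   have key: "(LINT x|dm Om. (\<phi> s x - \<phi> t x)^2) < \<eta>" if s: "s \<in> {0..T}" "\<bar>s - t\<bar> \<le> d" for s
   proof -
    let ?u = "\<lambda>x. \<phi> s x - F (c j) (L j) s x" and ?v = "\<lambda>x. F (c j) (L j) s x - F (c j) (L j) t x"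
     and ?w = "\<lambda>x. F (c j) (L j) t x - \<phi> t x"
    have "(LINT x|dm Om. (\<phi> s x - \<phi> t x)^2) = (LINT x|dm Om. (norm (?u x + ?v x + ?w x))^2)"
     by (intro lint_cong refl) simp
    also have "... \<le> 4 * (LINT x|dm Om. (norm (?u x))^2) + 4 * (LINT x|dm Om. (norm (?v x))^2) + 2 * (LINT x|dm Om. (norm (?w x))^2)"
     by (intro integral_sum3_le sqint_diff limS(1) Fs s t)
    also have "(LINT x|dm Om. (norm (?w x))^2) = (LINT x|dm Om. (\<phi> t x - F (c j) (L j) t x)^2)"
     by (simp add: power2_commute)
    finally have le: "(LINT x|dm Om. (\<phi> s x - \<phi> t x)^2) \<le> 4 * (LINT x|dm Om. (\<phi> s x - F (c j) (L j) s x)^2)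
     + 4 * (LINT x|dm Om. (F (c j) (L j) s x - F (c j) (L j) t x)^2) + 2 * (LINT x|dm Om. (\<phi> t x - F (c j) (L j) t x)^2)"
     by simp
    have gen: "a < \<eta>" if "a \<le> 4 * b + 4 * e + 2 * f" "b \<le> q" "e \<le> \<eta> / 16" "f \<le> q" "q < \<eta> / 32" for a b e f q :: real
     using that \<eta> by argo
    show ?thesis by (rule gen[OF le limS(2)[OF s(1)] K[OF j(2) s(1) t s(2)] limS(2)[OF t] j(1)])
   qed
   show "\<forall>\<^sub>F s in at t within {0..T}. dist (LINT x|dm Om. (\<phi> s x - \<phi> t x)^2) 0 < \<eta>"
    unfolding eventually_at using key d
    by (intro exI[of _ d]) (auto simp: dist_real_def abs_of_nonneg intro!: key)
  qed
 qed
qed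

section \<open>Equicontinuity in time\<close>

text \<open>Approximation by continuous functions, made concrete: the approximants are projected
  onto the ball of radius \<open>M\<close>, which keeps them continuous and provides the dominating
  function on a bounded window.\<close>

lemma translation_continuity_L1:
 fixes f :: "real => 'b::euclidean_space"
 assumes fm: "f \<in> borel_measurable borel" and fM: "\<And>t. norm (f t) \<le> M" and f0: "\<And>t. t \<notin> {0<..<T} ==> f t = 0"
  and T: "T > 0" and \<eta>: "\<eta> > 0"
 shows "\<exists>d>0. \<forall>s. \<bar>s\<bar> < d \<longrightarrow> integrable lborel (\<lambda>t. norm (f (t + s) - f t)) \<and> (LINT t|lborel. norm (f (t + s) - f t)) \<le> \<eta>"
proof -
 note [measurable] = fm
 have M0: "M \<ge> 0" using order_trans[OF norm_ge_zero fM] .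
 have "f \<in> borel_measurable lebesgue" using fm by (rule borel_measurable_if_I[where S=UNIV, simplified] | simp add: measurable_completion)
 then have "f measurable_on UNIV" using measurable_on_iff_borel_measurable[of UNIV f] by simp
 then obtain Z g where Z: "negligible Z" and gc: "\<And>n. continuous_on UNIV (g n :: real => 'b)"
  and gl: "\<And>x. x \<notin> Z ==> (\<lambda>n. g n x) \<longlonglongrightarrow> (if x \<in> UNIV then f x else 0)"
  unfolding measurable_on_def by auto
 define c where "c = closest_point (cball (0::'b) M)"
 have cc: "continuous_on UNIV c" unfolding c_def using M0 by (intro continuous_on_closest_point) auto
 have cb: "norm (c x) \<le> M" for x
  using closest_point_in_set[of "cball (0::'b) M" x] M0 by (auto simp: c_def)
 have cf: "c (f t) = f t" for t unfolding c_def using fM by (intro closest_point_self) auto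
 define G where "G n t = c (g n t)" for n t
 have Gc: "continuous_on UNIV (G n)" for n unfolding G_def[abs_def]
  by (rule continuous_on_compose2[OF cc gc]) auto
 have [measurable]: "G n \<in> borel_measurable borel" for n by (rule borel_measurable_continuous_onI[OF Gc])
 have AEZ: "AE t in lborel. t \<notin> Z"
 proof -
  have "Z \<in> null_sets lebesgue" using Z by (simp add: negligible_iff_null_sets)
  then have "AE t in lebesgue. t \<notin> Z" by (rule AE_not_in)
  then show ?thesis by (simp add: AE_completion_iff)
 qed
 \<comment> \<open>Points of the smaller window \<open>?I\<close> stay in \<open>?W\<close> under
   shifts of length below 1, and outside \<open>?I\<close> both values of \<open>f\<close>
   vanish.\<close>
 let ?W = "{-2..T + 2}"
 define u where "u n = (LINT t|lborel. indicator ?W t * norm (f t - G n t))" for n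
 have iW: "integrable lborel (\<lambda>t. indicator ?W t * (2 * M))"
  by (intro integrable_mult_left integrable_real_indicator) (auto simp: emeasure_lborel_Icc_eq)
 have bnd: "norm (f t - G n t) \<le> 2 * M" for t n
  using norm_triangle_ineq4[of "f t" "G n t"] fM[of t] cb[of "g n t"] by (simp add: G_def)
 have "u \<longlonglongrightarrow> (LINT t|(lborel::real measure). 0)"
  unfolding u_def
 proof (rule integral_dominated_convergence[where w="\<lambda>t. indicator ?W t * (2 * M)"])
  show "integrable lborel (\<lambda>t. indicator ?W t * (2 * M))" by (rule iW)
  show "AE t in lborel. (\<lambda>n. indicator ?W t * norm (f t - G n t)) \<longlonglongrightarrow> 0"
   using AEZ
  proof eventually_elim
   fix t assume "t \<notin> Z"
   then have "(\<lambda>n. g n t) \<longlonglongrightarrow> f t" using gl by simp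
   then have "(\<lambda>n. G n t) \<longlonglongrightarrow> c (f t)" unfolding G_def
    using cc by (intro isCont_tendsto_compose[of _ c]) (simp add: continuous_on_eq_continuous_at)
   then have "(\<lambda>n. f t - G n t) \<longlonglongrightarrow> f t - f t" unfolding cf by (intro tendsto_intros)
   then have "(\<lambda>n. indicator ?W t * norm (f t - G n t)) \<longlonglongrightarrow> indicator ?W t * norm (f t - f t)" by (rule tendsto_mult[OF tendsto_const tendsto_norm])
   then show "(\<lambda>n. indicator ?W t * norm (f t - G n t)) \<longlonglongrightarrow> 0" by simp
  qed
  show "AE t in lborel. norm (indicator ?W t * norm (f t - G n t)) \<le> indicator ?W t * (2 * M)" for n
   using bnd by (intro AE_I2) (auto simp: indicator_def)
 qed measurable
 then have "u \<longlonglongrightarrow> 0" by simp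
 moreover have "\<eta> / 3 > 0" using \<eta> by simp
 ultimately have "eventually (\<lambda>n. u n < \<eta> / 3) sequentially" by (rule order_tendstoD(2))
 then obtain n where n: "u n < \<eta> / 3" using eventually_happens trivial_limit_sequentially by blast
 have "uniformly_continuous_on ?W (G n)"
  by (rule compact_uniformly_continuous[OF continuous_on_subset[OF Gc]]) auto
 moreover have "\<eta> / (3 * (T + 2)) > 0" using \<eta> T by simp
 ultimately obtain d where d0: "d > 0" "\<forall>t\<in>?W. \<forall>t'\<in>?W. dist t' t < d \<longrightarrow> dist (G n t') (G n t) < \<eta> / (3 * (T + 2))"
  unfolding uniformly_continuous_on_def by blast
 have d: "d > 0" "\<And>t t'. t \<in> ?W ==> t' \<in> ?W ==> dist t' t < d ==> dist (G n t') (G n t) < \<eta> / (3 * (T + 2))"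
  using d0 by blast+
 show ?thesis
 proof (intro exI[of _ "min d 1"] conjI allI impI)
  show "min d 1 > 0" using d by simp
  fix s assume s: "\<bar>s\<bar> < min d 1"
  let ?I = "{-1..T + 1}"
  define F where "F t = indicator ?W t * norm (f t - G n t)" for t
  have Fi: "integrable lborel F" unfolding F_def
   by (rule lintegrable_bound[OF iW]) (auto intro!: AE_I2 order_trans[OF bnd abs_ge_self] simp: indicator_def)
  have Fsi: "integrable lborel (\<lambda>t. F (s + t))" "(LINT t|lborel. F (s + t)) = u n"
   using integrable_scale[OF Fi, of 1 s] integral_translate[of F s] Fi by (simp_all add: u_def F_def[abs_def])
  have b: "norm (f (t + s) - f t) \<le> F (s + t) + F t + indicator ?I t * (\<eta> / (3 * (T + 2)))" for t
  proof (cases "t \<in> ?I")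
   case True
   then have W: "t \<in> ?W" "s + t \<in> ?W" "dist (s + t) t < d" using s by (auto simp: dist_real_def)
   have "f (t + s) - f t = (f (s + t) - G n (s + t)) + (G n (s + t) - G n t) + (G n t - f t)" by (simp add: add.commute)
   then have "norm (f (t + s) - f t) \<le> norm (f (s + t) - G n (s + t)) + norm (G n (s + t) - G n t) + norm (G n t - f t)"
    by (simp only:) (intro norm_triangle_le add_mono norm_triangle_ineq order_refl)
   also have "norm (G n (s + t) - G n t) \<le> \<eta> / (3 * (T + 2))" using d(2)[OF W(1,2,3)] by (simp add: dist_norm)
   finally show ?thesis using True W by (simp add: F_def norm_minus_commute)
  next
   case False
   then have "f t = 0" "f (t + s) = 0" using s by (auto intro!: f0)
   then show ?thesis using False by (simp add: F_def)
  qed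
  have bi: "integrable lborel (\<lambda>t. F (s + t) + F t + indicator ?I t * (\<eta> / (3 * (T + 2))))"
   by (intro lintegrable_add Fi Fsi(1) integrable_mult_left integrable_real_indicator) (auto simp: emeasure_lborel_Icc_eq)
  show i: "integrable lborel (\<lambda>t. norm (f (t + s) - f t))"
   by (rule lintegrable_bound[OF bi]) (measurable, rule AE_I2, unfold real_norm_def abs_norm_cancel, rule order_trans[OF b abs_ge_self])
  have "(LINT t|lborel. norm (f (t + s) - f t)) \<le> (LINT t|lborel. F (s + t) + F t + indicator ?I t * (\<eta> / (3 * (T + 2))))"
   by (intro integral_mono i bi b)
  also have "... = u n + u n + (T + 2) * (\<eta> / (3 * (T + 2)))"
   using Fi Fsi T by (simp add: u_def F_def[abs_def])
  also have "(T + 2) * (\<eta> / (3 * (T + 2))) = \<eta> / 3" using T by (simp add: field_simps)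
  also have "u n + u n + \<eta> / 3 \<le> \<eta>" using n by simp
  finally show "(LINT t|lborel. norm (f (t + s) - f t)) \<le> \<eta>" .
 qed
qed

context drift
begin

lemma bav_shift:
 "bav dt (n + m) x = (1 / dt) *\<^sub>R (LINT s|dm (slot dt n). B (s - real m * dt) x)"
proof -
 note [measurable] = B_section_measurable[of x] slot_sets(1)
 have "(LINT s|lborel. indicator (slot dt (n + m)) s *\<^sub>R B s x) = (LINT s|lborel. indicator (slot dt (n + m)) (- (real m * dt) + s) *\<^sub>R B (- (real m * dt) + s) x)"
  by (rule integral_translate[symmetric]) measurable
 also have "... = (LINT s|lborel. indicator (slot dt n) s *\<^sub>R B (s - real m * dt) x)"
  by (intro lint_cong refl) (auto simp: indicator_def slot_def algebra_simps)
 finally show ?thesis by (simp add: bav_def integral_dm)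
qed

lemma sum_slots_le:
 fixes f :: "real => real"
 assumes dt: "dt > 0" and f: "integrable lborel f" "\<And>s. 0 \<le> f s"
 shows "(\<Sum>n<N. LINT s|dm (slot dt n). f s) \<le> (LINT s|lborel. f s)"
proof -
 have [measurable]: "f \<in> borel_measurable borel" using f by auto
 note [measurable] = slot_sets(1)
 have ii: "integrable lborel (\<lambda>s. indicator (slot dt n) s *\<^sub>R f s)" for n
  by (rule lintegrable_bound[OF f(1)]) (measurable, auto intro!: AE_I2 simp: indicator_def)
 have "(\<Sum>n<N. LINT s|dm (slot dt n). f s) = (LINT s|lborel. (\<Sum>n<N. indicator (slot dt n) s *\<^sub>R f s))"
  by (simp only: lint_sum[OF ii]) (simp add: integral_dm)
 also have "... \<le> (LINT s|lborel. f s)"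
 proof (intro integral_mono lintegrable_sum ii f)
  fix s
  have "(\<Sum>n<N. indicator (slot dt n) s) \<le> (1::real)"
  proof (cases "\<exists>n<N. s \<in> slot dt n")
   case True
   then obtain n where n: "n < N" "s \<in> slot dt n" by blast
   have uniq: "m = n" if "s \<in> slot dt m" for m
   proof (rule ccontr)
    assume "m \<noteq> n"
    then consider "Suc m \<le> n" | "Suc n \<le> m" by linarith
    then show False
    proof cases
     case 1
     then have "real (Suc m) * dt \<le> real n * dt" using dt by (intro mult_right_mono) auto
     then show False using that n by (auto simp: slot_def)
    next
     case 2
     then have "real (Suc n) * dt \<le> real m * dt" using dt by (intro mult_right_mono) auto
     then show False using that n by (auto simp: slot_def)
    qed
   qed
   have "indicator (slot dt m) s = (if m = n then 1 else (0::real))" for m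
    using uniq[of m] n(2) by (cases "m = n") (auto simp: indicator_def)
   then have "(\<Sum>m<N. indicator (slot dt m) s) = (\<Sum>m<N. if m = n then 1 else (0::real))" by simp
   then show ?thesis using n by simp
  next
   case False
   then have "(\<Sum>n<N. indicator (slot dt n) s) = (0::real)" by (intro sum.neutral) (auto simp: indicator_def)
   then show ?thesis by simp
  qed
  then have "(\<Sum>n<N. indicator (slot dt n) s) * f s \<le> 1 * f s" using f by (intro mult_right_mono)
  then show "(\<Sum>n<N. indicator (slot dt n) s *\<^sub>R f s) \<le> f s" by (simp add: sum_distrib_right)
 qed
 finally show ?thesis .
qed

text \<open>For a drift that is only measurable in time a single slot need not be close to its
  shifted copy, but the sum over all slots is small. Uniformity in \<open>x\<close> comes from a
  finite net and the Lipschitz bound; the passage from L1 to squares uses the bound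
  \<open>2 * M\<close> on each difference.\<close>

lemma drift_modulus:
 assumes \<eta>: "\<eta> > 0"
 shows "\<exists>d>0. \<forall>dt m (N::nat). dt > 0 \<and> real m * dt < d \<and> real N * dt = T \<longrightarrow>
  (\<exists>\<beta>. (\<forall>n. 0 \<le> \<beta> n) \<and> (\<forall>n. \<forall>x\<in>Om. norm (bav dt (n + m) x - bav dt n x) \<le> \<beta> n) \<and> (\<Sum>n<N. dt * (\<beta> n)^2) \<le> \<eta>)"
proof -
 have Mp: "M > 0" using M_ge1 by simp
 \<comment> \<open>The distance to the net contributes \<open>8 * M^2 * \<epsilon>^2\<close> per
   unit of time; this choice makes it at most \<open>\<eta> / 2\<close> in total.\<close>
 define \<epsilon> where "\<epsilon> = sqrt (\<eta> / (16 * M^2 * T))"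
 have \<epsilon>: "\<epsilon> > 0" "8 * M^2 * \<epsilon>^2 * T \<le> \<eta> / 2" using \<eta> T_pos Mp by (auto simp: \<epsilon>_def field_simps)
 have "\<exists>P. finite P \<and> P \<subseteq> Om \<and> Om \<subseteq> (\<Union>p\<in>P. ball p \<epsilon>)"
 proof -
  have "compact (closure Om)" using bounded_dom by simp
  moreover have "closure Om \<subseteq> (\<Union>p\<in>Om. ball p \<epsilon>)"
   using \<epsilon> closure_approachable[of _ Om] by (force simp: dist_commute)
  ultimately obtain P where "P \<subseteq> Om" "finite P" "closure Om \<subseteq> (\<Union>p\<in>P. ball p \<epsilon>)"
   using compactE_image[of "closure Om" Om "\<lambda>p. ball p \<epsilon>"] by (metis open_ball)
  then show ?thesis using closure_subset[of Om] by blast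
 qed
 then obtain P where P: "finite P" "P \<subseteq> Om" "Om \<subseteq> (\<Union>p\<in>P. ball p \<epsilon>)" by blast
 define K where "K = real (card P) + 1"
 have K: "K > 0" by (simp add: K_def)
 define \<eta>1 where "\<eta>1 = \<eta> / (8 * M * K * K)"
 have \<eta>1: "\<eta>1 > 0" using \<eta> Mp K by (simp add: \<eta>1_def)
 have "\<forall>p. \<exists>d>0. \<forall>s. \<bar>s\<bar> < d \<longrightarrow> integrable lborel (\<lambda>t. norm (B (t + s) p - B t p)) \<and> (LINT t|lborel. norm (B (t + s) p - B t p)) \<le> \<eta>1"
  by (intro allI, rule translation_continuity_L1[OF B_section_measurable B_bound B_zero T_pos \<eta>1])
 from choice[OF this] obtain dp where
  dp0: "\<forall>p. dp p > 0 \<and> (\<forall>s. \<bar>s\<bar> < dp p \<longrightarrow> integrable lborel (\<lambda>t. norm (B (t + s) p - B t p)) \<and> (LINT t|lborel. norm (B (t + s) p - B t p)) \<le> \<eta>1)"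
  by (elim exE)
 have dp: "dp p > 0"
  "\<bar>s\<bar> < dp p ==> integrable lborel (\<lambda>t. norm (B (t + s) p - B t p)) \<and> (LINT t|lborel. norm (B (t + s) p - B t p)) \<le> \<eta>1" for p s
  using spec[OF dp0, of p] by simp_all
 define d where "d = Min (insert 1 (dp ` P))"
 have d: "d > 0" "\<And>p. p \<in> P ==> d \<le> dp p"
 proof -
  have fin: "finite (insert 1 (dp ` P))" using P by auto
  show "d > 0" unfolding d_def using dp(1) by (subst Min_gr_iff[OF fin]) auto
  show "d \<le> dp p" if "p \<in> P" for p unfolding d_def using that by (intro Min_le fin) auto
 qed
 show ?thesis
 proof (rule exI[of _ d], intro conjI d(1) allI impI, elim conjE)
  fix dt :: real and m N :: nat assume dt: "dt > 0" and m: "real m * dt < d" and N: "real N * dt = T"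
  let ?\<delta> = "\<lambda>n p. norm (bav dt (n + m) p - bav dt n p)"
  define \<beta> where "\<beta> n = 2 * M * \<epsilon> + (\<Sum>p\<in>P. ?\<delta> n p)" for n
  have \<delta>2: "?\<delta> n p \<le> 2 * M" for n p
   using norm_triangle_ineq4[of "bav dt (n + m) p" "bav dt n p"] bav_bound[OF dt, of "n + m" p] bav_bound[OF dt, of n p] by simp
  have 1: "\<forall>n. 0 \<le> \<beta> n" unfolding \<beta>_def using Mp \<epsilon> by (auto intro!: add_nonneg_nonneg sum_nonneg)
  have 2: "norm (bav dt (n + m) x - bav dt n x) \<le> \<beta> n" if x: "x \<in> Om" for n x
  proof -
   obtain p where p: "p \<in> P" "dist p x < \<epsilon>" using P(3) x by auto
   have xp: "norm (x - p) \<le> \<epsilon>" using p by (simp add: dist_norm norm_minus_commute)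
   have l: "norm (bav dt k x - bav dt k p) \<le> M * \<epsilon>" for k
    using order_trans[OF bav_lip[OF dt x] mult_left_mono[OF xp]] p P Mp by auto
   have "bav dt (n + m) x - bav dt n x = (bav dt (n + m) x - bav dt (n + m) p) + (bav dt (n + m) p - bav dt n p) - (bav dt n x - bav dt n p)" by simp
   then have "norm (bav dt (n + m) x - bav dt n x) \<le> norm (bav dt (n + m) x - bav dt (n + m) p) + ?\<delta> n p + norm (bav dt n x - bav dt n p)"
    by (simp only:) (intro order_trans[OF norm_triangle_ineq4] add_right_mono norm_triangle_ineq)
   also have "?\<delta> n p \<le> (\<Sum>p\<in>P. ?\<delta> n p)" using p P by (intro member_le_sum) auto
   finally show ?thesis unfolding \<beta>_def using l[of "n + m"] l[of n] by linarith
  qed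
  have sumd: "(\<Sum>n<N. dt * ?\<delta> n p) \<le> \<eta>1" if p: "p \<in> P" for p
  proof -
   let ?f = "\<lambda>s. norm (B (s + - (real m * dt)) p - B s p)"
   have "\<bar>- (real m * dt)\<bar> < dp p" using m d(2)[OF p] dt by simp
   then have fi: "integrable lborel ?f" "(LINT s|lborel. ?f s) \<le> \<eta>1" using dp(2) by blast+
   have sm: "(\<lambda>s. B (s - real m * dt) p) \<in> borel_measurable borel"
    using B_section_measurable[of p] by measurable
   have i1: "integrable (dm (slot dt n)) (\<lambda>s. B (s - real m * dt) p)" for n
    by (intro integrable_bmon slot_sets bmonI[of _ _ M] sm B_bound)
   have "dt * ?\<delta> n p \<le> (LINT s|dm (slot dt n). ?f s)" for n
   proof -
    have "dt * ?\<delta> n p = norm (LINT s|dm (slot dt n). B (s - real m * dt) p - B s p)"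
     unfolding bav_shift using dt unfolding bav_def
     by (simp add: lint_diff i1 integrable_slot flip: scaleR_diff_right)
    also have "... \<le> (LINT s|dm (slot dt n). ?f s)" using integral_norm_bound[of "dm (slot dt n)" "\<lambda>s. B (s - real m * dt) p - B s p"] by simp
    finally show ?thesis .
   qed
   then have "(\<Sum>n<N. dt * ?\<delta> n p) \<le> (\<Sum>n<N. LINT s|dm (slot dt n). ?f s)" by (intro sum_mono)
   also have "... \<le> (LINT s|lborel. ?f s)" by (rule sum_slots_le[OF dt fi(1)]) auto
   finally show ?thesis using fi(2) by linarith
  qed
  have 3: "(\<Sum>n<N. dt * (\<beta> n)^2) \<le> \<eta>"
  proof -
   have pt: "(\<beta> n)^2 \<le> 8 * M^2 * \<epsilon>^2 + 4 * M * K * (\<Sum>p\<in>P. ?\<delta> n p)" for n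
   proof -
    have "(\<beta> n)^2 \<le> 2 * (2 * M * \<epsilon>)^2 + 2 * (\<Sum>p\<in>P. ?\<delta> n p)^2" unfolding \<beta>_def by (rule sum_power2_le)
    also have "(\<Sum>p\<in>P. ?\<delta> n p)^2 \<le> (\<Sum>p\<in>P. (?\<delta> n p)^2) * real (card P)" by (rule sum_squared_le_sum_of_squares)
    also have "... \<le> (\<Sum>p\<in>P. 2 * M * ?\<delta> n p) * K"
     using \<delta>2 Mp by (intro mult_mono sum_mono sum_nonneg) (auto simp: power2_eq_square K_def intro!: mult_right_mono)
    finally show ?thesis by (simp add: power_mult_distrib sum_distrib_left mult_ac)
   qed
   have "(\<Sum>n<N. dt * (\<beta> n)^2) \<le> (\<Sum>n<N. dt * (8 * M^2 * \<epsilon>^2 + 4 * M * K * (\<Sum>p\<in>P. ?\<delta> n p)))"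
    using dt pt by (intro sum_mono mult_left_mono) auto
   also have "... = (real N * dt) * (8 * M^2 * \<epsilon>^2) + 4 * M * K * (\<Sum>p\<in>P. \<Sum>n<N. dt * ?\<delta> n p)"
    by (subst sum.swap[where A=P]) (simp add: distrib_left sum.distrib sum_distrib_left mult_ac)
   also have "(\<Sum>p\<in>P. \<Sum>n<N. dt * ?\<delta> n p) \<le> K * \<eta>1"
   proof -
    have "(\<Sum>p\<in>P. \<Sum>n<N. dt * ?\<delta> n p) \<le> real (card P) * \<eta>1" by (rule sum_bounded_above) (rule sumd)
    also have "... \<le> K * \<eta>1" using \<eta>1 by (intro mult_right_mono) (auto simp: K_def)
    finally show ?thesis .
   qed
   finally have "(\<Sum>n<N. dt * (\<beta> n)^2) \<le> T * (8 * M^2 * \<epsilon>^2) + 4 * M * K * (K * \<eta>1)"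
    using Mp K N by (simp add: mult_left_mono)
   also have "4 * M * K * (K * \<eta>1) = \<eta> / 2" using Mp K by (simp add: \<eta>1_def field_simps)
   finally show ?thesis using \<epsilon>(2) by (simp add: mult_ac)
  qed
  show "\<exists>\<beta>. (\<forall>n. 0 \<le> \<beta> n) \<and> (\<forall>n. \<forall>x\<in>Om. norm (bav dt (n + m) x - bav dt n x) \<le> \<beta> n) \<and> (\<Sum>n<N. dt * (\<beta> n)^2) \<le> \<eta>"
   using 1 2 3 by blast
 qed
qed

end

section \<open>Energy of the iterates and time shifts\<close>

lemma discrete_gronwall:
 fixes X y :: "nat => real"
 assumes step: "\<And>n. n < N ==> X (Suc n) \<le> (1 + dt * c) * X n + y n"
  and y: "\<And>n. 0 \<le> y n" and X: "\<And>n. 0 \<le> X n" and c: "0 \<le> c" and dt: "0 \<le> dt"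
 shows "n \<le> N ==> X n \<le> exp (c * (real n * dt)) * (X 0 + (\<Sum>j<n. y j))"
proof (induction n)
 case (Suc n)
 let ?S = "X 0 + (\<Sum>j<n. y j)"
 have S0: "0 \<le> ?S" using X y by (intro add_nonneg_nonneg sum_nonneg) auto
 have "X (Suc n) \<le> (1 + dt * c) * X n + y n" using Suc.prems by (intro step) simp
 also have "... \<le> exp (dt * c) * (exp (c * (real n * dt)) * ?S) + y n"
  using Suc X[of n] c dt by (intro add_right_mono mult_mono exp_ge_add_one_self) auto
 also have "exp (dt * c) * (exp (c * (real n * dt)) * ?S) = exp (c * (real (Suc n) * dt)) * ?S"
  by (simp add: algebra_simps exp_add)
 also have "y n \<le> exp (c * (real (Suc n) * dt)) * y n"
  using mult_right_mono[of 1 "exp (c * (real (Suc n) * dt))" "y n"] y[of n] c dt by simp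
 finally show ?case by (simp add: algebra_simps)
qed simp

context jump
begin

text \<open>The bound is uniform in \<open>h\<close>, which is the purpose of Lipschitz data: the
  first steps then move the solution little, independently of the mesh.\<close>

lemma energy_lipschitz:
 assumes f: "bmon Om f" and lip: "\<And>x y. x \<in> Om ==> y \<in> Om ==> \<bar>f x - f y\<bar> \<le> L * norm (x - y)" and L: "L \<ge> 0"
 shows "energy f \<le> 3 * L^2 * (real DIM('a))^2 * measure lborel Om"
proof -
 let ?c = "(L * h * real DIM('a))^2"
 have "(LINT p|dm J. (f (tgt p) - f (fst p))^2) \<le> (LINT p|dm J. (\<lambda>_. ?c) (fst p))"
 proof (intro integral_J_mono bmon_intros bmon_J f)
  fix p assume p: "p \<in> J"
  have "\<bar>f (tgt p) - f (fst p)\<bar> \<le> L * norm (tgt p - fst p)" using p by (intro lip) (auto simp: J_iff)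
  also have "... \<le> L * (h * real DIM('a))" using L h_pos J_norm[OF p] by (intro mult_left_mono) (auto simp: tgt_def)
  finally have "\<bar>f (tgt p) - f (fst p)\<bar>^2 \<le> (L * h * real DIM('a))^2" by (intro power_mono) (auto simp: mult.assoc)
  then show "(f (tgt p) - f (fst p))^2 \<le> ?c" by simp
 qed
 then have "kc TYPE('a) * (LINT p|dm J. (f (tgt p) - f (fst p))^2) \<le> kc TYPE('a) * (LINT p|dm J. (\<lambda>_. ?c) (fst p))"
  by (intro mult_left_mono) (auto intro: less_imp_le kc_pos)
 also have "... \<le> 3 * (LINT x|dm Om. ?c)" by (intro integral_J_fst bmon_const) auto
 also have "... = 3 * (?c * measure lborel Om)" by (simp add: measure_dm)
 finally have "kc TYPE('a) * (LINT p|dm J. (f (tgt p) - f (fst p))^2) / h^2 \<le> 3 * (?c * measure lborel Om) / h^2"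
  by (rule divide_right_mono) simp
 then show ?thesis unfolding energy_def using h_pos by (simp add: power_mult_distrib)
qed

lemma gen_zero: "gen e b (\<lambda>_. 0) x = 0"
 by (simp add: gen_def)

lemma kap_zero: "kap e \<beta> (\<lambda>_. 0) = 0"
 by (simp add: kap_def energy_def)

text \<open>Growth rate of the unweighted L2 norm. It blows up as \<open>e\<close> tends to 0, which
  does no harm: it is used for existence and compactness at fixed \<open>e\<close>, not in the
  concentration bound.\<close>

definition grow :: "real => real => real" where
 "grow e M = 3 * M^2 * (real DIM('a))^2 / e + 1"

lemma it_energy:
 assumes f: "bmon Om f" and b: "\<And>n. bmon Om (b n)" and e: "e > 0" and M: "M \<ge> 0"
  and bd: "\<And>n x. x \<in> Om ==> norm (b n x) \<le> M"
  and dt: "dt \<ge> 0" "2 * dt * crude e M \<le> 1" "48 * dt \<le> h^2"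
 shows "(LINT x|dm Om. (it e dt b f n x)^2) + dt * (e / 2) * (\<Sum>j<n. energy (it e dt b f j)) \<le> exp (grow e M * (real n * dt)) * (LINT x|dm Om. (f x)^2)"
proof -
 let ?u = "it e dt b f"
 \<comment> \<open>The accumulated dissipation is added to the norm, so that a single Gronwall
   argument yields the uniform bound and the summed energy together.\<close>
 define X where "X n = (LINT x|dm Om. (?u n x)^2) + dt * (e / 2) * (\<Sum>j<n. energy (?u j))" for n
 have ub: "bmon Om (?u n)" for n by (rule bmon_it[OF f b])
 have U0: "0 \<le> (LINT x|dm Om. (?u n x)^2)" for n by (intro integral_Om_nonneg) auto
 have S0: "0 \<le> dt * (e / 2) * (\<Sum>j<n. energy (?u j))" for n
  using dt e by (intro mult_nonneg_nonneg sum_nonneg energy_nonneg) auto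
 have g0: "grow e M \<ge> 0" unfolding grow_def using e by auto
 have step: "X (Suc n) \<le> (1 + dt * grow e M) * X n + 0" for n
 proof -
  have "(LINT x|dm Om. (?u n x + dt * (gen e (b n) (?u n) x + gen 0 (\<lambda>_. 0) (\<lambda>_. 0) x))^2) + dt * (e / 2) * energy (?u n)
   \<le> (1 + dt * (3 * M^2 * (real DIM('a))^2 / e + 1)) * (LINT x|dm Om. (?u n x)^2) + dt * (4 / e + 1) * kap 0 0 (\<lambda>_. 0)"
   by (intro step_energy[where M=M] ub bmon_const b e M bd dt) auto
  then have 1: "(LINT x|dm Om. (?u (Suc n) x)^2) + dt * (e / 2) * energy (?u n) \<le> (1 + dt * grow e M) * (LINT x|dm Om. (?u n x)^2)"
   by (simp add: gen_zero kap_zero grow_def)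
  have "X (Suc n) = (LINT x|dm Om. (?u (Suc n) x)^2) + dt * (e / 2) * energy (?u n) + dt * (e / 2) * (\<Sum>j<n. energy (?u j))"
   by (simp add: X_def algebra_simps)
  also have "... \<le> (1 + dt * grow e M) * (LINT x|dm Om. (?u n x)^2) + (1 + dt * grow e M) * (dt * (e / 2) * (\<Sum>j<n. energy (?u j)))"
  proof (rule add_mono[OF 1])
   have "1 * (dt * (e / 2) * (\<Sum>j<n. energy (?u j))) \<le> (1 + dt * grow e M) * (dt * (e / 2) * (\<Sum>j<n. energy (?u j)))"
    using S0[of n] g0 dt by (intro mult_right_mono) auto
   then show "dt * (e / 2) * (\<Sum>j<n. energy (?u j)) \<le> (1 + dt * grow e M) * (dt * (e / 2) * (\<Sum>j<n. energy (?u j)))" by simp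
  qed
  finally show ?thesis by (simp add: X_def distrib_left)
 qed
 have X0: "0 \<le> X n" for n unfolding X_def by (intro add_nonneg_nonneg U0 S0)
 have "X n \<le> exp (grow e M * (real n * dt)) * (X 0 + (\<Sum>j<n. 0))"
  by (rule discrete_gronwall[where N=n and X=X and y="\<lambda>_. 0" and dt=dt and c="grow e M"])
    (use step X0 g0 dt(1) in auto)
 then show ?thesis by (simp add: X_def)
qed

text \<open>By linearity the difference between the scheme and its copy shifted by \<open>m\<close>
  steps solves the scheme with the shifted drift and a source made from the drift difference. Its
  initial value, \<open>m\<close> steps away from \<open>f\<close>, is estimated in the same way
  with \<open>f\<close> generating the source.\<close>

lemma it_shift:
 fixes b :: "nat => 'a => 'a" and \<beta> :: "nat => real"
 assumes f: "bmon Om f" and b: "\<And>n. bmon Om (b n)" and e: "e > 0" and M: "M \<ge> 0"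
  and bd: "\<And>n x. x \<in> Om ==> norm (b n x) \<le> M"
  and dt: "dt \<ge> 0" "2 * dt * crude e M \<le> 1" "48 * dt \<le> h^2"
  and \<beta>: "\<And>n. 0 \<le> \<beta> n" "\<And>n x. x \<in> Om ==> norm (b (n + m) x - b n x) \<le> \<beta> n"
 shows "(LINT x|dm Om. (it e dt b f (n + m) x - it e dt b f n x)^2) \<le> exp (grow e M * (real n * dt)) *
   (exp (grow e M * (real m * dt)) * (real m * dt * ((4 / e + 1) * kap e M f))
   + (4 / e + 1) * 3 * (real DIM('a))^2 * (exp (grow e M * (real n * dt)) * (LINT x|dm Om. (f x)^2)) * (\<Sum>j<n. dt * (\<beta> j)^2))"
proof -
 let ?u = "it e dt b f"
 have ub: "bmon Om (?u n)" for n by (rule bmon_it[OF f b])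
 have g0: "grow e M \<ge> 0" unfolding grow_def using e by auto
 define W where "W k = (LINT x|dm Om. (?u k x - f x)^2)" for k
 have W0: "0 \<le> W k" for k unfolding W_def by (intro integral_Om_nonneg) auto
 have Wstep: "W (Suc k) \<le> (1 + dt * grow e M) * W k + dt * ((4 / e + 1) * kap e M f)" for k
 proof -
  have wb: "bmon Om (\<lambda>x. ?u k x - f x)" by (intro bmon_intros ub f)
  have "(LINT x|dm Om. (?u k x - f x + dt * (gen e (b k) (\<lambda>x. ?u k x - f x) x + gen e (b k) f x))^2) + dt * (e / 2) * energy (\<lambda>x. ?u k x - f x)
   \<le> (1 + dt * (3 * M^2 * (real DIM('a))^2 / e + 1)) * (LINT x|dm Om. (?u k x - f x)^2) + dt * (4 / e + 1) * kap e M f"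
   using e by (intro step_energy[where M=M] wb f b M bd dt) auto
  moreover have "?u k x - f x + dt * (gen e (b k) (\<lambda>x. ?u k x - f x) x + gen e (b k) f x) = ?u (Suc k) x - f x" for x
   unfolding gen_diff[OF ub b f, symmetric] by simp
  moreover have "0 \<le> dt * (e / 2) * energy (\<lambda>x. ?u k x - f x)" using dt e energy_nonneg by (intro mult_nonneg_nonneg) auto
  ultimately show ?thesis by (simp add: W_def grow_def mult.assoc)
 qed
 have k0: "0 \<le> (4 / e + 1) * kap e M f" using e kap_nonneg by (intro mult_nonneg_nonneg) auto
 have Wm: "W m \<le> exp (grow e M * (real m * dt)) * (real m * dt * ((4 / e + 1) * kap e M f))"
 proof -
  have "W m \<le> exp (grow e M * (real m * dt)) * (W 0 + (\<Sum>j<m. dt * ((4 / e + 1) * kap e M f)))"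
   by (rule discrete_gronwall[where N=m and X=W and y="\<lambda>_. dt * ((4 / e + 1) * kap e M f)" and dt=dt and c="grow e M"])
     (use Wstep W0 k0 g0 dt(1) in auto)
  then show ?thesis by (simp add: W_def mult.assoc)
 qed
 define S where "S = exp (grow e M * (real n * dt)) * (LINT x|dm Om. (f x)^2)"
 have F0: "0 \<le> (LINT x|dm Om. (f x)^2)" by (intro integral_Om_nonneg) auto
 have S: "(LINT x|dm Om. (?u j x)^2) \<le> S" if "j \<le> n" for j
 proof -
  have "0 \<le> dt * (e / 2) * (\<Sum>i<j. energy (?u i))"
   using dt e by (intro mult_nonneg_nonneg sum_nonneg energy_nonneg) auto
  then have "(LINT x|dm Om. (?u j x)^2) \<le> exp (grow e M * (real j * dt)) * (LINT x|dm Om. (f x)^2)"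
   using it_energy[where n=j and b=b, OF f b e M bd dt] by linarith
  also have "... \<le> S" unfolding S_def
  proof (intro mult_right_mono F0)
   have "real j * dt \<le> real n * dt" using that dt by (intro mult_right_mono) auto
   then show "exp (grow e M * (real j * dt)) \<le> exp (grow e M * (real n * dt))" using g0 by (simp add: mult_left_mono)
  qed
  finally show ?thesis .
 qed
 define U where "U k = (LINT x|dm Om. (?u (k + m) x - ?u k x)^2)" for k
 have Ustep: "U (Suc k) \<le> (1 + dt * grow e M) * U k + (4 / e + 1) * 3 * (real DIM('a))^2 * S * (dt * (\<beta> k)^2)" if k: "k < n" for k
 proof -
  have wb: "bmon Om (\<lambda>x. ?u (k + m) x - ?u k x)" by (intro bmon_intros ub)
  have bb: "bmon Om (\<lambda>x. b (k + m) x - b k x)" by (intro bmon_intros b)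
  have "(LINT x|dm Om. (?u (k + m) x - ?u k x + dt * (gen e (b (k + m)) (\<lambda>x. ?u (k + m) x - ?u k x) x + gen 0 (\<lambda>x. b (k + m) x - b k x) (?u k) x))^2)
    + dt * (e / 2) * energy (\<lambda>x. ?u (k + m) x - ?u k x)
   \<le> (1 + dt * (3 * M^2 * (real DIM('a))^2 / e + 1)) * (LINT x|dm Om. (?u (k + m) x - ?u k x)^2) + dt * (4 / e + 1) * kap 0 (\<beta> k) (?u k)"
   by (intro step_energy[where M=M] wb ub b bb e M bd \<beta> dt) auto
  moreover have "?u (k + m) x - ?u k x + dt * (gen e (b (k + m)) (\<lambda>x. ?u (k + m) x - ?u k x) x + gen 0 (\<lambda>x. b (k + m) x - b k x) (?u k) x)
    = ?u (Suc k + m) x - ?u (Suc k) x" for x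
   unfolding gen_diff[OF ub b ub, symmetric] using gen_diff_drift[where f="?u k" and b="b (k + m)" and b'="b k" and e=e and x=x, OF ub b b] by (simp add: algebra_simps)
  moreover have "0 \<le> dt * (e / 2) * energy (\<lambda>x. ?u (k + m) x - ?u k x)" using dt e energy_nonneg by (intro mult_nonneg_nonneg) auto
  ultimately have 1: "U (Suc k) \<le> (1 + dt * grow e M) * U k + dt * (4 / e + 1) * kap 0 (\<beta> k) (?u k)"
   by (simp add: U_def grow_def)
  have "kap 0 (\<beta> k) (?u k) \<le> 3 * (\<beta> k)^2 * (real DIM('a))^2 * S"
   unfolding kap_def using S[of k] k by (simp add: mult_left_mono)
  then have "dt * (4 / e + 1) * kap 0 (\<beta> k) (?u k) \<le> dt * (4 / e + 1) * (3 * (\<beta> k)^2 * (real DIM('a))^2 * S)"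
   using dt e by (intro mult_left_mono) auto
  also have "... = (4 / e + 1) * 3 * (real DIM('a))^2 * S * (dt * (\<beta> k)^2)" by simp
  finally show ?thesis using 1 by linarith
 qed
 have S0: "0 \<le> S" unfolding S_def using F0 by simp
 have U0: "0 \<le> U k" for k unfolding U_def by (intro integral_Om_nonneg) auto
 have y0: "0 \<le> (4 / e + 1) * 3 * (real DIM('a))^2 * S * (dt * (\<beta> k)^2)" for k using e S0 dt by (intro mult_nonneg_nonneg) auto
 have "U n \<le> exp (grow e M * (real n * dt)) * (U 0 + (\<Sum>j<n. (4 / e + 1) * 3 * (real DIM('a))^2 * S * (dt * (\<beta> j)^2)))"
  by (rule discrete_gronwall[where N=n and X=U and y="\<lambda>j. (4 / e + 1) * 3 * (real DIM('a))^2 * S * (dt * (\<beta> j)^2)" and dt=dt and c="grow e M"])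
    (use Ustep U0 y0 g0 dt(1) in auto)
 also have "U 0 = W m" by (simp add: U_def W_def)
 also have "exp (grow e M * (real n * dt)) * (W m + (\<Sum>j<n. (4 / e + 1) * 3 * (real DIM('a))^2 * S * (dt * (\<beta> j)^2)))
   \<le> exp (grow e M * (real n * dt)) * (exp (grow e M * (real m * dt)) * (real m * dt * ((4 / e + 1) * kap e M f)) + (4 / e + 1) * 3 * (real DIM('a))^2 * S * (\<Sum>j<n. dt * (\<beta> j)^2))"
  using Wm by (intro mult_left_mono add_mono) (auto simp: sum_distrib_left)
 finally show ?thesis unfolding U_def S_def .
qed

end

context drift
begin

text \<open>The threshold is uniform over all admissible meshes: the energy of the data handles the
  initial displacement, and \<open>drift_modulus\<close> the oscillation of the drift.\<close>

lemma scheme_equicontinuous: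
 assumes f: "bmon Om f" and lip: "\<And>x y. x \<in> Om ==> y \<in> Om ==> \<bar>f x - f y\<bar> \<le> L * norm (x - y)" and L: "L \<ge> 0"
  and e: "e > 0" and \<eta>: "\<eta> > 0"
 shows "\<exists>d>0. \<forall>h dt (N::nat) n m. 0 < h \<and> 0 < dt \<and> 2 * dt * (24 / h^2 * (12 * e^2 / h^2 + 3 * M^2 * (real DIM('a))^2)) \<le> 1 \<and> 48 * dt \<le> h^2 \<and>
  real N * dt = T \<and> n + m \<le> N \<and> real m * dt < d \<longrightarrow>
  (LINT x|dm Om. (jump.it Om h e dt (bav dt) f (n + m) x - jump.it Om h e dt (bav dt) f n x)^2) \<le> \<eta>"
proof -
 let ?D = "real DIM('a)"
 define c where "c = 3 * M^2 * ?D^2 / e + 1"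
 have c0: "c \<ge> 0" unfolding c_def using e by auto
 define F2 where "F2 = (LINT x|dm Om. (f x)^2)"
 have F20: "F2 \<ge> 0" unfolding F2_def by (intro integral_nonneg_AE) auto
 define ka where "ka = e^2 * (3 * L^2 * ?D^2 * measure lborel Om) + 3 * M^2 * ?D^2 * F2"
 have ka0: "ka \<ge> 0" unfolding ka_def using F20 by (intro add_nonneg_nonneg mult_nonneg_nonneg) auto
 define E where "E = exp (c * T)"
 have E: "E > 0" by (simp add: E_def)
 define A1 where "A1 = E * (E * ((4 / e + 1) * ka)) + 1"
 define A2 where "A2 = E * ((4 / e + 1) * 3 * ?D^2 * (E * F2)) + 1"
 have A: "A1 > 0" "A2 > 0" unfolding A1_def A2_def using E e ka0 F20 by (auto intro!: add_nonneg_pos mult_nonneg_nonneg)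
 have "\<eta> / (2 * A2) > 0" using \<eta> A by simp
 from drift_modulus[OF this] obtain d0 where d0: "d0 > 0" and mo: "\<And>dt m N. dt > 0 ==> real m * dt < d0 ==> real N * dt = T ==>
  (\<exists>\<beta>. (\<forall>n. 0 \<le> \<beta> n) \<and> (\<forall>n. \<forall>x\<in>Om. norm (bav dt (n + m) x - bav dt n x) \<le> \<beta> n) \<and> (\<Sum>n<N. dt * (\<beta> n)^2) \<le> \<eta> / (2 * A2))" by blast
 have dp: "min d0 (\<eta> / (2 * A1)) > 0" using d0 \<eta> A by simp
 show ?thesis
 proof (rule exI[of _ "min d0 (\<eta> / (2 * A1))"], rule conjI[OF dp], intro allI impI, elim conjE)
  fix h dt :: real and N n m :: nat
  assume h: "0 < h" and dt: "0 < dt" and cr: "2 * dt * (24 / h^2 * (12 * e^2 / h^2 + 3 * M^2 * ?D^2)) \<le> 1" "48 * dt \<le> h^2"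
   and N: "real N * dt = T" and nm: "n + m \<le> N" and m: "real m * dt < min d0 (\<eta> / (2 * A1))"
  interpret jump Om h using open_dom bounded_dom h by unfold_locales
  obtain \<beta> where \<beta>: "\<forall>n. 0 \<le> \<beta> n" "\<forall>n. \<forall>x\<in>Om. norm (bav dt (n + m) x - bav dt n x) \<le> \<beta> n" "(\<Sum>n<N. dt * (\<beta> n)^2) \<le> \<eta> / (2 * A2)"
   using mo[OF dt _ N, of m] m by auto
  have M0: "M \<ge> 0" using M_ge1 by simp
  have gr: "grow e M = c" by (simp add: grow_def c_def)
  have le: "real n * dt \<le> T" "real m * dt \<le> T"
   using nm dt N mult_right_mono[of "real n" "real N" dt] mult_right_mono[of "real m" "real N" dt] by auto
  have En: "exp (c * (real n * dt)) \<le> E" "exp (c * (real m * dt)) \<le> E" using le c0 by (auto simp: E_def mult_left_mono)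
  have kf: "kap e M f \<le> ka" unfolding kap_def ka_def F2_def
   using energy_lipschitz[OF f lip L] by (intro add_right_mono mult_left_mono) auto
  have kf0: "0 \<le> kap e M f" by (rule kap_nonneg)
  have sb: "(\<Sum>j<n. dt * (\<beta> j)^2) \<le> \<eta> / (2 * A2)"
  proof -
   have "(\<Sum>j<n. dt * (\<beta> j)^2) \<le> (\<Sum>j<N. dt * (\<beta> j)^2)" using nm dt by (intro sum_mono2) auto
   then show ?thesis using \<beta>(3) by linarith
  qed
  have sb0: "0 \<le> (\<Sum>j<n. dt * (\<beta> j)^2)" using dt by (intro sum_nonneg) auto
  have "(LINT x|dm Om. (it e dt (bav dt) f (n + m) x - it e dt (bav dt) f n x)^2) \<le> exp (c * (real n * dt)) *
   (exp (c * (real m * dt)) * (real m * dt * ((4 / e + 1) * kap e M f))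
   + (4 / e + 1) * 3 * ?D^2 * (exp (c * (real n * dt)) * F2) * (\<Sum>j<n. dt * (\<beta> j)^2))"
   unfolding gr[symmetric] F2_def
   using cr dt \<beta> by (intro it_shift[OF f bmon_bav[OF dt] e M0 bav_bound[OF dt]]) (auto simp: crude_def)
  also have "... \<le> E * (E * (real m * dt * ((4 / e + 1) * ka)) + (4 / e + 1) * 3 * ?D^2 * (E * F2) * (\<eta> / (2 * A2)))"
   using En kf kf0 e sb sb0 F20 dt E by (intro mult_mono add_mono add_nonneg_nonneg mult_nonneg_nonneg) (auto intro!: add_nonneg_nonneg mult_nonneg_nonneg)
  also have "... = real m * dt * (A1 - 1) + (A2 - 1) * (\<eta> / (2 * A2))" unfolding A1_def A2_def by (simp add: algebra_simps)
  also have "... \<le> \<eta> / (2 * A1) * A1 + A2 * (\<eta> / (2 * A2))"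
  proof (intro add_mono mult_mono)
   show "0 \<le> A1 - 1" unfolding A1_def using E e ka0 by auto
  qed (use m \<eta> A dt in auto)
  also have "... = \<eta>" using A by simp
  finally show "(LINT x|dm Om. (it e dt (bav dt) f (n + m) x - it e dt (bav dt) f n x)^2) \<le> \<eta>" .
 qed
qed

end

section \<open>Consistency of the scheme\<close>

text \<open>The layers within \<open>1 / real (Suc n)\<close> of the complement decrease to the
  empty set, because points of an open set have positive distance to its complement; the measure is
  continuous from above.\<close>

lemma boundary_layer_small:
 fixes Om :: "'a::euclidean_space set"
 assumes op: "open Om" and bd: "bounded Om" and \<eta>: "\<eta> > 0"
 obtains r A where "r > 0" "A \<in> sets borel" "A \<subseteq> Om" "measure lborel A \<le> \<eta>" "\<And>x. x \<in> Om ==> x \<notin> A ==> cball x r \<subseteq> Om"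
proof -
 define A where "A n = Om \<inter> {x. infdist x (- Om) \<le> 1 / real (Suc n)}" for n
 \<comment> \<open>\<open>infdist\<close> to the empty set is 0 by convention, so nonemptiness of
   the complement has to be secured.\<close>
 have ne: "- Om \<noteq> {}" using bd by (metis Compl_empty_eq compl_eq_compl_iff boolean_algebra.compl_one not_bounded_UNIV double_complement)
 have As: "A n \<in> sets borel" for n
 proof -
  have "closed {x. infdist x (- Om) \<le> 1 / real (Suc n)}"
   by (intro closed_Collect_le continuous_on_infdist continuous_on_id continuous_on_const)
  then show ?thesis unfolding A_def using op by (intro sets.Int borel_open borel_closed)
 qed
 have fin: "emeasure lborel (A n) \<noteq> \<infinity>" for n
  using emeasure_bounded_finite[OF bounded_subset[OF bd], of "A n"] by (auto simp: A_def)
 have dec: "decseq A"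
 proof (rule decseq_SucI)
  show "A (Suc n) \<subseteq> A n" for n
  proof -
   have "1 / real (Suc (Suc n)) \<le> 1 / real (Suc n)" by (intro divide_left_mono) auto
   then show ?thesis by (auto simp: A_def)
  qed
 qed
 have "(\<Inter>n. A n) = {}"
 proof (rule ccontr)
  assume "(\<Inter>n. A n) \<noteq> {}"
  then obtain x where x: "\<And>n. x \<in> A n" by auto
  have cl: "closed (- Om)" using op by (simp add: closed_def)
  have "infdist x (- Om) > 0"
   using x[of 0] in_closed_iff_infdist_zero[OF cl ne, of x] infdist_nonneg[of x "- Om"] by (auto simp: A_def less_le)
  then obtain n where "1 / real (Suc n) < infdist x (- Om)" using nat_approx_posE by blast
  then show False using x[of n] by (auto simp: A_def)
 qed
 moreover have "(\<lambda>n. measure lborel (A n)) \<longlonglongrightarrow> measure lborel (\<Inter>n. A n)"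
  by (rule Lim_measure_decseq[OF _ dec fin]) (use As in auto)
 ultimately have "(\<lambda>n. measure lborel (A n)) \<longlonglongrightarrow> 0" by simp
 from LIMSEQ_D[OF this \<eta>] obtain n where n: "measure lborel (A n) < \<eta>" by auto
 show ?thesis
 proof (rule that[of "1 / (2 * real (Suc n))" "A n"])
  show "cball x (1 / (2 * real (Suc n))) \<subseteq> Om" if x: "x \<in> Om" "x \<notin> A n" for x
  proof
   fix y assume y: "y \<in> cball x (1 / (2 * real (Suc n)))"
   have "1 / (2 * real (Suc n)) < 1 / real (Suc n)" by (intro divide_strict_left_mono) auto
   then have "dist x y < infdist x (- Om)" using y x by (auto simp: A_def)
   then show "y \<in> Om" using infdist_le[of y "- Om" x] by auto
  qed
 qed (use n As in \<open>auto simp: A_def\<close>)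
qed

context jump
begin

text \<open>Mean value inequality for \<open>q\<close> minus its linearization on a ball containing
  all jumps from \<open>fst p\<close>. The remainder is \<open>h\<close> times the oscillation of
  the gradient, which is all that a C1 test function gives.\<close>

lemma taylor_tgt:
 fixes q :: "'a => real" and P :: "'a => 'a"
 assumes der: "\<And>\<xi>. (q has_derivative (\<lambda>v. P \<xi> \<bullet> v)) (at \<xi>)"
  and osc: "\<And>\<xi>. norm (\<xi> - fst p) \<le> h * real DIM('a) ==> norm (P \<xi> - P (fst p)) \<le> \<delta>"
  and p: "p \<in> J"
 shows "\<bar>q (tgt p) - q (fst p) - h * (P (fst p) \<bullet> snd p)\<bar> \<le> h * real DIM('a) * \<delta>"
proof -
 let ?x = "fst p"
 let ?r = "\<lambda>\<xi>. q \<xi> - P ?x \<bullet> \<xi>"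
 let ?S = "cball ?x (h * real DIM('a))"
 have d0: "0 \<le> \<delta>" using osc[of ?x] h_pos by simp
 have nz: "norm (tgt p - ?x) \<le> h * real DIM('a)" using J_norm[OF p] h_pos by (simp add: tgt_def)
 have "norm (?r (tgt p) - ?r ?x) \<le> \<delta> * norm (tgt p - ?x)"
 proof (rule differentiable_bound[where S="?S" and f'="\<lambda>\<xi> v. P \<xi> \<bullet> v - P ?x \<bullet> v"])
  show "convex ?S" by simp
  show "(?r has_derivative (\<lambda>v. P \<xi> \<bullet> v - P ?x \<bullet> v)) (at \<xi> within ?S)" for \<xi>
   by (intro has_derivative_diff has_derivative_at_withinI[OF der] has_derivative_inner_right has_derivative_ident)
  show "onorm (\<lambda>v. P \<xi> \<bullet> v - P ?x \<bullet> v) \<le> \<delta>" if "\<xi> \<in> ?S" for \<xi>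
  proof (rule onorm_le)
   fix v
   have "norm (P \<xi> \<bullet> v - P ?x \<bullet> v) = \<bar>(P \<xi> - P ?x) \<bullet> v\<bar>" by (simp add: inner_diff_left)
   also have "... \<le> norm (P \<xi> - P ?x) * norm v" by (rule Cauchy_Schwarz_ineq2)
   also have "... \<le> \<delta> * norm v" using osc[of \<xi>] that by (intro mult_right_mono) (auto simp: dist_norm norm_minus_commute)
   finally show "norm (P \<xi> \<bullet> v - P ?x \<bullet> v) \<le> \<delta> * norm v" .
  qed
 qed (use nz h_pos in \<open>auto simp: dist_norm norm_minus_commute\<close>)
 also have "... \<le> \<delta> * (h * real DIM('a))" using nz d0 by (intro mult_left_mono)
 finally have "\<bar>?r (tgt p) - ?r ?x\<bar> \<le> h * real DIM('a) * \<delta>" by (simp add: mult_ac)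
 moreover have "?r (tgt p) - ?r ?x = q (tgt p) - q ?x - h * (P ?x \<bullet> snd p)"
  by (simp add: tgt_def inner_add_right)
 ultimately show ?thesis by simp
qed

lemma integral_dm_fst_const:
 assumes "c \<ge> 0" shows "kc TYPE('a) * (LINT p|dm J. c) \<le> 3 * c * measure lborel Om"
 using integral_J_fst[OF bmon_const, of c] assms by (simp add: measure_dm mult_ac)

text \<open>Two errors occur. The Taylor remainder of \<open>q\<close> is weighed against energy and
  L2 norm by Young. The drift term also contains the second moment of the admissible jumps, which is
  the identity except on \<open>A\<close>; a measure of at most \<open>\<delta>^2\<close> balances
  the factor \<open>1 / \<delta>\<close> from Young. The diffusion term needs no such correction,
  \<open>gradh\<close> being exactly dual to increments.\<close>

lemma form_consistent:
 assumes u: "bmon Om u" and b: "bmon Om b" and q: "bmon Om q" and P: "bmon Om P"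
  and M: "M \<ge> 0" and e: "e > 0" and bd: "\<And>x. x \<in> Om ==> norm (b x) \<le> M" and PC: "\<And>x. x \<in> Om ==> norm (P x) \<le> CP" and CP: "CP \<ge> 0"
  and tay: "\<And>p. p \<in> J ==> \<bar>q (tgt p) - q (fst p) - h * (P (fst p) \<bullet> snd p)\<bar> \<le> h * real DIM('a) * \<delta>"
  and \<delta>: "\<delta> > 0" and A: "A \<in> sets borel" "A \<subseteq> Om" "measure lborel A \<le> \<delta>^2" and inn: "\<And>x. x \<in> Om ==> x \<notin> A ==> JX x = cube"
 defines "C \<equiv> e + 2 * e * (real DIM('a))^2 * measure lborel Om + 2 * M * (real DIM('a))^2 * (1 + measure lborel Om) + 4 * M * (real DIM('a))^2 * CP"
 shows "\<bar>form e b u q - (LINT x|dm Om. e * (gradh u x \<bullet> P x) + u x * (b x \<bullet> P x))\<bar> \<le> \<delta> * C * (1 + energy u + (LINT x|dm Om. (u x)^2))"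
proof -
 let ?D = "real DIM('a)" and ?K = "kc TYPE('a)"
 let ?U = "LINT x|dm Om. (u x)^2"
 have K0: "?K > 0" by (rule kc_pos)
 have U0: "?U \<ge> 0" by (intro integral_Om_nonneg) auto
 have u2: "bmon Om (\<lambda>x. (u x)^2)" by (intro bmon_intros u)
 define F where "F p = e / h^2 * ((u (tgt p) - u (fst p)) * (q (tgt p) - q (fst p)))
   + u (fst p) * (b (fst p) \<bullet> snd p) * (q (tgt p) - q (fst p)) / h" for p
 define F1 where "F1 p = e / h * ((u (tgt p) - u (fst p)) * (snd p \<bullet> P (fst p)))" for p
 define F2 where "F2 p = u (fst p) * ((b (fst p) \<bullet> snd p) * (P (fst p) \<bullet> snd p))" for p
 define Q where "Q p = (\<delta> * e / 2) / h^2 * (u (tgt p) - u (fst p))^2 + (\<delta> * M * ?D^2 / 2) * (u (fst p))^2 + \<delta> * (e * ?D^2 + M * ?D^2) / 2" for p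
 have bF: "bmon J F" and bF1: "bmon J F1" and bF2: "bmon J F2" and bQ: "bmon J Q"
  unfolding F_def[abs_def] F1_def[abs_def] F2_def[abs_def] Q_def[abs_def] by (intro bmon_intros bmon_J u b q P)+
 have pw: "\<bar>F p - (F1 p + F2 p)\<bar> \<le> Q p" if p: "p \<in> J" for p
 proof -
  define r where "r = (q (tgt p) - q (fst p) - h * (P (fst p) \<bullet> snd p)) / h"
  have r: "\<bar>r\<bar> \<le> ?D * \<delta>" unfolding r_def using tay[OF p] h_pos by (simp add: pos_divide_le_eq mult_ac)
  define s where "s = (u (tgt p) - u (fst p)) / h"
  have "F p - (F1 p + F2 p) = e * s * r + u (fst p) * (b (fst p) \<bullet> snd p) * r"
   unfolding F_def F1_def F2_def r_def s_def using h_pos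
   by (simp add: field_simps power2_eq_square inner_commute)
  then have "\<bar>F p - (F1 p + F2 p)\<bar> \<le> \<bar>e * s * r\<bar> + \<bar>u (fst p) * (b (fst p) \<bullet> snd p) * r\<bar>" by (simp only: abs_triangle_ineq)
  also have "\<bar>e * s * r\<bar> \<le> e * \<bar>s\<bar> * (?D * \<delta>)" using e r by (simp add: abs_mult mult_left_mono)
  also have "e * \<bar>s\<bar> * (?D * \<delta>) \<le> e * \<delta> * ((s^2 + ?D^2) / 2)"
  proof -
   have "\<bar>s\<bar> * ?D \<le> (s^2 + ?D^2) / 2" using zero_le_power2[of "\<bar>s\<bar> - ?D"] by (simp add: power2_eq_square algebra_simps)
   then have "e * \<delta> * (\<bar>s\<bar> * ?D) \<le> e * \<delta> * ((s^2 + ?D^2) / 2)" using e \<delta> by (intro mult_left_mono) auto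
   then show ?thesis by (simp add: mult_ac)
  qed
  also have "\<bar>u (fst p) * (b (fst p) \<bullet> snd p) * r\<bar> \<le> \<bar>u (fst p)\<bar> * (M * ?D) * (?D * \<delta>)"
   unfolding abs_mult using r drift_bound[where b=b, OF bd p] M by (intro mult_mono) auto
  also have "... = (\<delta> * M * ?D^2) * \<bar>u (fst p)\<bar>" by (simp add: power2_eq_square)
  also have "... \<le> (\<delta> * M * ?D^2) * (((u (fst p))^2 + 1) / 2)"
  proof -
   have "\<bar>u (fst p)\<bar> \<le> ((u (fst p))^2 + 1) / 2" using zero_le_power2[of "\<bar>u (fst p)\<bar> - 1"] by (simp add: power2_eq_square algebra_simps)
   then show ?thesis using \<delta> M by (intro mult_left_mono) auto
  qed
  finally show ?thesis unfolding Q_def s_def by (simp add: power_divide field_simps)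
 qed
 have "\<bar>LINT p|dm J. F p - (F1 p + F2 p)\<bar> \<le> (LINT p|dm J. \<bar>F p - (F1 p + F2 p)\<bar>)"
  using integral_norm_bound[of "dm J" "\<lambda>p. F p - (F1 p + F2 p)"] by simp
 also have "... \<le> (LINT p|dm J. Q p)" by (intro integral_J_mono bmon_intros bF bF1 bF2 bQ pw)
 finally have "?K * \<bar>LINT p|dm J. F p - (F1 p + F2 p)\<bar> \<le> ?K * (LINT p|dm J. Q p)" using K0 by (intro mult_left_mono) auto
 also have "... = (\<delta> * e / 2) * energy u + (\<delta> * M * ?D^2 / 2) * (?K * (LINT p|dm J. (u (fst p))^2)) + ?K * (LINT p|dm J. \<delta> * (e * ?D^2 + M * ?D^2) / 2)"
 proof -
  have "(LINT p|dm J. Q p) = (\<delta> * e / 2) / h^2 * (LINT p|dm J. (u (tgt p) - u (fst p))^2) + (\<delta> * M * ?D^2 / 2) * (LINT p|dm J. (u (fst p))^2) + (LINT p|dm J. \<delta> * (e * ?D^2 + M * ?D^2) / 2)"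
   unfolding Q_def
   apply (subst lint_add, (intro integrable_J bmon_intros bmon_J u)+)
   apply (subst lint_add, (intro integrable_J bmon_intros bmon_J u)+)
   by (simp only: integral_mult_right_zero)
  then show ?thesis unfolding energy_def by (simp only:) (simp add: algebra_simps)
 qed
 also have "... \<le> (\<delta> * e / 2) * energy u + (\<delta> * M * ?D^2 / 2) * (3 * ?U) + 3 * (\<delta> * (e * ?D^2 + M * ?D^2) / 2) * measure lborel Om"
  using \<delta> M e by (intro add_mono mult_left_mono integral_J_fst[OF u2] integral_dm_fst_const) auto
 finally have E1: "?K * \<bar>LINT p|dm J. F p - (F1 p + F2 p)\<bar> \<le> ..." .
 define m where "m x = ?K * (LINT z|dm (JX x). (b x \<bullet> z) * (P x \<bullet> z))" for x
 have bm: "bmon Om m"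
 proof -
  have "bmon J (\<lambda>p. (b (fst p) \<bullet> snd p) * (P (fst p) \<bullet> snd p))" by (intro bmon_intros bmon_J b P)
  from bmon_inner_integral[OF this] show ?thesis unfolding m_def[abs_def] by (intro bmon_intros) simp
 qed
 have KF2: "?K * (LINT p|dm J. F2 p) = (LINT x|dm Om. u x * m x)"
  unfolding integral_J_iterated[OF bF2] by (simp add: F2_def m_def mult_ac)
 have KF1: "?K * (LINT p|dm J. F1 p) = (LINT x|dm Om. e * (gradh u x \<bullet> P x))"
  using gradh_dual[OF u P] by (simp add: F1_def)
 have mb: "\<bar>m x - b x \<bullet> P x\<bar> \<le> 4 * M * ?D^2 * CP * indicator A x" if x: "x \<in> Om" for x
 proof (cases "x \<in> A")
  case False
  then show ?thesis using inn[OF x] by (simp add: m_def cube_moment)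
 next
  case True
  have bi: "bmon (JX x) (\<lambda>z. (b x \<bullet> z) * (P x \<bullet> z))" by (intro bmon_intros bmon_JX_id)
  have "\<bar>LINT z|dm (JX x). (b x \<bullet> z) * (P x \<bullet> z)\<bar> \<le> (LINT z|dm (JX x). \<bar>(b x \<bullet> z) * (P x \<bullet> z)\<bar>)"
   using integral_norm_bound[of "dm (JX x)" "\<lambda>z. (b x \<bullet> z) * (P x \<bullet> z)"] by simp
  also have "... \<le> (LINT z|dm (JX x). (M * ?D) * (CP * ?D))"
  proof (intro integral_JX_mono bmon_abs bi bmon_const)
   fix z assume z: "z \<in> JX x"
   have nz: "norm z \<le> ?D" using z JX_cube cube_norm by blast
   have "\<bar>b x \<bullet> z\<bar> \<le> M * ?D" using order_trans[OF Cauchy_Schwarz_ineq2 mult_mono[OF bd[OF x] nz M norm_ge_zero]] .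
   moreover have "\<bar>P x \<bullet> z\<bar> \<le> CP * ?D" using order_trans[OF Cauchy_Schwarz_ineq2 mult_mono[OF PC[OF x] nz CP norm_ge_zero]] .
   ultimately show "\<bar>(b x \<bullet> z) * (P x \<bullet> z)\<bar> \<le> (M * ?D) * (CP * ?D)" unfolding abs_mult using M CP by (intro mult_mono) auto
  qed
  also have "... = (M * ?D) * (CP * ?D) * measure lborel (JX x)" by (simp add: measure_dm)
  finally have "?K * \<bar>LINT z|dm (JX x). (b x \<bullet> z) * (P x \<bullet> z)\<bar> \<le> ?K * ((M * ?D) * (CP * ?D) * measure lborel (JX x))"
   using K0 by (intro mult_left_mono) auto
  also have "... = (M * ?D) * (CP * ?D) * (?K * measure lborel (JX x))" by simp
  also have "... \<le> (M * ?D) * (CP * ?D) * 3" using measure_JX[of x] M CP by (intro mult_left_mono) auto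
  finally have 1: "\<bar>m x\<bar> \<le> 3 * (M * ?D^2 * CP)" unfolding m_def using K0 by (simp add: abs_mult power2_eq_square mult_ac)
  have "\<bar>b x \<bullet> P x\<bar> \<le> M * CP" using order_trans[OF Cauchy_Schwarz_ineq2 mult_mono[OF bd[OF x] PC[OF x] M norm_ge_zero]] .
  also have "... \<le> M * ?D^2 * CP"
  proof -
   have "1 \<le> ?D^2" using d_ge1 by (simp add: one_le_power)
   then have "M * CP * 1 \<le> M * CP * ?D^2" using M CP by (intro mult_left_mono) auto
   then show ?thesis by (simp add: mult_ac)
  qed
  finally have "\<bar>b x \<bullet> P x\<bar> \<le> M * ?D^2 * CP" .
  then have "\<bar>m x - b x \<bullet> P x\<bar> \<le> 4 * (M * ?D^2 * CP)" using 1 abs_triangle_ineq4[of "m x" "b x \<bullet> P x"] by simp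
  then show ?thesis using True by (simp add: mult.assoc)
 qed
 let ?c = "4 * M * ?D^2 * CP"
 have c0: "?c \<ge> 0" using M CP by simp
 have bbP: "bmon Om (\<lambda>x. u x * m x - u x * (b x \<bullet> P x))" by (intro bmon_intros u bm b P)
 have bA: "bmon Om (\<lambda>x. indicator A x :: real)" using A by (intro bmonI[of _ _ 1]) (auto simp: indicator_def)
 have "\<bar>LINT x|dm Om. u x * m x - u x * (b x \<bullet> P x)\<bar> \<le> (LINT x|dm Om. \<bar>u x * m x - u x * (b x \<bullet> P x)\<bar>)"
  using integral_norm_bound[of "dm Om" "\<lambda>x. u x * m x - u x * (b x \<bullet> P x)"] by simp
 also have "... \<le> (LINT x|dm Om. ?c * \<delta> * (u x)^2 + ?c / (4 * \<delta>) * indicator A x)"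
 proof (intro integral_Om_mono bmon_abs bbP)
  show "bmon Om (\<lambda>x. ?c * \<delta> * (u x)^2 + ?c / (4 * \<delta>) * indicator A x)" by (intro bmon_intros u bA)
  fix x assume x: "x \<in> Om"
  have "\<bar>u x * m x - u x * (b x \<bullet> P x)\<bar> = \<bar>u x\<bar> * \<bar>m x - b x \<bullet> P x\<bar>" by (simp add: abs_mult flip: right_diff_distrib)
  also have "... \<le> \<bar>u x\<bar> * (?c * indicator A x)" using mb[OF x] by (intro mult_left_mono) auto
  also have "... = ?c * (\<bar>u x\<bar> * indicator A x)" by simp
  also have "... \<le> ?c * (\<delta> * \<bar>u x\<bar>^2 + (indicator A x)^2 / (4 * \<delta>))" using c0 \<delta> by (intro mult_left_mono young) auto
  also have "... = ?c * \<delta> * (u x)^2 + ?c / (4 * \<delta>) * indicator A x" by (simp add: indicator_def distrib_left)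
  finally show "\<bar>u x * m x - u x * (b x \<bullet> P x)\<bar> \<le> ?c * \<delta> * (u x)^2 + ?c / (4 * \<delta>) * indicator A x" .
 qed
 also have "... = ?c * \<delta> * ?U + ?c / (4 * \<delta>) * measure lborel A"
 proof -
  have "(LINT x|dm Om. indicator A x :: real) = measure lborel A" using A by (simp add: measure_dm Int_absorb1)
  then show ?thesis
   by (subst lint_add) (auto intro!: integrable_Om bmon_intros u bA)
 qed
 also have "... \<le> ?c * \<delta> * ?U + ?c / (4 * \<delta>) * \<delta>^2" using A(3) c0 \<delta> by (intro add_left_mono mult_left_mono divide_nonneg_pos) auto
 also have "?c / (4 * \<delta>) * \<delta>^2 = ?c * \<delta> / 4" using \<delta> by (simp add: power2_eq_square)
 finally have E2: "\<bar>LINT x|dm Om. u x * m x - u x * (b x \<bullet> P x)\<bar> \<le> ?c * \<delta> * ?U + ?c * \<delta> / 4" .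
 have split1: "?K * (LINT p|dm J. F p - (F1 p + F2 p)) = form e b u q - (LINT x|dm Om. e * (gradh u x \<bullet> P x)) - (LINT x|dm Om. u x * m x)"
 proof -
  have "(LINT p|dm J. F p - (F1 p + F2 p)) = (LINT p|dm J. F p) - ((LINT p|dm J. F1 p) + (LINT p|dm J. F2 p))"
   by (simp add: integrable_J bF bF1 bF2)
  then show ?thesis unfolding KF1[symmetric] KF2[symmetric] form_def F_def[symmetric] by (simp only:) (simp add: algebra_simps)
 qed
 have split2: "(LINT x|dm Om. e * (gradh u x \<bullet> P x) + u x * (b x \<bullet> P x)) = (LINT x|dm Om. e * (gradh u x \<bullet> P x)) + (LINT x|dm Om. u x * (b x \<bullet> P x))"
  by (intro lint_add integrable_Om bmon_intros bmon_gradh u b P)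
 have split3: "(LINT x|dm Om. u x * m x - u x * (b x \<bullet> P x)) = (LINT x|dm Om. u x * m x) - (LINT x|dm Om. u x * (b x \<bullet> P x))"
  by (intro lint_diff integrable_Om bmon_intros bm u b P)
 have "\<bar>form e b u q - (LINT x|dm Om. e * (gradh u x \<bullet> P x) + u x * (b x \<bullet> P x))\<bar> \<le>
   \<bar>?K * (LINT p|dm J. F p - (F1 p + F2 p))\<bar> + \<bar>LINT x|dm Om. u x * m x - u x * (b x \<bullet> P x)\<bar>"
  unfolding split1 split2 split3 by linarith
 also have "... \<le> ((\<delta> * e / 2) * energy u + (\<delta> * M * ?D^2 / 2) * (3 * ?U) + 3 * (\<delta> * (e * ?D^2 + M * ?D^2) / 2) * measure lborel Om)
   + (?c * \<delta> * ?U + ?c * \<delta> / 4)"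
  using E1 E2 K0 by (intro add_mono) (auto simp: abs_mult)
 also have "... \<le> \<delta> * C * (1 + energy u + ?U)"
 proof -
  let ?m = "measure lborel Om" and ?E = "energy u"
  have a: "0 \<le> \<delta> * e" "0 \<le> \<delta> * M * ?D^2" "0 \<le> ?m" "0 \<le> ?E" "0 \<le> \<delta> * e * ?D^2" "0 \<le> \<delta> * ?c"
   using \<delta> e M energy_nonneg c0 by auto
  have "\<delta> * C * (1 + ?E + ?U) = \<delta> * e * (1 + ?E + ?U) + 2 * (\<delta> * e * ?D^2 * ?m) * (1 + ?E + ?U)
    + 2 * (\<delta> * M * ?D^2) * (1 + ?m) * (1 + ?E + ?U) + \<delta> * ?c * (1 + ?E + ?U)"
   unfolding C_def by (simp add: algebra_simps)
  moreover have "\<delta> * e * (1 + ?E + ?U) \<ge> \<delta> * e * ?E / 2" 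
   using mult_nonneg_nonneg[OF a(1,4)] mult_nonneg_nonneg[OF a(1) U0] a(1) by (simp add: distrib_left)
  moreover have "2 * (\<delta> * e * ?D^2 * ?m) * (1 + ?E + ?U) \<ge> 2 * (\<delta> * e * ?D^2 * ?m)"
   using mult_left_mono[of 1 "1 + ?E + ?U" "2 * (\<delta> * e * ?D^2 * ?m)"] a U0 mult_nonneg_nonneg[OF a(5,3)] by simp
  moreover have "2 * (\<delta> * M * ?D^2) * (1 + ?m) * (1 + ?E + ?U) \<ge> 2 * (\<delta> * M * ?D^2) * (?m + ?U)"
  proof -
   have "(1 + ?m) * (1 + ?E + ?U) = ?m + ?U + (1 + ?E + ?m * ?E + ?m * ?U)" by (simp add: algebra_simps)
   also have "... \<ge> ?m + ?U" using a U0 by (simp add: add_nonneg_nonneg)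
   finally have "2 * (\<delta> * M * ?D^2) * (?m + ?U) \<le> 2 * (\<delta> * M * ?D^2) * ((1 + ?m) * (1 + ?E + ?U))"
    using a(2) by (intro mult_left_mono) auto
   then show ?thesis by (simp only: mult.assoc)
  qed
  moreover have "\<delta> * ?c * (1 + ?E + ?U) \<ge> \<delta> * ?c * (1/4 + ?U)" using a(4,6) U0 by (intro mult_left_mono) auto
  moreover have "3 * (\<delta> * (e * ?D^2 + M * ?D^2) / 2) * ?m \<le> 2 * (\<delta> * e * ?D^2 * ?m) + 2 * (\<delta> * M * ?D^2) * ?m"
   using mult_nonneg_nonneg[OF a(5,3)] mult_nonneg_nonneg[OF a(2,3)] by (simp add: algebra_simps)
  moreover have "(\<delta> * M * ?D^2 / 2) * (3 * ?U) \<le> 2 * (\<delta> * M * ?D^2) * ?U"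
   using mult_nonneg_nonneg[OF a(2) U0] by (simp add: mult_ac)
  moreover have "?c * \<delta> * ?U + ?c * \<delta> / 4 = \<delta> * ?c * (1/4 + ?U)" by (simp add: algebra_simps)
  moreover have "(\<delta> * e / 2) * ?E = \<delta> * e * ?E / 2" by simp
  moreover have "2 * (\<delta> * M * ?D^2) * (?m + ?U) = 2 * (\<delta> * M * ?D^2) * ?m + 2 * (\<delta> * M * ?D^2) * ?U" by (simp add: algebra_simps)
  ultimately show ?thesis by linarith
 qed
 finally show ?thesis .
qed

text \<open>Discrete integration by parts: \<open>flip\<close> shifts the difference from
  \<open>u\<close> to \<open>q\<close>. The term \<open>G2\<close> vanishes as an odd moment and
  \<open>G3\<close> is a second moment, both because the full cube is admissible wherever
  \<open>q\<close> or \<open>P\<close> is not 0. The Taylor remainder \<open>R\<close> is the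
  error.\<close>

lemma weakgrad_consistent:
 fixes a :: 'a
 assumes u: "bmon Om u" and q: "bmon Om q" and P: "bmon Om P"
  and tay: "\<And>p. p \<in> J ==> \<bar>q (tgt p) - q (fst p) - h * (P (fst p) \<bullet> snd p)\<bar> \<le> h * real DIM('a) * \<delta>"
  and \<delta>: "\<delta> > 0" and inn: "\<And>x. x \<in> Om ==> q x \<noteq> 0 \<or> P x \<noteq> 0 ==> JX x = cube"
 shows "\<bar>LINT x|dm Om. u x * (P x \<bullet> a) + q x * (gradh u x \<bullet> a)\<bar> \<le> 3 * (real DIM('a))^2 * \<delta> * norm a * (LINT x|dm Om. \<bar>u x\<bar>)"
proof -
 let ?D = "real DIM('a)" and ?K = "kc TYPE('a)"
 have K0: "?K > 0" by (rule kc_pos)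
 define F where "F p = (u (tgt p) - u (fst p)) * (snd p \<bullet> (q (fst p) *\<^sub>R a))" for p
 define G1 where "G1 p = u (tgt p) * q (fst p) * (snd p \<bullet> a)" for p
 define G2 where "G2 p = u (fst p) * q (fst p) * (snd p \<bullet> a)" for p
 define G3 where "G3 p = u (fst p) * ((P (fst p) \<bullet> snd p) * (a \<bullet> snd p))" for p
 define R where "R p = u (fst p) * (q (tgt p) - q (fst p) - h * (P (fst p) \<bullet> snd p)) * (snd p \<bullet> a)" for p
 have bG1: "bmon J G1" and bG2: "bmon J G2" and bG3: "bmon J G3" and bR: "bmon J R"
  unfolding G1_def[abs_def] G2_def[abs_def] G3_def[abs_def] R_def[abs_def] by (intro bmon_intros bmon_J u q P)+
 have bG1f: "bmon J (\<lambda>p. G1 (flip p))" by (rule bmon_compose[OF bG1]) auto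
 have Feq: "(LINT p|dm J. F p) = (LINT p|dm J. G1 p) - (LINT p|dm J. G2 p)"
 proof -
  have "(LINT p|dm J. F p) = (LINT p|dm J. G1 p - G2 p)"
   by (intro lint_cong refl) (simp add: F_def G1_def G2_def algebra_simps)
  then show ?thesis by (simp add: integrable_J bG1 bG2)
 qed
 have G1eq: "(LINT p|dm J. G1 p) = - (LINT p|dm J. R p) - (LINT p|dm J. G2 p) - h * (LINT p|dm J. G3 p)"
 proof -
  have "G1 (flip p) = - R p - G2 p - h * G3 p" for p
   by (simp add: G1_def R_def G2_def G3_def inner_commute algebra_simps)
  then have "(LINT p|dm J. G1 p) = (LINT p|dm J. - R p - G2 p - h * G3 p)"
   using integral_flip[OF bG1] by simp
  also have "... = - (LINT p|dm J. R p) - (LINT p|dm J. G2 p) - h * (LINT p|dm J. G3 p)"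
   by (simp add: integrable_J bG2 bG3 bR)
  finally show ?thesis .
 qed
 have G20: "(LINT p|dm J. G2 p) = 0"
 proof -
  have "(LINT z|dm (JX x). G2 (x, z)) = 0" if "x \<in> Om" for x
  proof (cases "q x = 0")
   case False
   then have "JX x = cube" using inn[OF that] by simp
   then have "(LINT z|dm (JX x). G2 (x, z)) = u x * q x * (LINT z|dm cube. z \<bullet> a)" by (simp add: G2_def)
   also have "(LINT z|dm cube. z \<bullet> a) = 0" by (rule cube_odd) auto
   finally show ?thesis by simp
  qed (simp add: G2_def)
  then have "(LINT x|dm Om. LINT z|dm (JX x). G2 (x, z)) = (LINT x|dm Om. 0)"
   using bmon_measurable[OF bmon_inner_integral[OF bG2]] by (intro integral_cong_AE AE_dmI) auto
  then show ?thesis unfolding integral_J_iterated[OF bG2] by simp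
 qed
 have G3eq: "?K * (LINT p|dm J. G3 p) = (LINT x|dm Om. u x * (P x \<bullet> a))"
 proof -
  have "?K * (LINT z|dm (JX x). G3 (x, z)) = u x * (P x \<bullet> a)" if "x \<in> Om" for x
  proof (cases "P x = 0")
   case False
   then have "JX x = cube" using inn[OF that] by simp
   then have "?K * (LINT z|dm (JX x). G3 (x, z)) = u x * (?K * (LINT z|dm cube. (P x \<bullet> z) * (a \<bullet> z)))" by (simp add: G3_def)
   then show ?thesis by (simp add: cube_moment)
  qed (simp add: G3_def)
  then have "(LINT x|dm Om. ?K * (LINT z|dm (JX x). G3 (x, z))) = (LINT x|dm Om. u x * (P x \<bullet> a))"
   using bmon_measurable[OF bmon_mult[OF bmon_const bmon_inner_integral[OF bG3]]] bmon_measurable[OF bmon_mult[OF u bmon_inner[OF P bmon_const]]]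
   by (intro integral_cong_AE AE_dmI) auto
  then show ?thesis unfolding integral_J_iterated[OF bG3] by simp
 qed
 have qa: "bmon Om (\<lambda>x. q x *\<^sub>R a)" by (intro bmon_intros q)
 have "(LINT x|dm Om. q x * (gradh u x \<bullet> a)) = ?K / h * (LINT p|dm J. F p)"
  using gradh_dual[OF u qa] by (simp add: F_def)
 also have "... = - (LINT x|dm Om. u x * (P x \<bullet> a)) - ?K / h * (LINT p|dm J. R p)"
  unfolding Feq G1eq G20 G3eq[symmetric] using h_pos by (simp add: field_simps)
 finally have main: "(LINT x|dm Om. u x * (P x \<bullet> a)) + (LINT x|dm Om. q x * (gradh u x \<bullet> a)) = - (?K / h * (LINT p|dm J. R p))" by simp
 have "\<bar>LINT p|dm J. R p\<bar> \<le> (LINT p|dm J. \<bar>R p\<bar>)" using integral_norm_bound[of "dm J" R] by simp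
 also have "... \<le> (LINT p|dm J. (h * ?D^2 * \<delta> * norm a) * \<bar>u (fst p)\<bar>)"
 proof (intro integral_J_mono bmon_intros bR bmon_J u)
  fix p assume p: "p \<in> J"
  have "\<bar>snd p \<bullet> a\<bar> \<le> ?D * norm a" using order_trans[OF Cauchy_Schwarz_ineq2 mult_right_mono[OF J_norm[OF p] norm_ge_zero]] .
  then have "\<bar>R p\<bar> \<le> \<bar>u (fst p)\<bar> * (h * ?D * \<delta>) * (?D * norm a)"
   unfolding R_def abs_mult using tay[OF p] h_pos \<delta> by (intro mult_mono) auto
  then show "\<bar>R p\<bar> \<le> (h * ?D^2 * \<delta> * norm a) * \<bar>u (fst p)\<bar>" by (simp add: power2_eq_square mult_ac)
 qed
 also have "... = (h * ?D^2 * \<delta> * norm a) * (LINT p|dm J. \<bar>u (fst p)\<bar>)" by simp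
 finally have "?K / h * \<bar>LINT p|dm J. R p\<bar> \<le> ?K / h * ((h * ?D^2 * \<delta> * norm a) * (LINT p|dm J. \<bar>u (fst p)\<bar>))"
  using K0 h_pos by (intro mult_left_mono) auto
 also have "... = (?D^2 * \<delta> * norm a) * (?K * (LINT p|dm J. \<bar>u (fst p)\<bar>))" using h_pos by simp
 also have "... \<le> (?D^2 * \<delta> * norm a) * (3 * (LINT x|dm Om. \<bar>u x\<bar>))"
  using \<delta> by (intro mult_left_mono integral_J_fst[OF bmon_abs[OF u]]) auto
 finally have "?K / h * \<bar>LINT p|dm J. R p\<bar> \<le> 3 * ?D^2 * \<delta> * norm a * (LINT x|dm Om. \<bar>u x\<bar>)" by simp
 moreover have "(LINT x|dm Om. u x * (P x \<bullet> a) + q x * (gradh u x \<bullet> a)) = (LINT x|dm Om. u x * (P x \<bullet> a)) + (LINT x|dm Om. q x * (gradh u x \<bullet> a))"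
  by (intro lint_add integrable_Om bmon_intros u P q bmon_gradh)
 ultimately show ?thesis unfolding main using K0 h_pos by (simp add: abs_mult)
qed

end

section \<open>Test functions and their moduli of continuity\<close>

lemma norm_fst_snd_diff:
 fixes p q :: "'a::real_normed_vector \<times> 'b::real_normed_vector"
 shows "norm (fst p - fst q) \<le> norm (p - q)" "norm (snd p - snd q) \<le> norm (p - q)"
 using norm_fst_le[of "fst (p - q)" "snd (p - q)"] norm_snd_le[of "snd (p - q)" "fst (p - q)"]
 unfolding prod.collapse by (simp_all only: fst_diff snd_diff)

lemma bmon_param_integral:
 fixes F :: "'a::euclidean_space \<times> 'b::euclidean_space => 'c::euclidean_space"
 assumes A: "A \<in> sets borel" "bounded A" and F: "bmon (A \<times> B) F"
 shows "bmon B (\<lambda>s. LINT x|dm A. F (x, s))"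
proof -
 obtain C where C: "\<forall>p\<in>A \<times> B. norm (F p) \<le> C" using F by (auto simp: bmon_def)
 have Fm: "F \<in> borel_measurable borel" using F by (rule bmon_measurable)
 have sec: "(\<lambda>x. F (x, s)) \<in> borel_measurable borel" for s
 proof -
  have "(\<lambda>x. (x, s)) \<in> borel_measurable borel" by (intro borel_measurable_continuous_onI continuous_intros)
  from measurable_compose[OF this Fm] show ?thesis by simp
 qed
 have "(\<lambda>p::'b \<times> 'a. (snd p, fst p)) \<in> borel_measurable borel" by (intro borel_measurable_continuous_onI continuous_intros)
 from measurable_compose[OF this Fm] have sw: "(\<lambda>p::'b \<times> 'a. F (snd p, fst p)) \<in> borel_measurable borel" by simp
 have "(\<lambda>(s, x). indicator A x *\<^sub>R F (x, s)) \<in> borel_measurable (lborel \<Otimes>\<^sub>M lborel)"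
  unfolding lborel_prod split_beta' using sw snd_borel_measurable A(1) by measurable
 from lborel.borel_measurable_lebesgue_integral[OF this]
 have m: "(\<lambda>s. LINT x|dm A. F (x, s)) \<in> borel_measurable borel" by (simp add: integral_dm[OF A(1) sec])
 show ?thesis
 proof (rule bmonI[OF m])
  fix s assume s: "s \<in> B"
  have "norm (LINT x|dm A. F (x, s)) \<le> (LINT x|dm A. norm (F (x, s)))" by (rule integral_norm_bound)
  also have "... \<le> (LINT x|dm A. max C 0)"
  proof (rule integral_mono_AE)
   show "integrable (dm A) (\<lambda>x. norm (F (x, s)))"
    by (intro integrable_bmon A bmon_norm bmonI[of _ _ C] sec) (use C s in auto)
   show "integrable (dm A) (\<lambda>x. max C 0)" by (intro integrable_bmon A bmon_const)
   show "AE x in dm A. norm (F (x, s)) \<le> max C 0" by (intro AE_dmI A) (use C s in \<open>auto simp: le_max_iff_disj\<close>)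
  qed
  finally show "norm (LINT x|dm A. F (x, s)) \<le> max C 0 * measure lborel A" by (simp add: measure_dm A mult.commute)
 qed
qed

lemma bmon_continuous:
 assumes g: "continuous_on UNIV g" and A: "bounded A"
 shows "bmon A g"
proof -
 have "compact (g ` closure A)"
  by (rule compact_continuous_image[OF continuous_on_subset[OF g]]) (use A in auto)
 then obtain C where "\<forall>y\<in>g ` closure A. norm y \<le> C" using compact_imp_bounded[of "g ` closure A"] by (auto simp: bounded_iff)
 then show ?thesis
  by (intro bmonI[of _ _ C] borel_measurable_continuous_onI g) (use closure_subset[of A] in auto)
qed

lemma C1_test_partials:
 assumes "C1_test \<psi> D\<psi>"
 shows "((\<lambda>\<xi>. \<psi> (\<xi>, s)) has_derivative (\<lambda>v. fst (D\<psi> (x, s)) \<bullet> v)) (at x)"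
  and "((\<lambda>s. \<psi> (x, s)) has_real_derivative snd (D\<psi> (x, s))) (at s)"
  and "continuous_on UNIV \<psi>" and "continuous_on UNIV D\<psi>"
proof -
 have d: "(\<psi> has_derivative (\<lambda>k. D\<psi> z \<bullet> k)) (at z)" for z using assms unfolding C1_test_def by blast
 show "continuous_on UNIV D\<psi>" using assms by (auto simp: C1_test_def)
 show "continuous_on UNIV \<psi>" by (intro continuous_at_imp_continuous_on ballI has_derivative_continuous[OF d])
 have "((\<lambda>\<xi>. (\<xi>, s)) has_derivative (\<lambda>v. (v, 0))) (at x)" by (intro has_derivative_Pair has_derivative_ident has_derivative_const)
 from has_derivative_compose[OF this d] show "((\<lambda>\<xi>. \<psi> (\<xi>, s)) has_derivative (\<lambda>v. fst (D\<psi> (x, s)) \<bullet> v)) (at x)"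
  by (simp add: inner_Pair_0)
 have "((\<lambda>s. (x, s)) has_derivative (\<lambda>v. (0, v))) (at s)" by (intro has_derivative_Pair has_derivative_ident has_derivative_const)
 from has_derivative_compose[OF this d] show "((\<lambda>s. \<psi> (x, s)) has_real_derivative snd (D\<psi> (x, s))) (at s)"
  by (simp add: inner_Pair_0 has_field_derivative_def)
qed

text \<open>\<open>\<xi>\<close> may lie outside \<open>A\<close>, since the Taylor estimate runs
  over whole balls around points of the domain; hence uniform continuity is taken on a larger ball
  with one unit of room.\<close>

lemma test_modulus:
 fixes D :: "'a::euclidean_space \<times> real => 'b::euclidean_space"
 assumes C: "continuous_on UNIV D" and bd: "bounded A" and \<delta>: "\<delta> > 0"
 shows "\<exists>d>0. \<forall>x\<in>A. \<forall>\<xi>. \<forall>s\<in>{0..T}. \<forall>s'\<in>{0..T}. norm (\<xi> - x) \<le> d \<and> \<bar>s - s'\<bar> \<le> d \<longrightarrow> norm (D (\<xi>, s) - D (x, s')) \<le> \<delta>"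
proof -
 obtain r where r: "\<And>x. x \<in> A ==> norm x \<le> r" using bd by (auto simp: bounded_iff)
 let ?K = "cball (0::'a) (r + 1) \<times> {0..T}"
 have "uniformly_continuous_on ?K D"
  by (rule compact_uniformly_continuous[OF continuous_on_subset[OF C]]) (auto intro: compact_Times)
 then obtain d where d: "d > 0" "\<And>z z'. z \<in> ?K ==> z' \<in> ?K ==> dist z' z < d ==> dist (D z') (D z) < \<delta>"
  unfolding uniformly_continuous_on_def using \<delta> by meson
 show ?thesis
 proof (rule exI[of _ "min 1 (d / 3)"], intro conjI ballI allI impI)
  show "min 1 (d / 3) > 0" using d by simp
  fix x \<xi> s s' assume x: "x \<in> A" "s \<in> {0..T}" "s' \<in> {0..T}" and n: "norm (\<xi> - x) \<le> min 1 (d / 3) \<and> \<bar>s - s'\<bar> \<le> min 1 (d / 3)"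
  have "norm \<xi> \<le> r + 1" using r[OF x(1)] norm_triangle_ineq[of "\<xi> - x" x] n by simp
  then have K: "(x, s') \<in> ?K" "(\<xi>, s) \<in> ?K" using x r[OF x(1)] by auto
  have "dist (\<xi>, s) (x, s') \<le> norm (\<xi> - x) + \<bar>s - s'\<bar>"
   using sqrt_sum_squares_le_sum[of "norm (\<xi> - x)" "\<bar>s - s'\<bar>"] by (simp add: dist_norm norm_Pair)
  then have "dist (\<xi>, s) (x, s') < d" using n d(1) by linarith
  from d(2)[OF K this] show "norm (D (\<xi>, s) - D (x, s')) \<le> \<delta>" by (simp add: dist_norm)
 qed
qed

section \<open>Interpolation of the scheme in time\<close>

context drift
begin

text \<open>Number of full steps from \<open>T\<close> back to \<open>t\<close>. The interpolation
  is constant on slots closed at their later end, which gives the data themselves at time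
  \<open>T\<close> and the last iterate at time 0.\<close>

definition idx :: "real => real => nat" where
 "idx dt t = nat \<lfloor>(T - t) / dt\<rfloor>"

lemma idx_slot: assumes "dt > 0" "s \<in> slot dt n" shows "idx dt s = n"
proof -
 have "real n \<le> (T - s) / dt" "(T - s) / dt < real n + 1" using assms by (auto simp: slot_def field_simps)
 then have "\<lfloor>(T - s) / dt\<rfloor> = int n" by (intro floor_unique) auto
 then show ?thesis by (simp add: idx_def)
qed

lemma idx_ends: "dt > 0 ==> idx dt T = 0" "dt > 0 ==> real N * dt = T ==> idx dt 0 = N"
 by (auto simp: idx_def)

lemma idx_le: assumes "dt > 0" "real N * dt = T" "0 \<le> t" shows "idx dt t \<le> N"
proof -
 have "(T - t) / dt < real N + 1" using assms by (simp add: field_simps)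
 then have "\<lfloor>(T - t) / dt\<rfloor> \<le> int N" by (simp add: floor_le_iff)
 then show ?thesis by (simp add: idx_def)
qed

lemma idx_diff:
 assumes "dt > 0" "s \<le> t" "t \<le> T"
 shows "idx dt t \<le> idx dt s" "real (idx dt s - idx dt t) * dt < t - s + dt"
proof -
 have a: "0 \<le> (T - t) / dt" "(T - t) / dt \<le> (T - s) / dt" using assms by (auto simp: divide_right_mono)
 then have f: "0 \<le> \<lfloor>(T - t) / dt\<rfloor>" "\<lfloor>(T - t) / dt\<rfloor> \<le> \<lfloor>(T - s) / dt\<rfloor>" by (auto intro: floor_mono)
 from f(2) show le: "idx dt t \<le> idx dt s" unfolding idx_def by (rule nat_mono)
 have "real (idx dt s - idx dt t) = real_of_int \<lfloor>(T - s) / dt\<rfloor> - real_of_int \<lfloor>(T - t) / dt\<rfloor>"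
  using f(1) order_trans[OF f] le by (simp add: of_nat_diff) (simp add: idx_def)
 also have "... < (T - s) / dt - (T - t) / dt + 1" by linarith
 finally have "real (idx dt s - idx dt t) * dt < ((T - s) / dt - (T - t) / dt + 1) * dt" using assms by (intro mult_strict_right_mono)
 also have "... = t - s + dt" using assms by (simp add: field_simps)
 finally show "real (idx dt s - idx dt t) * dt < t - s + dt" .
qed

lemma slot_subset: assumes "dt > 0" "real N * dt = T" "n < N" shows "slot dt n \<subseteq> {0<..<T}"
proof -
 have "real (Suc n) * dt \<le> real N * dt" using assms by (intro mult_right_mono) auto
 moreover have "0 \<le> real n * dt" using assms by simp
 ultimately show ?thesis unfolding slot_def assms(2) by auto
qed

lemma integral_slots:
 fixes g :: "real => 'b::euclidean_space"
 assumes dt: "dt > 0" and N: "real N * dt = T" and g: "bmon {0<..<T} g"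
 shows "(LINT s|dm {0<..<T}. g s) = (\<Sum>n<N. LINT s|dm (slot dt n). g s)"
proof -
 note [measurable] = bmon_measurable[OF g] slot_sets(1)
 let ?S = "(\<lambda>n. T - real n * dt) ` {..N}"
 have "AE s in lborel. s \<notin> ?S" by (rule AE_not_in) (rule finite_imp_null_set_lborel, simp)
 then have ae: "AE s in lborel. indicator {0<..<T} s *\<^sub>R g s = (\<Sum>n<N. indicator (slot dt n) s *\<^sub>R g s)"
 proof eventually_elim
  fix s assume s: "s \<notin> ?S"
  show "indicator {0<..<T} s *\<^sub>R g s = (\<Sum>n<N. indicator (slot dt n) s *\<^sub>R g s)"
  proof (cases "s \<in> {0<..<T}")
   case True
   define n where "n = idx dt s"
   have r: "0 \<le> (T - s) / dt" "(T - s) / dt < real N" using True dt N by (auto simp: field_simps)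
   have "real n = real_of_int \<lfloor>(T - s) / dt\<rfloor>" using r by (simp add: n_def idx_def)
   then have n: "real n \<le> (T - s) / dt" "(T - s) / dt < real n + 1" by linarith+
   then have nN: "n < N" using r by linarith
   then have "s \<noteq> T - real n * dt" using s by auto
   then have sl: "s \<in> slot dt n" using n dt by (auto simp: slot_def field_simps less_le)
   have "indicator (slot dt m) s = (if m = n then 1 else (0::real))" for m
    using idx_slot[OF dt, of s m] sl unfolding n_def[symmetric] by (cases "s \<in> slot dt m") auto
   then show ?thesis using True nN by (simp add: if_distrib[of "\<lambda>c. c *\<^sub>R _"] cong: if_cong)
  next
   case False
   then have "s \<notin> slot dt n" if "n < N" for n using slot_subset[OF dt N that] by auto
   then show ?thesis using False by simp
  qed
 qed
 have i: "integrable lborel (\<lambda>s. indicator (slot dt n) s *\<^sub>R g s)" if "n < N" for n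
  using integrable_bmon[OF slot_sets bmon_subset[OF g slot_subset[OF dt N that]]] by (subst (asm) integrable_dm_iff) auto
 have "(LINT s|dm {0<..<T}. g s) = (LINT s|lborel. indicator {0<..<T} s *\<^sub>R g s)" by (intro integral_dm) auto
 also have "... = (LINT s|lborel. (\<Sum>n<N. indicator (slot dt n) s *\<^sub>R g s))" by (intro integral_cong_AE ae) measurable
 also have "... = (\<Sum>n<N. LINT s|lborel. indicator (slot dt n) s *\<^sub>R g s)" using i by (intro lint_sum) auto
 also have "... = (\<Sum>n<N. LINT s|dm (slot dt n). g s)" by (intro sum.cong refl integral_dm[symmetric]) auto
 finally show ?thesis .
qed

definition sol :: "real => real => real => ('a => real) => real => 'a => real" where
 "sol h e dt f t x = jump.it Om h e dt (bav dt) f (idx dt t) x"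

definition solg :: "real => real => real => ('a => real) => real => 'a => 'a" where
 "solg h e dt f t x = jump.gradh Om h (jump.it Om h e dt (bav dt) f (idx dt t)) x"

text \<open>Residual of the weak formulation along the scheme. It is linear in the pair of
  \<open>sol\<close> and \<open>solg\<close>, so its smallness passes to convex
  combinations.\<close>

definition defect :: "real => real => real => ('a => real) => ('a \<times> real => real) => ('a \<times> real => 'a \<times> real) => real" where
 "defect h e dt f \<psi> D\<psi> = (LINT x|dm Om. sol h e dt f T x * \<psi> (x, T)) - (LINT x|dm Om. sol h e dt f 0 x * \<psi> (x, 0))
  - (LINT z|dm (Om \<times> {0<..<T}). ev (sol h e dt f) z * snd (D\<psi> z) + (ev (solg h e dt f) z \<bullet> (e *\<^sub>R fst (D\<psi> z))
   + ev (sol h e dt f) z * (ev B z \<bullet> fst (D\<psi> z))))"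

text \<open>The time-step restrictions of \<open>step_energy\<close>; the constant
  \<open>crude\<close> is written out because it belongs to the locale \<open>jump\<close>, whose
  \<open>h\<close> is not yet fixed here.\<close>

definition mesh :: "real => real => real => nat => bool" where
 "mesh e h dt N \<longleftrightarrow> 0 < h \<and> 0 < dt \<and> real N * dt = T \<and> 48 * dt \<le> h^2 \<and>
   2 * dt * (24 / h^2 * (12 * e^2 / h^2 + 3 * M^2 * (real DIM('a))^2)) \<le> 1"

end

section \<open>Bounds and residuals on a fixed mesh\<close>

locale scheme = drift Om T B M for Om :: "'a::euclidean_space set" and T B M +
 fixes e h dt :: real and N :: nat and f :: "'a => real"
 assumes e_pos: "e > 0" and mesh: "mesh e h dt N" and f: "bmon Om f"
begin

lemma h0: "h > 0" using mesh by (simp add: mesh_def)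

sublocale jump Om h using open_dom bounded_dom h0 by unfold_locales

lemma dt0: "dt > 0" and NT: "real N * dt = T" and dth: "48 * dt \<le> h^2" and dtc: "2 * dt * crude e M \<le> 1"
 using mesh by (simp_all add: mesh_def crude_def)

lemma M0: "M \<ge> 0" using M_ge1 by simp

definition u :: "nat => 'a => real" where "u = it e dt (bav dt) f"

lemma sol_u: "sol h e dt f t = u (idx dt t)" and solg_u: "solg h e dt f t = gradh (u (idx dt t))"
 by (auto simp: sol_def solg_def u_def)

lemma bmon_u: "bmon Om (u n)" unfolding u_def by (rule bmon_it[OF f bmon_bav[OF dt0]])

definition X :: real where "X = exp (grow e M * T) * (LINT x|dm Om. (f x)^2)"

lemma X_eq: "X = exp ((3 * M^2 * (real DIM('a))^2 / e + 1) * T) * (LINT x|dm Om. (f x)^2)"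
 by (simp add: X_def grow_def)

lemma grow0: "grow e M \<ge> 0" unfolding grow_def using e_pos by auto

lemma X0: "X \<ge> 0" unfolding X_def by (intro mult_nonneg_nonneg integral_Om_nonneg) auto

lemma u_energy:
 assumes "n \<le> N"
 shows "(LINT x|dm Om. (u n x)^2) + dt * (e / 2) * (\<Sum>j<n. energy (u j)) \<le> X"
proof -
 have "(LINT x|dm Om. (u n x)^2) + dt * (e / 2) * (\<Sum>j<n. energy (u j)) \<le> exp (grow e M * (real n * dt)) * (LINT x|dm Om. (f x)^2)"
  unfolding u_def using e_pos M0 dt0 dtc dth
  by (intro it_energy[where b="bav dt"] f bmon_bav bav_bound) auto
 also have "... \<le> X" unfolding X_def
 proof (intro mult_right_mono)
  have "real n * dt \<le> T" using assms dt0 NT mult_right_mono[of "real n" "real N" dt] by simp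
  then show "exp (grow e M * (real n * dt)) \<le> exp (grow e M * T)" using grow0 by (simp add: mult_left_mono)
 qed (intro integral_Om_nonneg, auto)
 finally show ?thesis .
qed

lemma u_L2: assumes "n \<le> N" shows "(LINT x|dm Om. (u n x)^2) \<le> X"
proof -
 have "0 \<le> dt * (e / 2) * (\<Sum>j<n. energy (u j))" using dt0 e_pos by (intro mult_nonneg_nonneg sum_nonneg energy_nonneg) auto
 then show ?thesis using u_energy[OF assms] by linarith
qed

lemma sum_energy: "(\<Sum>n<N. dt * energy (u n)) \<le> 2 / e * X"
proof -
 have "0 \<le> (LINT x|dm Om. (u N x)^2)" by (intro integral_Om_nonneg) auto
 moreover have "(e / 2) * (\<Sum>j<N. dt * energy (u j)) = dt * (e / 2) * (\<Sum>j<N. energy (u j))" by (simp add: sum_distrib_left[symmetric])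
 ultimately have "(e / 2) * (\<Sum>j<N. dt * energy (u j)) \<le> X" using u_energy[OF order_refl] by linarith
 then show ?thesis using e_pos by (simp add: field_simps)
qed

text \<open>Only the iterates up to \<open>N\<close> occur on the time range, so their bounds have a
  common majorant; joint measurability holds because the index takes countably many values.\<close>

lemma bmon_idx:
 fixes v :: "nat => 'a => 'b::euclidean_space"
 assumes v: "\<And>n. bmon Om (v n)"
 shows "(\<lambda>z. v (idx dt (snd z)) (fst z)) \<in> borel_measurable borel" "bmon (Om \<times> {0..T}) (\<lambda>z. v (idx dt (snd z)) (fst z))"
proof -
 note [measurable] = fst_borel_measurable snd_borel_measurable bmon_measurable[OF v]
 have [measurable]: "nat \<in> measurable (count_space UNIV) (count_space UNIV)" by simp
 have "(\<lambda>z::'a \<times> real. idx dt (snd z)) \<in> measurable borel (count_space UNIV)" unfolding idx_def by measurable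
 then show m: "(\<lambda>z. v (idx dt (snd z)) (fst z)) \<in> borel_measurable borel"
  by (rule measurable_compose_countable[rotated]) measurable
 have "\<forall>n. \<exists>C. \<forall>x\<in>Om. norm (v n x) \<le> C" using v by (auto simp: bmon_def)
 from choice[OF this] obtain C where C: "\<forall>n. \<forall>x\<in>Om. norm (v n x) \<le> C n" by (elim exE)
 show "bmon (Om \<times> {0..T}) (\<lambda>z. v (idx dt (snd z)) (fst z))"
 proof (rule bmonI[OF m])
  fix p assume p: "p \<in> Om \<times> {0..T}"
  then have "idx dt (snd p) \<le> N" by (intro idx_le[OF dt0 NT]) auto
  then have "\<bar>C (idx dt (snd p))\<bar> \<le> (\<Sum>n\<le>N. \<bar>C n\<bar>)" by (intro member_le_sum) auto
  moreover have "norm (v (idx dt (snd p)) (fst p)) \<le> C (idx dt (snd p))" using C p by auto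
  ultimately show "norm (v (idx dt (snd p)) (fst p)) \<le> (\<Sum>n\<le>N. \<bar>C n\<bar>)" by linarith
 qed
qed

lemma sol_measurable: "(\<lambda>z. ev (sol h e dt f) z) \<in> borel_measurable borel"
 and bmon_sol: "bmon (Om \<times> {0..T}) (\<lambda>z. ev (sol h e dt f) z)"
 unfolding sol_u by (intro bmon_idx bmon_u)+

lemma solg_measurable: "(\<lambda>z. ev (solg h e dt f) z) \<in> borel_measurable borel"
 and bmon_solg: "bmon (Om \<times> {0..T}) (\<lambda>z. ev (solg h e dt f) z)"
 unfolding solg_u by (intro bmon_idx bmon_gradh bmon_u)+

lemma strips:
 fixes F :: "'a \<times> real => 'b::euclidean_space"
 assumes A: "A \<in> sets borel" "A \<subseteq> Om" and F: "bmon (A \<times> {0<..<T}) F"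
 shows "(LINT z|dm (A \<times> {0<..<T}). F z) = (\<Sum>n<N. LINT s|dm (slot dt n). LINT x|dm A. F (x, s))"
proof -
 have bA: "bounded A" using A(2) bounded_subset bounded_dom by blast
 have "integrable (dm (A \<times> {0<..<T})) F"
  by (intro integrable_bmon Times_sets_borel A F bounded_Times bA) (auto simp flip: box_real)
 then have "(LINT z|dm (A \<times> {0<..<T}). F z) = (LINT s|dm {0<..<T}. LINT x|dm A. F (x, s))"
  by (intro integral_dm_Times(2) A bmon_measurable[OF F]) auto
 also have "... = (\<Sum>n<N. LINT s|dm (slot dt n). LINT x|dm A. F (x, s))"
  by (intro integral_slots[OF dt0 NT] bmon_param_integral A bA F)
 finally show ?thesis .
qed

lemma strips_le:
 fixes F :: "'a \<times> real => real"
 assumes A: "A \<in> sets borel" "A \<subseteq> Om" and F: "bmon (A \<times> {0<..<T}) F"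
  and b: "\<And>n s. n < N ==> s \<in> slot dt n ==> (LINT x|dm A. F (x, s)) \<le> \<beta> n"
 shows "(LINT z|dm (A \<times> {0<..<T}). F z) \<le> (\<Sum>n<N. dt * \<beta> n)"
 unfolding strips[OF A F]
proof (rule sum_mono)
 fix n assume "n \<in> {..<N}"
 then have n: "n < N" by simp
 have bA: "bounded A" using A(2) bounded_subset bounded_dom by blast
 have "(LINT s|dm (slot dt n). LINT x|dm A. F (x, s)) \<le> (LINT s|dm (slot dt n). \<beta> n)"
  by (intro integral_mono_AE integrable_bmon slot_sets bmon_const AE_dmI b[OF n]
    bmon_subset[OF bmon_param_integral[OF A(1) bA F] slot_subset[OF dt0 NT n]])
 then show "(LINT s|dm (slot dt n). LINT x|dm A. F (x, s)) \<le> dt * \<beta> n" by (simp add: measure_dm measure_slot dt0)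
qed

lemma strips_abs:
 fixes F :: "'a \<times> real => real"
 assumes A: "A \<in> sets borel" "A \<subseteq> Om" and F: "bmon (A \<times> {0<..<T}) F"
  and b: "\<And>n s. n < N ==> s \<in> slot dt n ==> \<bar>LINT x|dm A. F (x, s)\<bar> \<le> \<beta> n"
 shows "\<bar>LINT z|dm (A \<times> {0<..<T}). F z\<bar> \<le> (\<Sum>n<N. dt * \<beta> n)"
proof -
 have "(LINT z|dm (A \<times> {0<..<T}). F z) \<le> (\<Sum>n<N. dt * \<beta> n)"
  by (rule strips_le[OF A F]) (use b in \<open>auto simp: abs_le_iff\<close>)
 moreover have "(LINT z|dm (A \<times> {0<..<T}). - F z) \<le> (\<Sum>n<N. dt * \<beta> n)"
  by (rule strips_le[OF A bmon_minus[OF F]]) (use b in \<open>auto simp: abs_le_iff\<close>)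
 ultimately show ?thesis by simp
qed

lemma Q_sub: "A \<subseteq> Om ==> A \<times> {0<..<T} \<subseteq> Om \<times> {0..T}" by auto

lemma sol_slot: "s \<in> slot dt n ==> sol h e dt f s = u n" "s \<in> slot dt n ==> solg h e dt f s = gradh (u n)"
 using idx_slot[OF dt0] by (simp_all add: sol_u solg_u)

lemma sol_strip_bound:
 assumes A: "A \<in> sets borel" "A \<subseteq> Om" and b: "\<And>n. n < N ==> (LINT x|dm A. (u n x)^2) \<le> \<eta>"
 shows "(LINT z|dm (A \<times> {0<..<T}). (ev (sol h e dt f) z)^2) \<le> T * \<eta>"
proof -
 have "(LINT z|dm (A \<times> {0<..<T}). (ev (sol h e dt f) z)^2) \<le> (\<Sum>n<N. dt * \<eta>)"
  by (intro strips_le A bmon_power bmon_subset[OF bmon_sol Q_sub]) (use b in \<open>auto simp: sol_slot\<close>)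
 also have "... = T * \<eta>" by (simp flip: NT)
 finally show ?thesis .
qed

lemma sol_bound: "(LINT z|dm (Om \<times> {0<..<T}). (ev (sol h e dt f) z)^2) \<le> T * X"
 by (intro sol_strip_bound u_L2) auto

lemma solg_bound: "(LINT z|dm (Om \<times> {0<..<T}). (norm (ev (solg h e dt f) z))^2) \<le> 3 * (real DIM('a))^2 * (2 / e * X)"
proof -
 have "(LINT z|dm (Om \<times> {0<..<T}). (norm (ev (solg h e dt f) z))^2) \<le> (\<Sum>n<N. dt * (3 * (real DIM('a))^2 * energy (u n)))"
  by (intro strips_le bmon_power bmon_norm bmon_subset[OF bmon_solg Q_sub]) (auto simp: sol_slot gradh_bound[OF bmon_u])
 also have "... = 3 * (real DIM('a))^2 * (\<Sum>n<N. dt * energy (u n))" by (simp add: sum_distrib_left mult_ac)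
 also have "... \<le> 3 * (real DIM('a))^2 * (2 / e * X)" by (intro mult_left_mono sum_energy) auto
 finally show ?thesis .
qed

lemma weakgrad_residual:
 assumes test: "C1_test \<psi> D\<psi>" and \<delta>: "\<delta> > 0"
  and oX: "\<And>x \<xi> s. x \<in> Om ==> s \<in> {0..T} ==> norm (\<xi> - x) \<le> h * real DIM('a) ==> norm (D\<psi> (\<xi>, s) - D\<psi> (x, s)) \<le> \<delta>"
  and inn: "\<And>x s. x \<in> Om ==> s \<in> {0<..<T} ==> \<psi> (x, s) \<noteq> 0 \<or> fst (D\<psi> (x, s)) \<noteq> 0 ==> JX x = cube"
 shows "\<bar>LINT z|dm (Om \<times> {0<..<T}). ev (sol h e dt f) z * (fst (D\<psi> z) \<bullet> a) + \<psi> z * (ev (solg h e dt f) z \<bullet> a)\<bar>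
  \<le> \<delta> * (3 * (real DIM('a))^2 * norm a * (measure lborel Om + X) * T)"
proof -
 let ?D = "real DIM('a)"
 note cont = C1_test_partials(3,4)[OF test]
 have bQ: "bounded (Om \<times> {0<..<T})" using bounded_dom by (intro bounded_Times) (auto simp flip: box_real)
 have cs: "continuous_on UNIV (\<lambda>x. g (x, s))" if "continuous_on UNIV g" for g :: "'a \<times> real => 'b::euclidean_space" and s
  by (rule continuous_on_compose2[OF that]) (auto intro!: continuous_intros)
 have "\<bar>LINT z|dm (Om \<times> {0<..<T}). ev (sol h e dt f) z * (fst (D\<psi> z) \<bullet> a) + \<psi> z * (ev (solg h e dt f) z \<bullet> a)\<bar>
   \<le> (\<Sum>n<N. dt * (3 * ?D^2 * \<delta> * norm a * (measure lborel Om + X)))"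
 proof (intro strips_abs Om_sets order_refl)
  show "bmon (Om \<times> {0<..<T}) (\<lambda>z. ev (sol h e dt f) z * (fst (D\<psi> z) \<bullet> a) + \<psi> z * (ev (solg h e dt f) z \<bullet> a))"
   by (intro bmon_intros bmon_subset[OF bmon_sol Q_sub] bmon_subset[OF bmon_solg Q_sub] order_refl
     bmon_continuous[OF _ bQ] continuous_on_fst cont)
  fix n s assume n: "n < N" and s: "s \<in> slot dt n"
  have sT: "s \<in> {0<..<T}" using slot_subset[OF dt0 NT n] s by auto
  have sT': "s \<in> {0..T}" using sT by auto
  have "\<bar>LINT x|dm Om. u n x * (fst (D\<psi> (x, s)) \<bullet> a) + \<psi> (x, s) * (gradh (u n) x \<bullet> a)\<bar> \<le> 3 * ?D^2 * \<delta> * norm a * (LINT x|dm Om. \<bar>u n x\<bar>)"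
  proof (rule weakgrad_consistent[OF bmon_u _ _ _ \<delta>])
   show "bmon Om (\<lambda>x. \<psi> (x, s))" "bmon Om (\<lambda>x. fst (D\<psi> (x, s)))"
    by (intro bmon_continuous bounded_dom cs continuous_on_fst cont)+
   show "JX x = cube" if "x \<in> Om" "\<psi> (x, s) \<noteq> 0 \<or> fst (D\<psi> (x, s)) \<noteq> 0" for x using inn[OF that(1) sT that(2)] .
   fix p assume p: "p \<in> J"
   show "\<bar>\<psi> (tgt p, s) - \<psi> (fst p, s) - h * (fst (D\<psi> (fst p, s)) \<bullet> snd p)\<bar> \<le> h * real DIM('a) * \<delta>"
   proof (rule taylor_tgt[where q="\<lambda>x. \<psi> (x, s)" and P="\<lambda>x. fst (D\<psi> (x, s))", OF C1_test_partials(1)[OF test] _ p])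
    fix \<xi> assume "norm (\<xi> - fst p) \<le> h * real DIM('a)"
    then have "norm (D\<psi> (\<xi>, s) - D\<psi> (fst p, s)) \<le> \<delta>" using p by (intro oX sT') (auto simp: J_iff)
    then show "norm (fst (D\<psi> (\<xi>, s)) - fst (D\<psi> (fst p, s))) \<le> \<delta>"
      by (rule order_trans[OF norm_fst_snd_diff(1)])
   qed
  qed
  also have "(LINT x|dm Om. \<bar>u n x\<bar>) \<le> measure lborel Om + X"
  proof -
   have "(LINT x|dm Om. \<bar>u n x\<bar>) \<le> (LINT x|dm Om. 1 + (u n x)^2)"
   proof (intro integral_Om_mono bmon_intros bmon_u)
    fix x show "\<bar>u n x\<bar> \<le> 1 + (u n x)^2" using zero_le_power2[of "\<bar>u n x\<bar> - 1"] zero_le_power2[of "u n x"] by (simp add: power2_diff)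
   qed
   also have "... = measure lborel Om + (LINT x|dm Om. (u n x)^2)"
    by (subst lint_add) (auto intro!: integrable_Om bmon_intros bmon_u simp: measure_dm)
   also have "... \<le> measure lborel Om + X" using u_L2[of n] n by simp
   finally show ?thesis .
  qed
  finally show "\<bar>LINT x|dm Om. sol h e dt f (snd (x, s)) (fst (x, s)) * (fst (D\<psi> (x, s)) \<bullet> a) + \<psi> (x, s) * (solg h e dt f (snd (x, s)) (fst (x, s)) \<bullet> a)\<bar>
    \<le> 3 * ?D^2 * \<delta> * norm a * (measure lborel Om + X)" using \<delta> s by (simp add: sol_slot mult_left_mono)
 qed
 also have "... = \<delta> * (3 * ?D^2 * norm a * (measure lborel Om + X) * T)" by (simp flip: NT)
 finally show ?thesis .
qed

lemma slot_average:
 "(LINT s|dm (slot dt n). c + B s x \<bullet> w) = dt * (c + bav dt n x \<bullet> w)"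
proof -
 have i: "integrable (dm (slot dt n)) (\<lambda>s. B s x \<bullet> w)" by (rule integrable_inner_left) (rule integrable_slot)
 have "(LINT s|dm (slot dt n). c + B s x \<bullet> w) = (LINT s|dm (slot dt n). c) + (LINT s|dm (slot dt n). B s x \<bullet> w)"
  by (intro lint_add i integrable_bmon slot_sets bmon_const)
 also have "(LINT s|dm (slot dt n). B s x \<bullet> w) = (LINT s|dm (slot dt n). B s x) \<bullet> w" using integrable_slot by (intro integral_inner_left)
 also have "(LINT s|dm (slot dt n). B s x) = dt *\<^sub>R bav dt n x" using dt0 by (simp add: bav_def)
 finally show ?thesis using dt0 by (simp add: measure_dm measure_slot distrib_left)
qed

lemma residual:
 assumes test: "C1_test \<psi> D\<psi>" and \<delta>: "\<delta> > 0"
  and oT: "\<And>x s s'. x \<in> Om ==> s \<in> {0..T} ==> s' \<in> {0..T} ==> \<bar>s - s'\<bar> \<le> dt ==> norm (D\<psi> (x, s) - D\<psi> (x, s')) \<le> \<delta>"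
  and oX: "\<And>x \<xi> s. x \<in> Om ==> s \<in> {0..T} ==> norm (\<xi> - x) \<le> h * real DIM('a) ==> norm (D\<psi> (\<xi>, s) - D\<psi> (x, s)) \<le> \<delta>"
  and CP: "\<And>x s. x \<in> Om ==> s \<in> {0..T} ==> norm (D\<psi> (x, s)) \<le> CP" "CP \<ge> 0"
  and A: "A \<in> sets borel" "A \<subseteq> Om" "measure lborel A \<le> \<delta>^2" and inn: "\<And>x. x \<in> Om ==> x \<notin> A ==> JX x = cube"
 defines "C1 \<equiv> e + 2 * e * (real DIM('a))^2 * measure lborel Om + 2 * M * (real DIM('a))^2 * (1 + measure lborel Om) + 4 * M * (real DIM('a))^2 * CP"
  and "C2 \<equiv> (1 + M + e) * measure lborel Om + (1 + M) + 3 * e * (real DIM('a))^2"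
 shows "\<bar>defect h e dt f \<psi> D\<psi>\<bar>
  \<le> \<delta> * ((C1 + C2) * (T + 2 / e * X + T * X))"
proof -
 let ?D = "real DIM('a)" and ?m = "measure lborel Om"
 note cont = C1_test_partials(3,4)[OF test]
 have bQ: "bounded (Om \<times> {0<..<T})" using bounded_dom by (intro bounded_Times) (auto simp flip: box_real)
 have cs: "continuous_on UNIV (\<lambda>x. g (x, s))" if "continuous_on UNIV g" for g :: "'a \<times> real => 'b::euclidean_space" and s
  by (rule continuous_on_compose2[OF that]) (auto intro!: continuous_intros)
 have b\<psi>: "bmon Om (\<lambda>x. \<psi> (x, s))" and bP: "bmon Om (\<lambda>x. fst (D\<psi> (x, s)))" and bS: "bmon Om (\<lambda>x. snd (D\<psi> (x, s)))" for s
  by (intro bmon_continuous bounded_dom cs continuous_on_fst continuous_on_snd cont)+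
 have bB: "bmon Om (B s)" for s
 proof (rule bmonI[OF _ B_bound])
  have "(\<lambda>x. (x, s)) \<in> borel_measurable borel" by (intro borel_measurable_continuous_onI continuous_intros)
  from measurable_compose[OF this B_measurable] show "B s \<in> borel_measurable borel" by simp
 qed
 have bBQ: "bmon (Om \<times> K) (\<lambda>z. ev B z)" for K by (rule bmonI[OF B_measurable B_bound])
 define E U where "E n = energy (u n)" and "U n = (LINT x|dm Om. (u n x)^2)" for n
 have E0: "0 \<le> E n" and U0: "0 \<le> U n" for n unfolding E_def U_def by (rule energy_nonneg, intro integral_Om_nonneg, auto)
 have C20: "C1 \<ge> 0" "C2 \<ge> 0" unfolding C1_def C2_def using e_pos M0 CP by (auto intro!: add_nonneg_nonneg mult_nonneg_nonneg)
 define W where "W z = ev (sol h e dt f) z * snd (D\<psi> z) + (ev (solg h e dt f) z \<bullet> (e *\<^sub>R fst (D\<psi> z))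
     + ev (sol h e dt f) z * (ev B z \<bullet> fst (D\<psi> z)))" for z
 have bW: "bmon (Om \<times> {0<..<T}) W" unfolding W_def[abs_def]
  by (intro bmon_intros bmon_subset[OF bmon_sol Q_sub] bmon_subset[OF bmon_solg Q_sub] order_refl bBQ
     bmon_continuous[OF _ bQ] continuous_on_fst continuous_on_snd cont)
 define a where "a n = (LINT x|dm Om. u n x * \<psi> (x, T - real n * dt))" for n
 define \<rho> where "\<rho> n = a n - a (Suc n) - (LINT s|dm (slot dt n). LINT x|dm Om. W (x, s))" for n
 have main: "\<bar>\<rho> n\<bar> \<le> dt * (\<delta> * (C1 + C2) * (1 + E n + U n))" if n: "n < N" for n
 proof -
  define t' where "t' = T - real (Suc n) * dt"
  have tt: "T - real n * dt = t' + dt" by (simp add: t'_def algebra_simps)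
  have nN: "real (Suc n) * dt \<le> real N * dt" using n dt0 by (intro mult_right_mono) auto
  have t'0: "0 \<le> t'" unfolding t'_def using nN NT by linarith
  have tT: "t' + dt \<le> T" unfolding tt[symmetric] using dt0 by simp
  have slot_t: "s \<in> slot dt n \<longleftrightarrow> t' < s \<and> s < t' + dt" for s unfolding slot_def t'_def[symmetric] tt by auto
  \<comment> \<open>\<open>q\<close> is the test function at the earlier end \<open>t'\<close>, the
    time to which iterate \<open>Suc n\<close> belongs; \<open>\<theta>\<close> is a difference
    quotient instead of the derivative, so that \<open>adiff\<close> is an exact identity.\<close>
  define q p \<theta> g where "q x = \<psi> (x, t')" and "p x = fst (D\<psi> (x, t'))" and "\<theta> x = (\<psi> (x, t' + dt) - \<psi> (x, t')) / dt" and "g = gradh (u n)" for x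
  have bq: "bmon Om q" and bp: "bmon Om p" and b\<theta>: "bmon Om \<theta>" and bg: "bmon Om g"
   unfolding q_def[abs_def] p_def[abs_def] \<theta>_def[abs_def] g_def by (intro bmon_intros b\<psi> bP bmon_gradh bmon_u)+
  define V where "V z = (u n (fst z) * \<theta> (fst z) + e * (g (fst z) \<bullet> p (fst z))) + ev B z \<bullet> (u n (fst z) *\<^sub>R p (fst z))" for z
  have bc: "bmon (Om \<times> K) (\<lambda>z. v (fst z))" if "bmon Om v" for v :: "'a => 'b::euclidean_space" and K :: "real set"
   by (rule bmon_compose[OF that fst_borel_measurable]) auto
  have bV: "bmon (Om \<times> slot dt n) V" unfolding V_def[abs_def] by (intro bmon_intros bBQ bc bmon_u b\<theta> bg bp)
  define Z where "Z = (LINT x|dm Om. e * (g x \<bullet> p x) + u n x * (bav dt n x \<bullet> p x))"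
  have intV: "(LINT s|dm (slot dt n). LINT x|dm Om. V (x, s)) = dt * (LINT x|dm Om. u n x * \<theta> x) + dt * Z"
  proof -
   have iV: "integrable (dm (Om \<times> slot dt n)) V"
    by (intro integrable_bmon Times_sets_borel bounded_Times bV) (auto simp: bounded_dom)
   have "(LINT s|dm (slot dt n). LINT x|dm Om. V (x, s)) = (LINT x|dm Om. LINT s|dm (slot dt n). V (x, s))"
    using integral_dm_Times[OF Om_sets slot_sets(1) bmon_measurable[OF bV] iV] by simp
   also have "... = (LINT x|dm Om. dt * (u n x * \<theta> x) + dt * (e * (g x \<bullet> p x) + u n x * (bav dt n x \<bullet> p x)))"
    unfolding V_def fst_conv snd_conv slot_average by (intro lint_cong refl) (simp add: algebra_simps)
   also have "... = (LINT x|dm Om. dt * (u n x * \<theta> x)) + (LINT x|dm Om. dt * (e * (g x \<bullet> p x) + u n x * (bav dt n x \<bullet> p x)))"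
    by (intro lint_add integrable_Om bmon_intros bmon_u b\<theta> bg bp bmon_bav dt0)
   finally show ?thesis by (simp add: Z_def)
  qed
  have adiff: "a n - a (Suc n) = dt * (LINT x|dm Om. u n x * \<theta> x) + dt * form e (bav dt n) (u n) q"
  proof -
   have bgen: "bmon Om (gen e (bav dt n) (u n))" by (intro bmon_gen bmon_u bmon_bav dt0)
   have "a (Suc n) = (LINT x|dm Om. u n x * q x + dt * (q x * gen e (bav dt n) (u n) x))"
    unfolding a_def t'_def[symmetric] q_def u_def by (intro lint_cong refl) (simp add: algebra_simps)
   also have "... = (LINT x|dm Om. u n x * q x) + dt * (LINT x|dm Om. q x * gen e (bav dt n) (u n) x)"
    by (subst lint_add) (auto intro!: integrable_Om bmon_intros bmon_u bq bgen)
   also have "(LINT x|dm Om. q x * gen e (bav dt n) (u n) x) = - form e (bav dt n) (u n) q"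
    by (rule gen_dual[OF bmon_u bmon_bav[OF dt0] bq])
   finally have 1: "a (Suc n) = (LINT x|dm Om. u n x * q x) - dt * form e (bav dt n) (u n) q" by simp
   have "a n = (LINT x|dm Om. u n x * q x + dt * (u n x * \<theta> x))"
    unfolding a_def tt q_def \<theta>_def using dt0 by (intro lint_cong refl) (simp add: field_simps)
   also have "... = (LINT x|dm Om. u n x * q x) + dt * (LINT x|dm Om. u n x * \<theta> x)"
    by (subst lint_add) (auto intro!: integrable_Om bmon_intros bmon_u bq b\<theta>)
   finally show ?thesis using 1 by simp
  qed
  have formb: "\<bar>form e (bav dt n) (u n) q - Z\<bar> \<le> \<delta> * C1 * (1 + E n + U n)"
   unfolding Z_def g_def E_def U_def C1_def
  proof (rule form_consistent[OF bmon_u bmon_bav[OF dt0] bq bp M0 e_pos bav_bound[OF dt0] _ CP(2) _ \<delta> A inn])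
   show "norm (p x) \<le> CP" if "x \<in> Om" for x
    using order_trans[OF norm_fst_le[of "p x" "snd (D\<psi> (x, t'))"]] CP(1)[OF that, of t'] t'0 tT dt0 by (simp add: p_def)
   fix y assume y: "y \<in> J"
   show "\<bar>q (tgt y) - q (fst y) - h * (p (fst y) \<bullet> snd y)\<bar> \<le> h * real DIM('a) * \<delta>"
    unfolding q_def p_def
   proof (rule taylor_tgt[where q="\<lambda>x. \<psi> (x, t')" and P="\<lambda>x. fst (D\<psi> (x, t'))", OF C1_test_partials(1)[OF test] _ y])
    fix \<xi> assume "norm (\<xi> - fst y) \<le> h * real DIM('a)"
    then have "norm (D\<psi> (\<xi>, t') - D\<psi> (fst y, t')) \<le> \<delta>" using y t'0 tT dt0 by (intro oX) (auto simp: J_iff)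
    then show "norm (fst (D\<psi> (\<xi>, t')) - fst (D\<psi> (fst y, t'))) \<le> \<delta>"
      by (rule order_trans[OF norm_fst_snd_diff(1)])
   qed
  qed
  let ?\<beta> = "\<delta> * C2 * (1 + E n + U n)"
  have bWs: "bmon Om (\<lambda>x. W (x, s))" if "s \<in> slot dt n" for s
   unfolding W_def fst_conv snd_conv sol_slot[OF that] by (intro bmon_intros bmon_u bmon_gradh bS bP bB)
  have bVs: "bmon Om (\<lambda>x. V (x, s))" for s
   unfolding V_def fst_conv snd_conv by (intro bmon_intros bmon_u bg bp b\<theta> bB)
  have slice: "\<bar>LINT x|dm Om. W (x, s) - V (x, s)\<bar> \<le> ?\<beta>" if s: "s \<in> slot dt n" for s
  proof -
   have st: "t' < s" "s < t' + dt" using s slot_t by auto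
   have sT: "s \<in> {0..T}" using st t'0 tT by auto
   have pw: "\<bar>W (x, s) - V (x, s)\<bar> \<le> (\<delta> * (1 + M)) * (1 + (u n x)^2) + (\<delta> * e) * (1 + (norm (g x))^2)" if x: "x \<in> Om" for x
   proof -
    have th: "\<bar>snd (D\<psi> (x, s)) - \<theta> x\<bar> \<le> \<delta>"
    proof -
     have "\<exists>z>t'. z < t' + dt \<and> \<psi> (x, t' + dt) - \<psi> (x, t') = (t' + dt - t') * snd (D\<psi> (x, z))"
      by (rule MVT2[where f="\<lambda>s. \<psi> (x, s)"]) (use dt0 C1_test_partials(2)[OF test] in auto)
     then obtain z where z: "t' < z" "z < t' + dt" "\<psi> (x, t' + dt) - \<psi> (x, t') = dt * snd (D\<psi> (x, z))" by auto
     have "norm (D\<psi> (x, s) - D\<psi> (x, z)) \<le> \<delta>" using z st t'0 tT by (intro oT x sT) auto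
     then have "\<bar>snd (D\<psi> (x, s)) - snd (D\<psi> (x, z))\<bar> \<le> \<delta>"
      using norm_fst_snd_diff(2)[of "D\<psi> (x, s)" "D\<psi> (x, z)"] by simp
     then show ?thesis using z(3) dt0 by (simp add: \<theta>_def)
    qed
    have pp: "norm (fst (D\<psi> (x, s)) - p x) \<le> \<delta>"
    proof -
     have "norm (D\<psi> (x, s) - D\<psi> (x, t')) \<le> \<delta>" using st t'0 tT dt0 by (intro oT x sT) auto
     then show ?thesis unfolding p_def
      by (rule order_trans[OF norm_fst_snd_diff(1)])
    qed
    have a1: "\<bar>v\<bar> \<le> 1 + v^2" for v :: real using zero_le_power2[of "\<bar>v\<bar> - 1"] zero_le_power2[of v] by (simp add: power2_diff)
    have gp: "\<bar>g x \<bullet> (fst (D\<psi> (x, s)) - p x)\<bar> \<le> norm (g x) * \<delta>"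
     using order_trans[OF Cauchy_Schwarz_ineq2 mult_left_mono[OF pp norm_ge_zero]] .
    have Bp: "\<bar>B s x \<bullet> (fst (D\<psi> (x, s)) - p x)\<bar> \<le> M * \<delta>"
     using order_trans[OF Cauchy_Schwarz_ineq2 mult_mono[OF B_bound pp M0 norm_ge_zero]] .
    have "W (x, s) - V (x, s) = u n x * (snd (D\<psi> (x, s)) - \<theta> x) + e * (g x \<bullet> (fst (D\<psi> (x, s)) - p x)) + u n x * (B s x \<bullet> (fst (D\<psi> (x, s)) - p x))"
     unfolding W_def V_def fst_conv snd_conv sol_slot[OF s] g_def by (simp add: algebra_simps inner_diff_right)
    then have "\<bar>W (x, s) - V (x, s)\<bar> \<le> \<bar>u n x * (snd (D\<psi> (x, s)) - \<theta> x)\<bar> + \<bar>e * (g x \<bullet> (fst (D\<psi> (x, s)) - p x))\<bar> + \<bar>u n x * (B s x \<bullet> (fst (D\<psi> (x, s)) - p x))\<bar>"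
     by linarith
    also have "... \<le> \<bar>u n x\<bar> * \<delta> + e * (norm (g x) * \<delta>) + \<bar>u n x\<bar> * (M * \<delta>)"
     unfolding abs_mult using th gp Bp e_pos by (intro add_mono mult_left_mono) auto
    also have "... = (\<delta> * (1 + M)) * \<bar>u n x\<bar> + (\<delta> * e) * \<bar>norm (g x)\<bar>" by (simp add: algebra_simps)
    also have "... \<le> (\<delta> * (1 + M)) * (1 + (u n x)^2) + (\<delta> * e) * (1 + (norm (g x))^2)"
     using \<delta> M0 e_pos by (intro add_mono mult_left_mono a1) auto
    finally show ?thesis .
   qed
   have "\<bar>LINT x|dm Om. W (x, s) - V (x, s)\<bar> \<le> (LINT x|dm Om. \<bar>W (x, s) - V (x, s)\<bar>)"
    using integral_norm_bound[of "dm Om" "\<lambda>x. W (x, s) - V (x, s)"] by simp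
   also have "... \<le> (LINT x|dm Om. (\<delta> * (1 + M)) * (1 + (u n x)^2) + (\<delta> * e) * (1 + (norm (g x))^2))"
    by (intro integral_Om_mono bmon_intros bWs[OF s] bVs bmon_u bg pw)
   also have "... = (\<delta> * (1 + M)) * (?m + U n) + (\<delta> * e) * (?m + (LINT x|dm Om. (norm (g x))^2))"
   proof -
    have "(LINT x|dm Om. 1 + (u n x)^2) = ?m + U n" "(LINT x|dm Om. 1 + (norm (g x))^2) = ?m + (LINT x|dm Om. (norm (g x))^2)"
     unfolding U_def by (subst lint_add, auto intro!: integrable_Om bmon_intros bmon_u bg simp: measure_dm)+
    then show ?thesis
     by (subst lint_add) (auto intro!: integrable_Om bmon_intros bmon_u bg)
   qed
   also have "... \<le> (\<delta> * (1 + M)) * (?m + U n) + (\<delta> * e) * (?m + 3 * ?D^2 * E n)"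
    unfolding g_def E_def using \<delta> e_pos gradh_bound[OF bmon_u[of n]] by (intro add_left_mono mult_left_mono) auto
   also have "... \<le> ?\<beta>"
   proof -
    have "(1 + M) * (?m + U n) + e * (?m + 3 * ?D^2 * E n) = (1 + M + e) * ?m + (1 + M) * U n + (3 * e * ?D^2) * E n"
     by (simp add: algebra_simps)
    also have "... \<le> C2 * 1 + C2 * U n + C2 * E n"
    proof (intro add_mono mult_right_mono U0 E0)
     have "0 \<le> (1 + M + e) * ?m" "0 \<le> 1 + M" "0 \<le> 3 * e * ?D^2" using M0 e_pos by auto
     then show "(1 + M + e) * ?m \<le> C2 * 1" "1 + M \<le> C2" "3 * e * ?D^2 \<le> C2" unfolding C2_def by simp_all
    qed
    finally have "\<delta> * ((1 + M) * (?m + U n) + e * (?m + 3 * ?D^2 * E n)) \<le> \<delta> * (C2 * (1 + E n + U n))"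
     using \<delta> by (intro mult_left_mono) (auto simp: algebra_simps)
    then show ?thesis by (simp add: algebra_simps)
   qed
   finally show ?thesis .
  qed
  have Wp: "bmon (slot dt n) (\<lambda>s. LINT x|dm Om. W (x, s))" and Vp: "bmon (slot dt n) (\<lambda>s. LINT x|dm Om. V (x, s))"
   by (rule bmon_subset[OF bmon_param_integral[OF Om_sets bounded_dom bW] slot_subset[OF dt0 NT n]],
     rule bmon_param_integral[OF Om_sets bounded_dom bV])
  have "\<bar>(LINT s|dm (slot dt n). LINT x|dm Om. W (x, s)) - (LINT s|dm (slot dt n). LINT x|dm Om. V (x, s))\<bar> \<le> dt * ?\<beta>"
  proof -
   have "(LINT s|dm (slot dt n). LINT x|dm Om. W (x, s)) - (LINT s|dm (slot dt n). LINT x|dm Om. V (x, s))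
    = (LINT s|dm (slot dt n). (LINT x|dm Om. W (x, s)) - (LINT x|dm Om. V (x, s)))"
    by (intro lint_diff[symmetric] integrable_bmon slot_sets Wp Vp)
   also have "norm ... \<le> dt * ?\<beta>"
   proof (rule norm_integral_slot[OF dt0])
    show "integrable (dm (slot dt n)) (\<lambda>s. (LINT x|dm Om. W (x, s)) - (LINT x|dm Om. V (x, s)))"
     by (intro integrable_bmon slot_sets bmon_diff Wp Vp)
    fix s assume s: "s \<in> slot dt n"
    have "(LINT x|dm Om. W (x, s) - V (x, s)) = (LINT x|dm Om. W (x, s)) - (LINT x|dm Om. V (x, s))"
     by (intro lint_diff integrable_Om bWs[OF s] bVs)
    then show "norm ((LINT x|dm Om. W (x, s)) - (LINT x|dm Om. V (x, s))) \<le> ?\<beta>" using slice[OF s] by simp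
   qed
   finally show ?thesis by simp
  qed
  moreover have "\<rho> n = dt * (form e (bav dt n) (u n) q - Z) - ((LINT s|dm (slot dt n). LINT x|dm Om. W (x, s)) - (LINT s|dm (slot dt n). LINT x|dm Om. V (x, s)))"
   unfolding \<rho>_def adiff intV by (simp add: algebra_simps)
  moreover have "\<bar>dt * (form e (bav dt n) (u n) q - Z)\<bar> \<le> dt * (\<delta> * C1 * (1 + E n + U n))"
   unfolding abs_mult using dt0 formb by (simp add: mult_left_mono)
  ultimately have "\<bar>\<rho> n\<bar> \<le> dt * (\<delta> * C1 * (1 + E n + U n)) + dt * ?\<beta>" by linarith
  then show ?thesis by (simp add: algebra_simps)
 qed
 have "(LINT x|dm Om. sol h e dt f T x * \<psi> (x, T)) = a 0" by (simp add: a_def sol_u idx_ends dt0)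
 moreover have "(LINT x|dm Om. sol h e dt f 0 x * \<psi> (x, 0)) = a N" by (simp add: a_def sol_u idx_ends(2)[OF dt0 NT] NT)
 moreover have "(LINT z|dm (Om \<times> {0<..<T}). W z) = (\<Sum>n<N. LINT s|dm (slot dt n). LINT x|dm Om. W (x, s))"
  by (rule strips[OF Om_sets order_refl bW])
 moreover have "(\<Sum>n<N. \<rho> n) = a 0 - a N - (\<Sum>n<N. LINT s|dm (slot dt n). LINT x|dm Om. W (x, s))"
  unfolding \<rho>_def sum_subtractf[of "\<lambda>n. a n - a (Suc n)"] sum_lessThan_telescope' by simp
 ultimately have "\<bar>(LINT x|dm Om. sol h e dt f T x * \<psi> (x, T)) - (LINT x|dm Om. sol h e dt f 0 x * \<psi> (x, 0)) - (LINT z|dm (Om \<times> {0<..<T}). W z)\<bar> = \<bar>\<Sum>n<N. \<rho> n\<bar>" by simp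
 also have "... \<le> (\<Sum>n<N. \<bar>\<rho> n\<bar>)" by (rule sum_abs)
 also have "... \<le> (\<Sum>n<N. dt * (\<delta> * (C1 + C2) * (1 + E n + U n)))" by (intro sum_mono main) simp
 also have "... = \<delta> * ((C1 + C2) * ((\<Sum>n<N. dt) + (\<Sum>n<N. dt * E n) + (\<Sum>n<N. dt * U n)))"
  by (simp add: sum.distrib distrib_left sum_distrib_left mult_ac)
 also have "... \<le> \<delta> * ((C1 + C2) * (T + 2 / e * X + T * X))"
 proof (intro mult_left_mono add_mono)
  show "(\<Sum>n<N. dt) \<le> T" by (simp add: NT)
  show "(\<Sum>n<N. dt * E n) \<le> 2 / e * X" unfolding E_def by (rule sum_energy)
  have "(\<Sum>n<N. dt * U n) \<le> (\<Sum>n<N. dt * X)" unfolding U_def using dt0 u_L2 by (intro sum_mono mult_left_mono) auto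
  then show "(\<Sum>n<N. dt * U n) \<le> T * X" by (simp flip: NT)
 qed (use \<delta> C20 in auto)
 finally show ?thesis unfolding defect_def W_def .
qed

end

section \<open>Passage to the limit\<close>

text \<open>Index \<open>k\<close> enters the \<open>j\<close>-th combination only for
  \<open>k \<ge> j\<close>, so only the tail of \<open>r\<close> matters.\<close>

lemma comb_limit:
 assumes r: "r \<longlonglongrightarrow> (0::real)" and adm: "\<And>j. adm j (c j) (L j)"
 shows "(\<lambda>j. \<Sum>k<L j. c j k * r k) \<longlonglongrightarrow> 0"
proof (rule LIMSEQ_I)
 fix \<eta> :: real assume \<eta>: "\<eta> > 0"
 then obtain K where K: "\<And>k. k \<ge> K ==> \<bar>r k\<bar> < \<eta> / 2" using LIMSEQ_D[OF r, of "\<eta> / 2"] by auto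
 have "norm ((\<Sum>k<L j. c j k * r k) - 0) < \<eta>" if j: "j \<ge> K" for j
 proof -
  have a: "\<And>k. 0 \<le> c j k" "\<And>k. k < j ==> c j k = 0" "(\<Sum>k<L j. c j k) = 1" using adm[of j] by (auto simp: adm_def)
  have "\<bar>\<Sum>k<L j. c j k * r k\<bar> \<le> (\<Sum>k<L j. \<bar>c j k * r k\<bar>)" by (rule sum_abs)
  also have "... \<le> (\<Sum>k<L j. c j k * (\<eta> / 2))"
  proof (rule sum_mono)
   fix k
   show "\<bar>c j k * r k\<bar> \<le> c j k * (\<eta> / 2)"
   proof (cases "k < j")
    case False
    then have "\<bar>r k\<bar> \<le> \<eta> / 2" using K[of k] j by simp
    from mult_left_mono[OF this a(1)[of k]] show ?thesis unfolding abs_mult abs_of_nonneg[OF a(1)] .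
   qed (simp add: a)
  qed
  also have "... = (\<Sum>k<L j. c j k) * (\<eta> / 2)" by (rule sum_distrib_right[symmetric])
  finally show ?thesis using \<eta> a(3) by simp
 qed
 then show "\<exists>no. \<forall>j\<ge>no. norm ((\<Sum>k<L j. c j k * r k) - 0) < \<eta>" by blast
qed

lemma le_one_plus_square: "v \<le> 1 + v^2" for v :: real
 using zero_le_power2[of "v - 1 / 2"] by (simp add: power2_eq_square algebra_simps)

lemma sqint_inner_integrable:
 fixes F :: "'p => 'b::euclidean_space"
 assumes fin: "finite_measure P" and F: "sqint P F" and w: "w \<in> borel_measurable P" and wC: "AE x in P. norm (w x) \<le> C" and C: "C \<ge> 0"
 shows "integrable P (\<lambda>x. F x \<bullet> w x)"
proof -
 interpret finite_measure P by fact
 note [measurable] = sqint_measurable[OF F] w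
 have i: "integrable P (\<lambda>x. C * (1 + (norm (F x))^2))"
  by (intro integrable_mult_right lintegrable_add sqint_integrable[OF F]) simp
 show ?thesis
 proof (rule lintegrable_bound[OF i])
  show "(\<lambda>x. F x \<bullet> w x) \<in> borel_measurable P" by measurable
  show "AE x in P. norm (F x \<bullet> w x) \<le> norm (C * (1 + (norm (F x))^2))"
   using wC
  proof eventually_elim
   fix x assume wx: "norm (w x) \<le> C"
   have "\<bar>F x \<bullet> w x\<bar> \<le> norm (F x) * C" using order_trans[OF Cauchy_Schwarz_ineq2 mult_left_mono[OF wx norm_ge_zero]] .
   also have "... \<le> (1 + (norm (F x))^2) * C"
    by (intro mult_right_mono le_one_plus_square C)
   finally show "norm (F x \<bullet> w x) \<le> norm (C * (1 + (norm (F x))^2))" using C by (simp add: mult.commute)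
  qed
 qed
qed

lemma comb_L2_limit:
 fixes F :: "'p => 'b::euclidean_space"
 assumes fin: "finite_measure P" and F: "sqint P F" and H: "\<And>k. sqint P (H k)"
  and d: "\<And>j. (LINT x|P. (norm (F x - comb H (c j) (L j) x))^2) \<le> (1/4) ^ j"
  and w: "w \<in> borel_measurable P" and wC: "AE x in P. norm (w x) \<le> C" and C: "C \<ge> 0"
 shows "(\<lambda>j. \<Sum>k<L j. c j k * (LINT x|P. H k x \<bullet> w x)) \<longlonglongrightarrow> (LINT x|P. F x \<bullet> w x)"
proof -
 interpret finite_measure P by fact
 let ?m = "measure P (space P)"
 define Y where "Y j = comb H (c j) (L j)" for j
 have Y: "sqint P (Y j)" for j unfolding Y_def by (rule sqint_comb[OF H])
 note ii = sqint_inner_integrable[OF fin _ w wC C]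
 have Yi: "(LINT x|P. Y j x \<bullet> w x) = (\<Sum>k<L j. c j k * (LINT x|P. H k x \<bullet> w x))" for j
 proof -
  have "(LINT x|P. Y j x \<bullet> w x) = (LINT x|P. (\<Sum>k<L j. c j k * (H k x \<bullet> w x)))"
   by (simp add: Y_def comb_def inner_sum_left)
  also have "... = (\<Sum>k<L j. LINT x|P. c j k * (H k x \<bullet> w x))"
   by (intro lint_sum integrable_mult_right ii H)
  finally show ?thesis by simp
 qed
 have b: "\<bar>(LINT x|P. Y j x \<bullet> w x) - (LINT x|P. F x \<bullet> w x)\<bar> \<le> C * (?m + 1) * (1/2) ^ j" for j
 proof -
  \<comment> \<open>\<open>t\<close> bounds the L2 distance, so Young at this scale gives
    contributions of equal order from the finite measure and from the square.\<close>
  define t :: real where "t = (1/2) ^ j"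
  have t: "t > 0" "(1/4) ^ j / t = t" by (simp_all add: t_def power_divide field_simps flip: power_mult_distrib)
  have D: "sqint P (\<lambda>x. F x - Y j x)" by (rule sqint_diff[OF F Y])
  have iD: "integrable P (\<lambda>x. (norm (F x - Y j x))^2)" by (rule sqint_integrable[OF D])
  have "(LINT x|P. Y j x \<bullet> w x) - (LINT x|P. F x \<bullet> w x) = - (LINT x|P. (F x - Y j x) \<bullet> w x)"
   by (simp add: inner_diff_left ii[OF F] ii[OF Y])
  also have "\<bar>...\<bar> \<le> (LINT x|P. \<bar>(F x - Y j x) \<bullet> w x\<bar>)" using integral_norm_bound[of P "\<lambda>x. (F x - Y j x) \<bullet> w x"] by simp
  also have "... \<le> (LINT x|P. C * (t + (norm (F x - Y j x))^2 / t))"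
  proof (rule integral_mono_AE)
   show "integrable P (\<lambda>x. \<bar>(F x - Y j x) \<bullet> w x\<bar>)" by (intro integrable_abs ii D)
   show "integrable P (\<lambda>x. C * (t + (norm (F x - Y j x))^2 / t))" by (intro integrable_mult_right lintegrable_add integrable_divide iD) simp
   show "AE x in P. \<bar>(F x - Y j x) \<bullet> w x\<bar> \<le> C * (t + (norm (F x - Y j x))^2 / t)"
    using wC
   proof eventually_elim
    fix x assume wx: "norm (w x) \<le> C"
    let ?n = "norm (F x - Y j x)"
    have "\<bar>(F x - Y j x) \<bullet> w x\<bar> \<le> ?n * C" using order_trans[OF Cauchy_Schwarz_ineq2 mult_left_mono[OF wx norm_ge_zero]] .
    also have "?n * C \<le> (t + ?n^2 / t) * C"
    proof -
     have "0 \<le> ?n * t" using t(1) by simp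
     then have "?n * t \<le> t^2 + ?n^2" using sum_squares_bound[of ?n t] by linarith
     then have "?n \<le> t + ?n^2 / t" using t(1) by (simp add: field_simps power2_eq_square)
     then show ?thesis by (rule mult_right_mono[OF _ C])
    qed
    also have "... = C * (t + ?n^2 / t)" by (rule mult.commute)
    finally show "\<bar>(F x - Y j x) \<bullet> w x\<bar> \<le> C * (t + ?n^2 / t)" .
   qed
  qed
  also have "... = C * (t * ?m + (LINT x|P. (norm (F x - Y j x))^2) / t)"
   by (simp add: lint_add integrable_divide iD)
  also have "... \<le> C * (t * ?m + (1/4) ^ j / t)"
   using d[of j] t(1) C by (intro mult_left_mono add_left_mono divide_right_mono) (auto simp: Y_def)
  also have "... = C * (?m + 1) * (1/2) ^ j" unfolding t(2) by (simp add: t_def algebra_simps)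
  finally show ?thesis .
 qed
 have "(\<lambda>j. (LINT x|P. Y j x \<bullet> w x) - (LINT x|P. F x \<bullet> w x)) \<longlonglongrightarrow> 0"
 proof (rule Lim_null_comparison[where g="\<lambda>j. C * (?m + 1) * (1/2) ^ j"])
  show "(\<lambda>j. C * (?m + 1) * (1/2) ^ j) \<longlonglongrightarrow> 0"
   by (intro tendsto_mult_right_zero LIMSEQ_realpow_zero) auto
 qed (use b in auto)
 then show ?thesis unfolding Yi by (rule LIM_zero_cancel)
qed

lemma sqint_bmon: "A \<in> sets borel ==> bounded A ==> bmon A F ==> sqint (dm A) F"
 unfolding sqint_def by (auto intro!: integrable_bmon bmon_power bmon_norm bmon_measurable)

lemma C1_test_support:
 assumes test: "C1_test \<psi> D\<psi>" and z: "z \<notin> closure {z. \<psi> z \<noteq> 0}"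
 shows "\<psi> z = 0" "D\<psi> z = 0"
proof -
 let ?S = "- closure {z. \<psi> z \<noteq> 0}"
 have S: "\<psi> y = 0" if "y \<in> ?S" for y using that closure_subset[of "{z. \<psi> z \<noteq> 0}"] by auto
 have z': "z \<in> ?S" using z unfolding Compl_iff .
 show "\<psi> z = 0" by (rule S[OF z'])
 have "(\<psi> has_derivative (\<lambda>_. 0)) (at z)"
  by (rule has_derivative_transform_within_open[OF has_derivative_const open_Compl[OF closed_closure] z' S[symmetric]])
 moreover have "(\<psi> has_derivative (\<lambda>k. D\<psi> z \<bullet> k)) (at z)" using test unfolding C1_test_def by blast
 ultimately have "(\<lambda>k. D\<psi> z \<bullet> k) = (\<lambda>_. 0)" by (rule has_derivative_unique[rotated])
 from fun_cong[OF this, of "D\<psi> z"] show "D\<psi> z = 0" by simp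
qed

context drift
begin

lemma schemeI: "e > 0 ==> mesh e h dt N ==> bmon Om f ==> scheme Om T B M e h dt N f"
 by unfold_locales

lemma Q_sets: "Om \<times> {0<..<T} \<in> sets borel" "bounded (Om \<times> {0<..<T})" "Om \<in> sets borel"
 using open_dom bounded_dom by (auto intro!: Times_sets_borel bounded_Times simp flip: box_real)

text \<open>Order of choices: \<open>K\<close> depends only on the data, \<open>e\<close> and the
  test function, because the energy bound is independent of the mesh; then come
  \<open>\<delta>\<close>, a boundary layer \<open>A\<close> of measure at most
  \<open>\<delta>^2\<close>, and finally a mesh so fine that jumps from points outside
  \<open>A\<close> stay in the domain.\<close>

lemma residual_small:
 assumes f: "bmon Om f" and test: "C1_test \<psi> D\<psi>" and e: "e > 0" and \<eta>: "\<eta> > 0"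
 shows "\<exists>d>0. \<forall>h dt N. mesh e h dt N \<and> h \<le> d \<and> dt \<le> d \<longrightarrow>
  \<bar>defect h e dt f \<psi> D\<psi>\<bar> \<le> \<eta>"
proof -
 let ?D = "real DIM('a)"
 have D: "?D \<ge> 1" using DIM_positive[where 'a='a] by linarith
 note cont = C1_test_partials(3,4)[OF test]
 have "bmon (Om \<times> {0..T}) D\<psi>" by (intro bmon_continuous cont bounded_Times bounded_dom) simp
 then obtain CP0 where CP0: "\<And>p. p \<in> Om \<times> {0..T} ==> norm (D\<psi> p) \<le> CP0" by (auto simp: bmon_def)
 define CP where "CP = max CP0 0"
 have CP: "norm (D\<psi> (x, s)) \<le> CP" "CP \<ge> 0" if "x \<in> Om" "s \<in> {0..T}" for x s
  using CP0[of "(x, s)"] that by (auto simp: CP_def le_max_iff_disj)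
 have CPn: "CP \<ge> 0" by (simp add: CP_def)
 define X0 where "X0 = exp ((3 * M^2 * ?D^2 / e + 1) * T) * (LINT x|dm Om. (f x)^2)"
 define K where "K = ((e + 2 * e * ?D^2 * measure lborel Om + 2 * M * ?D^2 * (1 + measure lborel Om) + 4 * M * ?D^2 * CP)
  + ((1 + M + e) * measure lborel Om + (1 + M) + 3 * e * ?D^2)) * (T + 2 / e * X0 + T * X0)"
 define \<delta> where "\<delta> = \<eta> / (\<bar>K\<bar> + 1)"
 have \<delta>: "\<delta> > 0" using \<eta> by (simp add: \<delta>_def)
 have \<delta>K: "\<delta> * K \<le> \<eta>"
 proof -
  have "\<delta> * K \<le> \<delta> * (\<bar>K\<bar> + 1)" using \<delta> by (intro mult_left_mono) auto
  also have "... = \<eta>" by (simp add: \<delta>_def)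
  finally show ?thesis .
 qed
 obtain d1 where d1: "d1 > 0" and mo: "\<And>x \<xi> s s'. x \<in> Om ==> s \<in> {0..T} ==> s' \<in> {0..T} ==> norm (\<xi> - x) \<le> d1 ==> \<bar>s - s'\<bar> \<le> d1 ==> norm (D\<psi> (\<xi>, s) - D\<psi> (x, s')) \<le> \<delta>"
  using test_modulus[OF cont(2) bounded_dom \<delta>, of T] by blast
 have "\<delta>^2 > 0" using \<delta> by simp
 then obtain r A where r: "r > 0" and A: "A \<in> sets borel" "A \<subseteq> Om" "measure lborel A \<le> \<delta>^2" and rA: "\<And>x. x \<in> Om ==> x \<notin> A ==> cball x r \<subseteq> Om"
  using boundary_layer_small[OF open_dom bounded_dom, of "\<delta>^2"] by blast
 show ?thesis
 proof (rule exI[of _ "min d1 r / ?D"], rule conjI, goal_cases)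
  case 1 then show ?case using d1 r D by simp
 next
  case 2
  show ?case
  proof (intro allI impI, elim conjE)
  fix h dt N assume ms: "mesh e h dt N" and h: "h \<le> min d1 r / ?D" and dt: "dt \<le> min d1 r / ?D"
  interpret scheme Om T B M e h dt N f by (rule schemeI[OF e ms f])
  have hD: "h * ?D \<le> d1" "h * ?D \<le> r" using h D by (simp_all add: pos_le_divide_eq)
  have "dt * 1 \<le> dt * ?D" using dt0 D by (intro mult_left_mono) auto
  then have dtd: "dt \<le> d1" using dt D by (simp add: pos_le_divide_eq)
  have inn: "JX x = cube" if "x \<in> Om" "x \<notin> A" for x
  proof -
   have "x + h *\<^sub>R z \<in> Om" if z: "z \<in> cube" for z
   proof -
    have "norm (h *\<^sub>R z) \<le> h * ?D" using h0 cube_norm[OF z] by simp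
    then have "x + h *\<^sub>R z \<in> cball x r" using hD by (simp add: dist_norm)
    then show ?thesis using rA[OF \<open>x \<in> Om\<close> \<open>x \<notin> A\<close>] by blast
   qed
   then show ?thesis by (auto simp: JX_def)
  qed
  have "\<bar>defect h e dt f \<psi> D\<psi>\<bar> \<le> \<delta> * K"
   unfolding K_def X0_def X_eq[symmetric]
  proof (rule residual[OF test \<delta> _ _ CP(1) CPn A inn])
   show "norm (D\<psi> (x, s) - D\<psi> (x, s')) \<le> \<delta>" if "x \<in> Om" "s \<in> {0..T}" "s' \<in> {0..T}" "\<bar>s - s'\<bar> \<le> dt" for x s s'
    using that dtd d1 by (intro mo) auto
   show "norm (D\<psi> (\<xi>, s) - D\<psi> (x, s)) \<le> \<delta>" if "x \<in> Om" "s \<in> {0..T}" "norm (\<xi> - x) \<le> h * ?D" for x \<xi> s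
    using that hD d1 by (intro mo) auto
  qed
  then show "\<bar>defect h e dt f \<psi> D\<psi>\<bar> \<le> \<eta>" using \<delta>K by linarith
  qed
 qed
qed

lemma weakgrad_small:
 assumes f: "bmon Om f" and test: "C1_test \<psi> D\<psi>" and e: "e > 0" and \<eta>: "\<eta> > 0"
  and supp: "closure {z. \<psi> z \<noteq> 0} \<subseteq> Om \<times> {0<..<T}" "compact (closure {z. \<psi> z \<noteq> 0})"
 shows "\<exists>d>0. \<forall>h dt N. mesh e h dt N \<and> h \<le> d \<longrightarrow>
  \<bar>LINT z|dm (Om \<times> {0<..<T}). ev (sol h e dt f) z * (fst (D\<psi> z) \<bullet> a) + \<psi> z * (ev (solg h e dt f) z \<bullet> a)\<bar> \<le> \<eta>"
proof -
 let ?D = "real DIM('a)"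
 have D: "?D \<ge> 1" using DIM_positive[where 'a='a] by linarith
 note cont = C1_test_partials(3,4)[OF test]
 define X0 where "X0 = exp ((3 * M^2 * ?D^2 / e + 1) * T) * (LINT x|dm Om. (f x)^2)"
 define K where "K = 3 * ?D^2 * norm a * (measure lborel Om + X0) * T"
 define \<delta> where "\<delta> = \<eta> / (\<bar>K\<bar> + 1)"
 have \<delta>: "\<delta> > 0" using \<eta> by (simp add: \<delta>_def)
 have \<delta>K: "\<delta> * K \<le> \<eta>"
 proof -
  have "\<delta> * K \<le> \<delta> * (\<bar>K\<bar> + 1)" using \<delta> by (intro mult_left_mono) auto
  also have "... = \<eta>" by (simp add: \<delta>_def)
  finally show ?thesis .
 qed
 obtain d1 where d1: "d1 > 0" and mo: "\<And>x \<xi> s s'. x \<in> Om ==> s \<in> {0..T} ==> s' \<in> {0..T} ==> norm (\<xi> - x) \<le> d1 ==> \<bar>s - s'\<bar> \<le> d1 ==> norm (D\<psi> (\<xi>, s) - D\<psi> (x, s')) \<le> \<delta>"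
  using test_modulus[OF cont(2) bounded_dom \<delta>, of T] by blast
 \<comment> \<open>The spatial projection of the support keeps a positive distance from the
   boundary, so for small \<open>h\<close> all jumps from it are admissible.\<close>
 have "compact (fst ` closure {z. \<psi> z \<noteq> 0})" by (intro compact_continuous_image supp continuous_intros)
 moreover have "fst ` closure {z. \<psi> z \<noteq> 0} \<subseteq> Om" using supp(1) by auto
 ultimately obtain r where r: "r > 0" "(\<Union>x\<in>fst ` closure {z. \<psi> z \<noteq> 0}. cball x r) \<subseteq> Om"
  using compact_subset_open_imp_cball_epsilon_subset[OF _ open_dom] by blast
 show ?thesis
 proof (rule exI[of _ "min d1 r / ?D"], rule conjI, goal_cases)
  case 1 then show ?case using d1 r D by simp
 next
  case 2
  show ?case
  proof (intro allI impI, elim conjE)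
  fix h dt N assume ms: "mesh e h dt N" and h: "h \<le> min d1 r / ?D"
  interpret scheme Om T B M e h dt N f by (rule schemeI[OF e ms f])
  have hD: "h * ?D \<le> d1" "h * ?D \<le> r" using h D by (simp_all add: pos_le_divide_eq)
  have inn: "JX x = cube" if "x \<in> Om" "s \<in> {0<..<T}" and nz: "\<psi> (x, s) \<noteq> 0 \<or> fst (D\<psi> (x, s)) \<noteq> 0" for x s
  proof -
   have "(x, s) \<in> closure {z. \<psi> z \<noteq> 0}"
   proof (rule ccontr)
    assume "(x, s) \<notin> closure {z. \<psi> z \<noteq> 0}"
    from C1_test_support[OF test this] nz show False by simp
   qed
   then have cb: "cball x r \<subseteq> Om" using r(2) by force
   have "x + h *\<^sub>R z \<in> Om" if z: "z \<in> cube" for z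
   proof -
    have "norm (h *\<^sub>R z) \<le> h * ?D" using h0 cube_norm[OF z] by simp
    then have "x + h *\<^sub>R z \<in> cball x r" using hD by (simp add: dist_norm)
    then show ?thesis using cb by blast
   qed
   then show ?thesis by (auto simp: JX_def)
  qed
  have "\<bar>LINT z|dm (Om \<times> {0<..<T}). ev (sol h e dt f) z * (fst (D\<psi> z) \<bullet> a) + \<psi> z * (ev (solg h e dt f) z \<bullet> a)\<bar> \<le> \<delta> * K"
   unfolding K_def X0_def X_eq[symmetric]
  proof (rule weakgrad_residual[OF test \<delta> _ inn])
   show "norm (D\<psi> (\<xi>, s) - D\<psi> (x, s)) \<le> \<delta>" if "x \<in> Om" "s \<in> {0..T}" "norm (\<xi> - x) \<le> h * ?D" for x \<xi> s
    using that hD d1 by (intro mo) auto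
  qed
  then show "\<bar>LINT z|dm (Om \<times> {0<..<T}). ev (sol h e dt f) z * (fst (D\<psi> z) \<bullet> a) + \<psi> z * (ev (solg h e dt f) z \<bullet> a)\<bar> \<le> \<eta>"
   using \<delta>K by linarith
  qed
 qed
qed

lemma sol_equicontinuous:
 assumes f: "bmon Om f" and lip: "\<And>x y. x \<in> Om ==> y \<in> Om ==> \<bar>f x - f y\<bar> \<le> L * norm (x - y)" and L: "L \<ge> 0"
  and e: "e > 0" and \<eta>: "\<eta> > 0"
 shows "\<exists>d>0. \<forall>h dt N. \<forall>s\<in>{0..T}. \<forall>t\<in>{0..T}. mesh e h dt N \<and> dt \<le> d \<and> \<bar>s - t\<bar> \<le> d \<longrightarrow>
   (LINT x|dm Om. (sol h e dt f s x - sol h e dt f t x)^2) \<le> \<eta>"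
proof -
 obtain d0 where d0: "d0 > 0" and eq: "\<And>h dt (N::nat) n m. 0 < h ==> 0 < dt ==> 2 * dt * (24 / h^2 * (12 * e^2 / h^2 + 3 * M^2 * (real DIM('a))^2)) \<le> 1 ==> 48 * dt \<le> h^2 ==>
  real N * dt = T ==> n + m \<le> N ==> real m * dt < d0 ==>
  (LINT x|dm Om. (jump.it Om h e dt (bav dt) f (n + m) x - jump.it Om h e dt (bav dt) f n x)^2) \<le> \<eta>"
  using scheme_equicontinuous[OF f lip L e \<eta>] by blast
 \<comment> \<open>Passing to slot indices enlarges the gap by less than \<open>dt\<close>; thirds
   of \<open>d0\<close> leave room for this rounding and for the strict bound.\<close>
 have one: "(LINT x|dm Om. (sol h e dt f s x - sol h e dt f t x)^2) \<le> \<eta>"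
  if ms: "mesh e h dt N" and dt: "dt \<le> d0 / 3" and st: "0 \<le> s" "s \<le> t" "t \<le> T" "t - s \<le> d0 / 3" for h dt N s t
 proof -
  have dtp: "dt > 0" and N: "real N * dt = T" using ms by (auto simp: mesh_def)
  note id = idx_diff[OF dtp st(2,3)]
  have "(LINT x|dm Om. (jump.it Om h e dt (bav dt) f (idx dt t + (idx dt s - idx dt t)) x - jump.it Om h e dt (bav dt) f (idx dt t) x)^2) \<le> \<eta>"
  proof (rule eq[of h dt N])
   show "idx dt t + (idx dt s - idx dt t) \<le> N" using id(1) idx_le[OF dtp N st(1)] by simp
   show "real (idx dt s - idx dt t) * dt < d0" using id(2) dt st(4) d0 by linarith
  qed (use ms in \<open>auto simp: mesh_def\<close>)
  then show ?thesis using id(1) by (simp add: sol_def)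
 qed
 show ?thesis
 proof (rule exI[of _ "d0 / 3"], rule conjI, goal_cases)
  case 1 then show ?case using d0 by simp
 next
  case 2
  show ?case
  proof (intro allI ballI impI, elim conjE)
   fix h dt N s t assume s: "s \<in> {0..T}" and t: "t \<in> {0..T}" and ms: "mesh e h dt N" and dt: "dt \<le> d0 / 3" and st: "\<bar>s - t\<bar> \<le> d0 / 3"
   show "(LINT x|dm Om. (sol h e dt f s x - sol h e dt f t x)^2) \<le> \<eta>"
   proof (cases "s \<le> t")
    case True then show ?thesis using s t st by (intro one[OF ms dt]) auto
   next
    case False
    then have "(LINT x|dm Om. (sol h e dt f t x - sol h e dt f s x)^2) \<le> \<eta>" using s t st by (intro one[OF ms dt]) auto
    then show ?thesis by (simp add: power2_commute)
   qed
  qed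
 qed
qed

text \<open>Here \<open>e\<close> is fixed and the mesh is refined. The second conclusion carries a
  bound on \<open>A\<close> that holds for all iterates over to the limit; its factor 2 comes from
  splitting the limit into a convex combination and a remainder of squared norm at most
  \<open>(1/4) ^ j\<close>.\<close>

lemma scheme_limit:
 assumes f: "bmon Om f" and lip: "\<And>x y. x \<in> Om ==> y \<in> Om ==> \<bar>f x - f y\<bar> \<le> L * norm (x - y)" and L: "L \<ge> 0"
  and e: "e > 0" and ms: "\<And>k. mesh e (hk k) (dtk k) (Nk k)" and h0: "hk \<longlonglongrightarrow> 0" and dt0: "dtk \<longlonglongrightarrow> 0"
 obtains \<phi> where "adjoint_weak_solution e T Om B f \<phi>"
  "\<And>A \<eta>. A \<in> sets borel ==> A \<subseteq> Om ==>
   (\<And>k n. n \<le> Nk k ==> (LINT x|dm A. (jump.it Om (hk k) e (dtk k) (bav (dtk k)) f n x)^2) \<le> \<eta>) ==>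
   (LINT z:A \<times> {0<..<T}|lborel. (ev \<phi> z)^2) \<le> 2 * (T * \<eta>)"
proof -
 let ?Q = "Om \<times> {0<..<T}"
 define \<Phi> where "\<Phi> k = sol (hk k) e (dtk k) f" for k
 define G where "G k = solg (hk k) e (dtk k) f" for k
 note sch = schemeI[OF e ms f]
 note \<Phi>m = scheme.sol_measurable[OF sch, folded \<Phi>_def] and Gm = scheme.solg_measurable[OF sch, folded G_def]
 have b\<Phi>: "bmon (A \<times> {0<..<T}) (\<lambda>z. ev (\<Phi> k) z)" and bG: "bmon (A \<times> {0<..<T}) (\<lambda>z. ev (G k) z)" if "A \<subseteq> Om" for A k
  unfolding \<Phi>_def G_def using that
  by (intro bmon_subset[OF scheme.bmon_sol[OF sch]] bmon_subset[OF scheme.bmon_solg[OF sch]]; auto)+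
 have \<Phi>A: "sqint (dm (A \<times> {0<..<T})) (\<lambda>z. ev (\<Phi> k) z)" if "A \<in> sets borel" "A \<subseteq> Om" for A k
  using that bounded_subset[OF bounded_dom that(2)]
  by (intro sqint_bmon b\<Phi> Times_sets_borel bounded_Times) (auto simp flip: box_real)
 have \<Phi>Q: "sqint (dm ?Q) (\<lambda>z. ev (\<Phi> k) z)" for k by (intro \<Phi>A Q_sets) auto
 have GQ: "sqint (dm ?Q) (\<lambda>z. ev (G k) z)" for k by (intro sqint_bmon bG Q_sets order_refl)
 have \<Phi>s: "sqint (dm Om) (\<Phi> k t)" for k t
  unfolding \<Phi>_def scheme.sol_u[OF sch] by (intro sqint_bmon scheme.bmon_u[OF sch] Q_sets bounded_dom)
 have ev: "\<exists>K. \<forall>k\<ge>K. hk k \<le> d \<and> dtk k \<le> d" if d: "d > 0" for d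
 proof -
  have "eventually (\<lambda>k. hk k < d) sequentially" "eventually (\<lambda>k. dtk k < d) sequentially"
   using order_tendstoD(2)[OF h0 d] order_tendstoD(2)[OF dt0 d] by auto
  then have "eventually (\<lambda>k. hk k \<le> d \<and> dtk k \<le> d) sequentially" by eventually_elim auto
  then show ?thesis by (simp add: eventually_sequentially)
 qed
 have eqc: "\<exists>d>0. \<exists>K. \<forall>k\<ge>K. \<forall>s\<in>{0..T}. \<forall>t\<in>{0..T}. \<bar>s - t\<bar> \<le> d \<longrightarrow> (LINT x|dm Om. (\<Phi> k s x - \<Phi> k t x)^2) \<le> \<eta>" if \<eta>: "\<eta> > 0" for \<eta>
 proof -
  obtain d where d: "d > 0" "\<forall>h dt N. \<forall>s\<in>{0..T}. \<forall>t\<in>{0..T}. mesh e h dt N \<and> dt \<le> d \<and> \<bar>s - t\<bar> \<le> d \<longrightarrow>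
   (LINT x|dm Om. (sol h e dt f s x - sol h e dt f t x)^2) \<le> \<eta>" using sol_equicontinuous[OF f lip L e \<eta>] by blast
  obtain K where "\<forall>k\<ge>K. hk k \<le> d \<and> dtk k \<le> d" using ev[OF d(1)] by blast
  then have "\<forall>k\<ge>K. \<forall>s\<in>{0..T}. \<forall>t\<in>{0..T}. \<bar>s - t\<bar> \<le> d \<longrightarrow> (LINT x|dm Om. (\<Phi> k s x - \<Phi> k t x)^2) \<le> \<eta>"
   unfolding \<Phi>_def using d(2) ms by blast
  then show ?thesis using d(1) by blast
 qed
 define C0 where "C0 = exp ((3 * M^2 * (real DIM('a))^2 / e + 1) * T) * (LINT x|dm Om. (f x)^2)"
 have \<Phi>C: "(LINT z|dm ?Q. (ev (\<Phi> k) z)^2) \<le> T * C0" for k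
  using scheme.sol_bound[OF sch, unfolded scheme.X_eq[OF sch]] by (simp add: C0_def \<Phi>_def)
 have GC: "(LINT z|dm ?Q. (norm (ev (G k) z))^2) \<le> 3 * (real DIM('a))^2 * (2 / e * C0)" for k
  using scheme.solg_bound[OF sch, unfolded scheme.X_eq[OF sch]] by (simp add: C0_def G_def)
 obtain c LL \<phi> g where adm: "\<And>j. adm j (c j) (LL j)"
  and \<phi>m: "(\<lambda>z. ev \<phi> z) \<in> borel_measurable borel" and gm: "(\<lambda>z. ev g z) \<in> borel_measurable borel"
  and \<phi>Q: "sqint (dm ?Q) (\<lambda>z. ev \<phi> z)" and gQ: "sqint (dm ?Q) (\<lambda>z. ev g z)"
  and \<phi>s: "\<And>t. t \<in> {0..T} ==> sqint (dm Om) (\<phi> t)"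
  and d\<phi>: "\<And>j. (LINT z|dm ?Q. (ev \<phi> z - comb (\<lambda>k z. ev (\<Phi> k) z) (c j) (LL j) z)^2) \<le> (1/4) ^ j"
  and dg: "\<And>j. (LINT z|dm ?Q. (norm (ev g z - comb (\<lambda>k z. ev (G k) z) (c j) (LL j) z))^2) \<le> (1/4) ^ j"
  and ds: "\<And>j t. t \<in> {0..T} ==> (LINT x|dm Om. (\<phi> t x - comb (\<lambda>k. \<Phi> k t) (c j) (LL j) x)^2) \<le> (1/4) ^ j"
  and cont: "\<And>t. t \<in> {0..T} ==> ((\<lambda>s. LINT x|dm Om. (\<phi> s x - \<phi> t x)^2) \<longlongrightarrow> 0) (at t within {0..T})"
  by (rule evolution_compactness[OF Q_sets(3) bounded_dom T_pos \<Phi>m Gm \<Phi>Q GQ \<Phi>C GC \<Phi>s eqc]) (assumption, rule that)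
 have finQ: "finite_measure (dm ?Q)" and finOm: "finite_measure (dm Om)" by (intro finite_measure_dm Q_sets bounded_dom)+
 have \<phi>sm: "\<phi> t \<in> borel_measurable borel" if "t \<in> {0..T}" for t using sqint_measurable[OF \<phi>s[OF that]] by simp
 have bI: "\<exists>C\<ge>0. AE x in dm A. norm (w x) \<le> C" if A: "A \<in> sets borel" and w: "bmon A w" for A :: "'d::euclidean_space set" and w :: "'d => 'b::euclidean_space"
 proof -
  obtain C where "\<forall>p\<in>A. norm (w p) \<le> C" using w by (auto simp: bmon_def)
  then have "AE x in dm A. norm (w x) \<le> max C 0" by (intro AE_dmI A) (auto simp: le_max_iff_disj)
  then show ?thesis by (intro exI[of _ "max C 0"]) auto
 qed
 have limQ: "(\<lambda>j. \<Sum>k<LL j. c j k * (LINT z|dm ?Q. ev (\<Phi> k) z * w z)) \<longlonglongrightarrow> (LINT z|dm ?Q. ev \<phi> z * w z)" if w: "bmon ?Q w" for w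
 proof -
  obtain C where C: "C \<ge> 0" "AE x in dm ?Q. norm (w x) \<le> C" using bI[OF Q_sets(1) w] by blast
  show ?thesis using comb_L2_limit[where c=c and L=LL and w=w, OF finQ \<phi>Q \<Phi>Q _ _ C(2,1)] d\<phi> bmon_measurable[OF w] by simp
 qed
 have limG: "(\<lambda>j. \<Sum>k<LL j. c j k * (LINT z|dm ?Q. ev (G k) z \<bullet> w z)) \<longlonglongrightarrow> (LINT z|dm ?Q. ev g z \<bullet> w z)" if w: "bmon ?Q w" for w
 proof -
  obtain C where C: "C \<ge> 0" "AE x in dm ?Q. norm (w x) \<le> C" using bI[OF Q_sets(1) w] by blast
  show ?thesis using comb_L2_limit[where c=c and L=LL and w=w, OF finQ gQ GQ dg _ C(2,1)] bmon_measurable[OF w] by simp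
 qed
 have limS: "(\<lambda>j. \<Sum>k<LL j. c j k * (LINT x|dm Om. \<Phi> k t x * w x)) \<longlonglongrightarrow> (LINT x|dm Om. \<phi> t x * w x)" if t: "t \<in> {0..T}" and w: "bmon Om w" for t w
 proof -
  obtain C where C: "C \<ge> 0" "AE x in dm Om. norm (w x) \<le> C" using bI[OF Q_sets(3) w] by blast
  show ?thesis using comb_L2_limit[where c=c and L=LL and w=w, OF finOm \<phi>s[OF t] \<Phi>s _ _ C(2,1)] ds[OF t] bmon_measurable[OF w] by simp
 qed
 have iQ: "integrable (dm ?Q) (\<lambda>z. F z \<bullet> w z)" if F: "sqint (dm ?Q) F" and w: "bmon ?Q w" for F w :: "'a \<times> real => 'b::euclidean_space"
 proof -
  obtain C where C: "C \<ge> 0" "AE x in dm ?Q. norm (w x) \<le> C" using bI[OF Q_sets(1) w] by blast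
  show ?thesis by (rule sqint_inner_integrable[OF finQ F _ C(2,1)]) (use bmon_measurable[OF w] in simp)
 qed
 have iQr: "integrable (dm ?Q) (\<lambda>z. F z * w z)" if "sqint (dm ?Q) F" "bmon ?Q w" for F w :: "'a \<times> real => real"
  using iQ[OF that] by simp
 have bBP: "bmon ?Q (\<lambda>z. ev B z \<bullet> fst (D\<psi> z))" "bmon ?Q (\<lambda>z. snd (D\<psi> z))" "bmon ?Q (\<lambda>z. e *\<^sub>R fst (D\<psi> z))"
  "bmon ?Q (\<lambda>z. fst (D\<psi> z))" "bmon ?Q \<psi>" "bmon Om (\<lambda>x. \<psi> (x, t))" if "C1_test \<psi> D\<psi>" for \<psi> :: "'a \<times> real => real" and D\<psi> t
 proof -
  note ct = C1_test_partials(3,4)[OF that]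
  have b: "bmon ?Q (\<lambda>z. fst (D\<psi> z))" by (intro bmon_continuous Q_sets continuous_on_fst ct)
  then show "bmon ?Q (\<lambda>z. fst (D\<psi> z))" .
  show "bmon ?Q (\<lambda>z. ev B z \<bullet> fst (D\<psi> z))" by (intro bmon_inner b bmonI[OF B_measurable B_bound])
  show "bmon ?Q (\<lambda>z. e *\<^sub>R fst (D\<psi> z))" by (intro bmon_scaleR bmon_const b)
  show "bmon ?Q (\<lambda>z. snd (D\<psi> z))" by (intro bmon_continuous Q_sets continuous_on_snd ct)
  show "bmon ?Q \<psi>" by (intro bmon_continuous Q_sets ct)
  show "bmon Om (\<lambda>x. \<psi> (x, t))"
   by (intro bmon_continuous bounded_dom continuous_on_compose2[OF ct(1)]) (auto intro!: continuous_intros)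
 qed
 \<comment> \<open>The residuals \<open>r k\<close> tend to 0, hence so do their convex
   combinations. These are the same combinations of the terms \<open>t1\<close> to
   \<open>t5\<close>, each of which converges because it is tested against a bounded
   function.\<close>
 have weakform: "(LINT x|dm Om. \<phi> T x * \<psi> (x, T)) - (LINT x|dm Om. \<phi> 0 x * \<psi> (x, 0)) - (LINT z|dm ?Q. ev \<phi> z * snd (D\<psi> z))
   = (LINT z|dm ?Q. e * (ev g z \<bullet> fst (D\<psi> z)) + ev \<phi> z * (ev B z \<bullet> fst (D\<psi> z)))"
  if test: "C1_test \<psi> D\<psi>" for \<psi> D\<psi>
 proof -
  note b = bBP[OF test]
  define t1 t2 t3 t4 t5 where "t1 k = (LINT x|dm Om. \<Phi> k T x * \<psi> (x, T))" and "t2 k = (LINT x|dm Om. \<Phi> k 0 x * \<psi> (x, 0))"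
   and "t3 k = (LINT z|dm ?Q. ev (\<Phi> k) z * snd (D\<psi> z))" and "t4 k = (LINT z|dm ?Q. ev (G k) z \<bullet> (e *\<^sub>R fst (D\<psi> z)))"
   and "t5 k = (LINT z|dm ?Q. ev (\<Phi> k) z * (ev B z \<bullet> fst (D\<psi> z)))" for k
  define r where "r k = t1 k - t2 k - (t3 k + (t4 k + t5 k))" for k
  have req: "r k = (LINT x|dm Om. \<Phi> k T x * \<psi> (x, T)) - (LINT x|dm Om. \<Phi> k 0 x * \<psi> (x, 0))
    - (LINT z|dm ?Q. ev (\<Phi> k) z * snd (D\<psi> z) + (ev (G k) z \<bullet> (e *\<^sub>R fst (D\<psi> z))
     + ev (\<Phi> k) z * (ev B z \<bullet> fst (D\<psi> z))))" for k
   unfolding r_def t1_def t2_def t3_def t4_def t5_def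
   by (subst lint_add, intro iQr \<Phi>Q b, intro lintegrable_add iQr iQ \<Phi>Q GQ b,
     subst lint_add, intro iQ GQ b, intro iQr \<Phi>Q b, rule refl)
  have r0: "r \<longlonglongrightarrow> 0"
  proof (rule LIMSEQ_I)
   fix \<eta> :: real assume \<eta>: "\<eta> > 0"
   then have "\<eta> / 2 > 0" by simp
   from residual_small[OF f test e this] obtain d where d: "d > 0" and
    rs: "\<And>h dt N. mesh e h dt N ==> h \<le> d ==> dt \<le> d ==> \<bar>defect h e dt f \<psi> D\<psi>\<bar> \<le> \<eta> / 2" by blast
   obtain K where K: "\<forall>k\<ge>K. hk k \<le> d \<and> dtk k \<le> d" using ev[OF d] by blast
   have "norm (r k - 0) < \<eta>" if "k \<ge> K" for k
    using rs[OF ms, of k] K that \<eta> unfolding req \<Phi>_def G_def defect_def by simp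
   then show "\<exists>no. \<forall>k\<ge>no. norm (r k - 0) < \<eta>" by blast
  qed
  have "(\<lambda>j. \<Sum>k<LL j. c j k * r k) \<longlonglongrightarrow> 0" by (rule comb_limit[OF r0 adm])
  moreover have "(\<lambda>j. (\<Sum>k<LL j. c j k * t1 k) - (\<Sum>k<LL j. c j k * t2 k) - ((\<Sum>k<LL j. c j k * t3 k) + ((\<Sum>k<LL j. c j k * t4 k) + (\<Sum>k<LL j. c j k * t5 k)))) \<longlonglongrightarrow>
    (LINT x|dm Om. \<phi> T x * \<psi> (x, T)) - (LINT x|dm Om. \<phi> 0 x * \<psi> (x, 0)) - ((LINT z|dm ?Q. ev \<phi> z * snd (D\<psi> z))
     + ((LINT z|dm ?Q. ev g z \<bullet> (e *\<^sub>R fst (D\<psi> z))) + (LINT z|dm ?Q. ev \<phi> z * (ev B z \<bullet> fst (D\<psi> z)))))"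
   unfolding t1_def t2_def t3_def t4_def t5_def using T_pos by (intro tendsto_diff tendsto_add limQ limG limS b) auto
  moreover have "(\<Sum>k<LL j. c j k * r k) = (\<Sum>k<LL j. c j k * t1 k) - (\<Sum>k<LL j. c j k * t2 k) - ((\<Sum>k<LL j. c j k * t3 k) + ((\<Sum>k<LL j. c j k * t4 k) + (\<Sum>k<LL j. c j k * t5 k)))" for j
   unfolding r_def by (simp add: right_diff_distrib distrib_left sum.distrib sum_subtractf)
  ultimately have "0 = (LINT x|dm Om. \<phi> T x * \<psi> (x, T)) - (LINT x|dm Om. \<phi> 0 x * \<psi> (x, 0)) - ((LINT z|dm ?Q. ev \<phi> z * snd (D\<psi> z))
     + ((LINT z|dm ?Q. ev g z \<bullet> (e *\<^sub>R fst (D\<psi> z))) + (LINT z|dm ?Q. ev \<phi> z * (ev B z \<bullet> fst (D\<psi> z)))))"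
   by (intro LIMSEQ_unique) simp_all
  moreover have "(LINT z|dm ?Q. ev g z \<bullet> (e *\<^sub>R fst (D\<psi> z))) + (LINT z|dm ?Q. ev \<phi> z * (ev B z \<bullet> fst (D\<psi> z)))
   = (LINT z|dm ?Q. e * (ev g z \<bullet> fst (D\<psi> z)) + ev \<phi> z * (ev B z \<bullet> fst (D\<psi> z)))"
   by (subst lint_add[symmetric], intro iQ gQ b, intro iQr \<phi>Q b) simp
  ultimately show ?thesis by linarith
 qed
 have weakgrad: "(LINT z|dm ?Q. ev \<phi> z *\<^sub>R fst (D\<psi> z)) = - (LINT z|dm ?Q. \<psi> z *\<^sub>R ev g z)"
  if test: "C1_test \<psi> D\<psi>" and supp: "closure {z. \<psi> z \<noteq> 0} \<subseteq> ?Q" "compact (closure {z. \<psi> z \<noteq> 0})" for \<psi> D\<psi>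
 proof -
  note b = bBP[OF test]
  have ba: "bmon ?Q (\<lambda>z. fst (D\<psi> z) \<bullet> a)" "bmon ?Q (\<lambda>z. \<psi> z *\<^sub>R a)" for a by (intro bmon_inner bmon_scaleR bmon_const b)+
  have sc: "(\<lambda>z. v z \<bullet> (\<psi> z *\<^sub>R a)) = (\<lambda>z. \<psi> z * (v z \<bullet> a))" for v and a :: 'a by auto
  have comp: "(LINT z|dm ?Q. ev \<phi> z * (fst (D\<psi> z) \<bullet> a)) + (LINT z|dm ?Q. ev g z \<bullet> (\<psi> z *\<^sub>R a)) = 0" for a
  proof -
   define t1 t2 where "t1 k = (LINT z|dm ?Q. ev (\<Phi> k) z * (fst (D\<psi> z) \<bullet> a))" and "t2 k = (LINT z|dm ?Q. ev (G k) z \<bullet> (\<psi> z *\<^sub>R a))" for k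
   define r where "r k = t1 k + t2 k" for k
   have req: "r k = (LINT z|dm ?Q. ev (\<Phi> k) z * (fst (D\<psi> z) \<bullet> a) + \<psi> z * (ev (G k) z \<bullet> a))" for k
    unfolding r_def t1_def t2_def
    by (subst lint_add[symmetric], intro iQr \<Phi>Q ba, intro iQ GQ ba) simp
   have r0: "r \<longlonglongrightarrow> 0"
   proof (rule LIMSEQ_I)
    fix \<eta> :: real assume \<eta>: "\<eta> > 0"
    then have "\<eta> / 2 > 0" by simp
    from weakgrad_small[OF f test e this supp, of a] obtain d where d: "d > 0" and
     rs: "\<And>h dt N. mesh e h dt N ==> h \<le> d ==> \<bar>LINT z|dm (Om \<times> {0<..<T}). ev (sol h e dt f) z * (fst (D\<psi> z) \<bullet> a) + \<psi> z * (ev (solg h e dt f) z \<bullet> a)\<bar> \<le> \<eta> / 2" by blast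
    obtain K where K: "\<forall>k\<ge>K. hk k \<le> d \<and> dtk k \<le> d" using ev[OF d] by blast
    have "norm (r k - 0) < \<eta>" if "k \<ge> K" for k
     using rs[OF ms, of k] K that \<eta> unfolding req \<Phi>_def G_def by simp
    then show "\<exists>no. \<forall>k\<ge>no. norm (r k - 0) < \<eta>" by blast
   qed
   have "(\<lambda>j. \<Sum>k<LL j. c j k * r k) \<longlonglongrightarrow> 0" by (rule comb_limit[OF r0 adm])
   moreover have "(\<lambda>j. (\<Sum>k<LL j. c j k * t1 k) + (\<Sum>k<LL j. c j k * t2 k)) \<longlonglongrightarrow>
     (LINT z|dm ?Q. ev \<phi> z * (fst (D\<psi> z) \<bullet> a)) + (LINT z|dm ?Q. ev g z \<bullet> (\<psi> z *\<^sub>R a))"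
    unfolding t1_def t2_def by (intro tendsto_add limQ limG ba)
   moreover have "(\<Sum>k<LL j. c j k * r k) = (\<Sum>k<LL j. c j k * t1 k) + (\<Sum>k<LL j. c j k * t2 k)" for j
    unfolding r_def by (simp add: distrib_left sum.distrib)
   ultimately show ?thesis by (intro LIMSEQ_unique) simp_all
  qed
  have vec: "integrable (dm ?Q) (\<lambda>z. F z *\<^sub>R w z)" if "sqint (dm ?Q) F" "bmon ?Q w" for F :: "'a \<times> real => real" and w :: "'a \<times> real => 'a"
  proof -
   have "sqint (dm ?Q) (\<lambda>z. norm (w z))" "bmon ?Q (\<lambda>z. norm (w z))" by (intro sqint_bmon Q_sets bmon_norm that(2))+
   then have i: "integrable (dm ?Q) (\<lambda>z. F z * norm (w z))" by (intro iQr that(1))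
   show ?thesis by (rule lintegrable_bound[OF i])
     (use sqint_measurable[OF that(1)] bmon_measurable[OF that(2)] in \<open>auto simp: abs_mult\<close>)
  qed
  have i1: "integrable (dm ?Q) (\<lambda>z. ev \<phi> z *\<^sub>R fst (D\<psi> z))" by (intro vec \<phi>Q b)
  have i2: "integrable (dm ?Q) (\<lambda>z. \<psi> z *\<^sub>R ev g z)"
  proof -
   have "sqint (dm ?Q) (\<lambda>z. norm (ev g z))" using gQ by (auto simp: sqint_def)
   then have i: "integrable (dm ?Q) (\<lambda>z. norm (ev g z) * \<psi> z)" by (intro iQr b)
   show ?thesis by (rule lintegrable_bound[OF i])
     (use gm bmon_measurable[OF b(5)] in \<open>auto simp: abs_mult mult.commute\<close>)
  qed
  show ?thesis
  proof (rule euclidean_eqI)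
   fix a :: 'a assume "a \<in> Basis"
   have "(LINT z|dm ?Q. ev \<phi> z *\<^sub>R fst (D\<psi> z)) \<bullet> a = (LINT z|dm ?Q. ev \<phi> z * (fst (D\<psi> z) \<bullet> a))"
    using integral_inner_left[of a "dm ?Q" "\<lambda>z. ev \<phi> z *\<^sub>R fst (D\<psi> z)"] i1 by simp
   moreover have "(LINT z|dm ?Q. \<psi> z *\<^sub>R ev g z) \<bullet> a = (LINT z|dm ?Q. ev g z \<bullet> (\<psi> z *\<^sub>R a))"
    using integral_inner_left[of a "dm ?Q" "\<lambda>z. \<psi> z *\<^sub>R ev g z"] i2 by (simp add: mult.commute)
   ultimately show "(LINT z|dm ?Q. ev \<phi> z *\<^sub>R fst (D\<psi> z)) \<bullet> a = (- (LINT z|dm ?Q. \<psi> z *\<^sub>R ev g z)) \<bullet> a"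
    using comp[of a] by simp
  qed
 qed
 \<comment> \<open>Every approximation equals \<open>f\<close> at time \<open>T\<close>, and the
   coefficients sum to 1.\<close>
 have \<phi>T: "AE x in lborel. x \<in> Om \<longrightarrow> \<phi> T x = f x"
 proof -
  have T: "T \<in> {0..T}" using T_pos by simp
  have "comb (\<lambda>k. \<Phi> k T) (c j) (LL j) x = f x" for j x
  proof -
   have "\<Phi> k T x = f x" for k
    using idx_ends(1)[OF scheme.dt0[OF sch[of k]]] jump.it.simps(1)[OF jump.intro[OF open_dom bounded_dom scheme.h0[OF sch[of k]]]]
    by (simp add: \<Phi>_def sol_def)
   then show ?thesis using adm[of j] by (simp add: comb_def adm_def flip: sum_distrib_right)
  qed
  then have le: "(LINT x|dm Om. (\<phi> T x - f x)^2) \<le> (1/4) ^ j" for j using ds[OF T, of j] by simp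
  have "(LINT x|dm Om. (\<phi> T x - f x)^2) \<le> 0"
   by (rule LIMSEQ_le_const[OF LIMSEQ_realpow_zero[of "1/4"]]) (use le in auto)
  moreover have "0 \<le> (LINT x|dm Om. (\<phi> T x - f x)^2)" by (intro integral_nonneg_AE) auto
  ultimately have z: "(LINT x|dm Om. (\<phi> T x - f x)^2) = 0" by simp
  have "sqint (dm Om) (\<lambda>x. \<phi> T x - f x)" by (intro sqint_diff \<phi>s T sqint_bmon f Q_sets bounded_dom)
  then have i: "integrable (dm Om) (\<lambda>x. (\<phi> T x - f x)^2)" using sqint_integrable by force
  have "AE x in dm Om. (\<phi> T x - f x)^2 = 0" using integral_nonneg_eq_0_iff_AE[OF i] z by simp
  then show ?thesis unfolding AE_dm[OF Q_sets(3)] by simp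
 qed
 have sint: "(LINT x:A|lborel. v x) = (LINT x|dm A. v x)" if "A \<in> sets borel" "v \<in> borel_measurable borel"
  for A :: "'d::euclidean_space set" and v :: "'d => 'b::euclidean_space"
  unfolding set_lebesgue_integral_def integral_dm[OF that] ..
 have sinb: "set_integrable lborel A v \<longleftrightarrow> integrable (dm A) v" if "A \<in> sets borel" "v \<in> borel_measurable borel"
  for A :: "'d::euclidean_space set" and v :: "'d => 'b::euclidean_space"
  unfolding set_integrable_def integrable_dm_iff[OF that] ..
 have sbm: "set_borel_measurable lborel A v" if [measurable]: "A \<in> sets borel" "v \<in> borel_measurable borel"
  for A :: "'d::euclidean_space set" and v :: "'d => 'b::euclidean_space"
  unfolding set_borel_measurable_def by measurable
 have T0: "0 \<in> {0..T}" "T \<in> {0..T}" using T_pos by auto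
 note mm = \<phi>m gm B_measurable
 show ?thesis
 proof (rule that)
  show "adjoint_weak_solution e T Om B f \<phi>"
   unfolding adjoint_weak_solution_def
  proof (rule exI[of _ g], intro conjI allI impI ballI)
   show "set_borel_measurable lborel ?Q (\<lambda>z. ev \<phi> z)" by (intro sbm Q_sets \<phi>m)
   show "set_borel_measurable lborel ?Q (\<lambda>z. ev g z)" by (intro sbm Q_sets gm)
   show "set_integrable lborel ?Q (\<lambda>z. (ev \<phi> z)^2)"
    using sqint_integrable[OF \<phi>Q] \<phi>m by (subst sinb) (auto intro: Q_sets)
   show "set_integrable lborel ?Q (\<lambda>z. (norm (ev g z))^2)"
    using sqint_integrable[OF gQ] gm by (subst sinb) (auto intro: Q_sets)
   show "set_borel_measurable lborel Om (\<phi> t)" if "t \<in> {0..T}" for t by (intro sbm Q_sets \<phi>sm that)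
   show "set_integrable lborel Om (\<lambda>x. (\<phi> t x)^2)" if "t \<in> {0..T}" for t
    using sqint_integrable[OF \<phi>s[OF that]] \<phi>sm[OF that] by (subst sinb) (auto intro: Q_sets)
   show "((\<lambda>s. LINT x:Om|lborel. (\<phi> s x - \<phi> t x)^2) \<longlongrightarrow> 0) (at t within {0..T})" if t: "t \<in> {0..T}" for t
   proof (rule Lim_transform_eventually[OF cont[OF t]])
    show "\<forall>\<^sub>F s in at t within {0..T}. (LINT x|dm Om. (\<phi> s x - \<phi> t x)^2) = (LINT x:Om|lborel. (\<phi> s x - \<phi> t x)^2)"
     unfolding eventually_at_filter using \<phi>sm[OF t] \<phi>sm by (intro always_eventually allI impI sint[symmetric] Q_sets) auto
   qed
   show "AE x in lborel. x \<in> Om \<longrightarrow> \<phi> T x = f x" by (rule \<phi>T)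
  next
   fix \<psi> D\<psi> assume a: "C1_test \<psi> D\<psi> \<and> closure {z. \<psi> z \<noteq> 0} \<subseteq> ?Q \<and> compact (closure {z. \<psi> z \<noteq> 0})"
   note bm = bBP[OF conjunct1[OF a], THEN bmon_measurable]
   have "(\<lambda>z. ev \<phi> z *\<^sub>R fst (D\<psi> z)) \<in> borel_measurable borel" "(\<lambda>z. \<psi> z *\<^sub>R ev g z) \<in> borel_measurable borel"
    using mm bm by (auto intro!: borel_measurable_scaleR)
   then show "(LINT z:?Q|lborel. ev \<phi> z *\<^sub>R fst (D\<psi> z)) = - (LINT z:?Q|lborel. \<psi> z *\<^sub>R ev g z)"
    using weakgrad[of \<psi> D\<psi>] a by (simp add: sint Q_sets)
  next
   fix \<psi> :: "'a \<times> real => real" and D\<psi> assume a: "C1_test \<psi> D\<psi>"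
   note bm = bBP[OF a, THEN bmon_measurable]
   have "(\<lambda>z. ev \<phi> z * snd (D\<psi> z)) \<in> borel_measurable borel"
    "(\<lambda>z. e * (ev g z \<bullet> fst (D\<psi> z)) + ev \<phi> z * (ev B z \<bullet> fst (D\<psi> z))) \<in> borel_measurable borel"
    "(\<lambda>x. \<phi> T x * \<psi> (x, T)) \<in> borel_measurable borel" "(\<lambda>x. \<phi> 0 x * \<psi> (x, 0)) \<in> borel_measurable borel"
    using mm bm \<phi>sm T0 by (auto intro!: borel_measurable_times borel_measurable_add borel_measurable_inner)
   then show "(LINT x:Om|lborel. \<phi> T x * \<psi> (x, T)) - (LINT x:Om|lborel. \<phi> 0 x * \<psi> (x, 0)) - (LINT z:?Q|lborel. ev \<phi> z * snd (D\<psi> z)) =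
     (LINT z:?Q|lborel. e * (ev g z \<bullet> fst (D\<psi> z)) + ev \<phi> z * (ev B z \<bullet> fst (D\<psi> z)))"
    using weakform[OF a] by (simp add: sint Q_sets)
  qed
 next
  fix A :: "'a set" and \<eta> assume A: "A \<in> sets borel" "A \<subseteq> Om"
   and b: "\<And>k n. n \<le> Nk k ==> (LINT x|dm A. (jump.it Om (hk k) e (dtk k) (bav (dtk k)) f n x)^2) \<le> \<eta>"
  let ?A = "A \<times> {0<..<T}"
  have As: "?A \<in> sets borel" by (intro Times_sets_borel A) auto
  have sub: "?A \<subseteq> ?Q" using A by auto
  have restr: "(LINT z|dm ?A. v z) \<le> (LINT z|dm ?Q. v z)" "integrable (dm ?A) v" if "integrable (dm ?Q) v" "v \<in> borel_measurable borel" "\<And>z. 0 \<le> v z" for v :: "_ => real"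
  proof -
   have iq: "integrable lborel (\<lambda>z. indicator ?Q z *\<^sub>R v z)" using that integrable_dm_iff[OF Q_sets(1) that(2)] by simp
   have ia: "integrable lborel (\<lambda>z. indicator ?A z *\<^sub>R v z)"
   proof (rule lintegrable_bound[OF iq])
    show "(\<lambda>z. indicator ?A z *\<^sub>R v z) \<in> borel_measurable lborel" using that(2) As by measurable
    have "norm (indicator ?A z *\<^sub>R v z) \<le> norm (indicator ?Q z *\<^sub>R v z)" for z
    proof (cases "z \<in> ?A")
     case True
     show ?thesis by (simp only: indicator_simps(1)[OF True] indicator_simps(1)[OF subsetD[OF sub True]] order_refl)
    next
     case False
     show ?thesis by (simp only: indicator_simps(2)[OF False] scaleR_zero_left norm_zero norm_ge_zero)
    qed
    then show "AE z in lborel. norm (indicator ?A z *\<^sub>R v z) \<le> norm (indicator ?Q z *\<^sub>R v z)" by (intro AE_I2)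
   qed
   then show "integrable (dm ?A) v" using integrable_dm_iff[OF As that(2)] by simp
   show "(LINT z|dm ?A. v z) \<le> (LINT z|dm ?Q. v z)"
    unfolding integral_dm[OF As that(2)] integral_dm[OF Q_sets(1) that(2)]
    by (rule integral_mono[OF ia iq]) (use that sub in \<open>auto simp: indicator_def\<close>)
  qed
  define Y where "Y j = comb (\<lambda>k z. ev (\<Phi> k) z) (c j) (LL j)" for j
  have Ym: "Y j \<in> borel_measurable borel" for j unfolding Y_def comb_def[abs_def] using \<Phi>m by measurable
  have YQ: "sqint (dm ?Q) (Y j)" for j unfolding Y_def by (rule sqint_comb[OF \<Phi>Q])
  have YA: "(LINT z|dm ?A. (Y j z)^2) \<le> T * \<eta>" for j
  proof -
   have "(LINT z|dm ?A. (norm (Y j z))^2) \<le> T * \<eta>"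
    unfolding Y_def
   proof (rule comb_bound[OF \<Phi>A[OF A] adm[of j]])
    fix k
    have "(LINT z|dm ?A. (ev (\<Phi> k) z)^2) \<le> T * \<eta>"
     unfolding \<Phi>_def by (rule scheme.sol_strip_bound[OF sch A]) (use b in \<open>auto simp: scheme.u_def[OF sch]\<close>)
    then show "(LINT z|dm ?A. (norm (ev (\<Phi> k) z))^2) \<le> T * \<eta>" by simp
   qed
   then show ?thesis by simp
  qed
  have main: "(LINT z|dm ?A. (ev \<phi> z)^2) \<le> 2 * (1/4) ^ j + 2 * (T * \<eta>)" for j
  proof -
   let ?d = "\<lambda>z. ev \<phi> z - Y j z"
   have dm: "?d \<in> borel_measurable borel" using \<phi>m Ym by measurable
   have dQ: "integrable (dm ?Q) (\<lambda>z. (?d z)^2)" using sqint_integrable[OF sqint_diff[OF \<phi>Q YQ[of j]]] by simp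
   have YQ2: "integrable (dm ?Q) (\<lambda>z. (Y j z)^2)" using sqint_integrable[OF YQ[of j]] by simp
   have \<phi>2: "integrable (dm ?Q) (\<lambda>z. (ev \<phi> z)^2)" using sqint_integrable[OF \<phi>Q] by simp
   have iA: "integrable (dm ?A) (\<lambda>z. (?d z)^2)" "integrable (dm ?A) (\<lambda>z. (Y j z)^2)" "integrable (dm ?A) (\<lambda>z. (ev \<phi> z)^2)"
    using dm Ym \<phi>m by (auto intro!: restr(2) dQ YQ2 \<phi>2)
   have "(LINT z|dm ?A. (ev \<phi> z)^2) \<le> (LINT z|dm ?A. 2 * (?d z)^2 + 2 * (Y j z)^2)"
   proof (rule integral_mono)
    fix z
    show "(ev \<phi> z)^2 \<le> 2 * (?d z)^2 + 2 * (Y j z)^2" using norm_add_power2_le[of "?d z" "Y j z"] by simp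
   qed (use iA in auto)
   also have "... = 2 * (LINT z|dm ?A. (?d z)^2) + 2 * (LINT z|dm ?A. (Y j z)^2)" using iA by simp
   also have "(LINT z|dm ?A. (?d z)^2) \<le> (LINT z|dm ?Q. (?d z)^2)" using dm by (intro restr(1) dQ) auto
   also have "(LINT z|dm ?Q. (?d z)^2) \<le> (1/4) ^ j" using d\<phi>[of j] by (simp add: Y_def)
   finally show ?thesis using YA[of j] by linarith
  qed
  have "(\<lambda>j. 2 * (1/4) ^ j + 2 * (T * \<eta>)) \<longlonglongrightarrow> 2 * 0 + 2 * (T * \<eta>)" by (intro tendsto_intros LIMSEQ_realpow_zero) auto
  then have "(LINT z|dm ?A. (ev \<phi> z)^2) \<le> 2 * 0 + 2 * (T * \<eta>)" by (rule LIMSEQ_le_const) (use main in auto)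
  moreover have "(LINT z:?A|lborel. (ev \<phi> z)^2) = (LINT z|dm ?A. (ev \<phi> z)^2)" using \<phi>m by (intro sint As) auto
  ultimately show "(LINT z:?A|lborel. (ev \<phi> z)^2) \<le> 2 * (T * \<eta>)" by simp
 qed
qed

end

section \<open>The cost of control\<close>

text \<open>The weak formulation sees the drift only on the open space-time cylinder, so the
  extension by zero used for the construction can be undone.\<close>

lemma adjoint_weak_solution_cong:
 assumes Q: "Om \<times> {0<..<T} \<in> sets borel" and eq: "\<And>t x. x \<in> Om ==> t \<in> {0<..<T} ==> B t x = B' t x"
  and sol: "adjoint_weak_solution e T Om B f \<phi>"
 shows "adjoint_weak_solution e T Om B' f \<phi>"
proof -
 have "(LINT z:Om \<times> {0<..<T}|lborel. e * (ev G z \<bullet> fst (D\<psi> z)) + ev \<phi> z * (ev B z \<bullet> fst (D\<psi> z)))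
   = (LINT z:Om \<times> {0<..<T}|lborel. e * (ev G z \<bullet> fst (D\<psi> z)) + ev \<phi> z * (ev B' z \<bullet> fst (D\<psi> z)))"
  for G and D\<psi> :: "'a \<times> real => 'a \<times> real"
  by (rule set_lebesgue_integral_cong) (use Q eq in auto)
 then show ?thesis using sol unfolding adjoint_weak_solution_def by (simp only:)
qed

text \<open>The constant test function 1 gives conservation of mass. The Cauchy-Schwarz bound comes
  from expanding the integral of \<open>(\<phi> 0 x - t)^2\<close> at
  \<open>t = m0 / (m + 1)\<close>; the added 1 keeps the denominator positive.\<close>

lemma weak_solution_mass:
 assumes Om: "Om \<in> sets borel" "bounded Om" and T: "T > 0" and sol: "adjoint_weak_solution e T Om B f \<phi>" and f: "f \<in> borel_measurable borel"
 shows "(LINT x:Om|lborel. f x)^2 \<le> (measure lborel Om + 1) * (LINT x:Om|lborel. (\<phi> 0 x)^2)"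
proof -
 obtain G where slice: "\<forall>t\<in>{0..T}. set_borel_measurable lborel Om (\<phi> t) \<and> set_integrable lborel Om (\<lambda>x. (\<phi> t x)^2)"
  and end': "AE x in lborel. x \<in> Om \<longrightarrow> \<phi> T x = f x"
  and weak: "\<forall>\<psi> D\<psi>. C1_test \<psi> D\<psi> \<longrightarrow> (LINT x:Om|lborel. \<phi> T x * \<psi> (x, T)) - (LINT x:Om|lborel. \<phi> 0 x * \<psi> (x, 0))
      - (LINT z:Om \<times> {0<..<T}|lborel. ev \<phi> z * snd (D\<psi> z)) =
      (LINT z:Om \<times> {0<..<T}|lborel. e * (ev G z \<bullet> fst (D\<psi> z)) + ev \<phi> z * (ev B z \<bullet> fst (D\<psi> z)))"
  using sol unfolding adjoint_weak_solution_def by (elim exE conjE) (rule that)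
 have c1: "C1_test (\<lambda>_. 1) (\<lambda>_::'a \<times> real. 0)" by (simp add: C1_test_def)
 have bal: "(LINT x:Om|lborel. \<phi> T x) = (LINT x:Om|lborel. \<phi> 0 x)"
  using weak[rule_format, OF c1] by (simp add: set_lebesgue_integral_def)
 have [measurable]: "(\<lambda>x. indicator Om x *\<^sub>R \<phi> T x) \<in> borel_measurable lborel" "(\<lambda>x. indicator Om x *\<^sub>R \<phi> 0 x) \<in> borel_measurable lborel"
  using slice T unfolding set_borel_measurable_def by auto
 note [measurable] = Om(1) f
 have mT: "(LINT x:Om|lborel. \<phi> T x) = (LINT x:Om|lborel. f x)"
  unfolding set_lebesgue_integral_def
 proof (rule integral_cong_AE)
  show "AE x in lborel. indicator Om x *\<^sub>R \<phi> T x = indicator Om x *\<^sub>R f x"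
   using end' by eventually_elim (auto simp: indicator_def)
 qed measurable
 define m m0 a where "m = measure lborel Om" and "m0 = (LINT x:Om|lborel. f x)" and "a = (LINT x:Om|lborel. (\<phi> 0 x)^2)"
 have m: "m \<ge> 0" by (simp add: m_def)
 have i1: "integrable lborel (indicator Om :: 'a => real)"
  using emeasure_bounded_finite[OF Om(2)] Om(1) by (intro integrable_real_indicator) auto
 have i2: "integrable lborel (\<lambda>x. indicator Om x * (\<phi> 0 x)^2)" using slice T by (simp add: set_integrable_def)
 have i3: "integrable lborel (\<lambda>x. indicator Om x * \<phi> 0 x)"
 proof (rule lintegrable_bound[OF lintegrable_add[OF i1 i2]])
  show "(\<lambda>x. indicator Om x * \<phi> 0 x) \<in> borel_measurable lborel" using \<open>(\<lambda>x. indicator Om x *\<^sub>R \<phi> 0 x) \<in> _\<close> by simp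
  have "\<bar>\<phi> 0 x\<bar> \<le> 1 + (\<phi> 0 x)^2" for x using le_one_plus_square[of "\<bar>\<phi> 0 x\<bar>"] by simp
  then show "AE x in lborel. norm (indicator Om x * \<phi> 0 x) \<le> norm (indicator Om x + indicator Om x * (\<phi> 0 x)^2)"
   by (intro AE_I2) (simp add: indicator_def)
 qed
 define t where "t = m0 / (m + 1)"
 have "0 \<le> (LINT x|lborel. indicator Om x * (\<phi> 0 x - t)^2)" by (intro integral_nonneg_AE AE_I2) (simp add: indicator_def)
 also have "... = (LINT x|lborel. indicator Om x * (\<phi> 0 x)^2 - (2 * t) * (indicator Om x * \<phi> 0 x) + t^2 * indicator Om x)"
  by (intro lint_cong refl) (simp add: power2_eq_square algebra_simps)
 also have "... = (LINT x|lborel. indicator Om x * (\<phi> 0 x)^2) - (2 * t) * (LINT x|lborel. indicator Om x * \<phi> 0 x) + t^2 * (LINT x|lborel. indicator Om x)"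
  using i1 i2 i3 by simp
 also have "... = a - 2 * t * m0 + t^2 * m"
  using bal mT Om(1) by (simp add: a_def m0_def m_def set_lebesgue_integral_def)
 finally have q: "0 \<le> a - 2 * t * m0 + t^2 * m" .
 have tm: "t * (m + 1) = m0" using m by (simp add: t_def)
 have "t^2 * m \<le> t * (t * (m + 1))" by (simp add: power2_eq_square algebra_simps)
 then have "t^2 * m \<le> t * m0" unfolding tm .
 then have "t * m0 \<le> a" using q by linarith
 then have "(m + 1) * (t * m0) \<le> (m + 1) * a" using m by (intro mult_left_mono) auto
 moreover have "(m + 1) * (t * m0) = m0^2" using tm by (simp add: power2_eq_square mult_ac)
 ultimately show ?thesis by (simp add: m_def m0_def a_def)
qed

text \<open>With \<open>y = c / (2 * e)\<close> the claim is that \<open>y ^ p\<close> is eventually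
  below a multiple of \<open>exp y\<close>: half of the exponent pays for the power and the
  constant.\<close>

lemma exp_absorbs_power:
 assumes K: "K > 0" and c: "c > (0::real)"
 shows "\<forall>\<^sub>F e in at_right 0. exp (c / (2 * e)) \<le> K * e ^ p * exp (c / e)"
proof -
 have "filterlim (\<lambda>e. c / 2 * inverse e) at_top (at_right 0)"
  by (rule filterlim_tendsto_pos_mult_at_top[OF tendsto_const _ filterlim_inverse_at_top_right]) (use c in simp)
 from filterlim_compose[OF tendsto_power_div_exp_0[of p] this]
 have "((\<lambda>e. (c / 2 * inverse e) ^ p / exp (c / 2 * inverse e)) \<longlongrightarrow> 0) (at_right 0)" .
 from order_tendstoD(2)[OF this, of "K * (c / 2) ^ p"]
 have "\<forall>\<^sub>F e in at_right 0. (c / 2 * inverse e) ^ p / exp (c / 2 * inverse e) < K * (c / 2) ^ p" using K c by simp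
 moreover have "\<forall>\<^sub>F e in at_right (0::real). 0 < e" by (rule eventually_at_right_less)
 ultimately show ?thesis
 proof eventually_elim
  fix e :: real assume l: "(c / 2 * inverse e) ^ p / exp (c / 2 * inverse e) < K * (c / 2) ^ p" and e: "0 < e"
  define y where "y = c / 2 * inverse e"
  have "y ^ p < K * (c / 2) ^ p * exp y"
   using l unfolding y_def[symmetric] by (simp add: pos_divide_less_eq)
  moreover have "y ^ p = (c / 2) ^ p * inverse (e ^ p)" unfolding y_def by (simp only: power_mult_distrib power_inverse)
  ultimately have "(c / 2) ^ p * inverse (e ^ p) < (c / 2) ^ p * (K * exp y)" by (simp only: mult_ac)
  then have "inverse (e ^ p) < K * exp y" using c by (simp add: mult_less_cancel_left)
  then have "1 \<le> K * e ^ p * exp y" using e by (simp add: inverse_eq_divide pos_divide_less_eq mult_ac)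
  then have "1 * exp y \<le> K * e ^ p * exp y * exp y" by (intro mult_right_mono) auto
  then have 1: "exp y \<le> K * e ^ p * (exp y * exp y)" by (simp only: mult.assoc mult_1_left)
  have ey: "exp y * exp y = exp (c / e)" and yc: "y = c / (2 * e)" using e by (simp_all add: y_def field_simps flip: exp_add)
  show "exp (c / (2 * e)) \<le> K * e ^ p * exp (c / e)" using 1 unfolding ey unfolding yc .
 qed
qed

text \<open>Covers also a solution that vanishes on the control region: there the numerator is
  positive and \<open>eratio\<close> is infinite.\<close>

lemma eratio_lower:
 assumes a: "0 < a0" "a0 \<le> a" and b: "0 \<le> b" "b \<le> b1" "0 < b1" and x: "0 < x" "x^2 \<le> a0 / b1"
 shows "ereal x \<le> eratio (sqrt a) (sqrt b)"
proof (cases "b = 0")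
 case True
 then show ?thesis using a by (simp add: eratio_def)
next
 case False
 then have b0: "b > 0" using b by simp
 have "x^2 \<le> a / b" using x(2) frac_le[of a a0 b b1] a b b0 by simp
 then have "x \<le> sqrt (a / b)" by (rule real_le_rsqrt)
 then show ?thesis using b0 by (simp add: eratio_def real_sqrt_divide)
qed

context drift
begin

lemma mesh_exists:
 assumes h: "h > 0" and b: "b > 0"
 shows "\<exists>dt N. mesh e h dt N \<and> dt \<le> b"
proof -
 define K where "K = 24 / h^2 * (12 * e^2 / h^2 + 3 * M^2 * (real DIM('a))^2)"
 have K: "K \<ge> 0" by (simp add: K_def)
 define b' where "b' = min b (min (h^2 / 48) (1 / (2 * (K + 1))))"
 have b': "b' > 0" using h b K by (simp add: b'_def)
 define N where "N = nat \<lceil>T / b'\<rceil>"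
 have q: "0 < T / b'" using T_pos b' by simp
 then have N: "T / b' \<le> real N" "real N > 0" unfolding N_def by linarith+
 have le: "T / real N \<le> b'" using N b' by (simp add: field_simps)
 have "2 * (T / real N) * K \<le> 2 * (1 / (2 * (K + 1))) * (K + 1)"
  using le K T_pos N by (intro mult_mono) (auto simp: b'_def)
 also have "... = 1" using K by simp
 finally have "2 * (T / real N) * K \<le> 1" .
 moreover have "T / real N \<le> b" "T / real N \<le> h^2 / 48" using le by (simp_all add: b'_def)
 moreover from this(2) have "48 * (T / real N) \<le> h^2" by linarith
 moreover have "0 < T / real N" "real N * (T / real N) = T" using N T_pos by auto
 ultimately have "mesh e h (T / real N) N \<and> T / real N \<le> b"
  unfolding mesh_def K_def[symmetric] using h by (intro conjI)
 then show ?thesis by blast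
qed

text \<open>For each \<open>e\<close> a sequence of meshes is chosen that meets the nested
  thresholds of \<open>discrete_decay\<close> and tends to 0; its limit inherits the bound on
  \<open>A\<close> through \<open>scheme_limit\<close>.\<close>

lemma concentrated_solution:
 assumes lb: "lipschitz_boundary Om"
  and tr: "backward_trajectory T B x0 \<gamma>" and inOm: "\<And>t. t \<in> {0..T} ==> ball (\<gamma> t) R \<subseteq> Om" and R: "R > 0"
  and f: "bmon Om f" and f0: "\<And>x. 0 \<le> f x" and supp: "\<And>x. f x \<noteq> 0 ==> exp ((2 * M + 1) * T) * (norm (x - x0))^2 \<le> R^2 / 16"
  and lip: "\<And>x y. x \<in> Om ==> y \<in> Om ==> \<bar>f x - f y\<bar> \<le> L * norm (x - y)" and L: "L \<ge> 0"
  and A: "A \<in> sets borel" "A \<subseteq> Om" "\<And>t x. t \<in> {0..T} ==> x \<in> A ==> R \<le> norm (x - \<gamma> t)"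
 obtains c C p where "c > 0" "C > 0"
  "\<And>e. 0 < e ==> e \<le> 1 ==> \<exists>\<phi>. adjoint_weak_solution e T Om B f \<phi> \<and>
    (LINT z:A \<times> {0<..<T}|lborel. (ev \<phi> z)^2) \<le> 2 * (T * (C / e ^ p * exp (- c / e)))"
proof -
 obtain \<kappa> c C p where \<kappa>: "\<kappa> > 0" and c: "c > 0" and C: "C > 0" and
  dec: "\<And>e. 0 < e ==> e \<le> 1 ==> \<exists>h0>0. \<forall>h. 0 < h \<and> h \<le> h0 \<and> (\<exists>k\<ge>1. real (k::nat) * h = \<kappa> * e) \<longrightarrow>
    (\<exists>dt0>0. \<forall>dt N. 0 < dt \<and> dt \<le> dt0 \<and> real N * dt = T \<longrightarrow>
     (\<forall>n\<le>N. \<forall>A. A \<in> sets borel \<and> A \<subseteq> Om \<and> (\<forall>t\<in>{0..T}. \<forall>x\<in>A. R \<le> norm (x - \<gamma> t)) \<longrightarrow>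
      (LINT x|dm A. (jump.it Om h e dt (bav dt) f n x)^2) \<le> C / e ^ p * exp (- c / e)))"
  by (rule discrete_decay[OF lb tr inOm R f f0 supp]) (assumption | rule that)+
 show ?thesis
 proof (rule that[OF c C, of p])
  fix e :: real assume e: "0 < e" "e \<le> 1"
  let ?\<eta> = "C / e ^ p * exp (- c / e)"
  obtain h0 where h0: "h0 > 0" and dec': "\<forall>h. 0 < h \<and> h \<le> h0 \<and> (\<exists>k\<ge>1. real (k::nat) * h = \<kappa> * e) \<longrightarrow>
    (\<exists>dt0>0. \<forall>dt N. 0 < dt \<and> dt \<le> dt0 \<and> real N * dt = T \<longrightarrow>
     (\<forall>n\<le>N. \<forall>A. A \<in> sets borel \<and> A \<subseteq> Om \<and> (\<forall>t\<in>{0..T}. \<forall>x\<in>A. R \<le> norm (x - \<gamma> t)) \<longrightarrow>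
      (LINT x|dm A. (jump.it Om h e dt (bav dt) f n x)^2) \<le> ?\<eta>))"
   using dec[OF e] by (elim exE conjE)
  define k0 where "k0 = nat \<lceil>\<kappa> * e / h0\<rceil>"
  \<comment> \<open>Dividing \<open>\<kappa> * e\<close> by integers keeps it a whole number of
    jumps, as \<open>discrete_decay\<close> demands; the offset \<open>k0\<close> starts the
    sequence below \<open>h0\<close>.\<close>
  define hk where "hk k = \<kappa> * e * inverse (real (Suc (k + k0)))" for k
  have ke: "\<kappa> * e > 0" using \<kappa> e by simp
  have hk: "0 < hk k" "hk k \<le> h0" "real (Suc (k + k0)) * hk k = \<kappa> * e" for k
  proof -
   show "0 < hk k" using ke by (simp add: hk_def)
   have "\<kappa> * e / h0 \<le> real k0" unfolding k0_def by linarith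
   also have "... \<le> real (Suc (k + k0))" by simp
   finally have "\<kappa> * e \<le> h0 * real (Suc (k + k0))" using h0 by (simp add: pos_divide_le_eq mult.commute)
   then show "hk k \<le> h0" unfolding hk_def by (simp add: inverse_eq_divide pos_divide_le_eq)
   show "real (Suc (k + k0)) * hk k = \<kappa> * e" by (simp add: hk_def)
  qed
  define S where "S k dt N \<longleftrightarrow> mesh e (hk k) dt N \<and> dt \<le> inverse (real (Suc k)) \<and>
   (\<forall>n\<le>N. (LINT x|dm A. (jump.it Om (hk k) e dt (bav dt) f n x)^2) \<le> ?\<eta>)" for k dt N
  have "\<forall>k. \<exists>q. S k (fst q) (snd q)"
  proof
   fix k
   have "0 < hk k \<and> hk k \<le> h0 \<and> (\<exists>j\<ge>1. real (j::nat) * hk k = \<kappa> * e)"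
    using hk[of k] by (intro conjI exI[of _ "Suc (k + k0)"]) auto
   from mp[OF spec[OF dec'] this] obtain dt0 where dt0: "dt0 > 0" and d: "\<forall>dt N. 0 < dt \<and> dt \<le> dt0 \<and> real N * dt = T \<longrightarrow>
     (\<forall>n\<le>N. \<forall>A. A \<in> sets borel \<and> A \<subseteq> Om \<and> (\<forall>t\<in>{0..T}. \<forall>x\<in>A. R \<le> norm (x - \<gamma> t)) \<longrightarrow>
      (LINT x|dm A. (jump.it Om (hk k) e dt (bav dt) f n x)^2) \<le> ?\<eta>)" by (elim exE conjE)
   have "min dt0 (inverse (real (Suc k))) > 0" using dt0 by simp
   from mesh_exists[where e=e, OF hk(1)[of k] this] obtain dt N where ms: "mesh e (hk k) dt N" and dt: "dt \<le> min dt0 (inverse (real (Suc k)))" by (elim exE conjE)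
   have "0 < dt \<and> dt \<le> dt0 \<and> real N * dt = T" using ms dt by (auto simp: mesh_def)
   from mp[OF spec[OF spec[OF d]] this]
   have d': "\<forall>n\<le>N. \<forall>A. A \<in> sets borel \<and> A \<subseteq> Om \<and> (\<forall>t\<in>{0..T}. \<forall>x\<in>A. R \<le> norm (x - \<gamma> t)) \<longrightarrow>
      (LINT x|dm A. (jump.it Om (hk k) e dt (bav dt) f n x)^2) \<le> ?\<eta>" .
   have "(LINT x|dm A. (jump.it Om (hk k) e dt (bav dt) f n x)^2) \<le> ?\<eta>" if "n \<le> N" for n
    by (rule d'[rule_format, OF that]) (use A in auto)
   then have "S k dt N" using ms dt by (simp add: S_def)
   then show "\<exists>q. S k (fst q) (snd q)" by (intro exI[of _ "(dt, N)"]) simp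
  qed
  from choice[OF this] obtain q where q: "\<forall>k. S k (fst (q k)) (snd (q k))" by (elim exE)
  have ms: "mesh e (hk k) (fst (q k)) (snd (q k))" and dtle: "fst (q k) \<le> inverse (real (Suc k))"
   and small: "n \<le> snd (q k) ==> (LINT x|dm A. (jump.it Om (hk k) e (fst (q k)) (bav (fst (q k))) f n x)^2) \<le> ?\<eta>" for k n
   using q[rule_format, of k] by (auto simp: S_def)
  have dt0: "(\<lambda>k. fst (q k)) \<longlonglongrightarrow> 0"
  proof (rule tendsto_sandwich[OF _ _ tendsto_const LIMSEQ_inverse_real_of_nat])
   show "\<forall>\<^sub>F k in sequentially. 0 \<le> fst (q k)" using ms by (intro always_eventually) (auto simp: mesh_def less_imp_le)
   show "\<forall>\<^sub>F k in sequentially. fst (q k) \<le> inverse (real (Suc k))" using dtle by (intro always_eventually) auto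
  qed
  have h00: "hk \<longlonglongrightarrow> 0" unfolding hk_def[abs_def]
   using LIMSEQ_ignore_initial_segment[OF LIMSEQ_inverse_real_of_nat, of k0] by (intro tendsto_mult_right_zero) auto
  show "\<exists>\<phi>. adjoint_weak_solution e T Om B f \<phi> \<and>
    (LINT z:A \<times> {0<..<T}|lborel. (ev \<phi> z)^2) \<le> 2 * (T * ?\<eta>)"
  proof (rule scheme_limit[where L=L, OF f _ L e(1) ms h00 dt0])
   show "\<bar>f x - f y\<bar> \<le> L * norm (x - y)" if "x \<in> Om" "y \<in> Om" for x y by (rule lip[OF that])
   fix \<phi> assume \<phi>: "adjoint_weak_solution e T Om B f \<phi>"
    "\<And>A \<eta>. A \<in> sets borel ==> A \<subseteq> Om ==>
    (\<And>k n. n \<le> snd (q k) ==> (LINT x|dm A. (jump.it Om (hk k) e (fst (q k)) (bav (fst (q k))) f n x)^2) \<le> \<eta>) ==>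
    (LINT z:A \<times> {0<..<T}|lborel. (ev \<phi> z)^2) \<le> 2 * (T * \<eta>)"
   have "(LINT z:A \<times> {0<..<T}|lborel. (ev \<phi> z)^2) \<le> 2 * (T * ?\<eta>)"
    by (rule \<phi>(2)[OF A(1,2) small])
   with \<phi>(1) show "\<exists>\<phi>. adjoint_weak_solution e T Om B f \<phi> \<and>
     (LINT z:A \<times> {0<..<T}|lborel. (ev \<phi> z)^2) \<le> 2 * (T * ?\<eta>)" by (intro exI[of _ \<phi>] conjI)
  qed
 qed
qed

end

theorem theorem1p2:
  fixes \<Omega> \<omega> :: "'a::euclidean_space set" and T :: real and B :: "real \<Rightarrow> 'a \<Rightarrow> 'a"
  assumes "open \<Omega>" and "connected \<Omega>" and "bounded \<Omega>" and "lipschitz_boundary \<Omega>"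
    and "open \<omega>" and "\<omega> \<noteq> {}" and "\<omega> \<subseteq> \<Omega>"
    and "T > 0"
    and "Linf_W1inf T \<Omega> B"
    and "\<exists>x0\<in>\<Omega>. \<exists>\<gamma>. backward_trajectory T B x0 \<gamma> \<and> (\<forall>t\<in>{0..T}. \<gamma> t \<in> \<Omega> - closure \<omega>)"
  shows "\<exists>C>0. \<forall>\<^sub>F \<epsilon> in at_right 0. ereal (exp (C / \<epsilon>)) \<le> control_cost \<epsilon> T \<Omega> \<omega> B"
proof -
 obtain x0 \<gamma> where tr: "backward_trajectory T B x0 \<gamma>" and \<gamma>\<Omega>: "\<And>t. t \<in> {0..T} \<Longrightarrow> \<gamma> t \<in> \<Omega> - closure \<omega>"
  using assms(10) by blast
 obtain M0 where Bm: "set_borel_measurable lborel (\<Omega> \<times> {0<..<T}) (\<lambda>z. ev B z)"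
  and M0: "\<And>t. t \<in> {0<..<T} \<Longrightarrow> M0-lipschitz_on \<Omega> (B t)" "\<And>t x. t \<in> {0<..<T} \<Longrightarrow> x \<in> \<Omega> \<Longrightarrow> norm (B t x) \<le> M0"
  using assms(9) unfolding Linf_W1inf_def by blast
 define M where "M = max M0 1"
 \<comment> \<open>Extension by zero makes the drift Borel on the whole space. Along the trajectory
   it changes values at most at the times 0 and \<open>T\<close>, a negligible set.\<close>
 define B0 where "B0 t x = (if x \<in> \<Omega> \<and> t \<in> {0<..<T} then B t x else 0)" for t x
 interpret drift \<Omega> T B0 M
 proof
  have "(\<lambda>z. ev B0 z) = (\<lambda>z. indicator (\<Omega> \<times> {0<..<T}) z *\<^sub>R ev B z)"
   by (auto simp: B0_def indicator_def)
  then show "(\<lambda>z. ev B0 z) \<in> borel_measurable borel" using Bm by (simp add: set_borel_measurable_def)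
  show "norm (B0 t x) \<le> M" for t x using M0(2)[of t x] by (auto simp: B0_def M_def le_max_iff_disj)
  show "norm (B0 t x - B0 t y) \<le> M * norm (x - y)" if "x \<in> \<Omega>" "y \<in> \<Omega>" for t x y
  proof (cases "t \<in> {0<..<T}")
   case True
   have "norm (B t x - B t y) \<le> M0 * norm (x - y)" using lipschitz_onD[OF M0(1)[OF True] that] by (simp add: dist_norm)
   also have "... \<le> M * norm (x - y)" by (intro mult_right_mono) (auto simp: M_def)
   finally show ?thesis using True that by (simp add: B0_def)
  next
   case False
   then have "B0 t x = 0" "B0 t y = 0" by (auto simp: B0_def)
   then show ?thesis by (simp add: M_def)
  qed
 qed (use assms in \<open>auto simp: M_def B0_def\<close>)
 have tr0: "backward_trajectory T B0 x0 \<gamma>"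
  unfolding backward_trajectory_def
 proof
  fix t assume t: "t \<in> {0..T}"
  have ng: "negligible {0, T}" by simp
  have eq: "B0 s (\<gamma> s) = B s (\<gamma> s)" if "s \<in> {t..T} - {0, T}" for s
   using that t \<gamma>\<Omega>[of s] by (auto simp: B0_def)
  have i: "(\<lambda>s. B s (\<gamma> s)) integrable_on {t..T}" "\<gamma> t = x0 - integral {t..T} (\<lambda>s. B s (\<gamma> s))"
   using tr t by (auto simp: backward_trajectory_def)
  have "(\<lambda>s. B0 s (\<gamma> s)) integrable_on {t..T}" by (rule integrable_spike[OF i(1) ng eq])
  moreover have "integral {t..T} (\<lambda>s. B s (\<gamma> s)) = integral {t..T} (\<lambda>s. B0 s (\<gamma> s))" by (rule integral_spike[OF ng eq])
  ultimately show "(\<lambda>s. B0 s (\<gamma> s)) integrable_on {t..T} \<and> \<gamma> t = x0 - integral {t..T} (\<lambda>s. B0 s (\<gamma> s))" using i(2) by simp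
 qed
 have "continuous_on {0..T} \<gamma>"
 proof (rule lipschitz_on_continuous_on[OF lipschitz_onI])
  fix s t assume st: "s \<in> {0..T}" "t \<in> {0..T}"
  show "dist (\<gamma> s) (\<gamma> t) \<le> M * dist s t"
  proof (cases "s \<le> t")
   case True
   then show ?thesis using trajectory_increment(3)[OF tr0, of s t] st by (simp add: dist_norm norm_minus_commute)
  next
   case False
   then show ?thesis using trajectory_increment(3)[OF tr0, of t s] st by (simp add: dist_norm)
  qed
 qed (simp add: M_def)
 then have "compact (\<gamma> ` {0..T})" by (intro compact_continuous_image) auto
 moreover have "open (\<Omega> - closure \<omega>)" using assms(1) by (intro open_Diff) auto
 moreover have "\<gamma> ` {0..T} \<subseteq> \<Omega> - closure \<omega>" using \<gamma>\<Omega> by blast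
 \<comment> \<open>One radius serves two needs: the tube around the trajectory lies in the domain,
   and it stays off \<open>\<omega>\<close>.\<close>
 ultimately obtain R where R: "R > 0" "(\<Union>x\<in>\<gamma> ` {0..T}. cball x R) \<subseteq> \<Omega> - closure \<omega>"
  by (rule compact_subset_open_imp_cball_epsilon_subset)
 have cb: "cball (\<gamma> t) R \<subseteq> \<Omega> - closure \<omega>" if "t \<in> {0..T}" for t using R(2) that by blast
 have in\<Omega>: "ball (\<gamma> t) R \<subseteq> \<Omega>" if "t \<in> {0..T}" for t using cb[OF that] ball_subset_cball[of "\<gamma> t" R] by blast
 have far: "R \<le> norm (x - \<gamma> t)" if "t \<in> {0..T}" "x \<in> \<omega>" for t x
 proof (rule ccontr)
  assume "\<not> R \<le> norm (x - \<gamma> t)"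
  then have "x \<in> cball (\<gamma> t) R" by (simp add: dist_norm norm_minus_commute)
  then show False using cb[OF that(1)] that(2) closure_subset[of \<omega>] by blast
 qed
 have \<gamma>T: "\<gamma> T = x0" using tr T_pos by (simp add: backward_trajectory_def)
 define k where "k = (2 * M + 1) * T"
 have k: "k \<ge> 0" using T_pos by (simp add: k_def M_def)
 \<comment> \<open>The support condition holds with room, as \<open>exp k * r^2\<close> equals
   \<open>R^2 / 16 * exp (- k)\<close>. The data will be a tent of this radius rather than an
   indicator, because the equicontinuity estimate asks for Lipschitz data.\<close>
 define r where "r = R / 4 * exp (- k)"
 have r: "r > 0" "r \<le> R / 4" using R(1) k by (simp_all add: r_def)
 define f where "f x = max 0 (r - norm (x - x0))" for x :: 'a
 have fc: "continuous_on UNIV f" unfolding f_def by (intro continuous_intros)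
 have fm: "f \<in> borel_measurable borel" by (rule borel_measurable_continuous_onI[OF fc])
 have f: "bmon \<Omega> f" by (rule bmon_continuous[OF fc bounded_dom])
 have f0: "0 \<le> f x" for x by (simp add: f_def)
 have lip: "\<bar>f x - f y\<bar> \<le> 1 * norm (x - y)" for x y
  using norm_triangle_ineq3[of "x - x0" "y - x0"] by (auto simp: f_def max_def)
 have supp: "exp ((2 * M + 1) * T) * (norm (x - x0))^2 \<le> R^2 / 16" if "f x \<noteq> 0" for x
 proof -
  have "norm (x - x0) \<le> r" using that by (auto simp: f_def max_def split: if_splits)
  then have "exp k * (norm (x - x0))^2 \<le> exp k * r^2" by (intro mult_left_mono power_mono) auto
  also have "... = R^2 / 16 * exp (- k)"
   by (simp add: r_def power2_eq_square exp_minus field_simps)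
  also have "... \<le> R^2 / 16 * 1" using k by (intro mult_left_mono) auto
  finally show ?thesis by (simp add: k_def)
 qed
 define m0 where "m0 = (LINT x:\<Omega>|lborel. f x)"
 have m0: "m0 > 0"
 proof -
  have "ball x0 (r / 2) \<subseteq> ball x0 R" using r R by (intro subset_ball) auto
  then have sub: "ball x0 (r / 2) \<subseteq> \<Omega>" using in\<Omega>[of T] \<gamma>T T_pos by auto
  have i: "integrable lborel (\<lambda>x. indicator \<Omega> x *\<^sub>R f x)"
   using integrable_bmon[OF Q_sets(3) bounded_dom f] integrable_dm_iff[OF Q_sets(3) fm] by simp
  have fin: "emeasure lborel (ball x0 (r / 2)) < \<infinity>" by (intro emeasure_bounded_finite) auto
  have "0 < r / 2 * measure lborel (ball x0 (r / 2))" using r content_ball_pos[of "r / 2" x0] by simp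
  also have "... = (LINT x|lborel. r / 2 * indicator (ball x0 (r / 2)) x)" by simp
  also have "... \<le> (LINT x|lborel. indicator \<Omega> x *\<^sub>R f x)"
  proof (rule integral_mono[OF _ i])
   show "integrable lborel (\<lambda>x. r / 2 * indicator (ball x0 (r / 2)) x)"
    using fin by (intro integrable_mult_right integrable_real_indicator) auto
   fix x show "r / 2 * indicator (ball x0 (r / 2)) x \<le> indicator \<Omega> x *\<^sub>R f x"
   proof (cases "x \<in> ball x0 (r / 2)")
    case True
    then have "r / 2 \<le> f x" "x \<in> \<Omega>" using sub by (auto simp: f_def dist_norm norm_minus_commute le_max_iff_disj)
    then show ?thesis using True by simp
   qed (simp add: f0 indicator_def)
  qed
  finally show ?thesis by (simp add: m0_def set_lebesgue_integral_def)
 qed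
 have \<omega>s: "\<omega> \<in> sets borel" using assms(5) by simp
 obtain c C p where c: "c > 0" and C: "C > 0" and sol:
  "\<And>e. 0 < e \<Longrightarrow> e \<le> 1 \<Longrightarrow> \<exists>\<phi>. adjoint_weak_solution e T \<Omega> B0 f \<phi> \<and>
    (LINT z:\<omega> \<times> {0<..<T}|lborel. (ev \<phi> z)^2) \<le> 2 * (T * (C / e ^ p * exp (- c / e)))"
  by (rule concentrated_solution[where L=1, OF assms(4) tr0 in\<Omega> R(1) f f0 supp lip _ \<omega>s assms(7) far]) (assumption | rule zero_le_one that)+
 have f2: "set_integrable lborel \<Omega> (\<lambda>x. (f x)^2)"
  using integrable_bmon[OF Q_sets(3) bounded_dom bmon_power[OF f]] integrable_dm_iff[OF Q_sets(3), of "\<lambda>x. (f x)^2"] fm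
  by (simp add: set_integrable_def)
 have nz: "L2_nonzero \<Omega> f"
  unfolding L2_nonzero_def
 proof (intro conjI notI f2)
  show "set_borel_measurable lborel \<Omega> f" using fm Q_sets(3) unfolding set_borel_measurable_def by measurable
  assume "AE x in lborel. x \<in> \<Omega> \<longrightarrow> f x = 0"
  then have "AE x in lborel. indicator \<Omega> x *\<^sub>R f x = 0" by eventually_elim (auto simp: indicator_def)
  from integral_eq_zero_AE[OF this] show False using m0 by (simp add: m0_def set_lebesgue_integral_def)
 qed
 define a0 where "a0 = m0^2 / (measure lborel \<Omega> + 1)"
 have mp: "measure lborel \<Omega> + 1 > 0" using measure_nonneg[of lborel \<Omega>] by linarith
 have a0: "a0 > 0" unfolding a0_def using m0 mp by (intro divide_pos_pos) auto
 define K where "K = a0 / (2 * T * C)"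
 have K: "K > 0" using a0 T_pos C by (simp add: K_def)
 have le1: "\<forall>\<^sub>F e in at_right (0::real). e \<le> 1" by (rule eventually_at_rightI[of 0 1]) auto
 have "\<forall>\<^sub>F \<epsilon> in at_right 0. ereal (exp (c / 4 / \<epsilon>)) \<le> control_cost \<epsilon> T \<Omega> \<omega> B"
  using exp_absorbs_power[OF K c, of p] eventually_at_right_less[of 0] le1
 proof eventually_elim
  fix e :: real assume ex: "exp (c / (2 * e)) \<le> K * e ^ p * exp (c / e)" and e: "0 < e" and e1: "e \<le> 1"
  from sol[OF e e1] obtain \<phi> where \<phi>0: "adjoint_weak_solution e T \<Omega> B0 f \<phi>"
   and \<phi>\<omega>: "(LINT z:\<omega> \<times> {0<..<T}|lborel. (ev \<phi> z)^2) \<le> 2 * (T * (C / e ^ p * exp (- c / e)))" by (elim exE conjE)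
  have \<phi>: "adjoint_weak_solution e T \<Omega> B f \<phi>"
   by (rule adjoint_weak_solution_cong[OF Q_sets(1) _ \<phi>0]) (simp add: B0_def)
  define a b b1 where "a = (LINT x:\<Omega>|lborel. (\<phi> 0 x)^2)" and "b = (LINT z:\<omega> \<times> {0<..<T}|lborel. (ev \<phi> z)^2)"
   and "b1 = 2 * (T * (C / e ^ p * exp (- c / e)))"
  have "m0^2 \<le> (measure lborel \<Omega> + 1) * a" unfolding m0_def a_def by (rule weak_solution_mass[OF Q_sets(3) bounded_dom T_pos \<phi> fm])
  then have "a0 \<le> a" unfolding a0_def using mp by (simp add: pos_divide_le_eq mult.commute)
  moreover have "0 \<le> b" unfolding b_def set_lebesgue_integral_def by (intro integral_nonneg_AE AE_I2) (simp add: indicator_def)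
  moreover have "b1 > 0" using T_pos C e by (simp add: b1_def)
  \<comment> \<open>The cost is a ratio of norms while the estimates concern their squares, so
    \<open>c / 4\<close> becomes \<open>c / 2\<close> here; the other half of \<open>c\<close> was
    given up to the power of \<open>e\<close> in \<open>exp_absorbs_power\<close>.\<close>
  moreover have "(exp (c / 4 / e))^2 \<le> a0 / b1"
  proof -
   have "(exp (c / 4 / e))^2 = exp (c / (2 * e))" using e by (simp add: power2_eq_square field_simps flip: exp_add)
   also have "... \<le> K * e ^ p * exp (c / e)" by (rule ex)
   also have "... = a0 / b1" using e T_pos C by (simp add: K_def b1_def exp_minus field_simps)
   finally show ?thesis .
  qed
  ultimately have "ereal (exp (c / 4 / e)) \<le> eratio (sqrt a) (sqrt b)"
   using a0 \<phi>\<omega> by (intro eratio_lower[of a0 a b b1]) (auto simp: b_def b1_def)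
  also have "... \<le> control_cost e T \<Omega> \<omega> B"
   unfolding control_cost_def a_def b_def using nz \<phi> by (intro SUP_upper2[of "(f, \<phi>)"]) auto
  finally show "ereal (exp (c / 4 / e)) \<le> control_cost e T \<Omega> \<omega> B" .
 qed
 moreover have "c / 4 > 0" using c by simp
 ultimately show ?thesis by blast
qed

end
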